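(* Let $d\in\{1,2,3\}$ and let $F:L^1(\Omega)\to\mathbb{R}$ be continuous and bounded from below, and let $\alpha>0$. Let $c\ge 1$ if $d=1$, $c\ge\sqrt{2}$ if $d=2$, and $c\ge 13\sqrt{3}$ if $d=3$. Let $\{(h,\tau_h)\}_{h}$ be a family of admissible mesh pairs such that $\frac{\tau_h}{h}\to 0$ as $h\searrow 0$. For each $h$ let $(w^{\tau_h},V^h)\in \mathrm{BV}_W(\Omega)\times\mathbb{R}$, with $w^{\tau_h}\in P0^{\tau_h}$, be an optimal solution to the discretized problem $(\mathrm{P}^h_c)$. Then $\{w^{\tau_h}\}_{h}$ admits a subsequence (as $h\searrow0$) that converges weakly-$*$ in $\mathrm{BV}(\Omega)$, and each (weak-$*$ in $\mathrm{BV}(\Omega)$) accumulation point of $\{w^{\tau_h}\}_{h}$ as $h\searrow 0$ is a minimizer of $(\mathrm{P}_c)$.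
   Context: Setting. $\Omega\subset\mathbb{R}^d$, $d\in\{1,2,3\}$, is a bounded Lipschitz domain that is a finite union of bounded intervals ($d=1$), axis-aligned squares ($d=2$) or axis-aligned cubes ($d=3$). $W\subset\mathbb{Z}$ is a finite nonempty set. $\|\cdot\|$ is the Euclidean norm and $\|\phi\|_{L^\infty(\Omega;\mathbb{R}^d)}=\operatorname{ess\,sup}_{x\in\Omega}\|\phi(x)\|$. For $w\in L^1(\Omega)$, $\operatorname{TV}(w)=\sup\{\int_\Omega w\,\operatorname{div}\phi\,dx : \phi\in C^1_c(\Omega;\mathbb{R}^d),\ \sup_{x}\|\phi(x)\|\le 1\}\in[0,\infty]$; $\mathrm{BV}(\Omega)=\{w\in L^1(\Omega):\operatorname{TV}(w)<\infty\}$; $L^1_W(\Omega)=\{w\in L^1(\Omega): w(x)\in W \text{ for a.a. } x\in\Omega\}$; $\mathrm{BV}_W(\Omega)=L^1_W(\Omega)\cap \mathrm{BV}(\Omega)$. Meshes. A mesh of $\Omega$ of size $\tau>0$ is a conforming finite element mesh $\mathcal{Q}_\tau$: a finite collection of intervals / axis-aligned squares / axis-aligned cubes of side length $\tau$ with pairwise disjoint interiors, whose union is $\Omega$ up to a Lebesgue null set, and such that two distinct closed cells intersect in the empty set or a common face. A pair $(h,\tau_h)$ with $h>0$ and $\tau_h\in(0,h]$ is an admissible mesh pair if there are given a mesh $\mathcal{Q}_h$ of size $h$ (the TV mesh) and a mesh $\mathcal{Q}_{\tau_h}$ of size $\tau_h$ (the input mesh) such that every cell of $\mathcal{Q}_h$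 is a union of cells of $\mathcal{Q}_{\tau_h}$. Families are indexed by $h$ in a set of positive numbers accumulating at $0$. $P0^\tau$ is the space of functions that are constant on each cell of $\mathcal{Q}_\tau$. Discretized total variation. For a cell $Q$, $RT0^h(Q)$ is the space of maps $Q\to\mathbb{R}^d$, $x\mapsto (a_i+c_ix_i)_{i=1}^d$ with $a,c\in\mathbb{R}^d$. $RT0^h=\{\phi\in H(\operatorname{div};\Omega):\phi|_Q\in RT0^h(Q)\ \forall Q\in\mathcal{Q}_h\}$, and $RT0^h_0=\{\phi\in RT0^h:(\phi\cdot n)|_{\partial\Omega}\equiv0\}$ with $n$ the outer unit normal of $\Omega$. For $w\in L^1(\Omega)$, $\operatorname{TV}^h(w)=\sup\{\int_\Omega w\operatorname{div}\phi\,dx:\phi\in RT0^h_0,\ \|\phi\|_{L^\infty(\Omega;\mathbb{R}^d)}\le1\}$. Problems. $(\mathrm{P}_c)$: minimize $G(w)=F(w)+\alpha\operatorname{TV}(w)+I_Z(w)$ over $w\in L^2(\Omega)$, where $Z=\{w\in L^1_W(\Omega):\operatorname{TV}(w)\le c\operatorname{TV}(w)\}$. $(\mathrm{P}^h_c)$: minimize $G^h(w,V)=F(w)+\alpha V+I_{Z^h}(w,V)$ over $(w,V)\in L^2(\Omega)\times\mathbb{R}$, where $Z^h=\{(w,V)\in(P0^{\tau_h}\cap L^1_W(\Omega))\times\mathbb{R}:\operatorname{TV}(w)\le cV,\ \operatorname{TV}^h(w)\le V\}$. $I_A$ denotes the $\{0,\infty\}$-valued indicator functional of $A$. Weak-$*$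 convergence $w^k\overset{*}{\rightharpoonup}w$ in $\mathrm{BV}(\Omega)$ means $w^k\to w$ in $L^1(\Omega)$ and $Dw^k\overset{*}{\rightharpoonup}Dw$ as measures. *)

theory Defs
  imports "HOL-Analysis.Analysis" "HOL-Probability.Essential_Supremum"
begin

text \<open>
  Functions on the open set \<open>\<Omega>\<close> are represented by total functions; only their values on \<open>\<Omega>\<close> matter,
  and elements of \<open>L\<^sup>1(\<Omega>)\<close>, \<open>L\<^sup>2(\<Omega>)\<close>, ... are represented by functions rather than by almost-everywhere
  classes. All integrals are with respect to Lebesgue measure restricted to \<open>\<Omega>\<close>.
\<close>

subsection \<open>The domain\<close>

text \<open>
  Near each boundary point the set lies strictly below the graph of a Lipschitz function over a
  hyperplane with unit normal \<open>\<nu>\<close>; \<open>x - (x \<bullet> \<nu>) *\<^sub>R \<nu>\<close> is the orthogonal projection of \<open>x\<close> onto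
  that hyperplane.
\<close>

definition lipschitz_boundary :: "(real^'d) set \<Rightarrow> bool" where
  "lipschitz_boundary \<Omega> \<longleftrightarrow>
     (\<forall>x0\<in>frontier \<Omega>. \<exists>\<nu> r L. \<exists>g :: real^'d \<Rightarrow> real.
        norm \<nu> = 1 \<and> r > 0 \<and> L-lipschitz_on {y. y \<bullet> \<nu> = 0} g \<and>
        (\<forall>x\<in>ball x0 r. x \<in> \<Omega> \<longleftrightarrow> x \<bullet> \<nu> < g (x - (x \<bullet> \<nu>) *\<^sub>R \<nu>)))"

definition bounded_lipschitz_domain :: "(real^'d) set \<Rightarrow> bool" where
  "bounded_lipschitz_domain \<Omega> \<longleftrightarrow>
     open \<Omega> \<and> connected \<Omega> \<and> \<Omega> \<noteq> {} \<and> bounded \<Omega> \<and> lipschitz_boundary \<Omega>"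

definition cube :: "real \<Rightarrow> (real^'d) set \<Rightarrow> bool" where
  "cube s Q \<longleftrightarrow> (\<exists>a. Q = cbox a (a + (\<chi> i. s)))"

text \<open>
  The cubes may have different side lengths. The open set \<open>\<Omega>\<close> is compared with closed cubes
  through its closure.
\<close>

definition finite_union_of_cubes :: "(real^'d) set \<Rightarrow> bool" where
  "finite_union_of_cubes \<Omega> \<longleftrightarrow>
     (\<exists>C. finite C \<and> (\<forall>Q\<in>C. \<exists>s>0. cube s Q) \<and> closure \<Omega> = \<Union>C)"

subsection \<open>Function spaces and total variation\<close>

definition L1 :: "(real^'d) set \<Rightarrow> (real^'d \<Rightarrow> real) set" where
  "L1 \<Omega> = {w. integrable (lebesgue_on \<Omega>) w}"

definition L2 :: "(real^'d) set \<Rightarrow> (real^'d \<Rightarrow> 'b::real_normed_vector) set" where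
  "L2 \<Omega> = {f \<in> borel_measurable (lebesgue_on \<Omega>).
             integrable (lebesgue_on \<Omega>) (\<lambda>x. (norm (f x))\<^sup>2)}"

definition L1_dist :: "(real^'d) set \<Rightarrow> (real^'d \<Rightarrow> real) \<Rightarrow> (real^'d \<Rightarrow> real) \<Rightarrow> real" where
  "L1_dist \<Omega> v w = (\<integral>x. \<bar>v x - w x\<bar> \<partial>lebesgue_on \<Omega>)"

text \<open>
  Continuity with respect to the seminorm on representatives; in particular, \<open>F\<close> takes the same
  value at functions that agree almost everywhere on \<open>\<Omega>\<close>, so it is a function on \<open>L\<^sup>1(\<Omega>)\<close>.
\<close>

definition L1_continuous :: "(real^'d) set \<Rightarrow> ((real^'d \<Rightarrow> real) \<Rightarrow> real) \<Rightarrow> bool" where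
  "L1_continuous \<Omega> F \<longleftrightarrow>
     (\<forall>w\<in>L1 \<Omega>. \<forall>\<epsilon>>0. \<exists>\<delta>>0. \<forall>v\<in>L1 \<Omega>. L1_dist \<Omega> v w < \<delta> \<longrightarrow> \<bar>F v - F w\<bar> < \<epsilon>)"

definition L1_bounded_below :: "(real^'d) set \<Rightarrow> ((real^'d \<Rightarrow> real) \<Rightarrow> real) \<Rightarrow> bool" where
  "L1_bounded_below \<Omega> F \<longleftrightarrow> (\<exists>m. \<forall>w\<in>L1 \<Omega>. m \<le> F w)"

text \<open>\<open>C\<^sup>1\<^sub>c(\<Omega>)\<close>, with its elements extended by zero to the whole space.\<close>

definition C1c :: "(real^'d) set \<Rightarrow> (real^'d \<Rightarrow> 'b::real_normed_vector) set" where
  "C1c \<Omega> = {\<phi>. (\<exists>\<phi>' :: real^'d \<Rightarrow> ((real^'d) \<Rightarrow>\<^sub>L 'b).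
                  (\<forall>x. (\<phi> has_derivative blinfun_apply (\<phi>' x)) (at x)) \<and> continuous_on UNIV \<phi>') \<and>
                compact (closure {x. \<phi> x \<noteq> 0}) \<and> closure {x. \<phi> x \<noteq> 0} \<subseteq> \<Omega>}"

definition partial_deriv ::
    "'d \<Rightarrow> (real^'d \<Rightarrow> 'b::real_normed_vector) \<Rightarrow> real^'d \<Rightarrow> 'b" where
  "partial_deriv i f x = frechet_derivative f (at x) (axis i 1)"

definition divergence :: "(real^'d \<Rightarrow> real^'d) \<Rightarrow> real^'d \<Rightarrow> real" where
  "divergence \<phi> x = (\<Sum>i\<in>UNIV. partial_deriv i \<phi> x $ i)"

definition TV :: "(real^'d) set \<Rightarrow> (real^'d \<Rightarrow> real) \<Rightarrow> ereal" where
  "TV \<Omega> w = (SUP \<phi>\<in>{\<phi> \<in> C1c \<Omega>. \<forall>x\<in>\<Omega>. norm (\<phi> x) \<le> 1}.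
               ereal (\<integral>x. w x * divergence \<phi> x \<partial>lebesgue_on \<Omega>))"

definition BV :: "(real^'d) set \<Rightarrow> (real^'d \<Rightarrow> real) set" where
  "BV \<Omega> = {w \<in> L1 \<Omega>. TV \<Omega> w < \<infinity>}"

definition L1_W :: "(real^'d) set \<Rightarrow> int set \<Rightarrow> (real^'d \<Rightarrow> real) set" where
  "L1_W \<Omega> W = {w \<in> L1 \<Omega>. AE x in lebesgue_on \<Omega>. w x \<in> real_of_int ` W}"

definition BV_W :: "(real^'d) set \<Rightarrow> int set \<Rightarrow> (real^'d \<Rightarrow> real) set" where
  "BV_W \<Omega> W = L1_W \<Omega> W \<inter> BV \<Omega>"

subsection \<open>Weak-* convergence\<close>

text \<open>
  The \<open>i\<close>-th component of the vector measure \<open>Dw\<close> is given as the difference \<open>\<mu> i - \<nu> i\<close> of two finite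
  (positive) Borel measures on \<open>\<Omega>\<close>.
\<close>

definition derivative_measure ::
    "(real^'d) set \<Rightarrow> (real^'d \<Rightarrow> real) \<Rightarrow> ('d \<Rightarrow> (real^'d) measure) \<Rightarrow> ('d \<Rightarrow> (real^'d) measure) \<Rightarrow> bool"
  where
  "derivative_measure \<Omega> w \<mu> \<nu> \<longleftrightarrow>
     (\<forall>i. finite_measure (\<mu> i) \<and> sets (\<mu> i) = sets (restrict_space borel \<Omega>) \<and>
          finite_measure (\<nu> i) \<and> sets (\<nu> i) = sets (restrict_space borel \<Omega>) \<and>
          (\<forall>\<psi>\<in>C1c \<Omega>. (\<integral>x. w x * partial_deriv i \<psi> x \<partial>lebesgue_on \<Omega>) =
             - ((\<integral>x. \<psi> x \<partial>\<mu> i) - (\<integral>x. \<psi> x \<partial>\<nu> i))))"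

text \<open>\<open>C\<^sub>0(\<Omega>)\<close>, the predual of the finite signed Borel measures on \<open>\<Omega>\<close>.\<close>

definition C0 :: "(real^'d) set \<Rightarrow> (real^'d \<Rightarrow> real) set" where
  "C0 \<Omega> = {\<psi>. continuous_on \<Omega> \<psi> \<and> (\<forall>\<epsilon>>0. compact {x\<in>\<Omega>. \<epsilon> \<le> \<bar>\<psi> x\<bar>})}"

definition BV_weak_star_tendsto ::
    "(real^'d) set \<Rightarrow> (nat \<Rightarrow> real^'d \<Rightarrow> real) \<Rightarrow> (real^'d \<Rightarrow> real) \<Rightarrow> bool" where
  "BV_weak_star_tendsto \<Omega> w w0 \<longleftrightarrow>
     (\<forall>k. w k \<in> BV \<Omega>) \<and> w0 \<in> BV \<Omega> \<and>
     (\<lambda>k. L1_dist \<Omega> (w k) w0) \<longlonglongrightarrow> 0 \<and>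
     (\<exists>\<mu> \<nu> \<mu>0 \<nu>0.
        (\<forall>k. derivative_measure \<Omega> (w k) (\<mu> k) (\<nu> k)) \<and> derivative_measure \<Omega> w0 \<mu>0 \<nu>0 \<and>
        (\<forall>i. \<forall>\<psi>\<in>C0 \<Omega>. (\<lambda>k. (\<integral>x. \<psi> x \<partial>\<mu> k i) - (\<integral>x. \<psi> x \<partial>\<nu> k i))
                          \<longlonglongrightarrow> (\<integral>x. \<psi> x \<partial>\<mu>0 i) - (\<integral>x. \<psi> x \<partial>\<nu>0 i)))"

subsection \<open>Meshes\<close>

definition mesh :: "(real^'d) set \<Rightarrow> real \<Rightarrow> (real^'d) set set \<Rightarrow> bool" where
  "mesh \<Omega> \<tau> \<Q> \<longleftrightarrow>
     \<tau> > 0 \<and> finite \<Q> \<and> (\<forall>Q\<in>\<Q>. cube \<tau> Q) \<and>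
     (\<forall>Q\<in>\<Q>. \<forall>R\<in>\<Q>. Q \<noteq> R \<longrightarrow> interior Q \<inter> interior R = {}) \<and>
     negligible ((\<Union>\<Q> - \<Omega>) \<union> (\<Omega> - \<Union>\<Q>)) \<and>
     (\<forall>Q\<in>\<Q>. \<forall>R\<in>\<Q>. Q \<noteq> R \<longrightarrow> Q \<inter> R = {} \<or> (Q \<inter> R face_of Q \<and> Q \<inter> R face_of R))"

definition admissible_mesh_pair ::
    "(real^'d) set \<Rightarrow> real \<Rightarrow> real \<Rightarrow> (real^'d) set set \<Rightarrow> (real^'d) set set \<Rightarrow> bool" where
  "admissible_mesh_pair \<Omega> h \<tau> \<Q>h \<Q>\<tau> \<longleftrightarrow>
     h > 0 \<and> 0 < \<tau> \<and> \<tau> \<le> h \<and> mesh \<Omega> h \<Q>h \<and> mesh \<Omega> \<tau> \<Q>\<tau> \<and>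
     (\<forall>Q\<in>\<Q>h. \<exists>S\<subseteq>\<Q>\<tau>. Q = \<Union>S)"

definition P0 :: "(real^'d) set set \<Rightarrow> (real^'d \<Rightarrow> real) set" where
  "P0 \<Q> = {w. \<forall>Q\<in>\<Q>. \<exists>v. AE x in lebesgue_on Q. w x = v}"

subsection \<open>Raviart-Thomas fields and the discretized total variation\<close>

definition has_weak_divergence ::
    "(real^'d) set \<Rightarrow> (real^'d \<Rightarrow> real^'d) \<Rightarrow> (real^'d \<Rightarrow> real) \<Rightarrow> bool" where
  "has_weak_divergence \<Omega> \<phi> g \<longleftrightarrow>
     (\<forall>\<psi>\<in>C1c \<Omega>. (\<integral>x. \<phi> x \<bullet> (\<chi> i. partial_deriv i \<psi> x) \<partial>lebesgue_on \<Omega>) =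
        - (\<integral>x. g x * \<psi> x \<partial>lebesgue_on \<Omega>))"

definition Hdiv :: "(real^'d) set \<Rightarrow> (real^'d \<Rightarrow> real^'d) set" where
  "Hdiv \<Omega> = {\<phi> \<in> L2 \<Omega>. \<exists>g\<in>L2 \<Omega>. has_weak_divergence \<Omega> \<phi> g}"

text \<open>
  The cellwise form is imposed on cell interiors only, because the tangential components of a
  Raviart-Thomas field may jump across faces.
\<close>

definition RT0 :: "(real^'d) set \<Rightarrow> (real^'d) set set \<Rightarrow> (real^'d \<Rightarrow> real^'d) set" where
  "RT0 \<Omega> \<Q> = {\<phi> \<in> Hdiv \<Omega>. \<forall>Q\<in>\<Q>. \<exists>a c. \<forall>x\<in>interior Q. \<phi> x = (\<chi> i. a $ i + c $ i * x $ i)}"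

text \<open>
  \<open>n\<close> is the outer unit normal at the boundary point \<open>x\<close> if the boundary has the tangent hyperplane
  orthogonal to \<open>n\<close> there and \<open>\<Omega>\<close> lies on the side of \<open>- n\<close>. No such \<open>n\<close> exists at points on edges
  and corners, which form a null set of the boundary.
\<close>

definition outer_unit_normal :: "(real^'d) set \<Rightarrow> real^'d \<Rightarrow> real^'d \<Rightarrow> bool" where
  "outer_unit_normal \<Omega> x n \<longleftrightarrow>
     x \<in> frontier \<Omega> \<and> norm n = 1 \<and>
     (\<forall>\<epsilon>>0. \<exists>r>0. \<forall>y\<in>ball x r.
        ((y - x) \<bullet> n < - \<epsilon> * norm (y - x) \<longrightarrow> y \<in> \<Omega>) \<and>
        ((y - x) \<bullet> n > \<epsilon> * norm (y - x) \<longrightarrow> y \<notin> \<Omega>))"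

text \<open>
  The boundary value of \<open>\<phi> \<bullet> n\<close> is the limit from within the adjacent cells. The filter is trivial,
  and so is the condition, for cells that do not contain \<open>x\<close>.
\<close>

definition RT0_0 :: "(real^'d) set \<Rightarrow> (real^'d) set set \<Rightarrow> (real^'d \<Rightarrow> real^'d) set" where
  "RT0_0 \<Omega> \<Q> = {\<phi> \<in> RT0 \<Omega> \<Q>. \<forall>x n. outer_unit_normal \<Omega> x n \<longrightarrow>
       (\<forall>Q\<in>\<Q>. ((\<lambda>y. \<phi> y \<bullet> n) \<longlongrightarrow> 0) (at x within interior Q))}"

definition Linf_norm :: "(real^'d) set \<Rightarrow> (real^'d \<Rightarrow> real^'d) \<Rightarrow> ereal" where
  "Linf_norm \<Omega> \<phi> = esssup (lebesgue_on \<Omega>) (\<lambda>x. ereal (norm (\<phi> x)))"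

definition TVh :: "(real^'d) set \<Rightarrow> (real^'d) set set \<Rightarrow> (real^'d \<Rightarrow> real) \<Rightarrow> ereal" where
  "TVh \<Omega> \<Q> w = (SUP (\<phi>, g)\<in>{(\<phi>, g). \<phi> \<in> RT0_0 \<Omega> \<Q> \<and> g \<in> L2 \<Omega> \<and> has_weak_divergence \<Omega> \<phi> g \<and>
                                  Linf_norm \<Omega> \<phi> \<le> 1}.
                  ereal (\<integral>x. w x * g x \<partial>lebesgue_on \<Omega>))"

subsection \<open>The optimization problems\<close>

definition indicator_functional :: "'a set \<Rightarrow> 'a \<Rightarrow> ereal" where
  "indicator_functional A x = (if x \<in> A then 0 else \<infinity>)"

definition Z :: "(real^'d) set \<Rightarrow> int set \<Rightarrow> real \<Rightarrow> (real^'d \<Rightarrow> real) set" where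
  "Z \<Omega> W c = {w \<in> L1_W \<Omega> W. TV \<Omega> w \<le> ereal c * TV \<Omega> w}"

definition G :: "(real^'d) set \<Rightarrow> int set \<Rightarrow> ((real^'d \<Rightarrow> real) \<Rightarrow> real) \<Rightarrow> real \<Rightarrow> real \<Rightarrow>
    (real^'d \<Rightarrow> real) \<Rightarrow> ereal" where
  "G \<Omega> W F \<alpha> c w = ereal (F w) + ereal \<alpha> * TV \<Omega> w + indicator_functional (Z \<Omega> W c) w"

definition minimizer_P :: "(real^'d) set \<Rightarrow> int set \<Rightarrow> ((real^'d \<Rightarrow> real) \<Rightarrow> real) \<Rightarrow> real \<Rightarrow> real \<Rightarrow>
    (real^'d \<Rightarrow> real) \<Rightarrow> bool" where
  "minimizer_P \<Omega> W F \<alpha> c w \<longleftrightarrow> w \<in> L2 \<Omega> \<and> (\<forall>v\<in>L2 \<Omega>. G \<Omega> W F \<alpha> c w \<le> G \<Omega> W F \<alpha> c v)"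

definition Zh :: "(real^'d) set \<Rightarrow> int set \<Rightarrow> real \<Rightarrow> (real^'d) set set \<Rightarrow> (real^'d) set set \<Rightarrow>
    ((real^'d \<Rightarrow> real) \<times> real) set" where
  "Zh \<Omega> W c \<Q>h \<Q>\<tau> = {(w, V). w \<in> P0 \<Q>\<tau> \<inter> L1_W \<Omega> W \<and> TV \<Omega> w \<le> ereal (c * V) \<and>
                             TVh \<Omega> \<Q>h w \<le> ereal V}"

definition Gh :: "(real^'d) set \<Rightarrow> int set \<Rightarrow> ((real^'d \<Rightarrow> real) \<Rightarrow> real) \<Rightarrow> real \<Rightarrow> real \<Rightarrow>
    (real^'d) set set \<Rightarrow> (real^'d) set set \<Rightarrow> (real^'d \<Rightarrow> real) \<Rightarrow> real \<Rightarrow> ereal" where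
  "Gh \<Omega> W F \<alpha> c \<Q>h \<Q>\<tau> w V =
     ereal (F w) + ereal (\<alpha> * V) + indicator_functional (Zh \<Omega> W c \<Q>h \<Q>\<tau>) (w, V)"

definition minimizer_Ph :: "(real^'d) set \<Rightarrow> int set \<Rightarrow> ((real^'d \<Rightarrow> real) \<Rightarrow> real) \<Rightarrow> real \<Rightarrow> real \<Rightarrow>
    (real^'d) set set \<Rightarrow> (real^'d) set set \<Rightarrow> (real^'d \<Rightarrow> real) \<Rightarrow> real \<Rightarrow> bool" where
  "minimizer_Ph \<Omega> W F \<alpha> c \<Q>h \<Q>\<tau> w V \<longleftrightarrow> w \<in> L2 \<Omega> \<and>
     (\<forall>v\<in>L2 \<Omega>. \<forall>U. Gh \<Omega> W F \<alpha> c \<Q>h \<Q>\<tau> w V \<le> Gh \<Omega> W F \<alpha> c \<Q>h \<Q>\<tau> v U)"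

subsection \<open>Subsequences of families indexed by mesh sizes\<close>

definition subsequence_to_0 :: "real set \<Rightarrow> (nat \<Rightarrow> real) \<Rightarrow> bool" where
  "subsequence_to_0 H hs \<longleftrightarrow> (\<forall>k. hs k \<in> H) \<and> (\<forall>k. hs (Suc k) < hs k) \<and> hs \<longlonglongrightarrow> 0"

definition weak_star_accumulation_point ::
    "(real^'d) set \<Rightarrow> real set \<Rightarrow> (real \<Rightarrow> real^'d \<Rightarrow> real) \<Rightarrow> (real^'d \<Rightarrow> real) \<Rightarrow> bool" where
  "weak_star_accumulation_point \<Omega> H w w0 \<longleftrightarrow>
     (\<exists>hs. subsequence_to_0 H hs \<and> BV_weak_star_tendsto \<Omega> (\<lambda>k. w (hs k)) w0)"

end

theory Submission
 imports Defs "HOL-Library.Diagonal_Subsequence" "HOL-Probability.Helly_Selection"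
begin

text \<open>
  Constants are admissible, so the minimizers have bounded total variation; the Poincare inequality
  on mesh cells then gives compactness in \<open>L\<^sup>1\<close>, and the derivatives converge because \<open>C\<^sup>1\<^sub>c\<close> is dense
  in \<open>C\<^sub>0\<close>. For the lower bound, the Raviart-Thomas interpolant of a smooth test field has almost the
  same norm and divergence, so \<open>TV\<^sup>h\<close> asymptotically dominates \<open>TV\<close>. For the recovery sequence, a
  competitor \<open>v\<close> is replaced in every input cell by its value at a sample point, with the same offset
  in all cells. On average over the offset the result \<open>v'\<close> has total variation at most \<open>sqrt d TV(v)\<close>,
  which is where the lower bound on \<open>c\<close> enters, and \<open>L\<^sup>1\<close> distance \<open>O(\<tau>)\<close> to \<open>v\<close>; a penalty of weight
  \<open>\<delta> / \<tau>\<close> on the distance achieves both for one offset. Since \<open>TV\<^sup>h(v) \<le> TV(v)\<close> and Raviart-Thomas fields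
  bounded by 1 have divergence at most \<open>2 d / h\<close>, one gets \<open>TV\<^sup>h(v') \<le> TV(v) + O(\<tau> / h)\<close>.
\<close>

text \<open>Two obstacles shape the argument. Fields in RT0 have divergences that are constant on TV
  cells, so \<open>TVh\<close> does not see oscillations inside a TV cell; compactness of the
  minimizers comes from the constraint TV \<le> c V. On the other side, a function that is constant
  on axis-aligned cells has an anisotropic perimeter, so its total variation cannot be expected to
  approach that of a competitor; the factor c absorbs the excess, which \<open>TVh\<close> must not
  see. Values in \<open>W\<close> forbid averaging over cells, hence the sampling, and its L1 error
  meets a divergence of size 1 / h, hence the condition on \<tau> / h.

  Raviart-Thomas fields are not admissible test fields for TV. The bridge is a duality for
  translations: a weighted sum of translation differences of v is the pairing of v with the
  divergence of a field built from averages of the weights along segments. It yields the Poincare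
  inequality, the cost of sampling, TVh \<le> TV and the mass of the difference quotients whose
  limits represent the derivative, so neither traces nor structure theory of BV functions
  enter.\<close>

lemmas lint_norm_bound_lint = Bochner_Integration.integral_norm_bound_integral
  and lintegrable_bound = Bochner_Integration.integrable_bound
  and lintegrable_diff = Bochner_Integration.integrable_diff
  and lint_nonneg = Bochner_Integration.integral_nonneg
  and lintegrable_add = Bochner_Integration.integrable_add
  and lintegrable_sum = Bochner_Integration.integrable_sum
  and lint_diff = Bochner_Integration.integral_diff
  and lint_zero = Bochner_Integration.integral_zero
  and lint_cong = Bochner_Integration.integral_cong
  and lint_sum = Bochner_Integration.integral_sum
  and lint_add = Bochner_Integration.integral_add

abbreviation ind :: "'a set => 'a => real" where
  "ind \<equiv> indicator"

abbreviation Borel :: "('a::topological_space => 'b::topological_space) set" where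
  "Borel \<equiv> borel_measurable borel"

section \<open>Continuously differentiable test functions\<close>

text \<open>The derivative is stored as a gradient vector rather than as a bounded linear map, so
  that components, inner products and norms can be used directly; \<open>C1cE\<close> and
  \<open>C1cI\<close> translate from and to \<open>C1c\<close>.\<close>

definition C1_grad :: "(real^'d => real) => (real^'d => real^'d) => bool" where
 "C1_grad f Df \<longleftrightarrow> (\<forall>x. (f has_derivative (\<lambda>h. Df x \<bullet> h)) (at x)) \<and> continuous_on UNIV Df"

lemma tendsto_at_sequence:
 assumes "(f \<longlongrightarrow> L) (at a)" "S \<longlonglongrightarrow> a" "\<And>n. S n \<noteq> a"
 shows "(\<lambda>n. f (S n)) \<longlonglongrightarrow> L"
 using assms by (intro filterlim_compose[OF assms(1)]) (simp add: filterlim_at)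

lemma C1_grad_partial_deriv:
 assumes "C1_grad f Df" shows "partial_deriv i f x = Df x $ i"
proof -
 have "(f has_derivative (\<lambda>h. Df x \<bullet> h)) (at x)"
  using assms by (simp add: C1_grad_def)
 from frechet_derivative_at[OF this, symmetric] show ?thesis
  by (simp add: partial_deriv_def inner_axis)
qed

lemma C1_grad_continuous:
 assumes "C1_grad f Df" shows "continuous_on UNIV f"
 using assms unfolding C1_grad_def
 by (meson continuous_at_imp_continuous_on has_derivative_continuous)

lemma C1_grad_measurable:
 assumes "C1_grad f Df" shows "f \<in> Borel" "Df \<in> Borel"
 using assms C1_grad_continuous[OF assms]
 by (auto simp: C1_grad_def borel_measurable_continuous_onI)

lemma C1_grad_lipschitz:
 assumes f: "C1_grad f Df" and C: "\<And>x. norm (Df x) \<le> C"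
 shows "\<bar>f x - f y\<bar> \<le> C * norm (x - y)"
proof -
 have "norm (f x - f y) \<le> C * norm (x - y)"
 proof (rule differentiable_bound[of UNIV f "\<lambda>x h. Df x \<bullet> h" C])
  fix x :: "real^'a"
  show "(f has_derivative (\<lambda>h. Df x \<bullet> h)) (at x within UNIV)"
   using f by (auto simp: C1_grad_def)
  have "norm (Df x \<bullet> h) \<le> C * norm h" for h
   using Cauchy_Schwarz_ineq2[of "Df x" h] C[of x]
   by (metis mult_right_mono norm_ge_zero order_trans real_norm_def)
  thus "onorm ((\<bullet>) (Df x)) \<le> C"
   by (intro onorm_le) auto
 qed auto
 thus ?thesis by simp
qed

lemma C1_grad_zero_outside:
 assumes f: "C1_grad f Df" and K: "closed K" "\<And>x. f x \<noteq> 0 ==> x \<in> K" and x: "x \<notin> K"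
 shows "Df x = 0"
proof -
 have "(f has_derivative (\<lambda>h. Df x \<bullet> h)) (at x)"
  using f by (auto simp: C1_grad_def)
 moreover have "((\<lambda>_. 0) has_derivative (\<lambda>h. 0)) (at x)"
  by simp
 hence "(f has_derivative (\<lambda>h. 0)) (at x)"
  by (rule has_derivative_transform_within_open[of _ _ _ _ "- K"]) (use K x in auto)
 ultimately have "(\<lambda>h. Df x \<bullet> h) = (\<lambda>h. 0)"
  by (rule has_derivative_unique)
 thus ?thesis
  by (metis inner_eq_zero_iff)
qed

lemma bounded_of_compact_support:
 fixes f :: "'a::topological_space => 'b::real_normed_vector"
 assumes "continuous_on UNIV f" "compact K" "\<And>x. f x \<noteq> 0 ==> x \<in> K"
 obtains C where "C > 0" "\<And>x. norm (f x) \<le> C"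
proof -
 have "compact (f ` K)"
  using assms by (meson compact_continuous_image continuous_on_subset subset_UNIV)
 then obtain C where C: "C > 0" "\<And>y. y \<in> f ` K ==> norm y \<le> C"
  using bounded_pos[of "f ` K"] compact_imp_bounded by blast
 have "norm (f x) \<le> C" for x
  using assms(3)[of x] C by (cases "f x = 0") auto
 with C show ?thesis using that by blast
qed

lemma uniformly_continuous_of_compact_support:
 fixes f :: "'a::heine_borel => 'b::real_normed_vector"
 assumes f: "continuous_on UNIV f" and K: "compact K" "\<And>x. f x \<noteq> 0 ==> x \<in> K" and e: "e > 0"
 obtains d where "d > 0" "\<And>x y. dist x y < d ==> norm (f x - f y) < e"
proof -
 have "bounded K"
  using K compact_imp_bounded by blast
 then obtain c r where cr: "K \<subseteq> cball c r"
  using bounded_subset_cball by blast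
 \<comment> \<open>The extra unit of radius puts both points into the ball as soon as one lies in
   \<open>K\<close> and their distance is below 1.\<close>
 let ?B = "cball c (r + 1)"
 have "uniformly_continuous_on ?B f"
  by (meson compact_cball compact_uniformly_continuous continuous_on_subset f subset_UNIV)
 then obtain d where d: "d > 0" "\<And>x y. x \<in> ?B ==> y \<in> ?B ==> dist y x < d ==> dist (f y) (f x) < e"
  unfolding uniformly_continuous_on_def using e by meson
 have "norm (f x - f y) < e" if xy: "dist x y < min d 1" for x y
 proof (cases "x \<in> K \<or> y \<in> K")
  case True
  hence "dist c x \<le> r \<or> dist c y \<le> r" using cr by auto
  hence "x \<in> ?B" "y \<in> ?B"
   using xy dist_triangle[of c x y] dist_triangle[of c y x] by (auto simp: dist_commute)
  thus ?thesis using d(2)[of y x] xy by (auto simp: dist_norm)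
 next
  case False
  hence "f x = 0" "f y = 0" using K by blast+
  thus ?thesis using e by simp
 qed
 with d show ?thesis
  by (intro that[of "min d 1"]) auto
qed

lemma compact_supportI:
 fixes f :: "'a::heine_borel => 'b::real_normed_vector"
 assumes "compact K" "K \<subseteq> S" "\<And>x. f x \<noteq> 0 ==> x \<in> K"
 shows "compact (closure {x. f x \<noteq> 0}) \<and> closure {x. f x \<noteq> 0} \<subseteq> S"
proof -
 have "closure {x. f x \<noteq> 0} \<subseteq> K"
  using assms by (intro closure_minimal) (auto simp: compact_imp_closed)
 thus ?thesis
  using assms by (meson closed_closure closed_subset compact_closure compact_imp_bounded
    bounded_subset dual_order.trans closure_subset)
qed

lemma C1c_memI:
 fixes f :: "real^'d => 'b::real_normed_vector"
 assumes "\<And>x. (f has_derivative blinfun_apply (f' x)) (at x)" "continuous_on UNIV f'"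
  and "compact (closure {x. f x \<noteq> 0}) \<and> closure {x. f x \<noteq> 0} \<subseteq> \<O>"
 shows "f \<in> C1c \<O>"
 unfolding C1c_def using assms by (auto intro!: exI[of _ f'])

lemma C1cI:
 assumes f: "C1_grad f Df" and K: "compact K" "K \<subseteq> \<O>" "\<And>x. f x \<noteq> 0 ==> x \<in> K"
 shows "f \<in> C1c \<O>"
proof -
 have "(f has_derivative blinfun_apply (blinfun_inner_right (Df x))) (at x)" for x
  using f by (simp add: C1_grad_def)
 moreover have "continuous_on UNIV (\<lambda>x. blinfun_inner_right (Df x))"
  using f by (auto simp: C1_grad_def
    intro: bounded_linear.continuous_on[OF bounded_linear_blinfun_inner_right])
 moreover have "compact (closure {x. f x \<noteq> 0}) \<and> closure {x. f x \<noteq> 0} \<subseteq> \<O>"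
  using K by (rule compact_supportI)
 ultimately show ?thesis
  by (rule C1c_memI)
qed

lemma C1cE:
 fixes f :: "real^'d => real"
 assumes "f \<in> C1c \<O>"
 obtains Df K where "C1_grad f Df" "compact K" "K \<subseteq> \<O>" "\<And>x. f x \<noteq> 0 ==> x \<in> K"
  "\<And>x. Df x \<noteq> 0 ==> x \<in> K"
proof -
 obtain f' :: "real^'d => ((real^'d) \<Rightarrow>\<^sub>L real)" where
  f': "\<And>x. (f has_derivative blinfun_apply (f' x)) (at x)" "continuous_on UNIV f'"
  using assms unfolding C1c_def by blast
 define Df where "Df x = (\<chi> i. f' x (axis i 1))" for x
 let ?K = "closure {x. f x \<noteq> 0}"
 have eq: "blinfun_apply (f' x) h = Df x \<bullet> h" for x h
 proof -
  have "f' x h = f' x (\<Sum>i\<in>UNIV. h $ i *\<^sub>R axis i 1)"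
   using basis_expansion[of h] by (simp add: scalar_mult_eq_scaleR)
  also have "... = (\<Sum>i\<in>UNIV. h $ i * f' x (axis i 1))"
   by (simp add: blinfun.sum_right blinfun.scaleR_right)
  also have "... = Df x \<bullet> h"
   by (simp add: Df_def inner_vec_def mult.commute[of "h $ _"])
  finally show ?thesis .
 qed
 have "continuous_on UNIV Df"
  unfolding Df_def
  by (intro continuous_on_vec_lambda blinfun.continuous_on f'(2) continuous_on_const)
 moreover have "(f has_derivative (\<lambda>h. Df x \<bullet> h)) (at x)" for x
  using f'(1)[of x] by (simp add: eq[abs_def])
 ultimately have "C1_grad f Df"
  unfolding C1_grad_def by blast
 have "compact ?K" "?K \<subseteq> \<O>" and nz: "\<And>x. f x \<noteq> 0 ==> x \<in> ?K"
  using assms closure_subset[of "{x. f x \<noteq> 0}"] by (auto simp: C1c_def)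
 have "Df x = 0" if "x \<notin> ?K" for x
  using \<open>C1_grad f Df\<close> closed_closure nz that by (rule C1_grad_zero_outside)
 hence "\<And>x. Df x \<noteq> 0 ==> x \<in> ?K"
  by blast
 with \<open>C1_grad f Df\<close> \<open>compact ?K\<close> \<open>?K \<subseteq> \<O>\<close> nz show ?thesis
  by (rule that)
qed

lemma C1c_vecI:
 fixes f :: "'d => real^'d => real"
 assumes f: "\<And>i. C1_grad (f i) (Df i)" and K: "compact K" "K \<subseteq> \<O>" "\<And>i x. f i x \<noteq> 0 ==> x \<in> K"
 shows "(\<lambda>x. \<chi> i. f i x) \<in> C1c \<O>" "divergence (\<lambda>x. \<chi> i. f i x) x = (\<Sum>i\<in>UNIV. Df i x $ i)"
proof -
 let ?f = "\<lambda>x. \<chi> i. f i x"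
 define f' where "f' x = (\<Sum>i\<in>UNIV. blinfun_scaleR_left (axis i 1 :: real^'d) o\<^sub>L blinfun_inner_right (Df i x))"
  for x :: "real^'d"
 have app: "blinfun_apply (f' x) h = (\<chi> i. Df i x \<bullet> h)" for x h
 proof -
  have "(\<chi> i. Df i x \<bullet> h) = (\<Sum>i\<in>UNIV. (Df i x \<bullet> h) *\<^sub>R axis i 1)"
   using basis_expansion[of "\<chi> i. Df i x \<bullet> h"] by (simp add: scalar_mult_eq_scaleR)
  thus ?thesis
   by (simp add: f'_def blinfun.sum_left)
 qed
 have der: "(?f has_derivative blinfun_apply (f' x)) (at x)" for x
  unfolding app[abs_def]
  by (subst has_derivative_componentwise_within)
   (use f in \<open>auto simp: C1_grad_def Basis_vec_def inner_axis\<close>)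
 have cont: "continuous_on UNIV (Df i)" for i
  using f by (auto simp: C1_grad_def)
 have "continuous_on UNIV f'"
  unfolding f'_def
  by (intro continuous_on_sum bounded_bilinear.continuous_on[OF bounded_bilinear_blinfun_compose]
    continuous_on_const bounded_linear.continuous_on[OF bounded_linear_blinfun_inner_right] cont)
 have nz: "?f x \<noteq> 0 ==> x \<in> K" for x
  using K(3)[of _ x] by (auto simp: vec_eq_iff)
 have "compact (closure {x. ?f x \<noteq> 0}) \<and> closure {x. ?f x \<noteq> 0} \<subseteq> \<O>"
  using K(1,2) nz by (rule compact_supportI)
 with \<open>continuous_on UNIV f'\<close> show "?f \<in> C1c \<O>"
  by (intro C1c_memI[OF der])
 show "divergence ?f x = (\<Sum>i\<in>UNIV. Df i x $ i)"
  unfolding divergence_def partial_deriv_def frechet_derivative_at[OF der, symmetric] app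
  by (simp add: inner_axis)
qed

lemma C1c_vecE:
 fixes \<phi> :: "real^'d => real^'d"
 assumes "\<phi> \<in> C1c \<O>"
 obtains Df K where "\<And>i. C1_grad (\<lambda>x. \<phi> x $ i) (Df i)" "compact K" "K \<subseteq> \<O>"
  "\<And>x. \<phi> x \<noteq> 0 ==> x \<in> K" "\<And>i x. Df i x \<noteq> 0 ==> x \<in> K"
  "\<And>x. divergence \<phi> x = (\<Sum>i\<in>UNIV. Df i x $ i)"
proof -
 obtain \<phi>' :: "real^'d => ((real^'d) \<Rightarrow>\<^sub>L (real^'d))" where
  \<phi>': "\<And>x. (\<phi> has_derivative blinfun_apply (\<phi>' x)) (at x)" "continuous_on UNIV \<phi>'"
  using assms unfolding C1c_def by blast
 let ?K = "closure {x. \<phi> x \<noteq> 0}"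
 have K: "compact ?K" "?K \<subseteq> \<O>" "\<And>x. \<phi> x \<noteq> 0 ==> x \<in> ?K"
  using assms closure_subset[of "{x. \<phi> x \<noteq> 0}"] by (auto simp: C1c_def)
 have "(\<lambda>x. \<phi> x $ i) \<in> C1c \<O>" for i
 proof -
  let ?g = "\<lambda>x. blinfun_inner_right (axis i 1) o\<^sub>L \<phi>' x"
  have "((\<lambda>x. \<phi> x $ i) has_derivative blinfun_apply (?g x)) (at x)" for x
  proof -
   have "((\<lambda>x. axis i 1 \<bullet> \<phi> x) has_derivative (\<lambda>h. axis i 1 \<bullet> \<phi>' x h)) (at x)"
    using \<phi>'(1) by (intro has_derivative_inner_right)
   moreover have "blinfun_apply (?g x) = (\<lambda>h. axis i 1 \<bullet> \<phi>' x h)"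
    by auto
   ultimately show ?thesis by (simp add: inner_axis')
  qed
  moreover have "continuous_on UNIV ?g"
   using \<phi>' by (intro bounded_bilinear.continuous_on[OF bounded_bilinear_blinfun_compose]
     continuous_on_const)
  moreover have "compact (closure {x. \<phi> x $ i \<noteq> 0}) \<and> closure {x. \<phi> x $ i \<noteq> 0} \<subseteq> \<O>"
   using K(1,2)
  proof (rule compact_supportI)
   show "\<phi> x $ i \<noteq> 0 ==> x \<in> ?K" for x
    using K(3)[of x] by force
  qed
  ultimately show ?thesis
   by (rule C1c_memI)
 qed
 hence "\<exists>Df. C1_grad (\<lambda>x. \<phi> x $ i) Df" for i
  using C1cE by blast
 then obtain Df where Df: "\<And>i. C1_grad (\<lambda>x. \<phi> x $ i) (Df i)"
  by metis
 have 1: "\<phi> x $ i \<noteq> 0 ==> x \<in> ?K" for i x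
  using K(3)[of x] by force
 have "x \<notin> ?K ==> Df i x = 0" for i x
  using Df closed_closure 1 by (rule C1_grad_zero_outside)
 hence "\<And>i x. Df i x \<noteq> 0 ==> x \<in> ?K"
  by blast
 moreover have "divergence \<phi> x = (\<Sum>i\<in>UNIV. Df i x $ i)" for x
  using C1c_vecI(2)[of "\<lambda>i x. \<phi> x $ i" Df ?K \<O> x] Df K(1,2) 1 by simp
 ultimately show ?thesis
  using Df K by (intro that[of Df ?K])
qed

section \<open>Integrals on the whole space: translations and integration by parts\<close>

lemma integrable_bounded_support:
 fixes u :: "'a::euclidean_space => 'b::{banach, second_countable_topology}"
 assumes u: "u \<in> Borel" "\<And>x. norm (u x) \<le> C" and S: "bounded S" "\<And>x. u x \<noteq> 0 ==> x \<in> S"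
 shows "integrable lborel u"
proof -
 obtain a where a: "S \<subseteq> cbox (-a) a"
  using bounded_subset_cbox_symmetric[OF S(1)] by blast
 show ?thesis
 proof (rule integrableI_bounded_set[where A="cbox (-a) a" and B=C])
  show "cbox (-a) a \<in> sets lborel" "emeasure lborel (cbox (-a) a) < \<infinity>"
   by (auto simp: emeasure_lborel_cbox_eq)
  show "AE x in lborel. x \<in> cbox (- a) a --> norm (u x) \<le> C"
   using u(2) by simp
  show "AE x in lborel. x \<notin> cbox (- a) a --> u x = 0"
   using S a by (intro AE_I2) blast
 qed (use u in auto)
qed

lemma
 fixes u :: "'a::euclidean_space => 'b::{banach, second_countable_topology}"
 assumes u: "u \<in> Borel"
 shows integral_lborel_translate: "(LBINT x. u (x + a)) = (LBINT x. u x)"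
  and integrable_lborel_translate: "integrable lborel (\<lambda>x. u (x + a)) \<longleftrightarrow> integrable lborel u"
proof -
 have "(LBINT x. u x) = (\<integral>x. u x \<partial>distr lborel borel ((+) a))"
  by (simp add: lborel_distr_plus)
 also have "... = (LBINT x. u (a + x))"
  using u by (subst integral_distr) auto
 finally show "(LBINT x. u (x + a)) = (LBINT x. u x)"
  by (simp add: add.commute)
 have "integrable lborel u \<longleftrightarrow> integrable (distr lborel borel ((+) a)) u"
  by (simp add: lborel_distr_plus)
 also have "... \<longleftrightarrow> integrable lborel (\<lambda>x. u (a + x))"
  using u by (subst integrable_distr_eq) auto
 finally show "integrable lborel (\<lambda>x. u (x + a)) \<longleftrightarrow> integrable lborel u"
  by (simp add: add.commute)
qed

text \<open>Dominated convergence: by the Lipschitz bound the quotients are at most a constant times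
  \<open>norm e\<close>, and for steps at most 1 they vanish outside an enlargement of
  \<open>K\<close>. Local boundedness of \<psi> suffices, which covers bounded Borel functions as
  well as affine ones.\<close>

lemma difference_quotient_limit:
 fixes \<psi> f :: "real^'d => real" and e :: "real^'d"
 assumes \<psi>: "\<psi> \<in> Borel" "\<And>S. bounded S ==> \<exists>B. \<forall>x\<in>S. \<bar>\<psi> x\<bar> \<le> B"
  and f: "C1_grad f Df" "compact K" "\<And>x. f x \<noteq> 0 ==> x \<in> K"
  and t: "\<And>n. 0 < t n" "\<And>n. t n \<le> 1" and t0: "t \<longlonglongrightarrow> 0"
 shows "(\<lambda>n. \<integral>x. \<psi> x * ((f (x + t n *\<^sub>R e) - f x) / t n) \<partial>lborel) \<longlonglongrightarrow> (LBINT x. \<psi> x * (Df x \<bullet> e))"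
proof -
 have [measurable]: "\<psi> \<in> Borel" "f \<in> Borel" "Df \<in> Borel"
  using \<psi> C1_grad_measurable[OF f(1)] by auto
 have "x \<notin> K ==> Df x = 0" for x
  using f(1) compact_imp_closed[OF f(2)] f(3) by (rule C1_grad_zero_outside)
 hence GK: "Df x \<noteq> 0 ==> x \<in> K" for x
  by blast
 obtain C where C: "C > 0" "\<And>x. norm (Df x) \<le> C"
  using bounded_of_compact_support[of Df K] f GK unfolding C1_grad_def by metis
 obtain c r where cr: "K \<subseteq> cball c r"
  using bounded_subset_cball compact_imp_bounded[OF f(2)] by blast
 let ?S = "cball c (r + norm e)"
 have shiftK: "x + s *\<^sub>R e \<in> K ==> \<bar>s\<bar> \<le> 1 ==> x \<in> ?S" for x s
 proof -
  assume a: "x + s *\<^sub>R e \<in> K" "\<bar>s\<bar> \<le> 1"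
  have "dist c x \<le> dist c (x + s *\<^sub>R e) + dist (x + s *\<^sub>R e) x"
   by (rule dist_triangle)
  also have "... \<le> r + norm e"
   using a cr by (intro add_mono) (auto simp: dist_norm mult_left_le_one_le)
  finally show "x \<in> ?S" by simp
 qed
 obtain B where B: "\<And>x. x \<in> ?S ==> \<bar>\<psi> x\<bar> \<le> B"
  using \<psi>(2)[OF bounded_cball] by blast
 define B' where "B' = max B 0"
 have B': "x \<in> ?S ==> \<bar>\<psi> x\<bar> \<le> B'" "B' \<ge> 0" for x
  using B[of x] by (auto simp: B'_def)
 define D where "D n x = (f (x + t n *\<^sub>R e) - f x) / t n" for n x
 have [measurable]: "D n \<in> Borel" for n
  unfolding D_def by measurable
 have lim1: "(\<lambda>n. \<integral>x. \<psi> x * D n x \<partial>lborel) \<longlonglongrightarrow> (LBINT x. \<psi> x * (Df x \<bullet> e))"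
 proof (rule integral_dominated_convergence[where w="\<lambda>x. ind ?S x * (B' * (C * norm e))"])
  show "integrable lborel (\<lambda>x. ind ?S x * (B' * (C * norm e)))"
   by (rule integrable_bounded_support[where C="B' * (C * norm e)" and S="?S"])
    (use B' C in \<open>auto simp: indicator_def split: if_splits\<close>)
  show "AE x in lborel. (\<lambda>n. \<psi> x * D n x) \<longlonglongrightarrow> \<psi> x * (Df x \<bullet> e)"
  proof (rule AE_I2)
   fix x
   have "(f has_derivative (\<lambda>h. Df x \<bullet> h)) (at x)"
    using f by (auto simp: C1_grad_def)
   hence "((\<lambda>s. f (x + s *\<^sub>R e)) has_derivative (\<lambda>s. Df x \<bullet> (s *\<^sub>R e))) (at 0)"
    by (intro has_derivative_compose[of "\<lambda>s. x + s *\<^sub>R e" "\<lambda>s. s *\<^sub>R e" 0 UNIV f, simplified])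
     (auto intro!: derivative_eq_intros)
   moreover have "(\<lambda>s. Df x \<bullet> (s *\<^sub>R e)) = (*) (Df x \<bullet> e)"
    by (auto simp: mult.commute)
   ultimately have "((\<lambda>s. f (x + s *\<^sub>R e)) has_real_derivative (Df x \<bullet> e)) (at 0)"
    by (simp add: has_field_derivative_def)
   hence "(\<lambda>s. (f (x + s *\<^sub>R e) - f x) / s) \<midarrow>0\<rightarrow> Df x \<bullet> e"
    by (simp add: DERIV_def)
   hence "(\<lambda>n. D n x) \<longlonglongrightarrow> Df x \<bullet> e"
    unfolding D_def by (rule tendsto_at_sequence) (use t0 less_imp_neq[OF t(1), symmetric] in auto)
   thus "(\<lambda>n. \<psi> x * D n x) \<longlonglongrightarrow> \<psi> x * (Df x \<bullet> e)"
    by (intro tendsto_intros)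
  qed
  show "AE x in lborel. norm (\<psi> x * D n x) \<le> ind ?S x * (B' * (C * norm e))" for n
  proof (rule AE_I2)
   fix x
   have "\<bar>f (x + t n *\<^sub>R e) - f x\<bar> \<le> C * norm (t n *\<^sub>R e)"
    using C1_grad_lipschitz[OF f(1) C(2), of "x + t n *\<^sub>R e" x] by simp
   hence "\<bar>D n x\<bar> \<le> C * norm e"
    using t[of n] by (simp add: D_def abs_divide pos_divide_le_eq mult_ac)
   moreover have "D n x \<noteq> 0 ==> x \<in> ?S"
    using f(3)[of x] f(3)[of "x + t n *\<^sub>R e"] shiftK[of x "t n"] shiftK[of x 0] t[of n]
    by (cases "f x = 0") (auto simp: D_def)
   ultimately have "norm (\<psi> x * D n x) \<le> ind ?S x * (B' * (C * norm e))
     \<and> (x \<in> ?S \<or> D n x = 0)" if "x \<in> ?S"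
    unfolding norm_mult using B'(1)[OF that] B'(2) that by (auto intro!: mult_mono)
   moreover have "x \<notin> ?S ==> D n x = 0"
    using \<open>D n x \<noteq> 0 ==> x \<in> ?S\<close> by blast
   ultimately show "norm (\<psi> x * D n x) \<le> ind ?S x * (B' * (C * norm e))"
    by (cases "x \<in> ?S") (simp_all only: mult_zero_right norm_zero, auto)
  qed
 qed auto
 thus ?thesis by (simp add: D_def)
qed

text \<open>Translation invariance moves the difference quotient from the test function to \<psi>,
  and both sides converge dominatedly. Regularity of \<psi> is required along the single direction
  \<open>e\<close> only, so components of Raviart-Thomas fields qualify although they jump across
  faces parallel to \<open>e\<close>.\<close>

lemma integration_by_parts_lipschitz:
 fixes \<psi> g f :: "real^'d => real" and e :: "real^'d"
 assumes \<psi>: "\<psi> \<in> Borel" "\<And>S. bounded S ==> \<exists>B. \<forall>x\<in>S. \<bar>\<psi> x\<bar> \<le> B"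
  and lip: "\<And>x t. \<bar>\<psi> (x + t *\<^sub>R e) - \<psi> x\<bar> \<le> L * \<bar>t\<bar>"
  and g: "g \<in> Borel"
  and der: "AE x in lborel. ((\<lambda>t. \<psi> (x + t *\<^sub>R e)) has_real_derivative g x) (at 0)"
  and f: "C1_grad f Df" "compact K" "\<And>x. f x \<noteq> 0 ==> x \<in> K"
 shows "(LBINT x. \<psi> x * (Df x \<bullet> e)) = - (LBINT x. g x * f x)"
proof -
 have [measurable]: "\<psi> \<in> Borel" "g \<in> Borel"
  "f \<in> Borel" "Df \<in> Borel"
  using \<psi> g C1_grad_measurable[OF f(1)] by auto
 define t where "t n = inverse (real (Suc n))" for n
 have t: "0 < t n" "t n \<le> 1" for n
  by (auto simp: t_def field_simps)
 have t0: "t \<longlonglongrightarrow> 0"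
  unfolding t_def by (rule LIMSEQ_inverse_real_of_nat)
 obtain Cf where Cf: "Cf > 0" "\<And>x. norm (f x) \<le> Cf"
  using bounded_of_compact_support[of f K] f C1_grad_continuous[OF f(1)] by metis
 obtain c r where cr: "K \<subseteq> cball c r"
  using bounded_subset_cball compact_imp_bounded[OF f(2)] by blast
 let ?S = "cball c (r + norm e)"
 have shiftK: "x + s *\<^sub>R e \<in> K ==> \<bar>s\<bar> \<le> 1 ==> x \<in> ?S" for x s
 proof -
  assume a: "x + s *\<^sub>R e \<in> K" "\<bar>s\<bar> \<le> 1"
  have "dist c x \<le> dist c (x + s *\<^sub>R e) + dist (x + s *\<^sub>R e) x"
   by (rule dist_triangle)
  also have "... \<le> r + norm e"
   using a cr by (intro add_mono) (auto simp: dist_norm mult_left_le_one_le)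
  finally show "x \<in> ?S" by simp
 qed
 obtain B where B: "\<And>x. x \<in> ?S ==> \<bar>\<psi> x\<bar> \<le> B"
  using \<psi>(2)[OF bounded_cball] by blast
 define B' where "B' = max B 0"
 have B': "x \<in> ?S ==> \<bar>\<psi> x\<bar> \<le> B'" "B' \<ge> 0" for x
  using B[of x] by (auto simp: B'_def)
 define D where "D n x = (f (x + t n *\<^sub>R e) - f x) / t n" for n x
 have [measurable]: "D n \<in> Borel" for n
  unfolding D_def by measurable
 have lim1: "(\<lambda>n. \<integral>x. \<psi> x * D n x \<partial>lborel) \<longlonglongrightarrow> (LBINT x. \<psi> x * (Df x \<bullet> e))"
  unfolding D_def using \<psi> f t t0 by (rule difference_quotient_limit)
 have f0: "f x \<noteq> 0 ==> x \<in> ?S" for x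
  using f(3)[of x] shiftK[of x 0] by simp
 have lim2: "(\<lambda>n. \<integral>x. (\<psi> (x - t n *\<^sub>R e) - \<psi> x) / t n * f x \<partial>lborel) \<longlonglongrightarrow> (LBINT x. - g x * f x)"
 proof (rule integral_dominated_convergence[where w="\<lambda>x. \<bar>L\<bar> * \<bar>f x\<bar>"])
  show "integrable lborel (\<lambda>x. \<bar>L\<bar> * \<bar>f x\<bar>)"
  proof (rule integrable_bounded_support[where C="\<bar>L\<bar> * Cf" and S="?S"])
   show "norm (\<bar>L\<bar> * \<bar>f x\<bar>) \<le> \<bar>L\<bar> * Cf" for x
    using Cf(2)[of x] by (simp add: abs_mult mult_left_mono)
   show "x \<in> ?S" if "\<bar>L\<bar> * \<bar>f x\<bar> \<noteq> 0" for x
    using that f0 by fastforce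
  qed auto
  show "AE x in lborel. (\<lambda>n. (\<psi> (x - t n *\<^sub>R e) - \<psi> x) / t n * f x) \<longlonglongrightarrow> - g x * f x"
   using der
  proof eventually_elim
   case (elim x)
   hence 1: "(\<lambda>s. (\<psi> (x + s *\<^sub>R e) - \<psi> x) / s) \<midarrow>0\<rightarrow> g x"
    by (simp add: DERIV_def)
   \<comment> \<open>After the translation \<psi> carries the step with the opposite sign, so the
     derivative at 0 is approached from the left.\<close>
   have "(\<lambda>n. - t n) \<longlonglongrightarrow> 0"
    using tendsto_minus[OF t0] by simp
   moreover have "- t n \<noteq> 0" for n
    using t(1)[of n] by simp
   ultimately have "(\<lambda>n. (\<psi> (x + (- t n) *\<^sub>R e) - \<psi> x) / (- t n)) \<longlonglongrightarrow> g x"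
    by (intro tendsto_at_sequence[OF 1])
   hence "(\<lambda>n. - ((\<psi> (x + (- t n) *\<^sub>R e) - \<psi> x) / (- t n)) * f x) \<longlonglongrightarrow> - g x * f x"
    by (intro tendsto_intros)
   thus ?case by simp
  qed
  show "AE x in lborel. norm ((\<psi> (x - t n *\<^sub>R e) - \<psi> x) / t n * f x) \<le> \<bar>L\<bar> * \<bar>f x\<bar>" for n
  proof (rule AE_I2)
   fix x
   have "\<bar>\<psi> (x - t n *\<^sub>R e) - \<psi> x\<bar> \<le> L * t n"
    using lip[of x "- t n"] t[of n] by simp
   also have "... \<le> \<bar>L\<bar> * t n"
    using t[of n] by (intro mult_right_mono) auto
   finally have "\<bar>(\<psi> (x - t n *\<^sub>R e) - \<psi> x) / t n\<bar> \<le> \<bar>L\<bar>"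
    using t[of n] by (simp add: abs_divide pos_divide_le_eq)
   thus "norm ((\<psi> (x - t n *\<^sub>R e) - \<psi> x) / t n * f x) \<le> \<bar>L\<bar> * \<bar>f x\<bar>"
    unfolding real_norm_def abs_mult by (intro mult_right_mono) auto
  qed
 qed auto
 have int1: "integrable lborel (\<lambda>x. \<psi> x * f (x + s *\<^sub>R e))" if "\<bar>s\<bar> \<le> 1" for s
 proof (rule integrable_bounded_support[where C="B' * Cf" and S="?S"])
  have 1: "f (x + s *\<^sub>R e) \<noteq> 0 ==> x \<in> ?S" for x
   using f(3) shiftK that by blast
  show "x \<in> ?S" if "\<psi> x * f (x + s *\<^sub>R e) \<noteq> 0" for x
   using that 1[of x] by fastforce
  show "norm (\<psi> x * f (x + s *\<^sub>R e)) \<le> B' * Cf" for x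
  proof (cases "f (x + s *\<^sub>R e) = 0")
   case False
   thus ?thesis
    unfolding norm_mult using B'(1)[OF 1[OF False]] Cf(2)[of "x + s *\<^sub>R e"]
    by (intro mult_mono) (auto simp: B')
  qed (use B' Cf(1) in auto)
 qed auto
 have int2: "integrable lborel (\<lambda>x. \<psi> (x - s *\<^sub>R e) * f x)" if "\<bar>s\<bar> \<le> 1" for s
  using integrable_lborel_translate[of "\<lambda>x. \<psi> (x - s *\<^sub>R e) * f x" "s *\<^sub>R e"] int1[OF that] by simp
 have "(LBINT x. \<psi> x * D n x) = (LBINT x. (\<psi> (x - t n *\<^sub>R e) - \<psi> x) / t n * f x)" for n
 proof -
  have "(LBINT x. \<psi> x * D n x) = (LBINT x. (\<psi> x * f (x + t n *\<^sub>R e) - \<psi> x * f x) / t n)"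
   by (simp add: D_def algebra_simps diff_divide_distrib)
  also have "... = ((LBINT x. \<psi> x * f (x + t n *\<^sub>R e)) - (LBINT x. \<psi> x * f x)) / t n"
   using int1[of "t n"] int1[of 0] t[of n] by simp
  also have "(LBINT x. \<psi> x * f (x + t n *\<^sub>R e)) = (LBINT x. \<psi> (x - t n *\<^sub>R e) * f x)"
   using integral_lborel_translate[of "\<lambda>x. \<psi> (x - t n *\<^sub>R e) * f x" "t n *\<^sub>R e"] by simp
  also have "((LBINT x. \<psi> (x - t n *\<^sub>R e) * f x) - (LBINT x. \<psi> x * f x)) / t n
    = (LBINT x. (\<psi> (x - t n *\<^sub>R e) * f x - \<psi> x * f x) / t n)"
   using int2[of "t n"] int2[of 0] t[of n] by simp
  finally show ?thesis
   by (simp add: algebra_simps diff_divide_distrib)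
 qed
 hence "(LBINT x. \<psi> x * (Df x \<bullet> e)) = (LBINT x. - g x * f x)"
  using LIMSEQ_unique[OF lim1] lim2 by simp
 thus ?thesis by simp
qed

section \<open>Mollification\<close>

text \<open>A quadratic remainder bound can be integrated against a weight, which is how
  mollifications are differentiated below.\<close>

lemma has_derivative_quadratic_remainder:
 fixes f :: "real^'d => real"
 assumes "\<And>h. norm h \<le> 1 ==> \<bar>f (x + h) - f x - g \<bullet> h\<bar> \<le> C * (norm h)\<^sup>2"
 shows "(f has_derivative (\<lambda>h. g \<bullet> h)) (at x)"
 unfolding has_derivative_at
proof
 show "bounded_linear ((\<bullet>) g)"
  by (rule bounded_linear_inner_right)
 show "(\<lambda>h. norm (f (x + h) - f x - g \<bullet> h) / norm h) \<midarrow>0\<rightarrow> 0"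
 proof (rule Lim_null_comparison)
  show "((\<lambda>h. C * norm h) \<longlongrightarrow> 0) (at (0::real^'d))"
   by (rule tendsto_eq_intros refl | simp)+
  have "norm (norm (f (x + h) - f x - g \<bullet> h) / norm h) \<le> C * norm h" if "h \<noteq> 0" "norm h < 1" for h
   using assms[of h] that by (simp add: abs_divide pos_divide_le_eq power2_eq_square mult.assoc)
  thus "\<forall>\<^sub>F h in at 0. norm (norm (f (x + h) - f x - g \<bullet> h) / norm h) \<le> C * norm h"
   unfolding eventually_at by (intro exI[of _ 1]) (auto simp: dist_norm)
 qed
qed

lemma Fubini_bounded_support:
 fixes f :: "'a::euclidean_space => 'b::euclidean_space => 'c::{banach, second_countable_topology}"
 assumes f: "case_prod f \<in> Borel" "\<And>x y. norm (f x y) \<le> C"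
  and S: "bounded S" "bounded T" "\<And>x y. f x y \<noteq> 0 ==> x \<in> S \<and> y \<in> T"
 shows "(LBINT x. (LBINT y. f x y)) = (LBINT y. (LBINT x. f x y))"
proof -
 have "integrable lborel (case_prod f)"
  by (rule integrable_bounded_support[where C=C and S="S \<times> T"])
   (use assms in \<open>auto simp: bounded_Times split: prod.splits\<close>)
 hence "integrable (lborel \<Otimes>\<^sub>M lborel) (case_prod f)"
  by (simp add: lborel_prod)
 from lborel_pair.Fubini_integral[OF this] show ?thesis by simp
qed

text \<open>The squared positive part is only C1, which is the regularity of the test functions, and
  it makes the gradient and the Taylor remainder explicit. It is not normalized;
  \<open>mollify\<close> divides by the integral.\<close>

definition bump :: "real => real^'d => real" where
 "bump r x = (max 0 (r\<^sup>2 - x \<bullet> x))\<^sup>2"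

definition bump_grad :: "real => real^'d => real^'d" where
 "bump_grad r x = (- 4 * max 0 (r\<^sup>2 - x \<bullet> x)) *\<^sub>R x"

text \<open>The derivative 2 max(0, s) of the squared positive part is 2-Lipschitz, so the first
  order Taylor remainder is at most the square of the increment.\<close>

lemma positive_part_square_remainder:
 fixes s u :: real
 shows "\<bar>(max 0 (s + u))\<^sup>2 - (max 0 s)\<^sup>2 - 2 * max 0 s * u\<bar> \<le> u\<^sup>2"
proof -
 consider "s \<ge> 0" "s + u \<ge> 0" | "s \<ge> 0" "s + u < 0" | "s < 0" "s + u \<ge> 0" | "s < 0" "s + u < 0"
  by linarith
 thus ?thesis
 proof cases
  case 1
  thus ?thesis by (simp add: max_def power2_eq_square algebra_simps)
 next
  case 2
  have "0 \<le> (s + u)\<^sup>2" by simp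
  moreover have "s * (s + 2 * u) \<le> 0"
   using 2 by (intro mult_nonneg_nonpos) auto
  ultimately show ?thesis
   using 2 by (simp add: max_def power2_eq_square algebra_simps abs_le_iff)
 next
  case 3
  hence "(s + u)\<^sup>2 \<le> u\<^sup>2"
   by (intro power_mono) auto
  thus ?thesis
   using 3 by (simp add: max_def)
 qed (simp add: max_def)
qed

text \<open>With s = r^2 - |x|^2 the increment of the argument is u = -2 x . h - |h|^2. The
  remainder of the squared positive part is at most u^2, and the part -|h|^2 of u, which the
  gradient term does not contain, gives the second summand of the constant.\<close>

lemma bump_remainder:
 fixes x h :: "real^'d"
 assumes "norm x \<le> R" "norm h \<le> 1"
 shows "\<bar>bump r (x + h) - bump r x - bump_grad r x \<bullet> h\<bar> \<le> ((2 * R + 1)\<^sup>2 + 2 * r\<^sup>2) * (norm h)\<^sup>2"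
proof -
 define s where "s = r\<^sup>2 - x \<bullet> x"
 define u where "u = - 2 * (x \<bullet> h) - h \<bullet> h"
 have su: "r\<^sup>2 - (x + h) \<bullet> (x + h) = s + u"
  by (simp add: s_def u_def inner_add_left inner_add_right inner_commute)
 have 1: "bump r (x + h) - bump r x - bump_grad r x \<bullet> h
   = ((max 0 (s + u))\<^sup>2 - (max 0 s)\<^sup>2 - 2 * max 0 s * u) - 2 * max 0 s * (h \<bullet> h)"
  unfolding bump_def bump_grad_def su s_def[symmetric] by (simp add: u_def algebra_simps)
 have "\<bar>u\<bar> \<le> 2 * \<bar>x \<bullet> h\<bar> + norm h * norm h"
  using abs_triangle_ineq4[of "- 2 * (x \<bullet> h)" "h \<bullet> h"]
  by (simp add: u_def abs_mult dot_square_norm power2_eq_square)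
 also have "... \<le> 2 * (R * norm h) + 1 * norm h"
  using Cauchy_Schwarz_ineq2[of x h] assms
  by (intro add_mono mult_left_mono mult_right_mono order_trans[OF Cauchy_Schwarz_ineq2]) auto
 finally have "\<bar>u\<bar> \<le> (2 * R + 1) * norm h"
  by (simp add: algebra_simps)
 hence "u\<^sup>2 \<le> ((2 * R + 1) * norm h)\<^sup>2"
  by (metis abs_ge_zero power2_abs power_mono)
 hence 2: "\<bar>(max 0 (s + u))\<^sup>2 - (max 0 s)\<^sup>2 - 2 * max 0 s * u\<bar> \<le> (2 * R + 1)\<^sup>2 * (norm h)\<^sup>2"
  using positive_part_square_remainder[of s u] by (simp add: power_mult_distrib)
 have "max 0 s \<le> r\<^sup>2"
  by (simp add: s_def)
 hence 3: "\<bar>2 * max 0 s * (h \<bullet> h)\<bar> \<le> 2 * r\<^sup>2 * (norm h)\<^sup>2"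
  by (simp add: dot_square_norm abs_mult mult_right_mono)
 show ?thesis
  unfolding 1 using abs_triangle_ineq4[of "(max 0 (s + u))\<^sup>2 - (max 0 s)\<^sup>2 - 2 * max 0 s * u" "2 * max 0 s * (h \<bullet> h)"] 2 3
  by (simp add: distrib_right)
qed

lemma bump_grad_continuous: "continuous_on UNIV (bump_grad r)"
 unfolding bump_grad_def by (intro continuous_intros)

lemma C1_grad_bump: "C1_grad (bump r) (bump_grad r)"
 unfolding C1_grad_def
 using has_derivative_quadratic_remainder[OF bump_remainder[OF order_refl]] bump_grad_continuous
 by blast

lemma bump_support: "bump r x \<noteq> 0 ==> 0 < r ==> norm x < r"
 and bump_grad_support: "bump_grad r x \<noteq> 0 ==> 0 < r ==> norm x < r"
proof -
 have "r\<^sup>2 - x \<bullet> x > 0 ==> 0 < r ==> norm x < r"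
  by (simp add: dot_square_norm power2_less_imp_less)
 thus "bump r x \<noteq> 0 ==> 0 < r ==> norm x < r" "bump_grad r x \<noteq> 0 ==> 0 < r ==> norm x < r"
  by (auto simp: bump_def bump_grad_def max_def split: if_splits)
qed

lemma bump_nonneg: "0 \<le> bump r x"
 by (simp add: bump_def)

lemma bump_measurable[measurable]:
 "bump r \<in> Borel" "bump_grad r \<in> Borel"
 using C1_grad_measurable[OF C1_grad_bump] by auto

lemma bump_bounds:
 assumes "r > 0"
 shows "bump r x \<le> r^4" "norm (bump_grad r x) \<le> 4 * r^3"
proof -
 have "max 0 (r\<^sup>2 - x \<bullet> x) \<le> r\<^sup>2" by simp
 hence "bump r x \<le> (r\<^sup>2)\<^sup>2"
  unfolding bump_def by (intro power_mono) auto
 thus "bump r x \<le> r^4" by simp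
 show "norm (bump_grad r x) \<le> 4 * r^3"
 proof (cases "bump_grad r x = 0")
  case False
  hence "norm x \<le> r" using bump_grad_support[of r x] assms by simp
  hence "max 0 (r\<^sup>2 - x \<bullet> x) * norm x \<le> r\<^sup>2 * r"
   using assms by (intro mult_mono) auto
  thus ?thesis
   by (simp add: bump_grad_def power2_eq_square power3_eq_cube mult.assoc)
 qed (use assms in simp)
qed

lemma bump_integrable: "r > 0 ==> integrable lborel (bump r :: real^'d => real)"
proof (rule integrable_bounded_support[where C="r^4" and S="cball 0 r"])
 assume "r > 0"
 thus "norm (bump r x) \<le> r^4" "bump r x \<noteq> 0 ==> x \<in> cball 0 r" for x :: "real^'d"
  using bump_bounds(1)[of r x] bump_support[of r x] bump_nonneg[of r x] by auto
qed auto

lemma bump_integral_pos: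
 assumes "r > 0" shows "0 < (LBINT x. bump r (x::real^'d))"
proof -
 have "(LBINT x. bump r (x::real^'d)) \<noteq> 0"
 proof
  assume "(LBINT x. bump r (x::real^'d)) = 0"
  hence "AE x in lborel. bump r (x::real^'d) = 0"
   using integral_nonneg_eq_0_iff_AE[of lborel "bump r :: real^'d => real"] bump_integrable[OF assms]
   by (simp add: bump_nonneg)
  hence "{x::real^'d. bump r x \<noteq> 0} \<in> null_sets lborel"
   by (subst AE_iff_null_sets) auto
  hence "negligible {x::real^'d. bump r x \<noteq> 0}"
   using null_sets_completionI negligible_iff_null_sets by blast
  moreover have "ball (0::real^'d) r \<subseteq> {x. bump r x \<noteq> 0}"
   using assms by (auto simp: bump_def dot_square_norm power_strict_mono)
  ultimately have "negligible (ball (0::real^'d) r)"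
   by (rule negligible_subset)
  moreover have "\<not> negligible (ball (0::real^'d) r)"
   using assms by (intro open_not_negligible) auto
  ultimately show False by simp
 qed
 moreover have "0 \<le> (LBINT x. bump r (x::real^'d))"
  by (simp add: bump_nonneg)
 ultimately show ?thesis by simp
qed

text \<open>Vector values are allowed so that a Euclidean bound on a field passes to its
  mollification; bounding the components separately would lose a factor.\<close>

definition mollify :: "real => (real^'d => 'b::{banach, second_countable_topology}) => real^'d => 'b" where
 "mollify r s x = (LBINT z. (bump r z / (LBINT z. bump r (z::real^'d))) *\<^sub>R s (x + z))"

text \<open>Written with the integration variable shifted to \<open>y\<close>, so that the
  derivative in \<open>x\<close> falls on the kernel \<open>bump r (y - x)\<close>; this is the
  reason for the sign.\<close>

definition mollify_grad :: "real => (real^'d => real) => real^'d => real^'d" where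
 "mollify_grad r s x = (LBINT y. (- s y / (LBINT z. bump r (z::real^'d))) *\<^sub>R bump_grad r (y - x))"

context
 fixes r :: real and s :: "real^'d => real" and C :: real and S :: "(real^'d) set"
 assumes r: "r > 0" and s[measurable]: "s \<in> Borel" and C: "\<And>x. \<bar>s x\<bar> \<le> C"
  and S: "bounded S" "\<And>x. s x \<noteq> 0 ==> x \<in> S"
begin

lemma mollify_alt: "mollify r s x = (LBINT y. s y * (bump r (y - x) / (LBINT z. bump r (z::real^'d))))"
 unfolding mollify_def
 by (subst integral_lborel_translate[of "\<lambda>y. s y * (bump r (y - x) / (LBINT z. bump r (z::real^'d)))" x, symmetric])
  (auto simp: algebra_simps)

lemma C_nonneg: "0 \<le> C"
 using C[of 0] by linarith

text \<open>The weight \<open>s\<close> is only Borel: the remainder estimate and the uniform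
  continuity of the kernel gradient are integrated against it to give differentiability and
  continuity of the gradient.\<close>

lemma C1_grad_mollify: "C1_grad (mollify r s) (mollify_grad r s)"
proof -
 define I where "I = (LBINT z. bump r (z::real^'d))"
 have I: "I > 0" unfolding I_def using r by (rule bump_integral_pos)
 have int1: "integrable lborel (\<lambda>y. s y * (bump r (y - x) / I))" for x
 proof (rule integrable_bounded_support[OF _ _ S(1)])
  show "norm (s y * (bump r (y - x) / I)) \<le> C * (r^4 / I)" for y
   unfolding norm_mult using C[of y] C_nonneg bump_bounds(1)[OF r, of "y - x"] bump_nonneg[of r "y - x"] I
   by (intro mult_mono) (auto simp: divide_right_mono abs_divide)
 qed (use S in auto)
 have int2: "integrable lborel (\<lambda>y. (- s y / I) *\<^sub>R bump_grad r (y - x))" for x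
 proof (rule integrable_bounded_support[OF _ _ S(1)])
  show "norm ((- s y / I) *\<^sub>R bump_grad r (y - x)) \<le> (C / I) * (4 * r^3)" for y
   unfolding norm_scaleR using C[of y] C_nonneg bump_bounds(2)[OF r, of "y - x"] I
   by (intro mult_mono) (auto simp: divide_right_mono abs_divide)
 qed (use S in auto)
 have int3: "integrable lborel (\<lambda>y. \<bar>s y\<bar> / I)"
 proof (rule integrable_bounded_support[OF _ _ S(1)])
  show "norm (\<bar>s y\<bar> / I) \<le> C / I" for y
   using C[of y] I by (simp add: divide_right_mono)
 qed (use S in auto)
 have "(mollify r s has_derivative (\<lambda>h. mollify_grad r s x \<bullet> h)) (at x)" for x
 proof -
  obtain c R0 where "S \<subseteq> cball c R0" using S(1) bounded_subset_cball by blast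
  \<comment> \<open>The remainder constant of the kernel depends on the size of its argument, which
    is \<open>y - x\<close> with \<open>y\<close> in the bounded support of
    \<open>s\<close>.\<close>
  define R where "R = R0 + dist c x"
  have R: "norm (y - x) \<le> R" if "s y \<noteq> 0" for y
   using S(2)[OF that] \<open>S \<subseteq> cball c R0\<close> dist_triangle[of y x c] by (auto simp: R_def dist_norm norm_minus_commute)
  let ?K = "(2 * R + 1)\<^sup>2 + 2 * r\<^sup>2"
  show ?thesis
  proof (rule has_derivative_quadratic_remainder[where C="?K * (LBINT y. \<bar>s y\<bar> / I)"])
   fix h :: "real^'d" assume h: "norm h \<le> 1"
   have gr: "mollify_grad r s x \<bullet> h = (LBINT y. ((- s y / I) *\<^sub>R bump_grad r (y - x)) \<bullet> h)"
    unfolding mollify_grad_def I_def[symmetric] using int2 by (intro integral_inner_left[symmetric])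
   have int4: "integrable lborel (\<lambda>y. ((- s y / I) *\<^sub>R bump_grad r (y - x)) \<bullet> h)"
    using int2 by (intro integrable_inner_left)
   have eq: "mollify r s (x + h) - mollify r s x - mollify_grad r s x \<bullet> h
     = (\<integral>y. s y * (bump r (y - (x + h)) / I) - s y * (bump r (y - x) / I)
      - ((- s y / I) *\<^sub>R bump_grad r (y - x)) \<bullet> h \<partial>lborel)"
    unfolding mollify_alt gr I_def[symmetric] using int1 int4 by simp
   have "\<bar>mollify r s (x + h) - mollify r s x - mollify_grad r s x \<bullet> h\<bar>
    \<le> (LBINT y. (\<bar>s y\<bar> / I) * (?K * (norm h)\<^sup>2))"
    unfolding eq real_norm_def[symmetric]
   proof (rule lint_norm_bound_lint)
    show "integrable lborel (\<lambda>y. s y * (bump r (y - (x + h)) / I) - s y * (bump r (y - x) / I)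
      - ((- s y / I) *\<^sub>R bump_grad r (y - x)) \<bullet> h)"
     using int1 int4 by (intro lintegrable_diff)
    show "integrable lborel (\<lambda>y. norm (s y) / I * (?K * (norm h)\<^sup>2))"
     unfolding real_norm_def by (intro integrable_mult_left int3)
    fix y
    have e: "s y * (bump r (y - (x + h)) / I) - s y * (bump r (y - x) / I)
      - ((- s y / I) *\<^sub>R bump_grad r (y - x)) \<bullet> h
     = (s y / I) * (bump r ((y - x) + (- h)) - bump r (y - x) - bump_grad r (y - x) \<bullet> (- h))"
     by (simp add: algebra_simps diff_divide_distrib add_divide_distrib)
    show "norm (s y * (bump r (y - (x + h)) / I) - s y * (bump r (y - x) / I)
      - ((- s y / I) *\<^sub>R bump_grad r (y - x)) \<bullet> h) \<le> norm (s y) / I * (?K * (norm h)\<^sup>2)"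
    proof (cases "s y = 0")
     case False
     show ?thesis
      unfolding e norm_mult using bump_remainder[OF R[OF False], of "- h" r] h I
      by (intro mult_mono) (auto simp: abs_divide)
    qed simp
   qed
   also have "... = ?K * (LBINT y. \<bar>s y\<bar> / I) * (norm h)\<^sup>2"
    by simp
   finally show "\<bar>mollify r s (x + h) - mollify r s x - mollify_grad r s x \<bullet> h\<bar>
    \<le> ?K * (LBINT y. \<bar>s y\<bar> / I) * (norm h)\<^sup>2" .
  qed
 qed
 moreover have "continuous_on UNIV (mollify_grad r s)"
  unfolding continuous_on_iff
 proof (intro ballI allI impI)
  fix x :: "real^'d" and e :: real assume e: "e > 0"
  define J where "J = (LBINT y. \<bar>s y\<bar> / I)"
  have J: "J \<ge> 0" unfolding J_def using I by (intro integral_nonneg_AE) auto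
  have ep: "e / (J + 1) > 0" using e J by simp
  obtain d where d: "d > 0" "\<And>u w :: real^'d. dist u w < d ==> norm (bump_grad r u - bump_grad r w) < e / (J + 1)"
  proof (rule uniformly_continuous_of_compact_support[OF bump_grad_continuous[of r] compact_cball[of 0 r] _ ep])
   show "bump_grad r x \<noteq> 0 ==> x \<in> cball 0 r" for x :: "real^'d"
    using bump_grad_support[of r x] r by simp
  qed blast
  show "\<exists>d>0. \<forall>x'\<in>UNIV. dist x' x < d --> dist (mollify_grad r s x') (mollify_grad r s x) < e"
  proof (intro exI[of _ d] conjI ballI impI)
   fix x' assume x': "dist x' x < d"
   have "mollify_grad r s x' - mollify_grad r s x
     = (LBINT y. (- s y / I) *\<^sub>R bump_grad r (y - x') - (- s y / I) *\<^sub>R bump_grad r (y - x))"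
    unfolding mollify_grad_def I_def[symmetric] using int2 by simp
   also have "norm ... \<le> (LBINT y. \<bar>s y\<bar> / I * (e / (J + 1)))"
   proof (rule lint_norm_bound_lint)
    show "integrable lborel (\<lambda>y. (- s y / I) *\<^sub>R bump_grad r (y - x') - (- s y / I) *\<^sub>R bump_grad r (y - x))"
     using int2 by (intro lintegrable_diff)
    show "integrable lborel (\<lambda>y. \<bar>s y\<bar> / I * (e / (J + 1)))"
     by (intro integrable_mult_left int3)
    fix y
    have "norm (bump_grad r (y - x') - bump_grad r (y - x)) \<le> e / (J + 1)"
     using d(2)[of "y - x'" "y - x"] x' by (auto simp: dist_norm norm_minus_commute)
    thus "norm ((- s y / I) *\<^sub>R bump_grad r (y - x') - (- s y / I) *\<^sub>R bump_grad r (y - x))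
      \<le> \<bar>s y\<bar> / I * (e / (J + 1))"
     unfolding scaleR_diff_right[symmetric] norm_scaleR using I by (intro mult_mono) (auto simp: abs_divide)
   qed
   also have "... = J * (e / (J + 1))"
    by (simp add: J_def)
   also have "... < e"
    using e J by (simp add: field_simps)
   finally show "dist (mollify_grad r s x') (mollify_grad r s x) < e"
    by (simp add: dist_norm)
  qed (rule d(1))
 qed
 ultimately show ?thesis
  by (simp add: C1_grad_def)
qed

lemma mollify_support:
 assumes "mollify r s x \<noteq> 0"
 obtains z where "norm z < r" "s (x + z) \<noteq> 0"
proof -
 have "\<exists>z. norm z < r \<and> s (x + z) \<noteq> 0"
 proof (rule ccontr)
  assume "\<not> ?thesis"
  hence "(bump r z / (LBINT z. bump r (z::real^'d))) *\<^sub>R s (x + z) = 0" for z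
   using bump_support[OF _ r, of z] by auto
  hence "mollify r s x = 0"
   unfolding mollify_def by (simp only: lint_zero)
  with assms show False by simp
 qed
 thus ?thesis using that by blast
qed

end

lemma mollify_norm_bound:
 fixes s :: "real^'d => 'b::{banach, second_countable_topology}"
 assumes r: "r > 0" and s[measurable]: "s \<in> Borel" and C: "\<And>z. norm z < r ==> norm (s (x + z)) \<le> C"
 shows "norm (mollify r s x) \<le> C"
proof -
 define I where "I = (LBINT z. bump r (z::real^'d))"
 have I: "I > 0" unfolding I_def using r by (rule bump_integral_pos)
 have b: "norm ((bump r z / I) *\<^sub>R s (x + z)) \<le> bump r z / I * C" for z
 proof (cases "bump r z = 0")
  case False
  thus ?thesis
   using C[of z] bump_support[OF _ r, of z] I bump_nonneg[of r z]
   by (simp add: abs_divide divide_right_mono mult_left_mono)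
 qed simp
 have "norm (mollify r s x) \<le> (LBINT z. bump r (z::real^'d) / I * C)"
  unfolding mollify_def I_def[symmetric]
 proof (rule lint_norm_bound_lint)
  show "integrable lborel (\<lambda>z::real^'d. bump r z / I * C)"
   by (intro integrable_mult_left integrable_divide bump_integrable[OF r])
  thus "integrable lborel (\<lambda>z. (bump r z / I) *\<^sub>R s (x + z))"
  proof (rule lintegrable_bound)
   show "AE z in lborel. norm ((bump r z / I) *\<^sub>R s (x + z)) \<le> norm (bump r z / I * C)"
    by (intro AE_I2 order_trans[OF b]) (simp only: real_norm_def abs_ge_self)
  qed auto
 qed (use b in auto)
 also have "... = C"
  using I by (simp add: I_def)
 finally show ?thesis .
qed

lemma mollify_integrable:
 fixes s :: "real^'d => 'b::{banach, second_countable_topology}"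
 assumes r: "r > 0" and s[measurable]: "s \<in> Borel" and C: "\<And>x. norm (s x) \<le> C"
 shows "integrable lborel (\<lambda>z. (bump r z / (LBINT z. bump r (z::real^'d))) *\<^sub>R s (x + z))"
proof (rule lintegrable_bound)
 let ?I = "\<integral>z. bump r (z::real^'d) \<partial>lborel"
 show "integrable lborel (\<lambda>z::real^'d. bump r z / ?I * C)"
  by (intro integrable_mult_left integrable_divide bump_integrable[OF r])
 have I: "?I > 0" using r by (rule bump_integral_pos)
 have b: "norm ((bump r z / ?I) *\<^sub>R s (x + z)) \<le> bump r z / ?I * C" for z
  using C[of "x + z"] I bump_nonneg[of r z] by (simp add: abs_divide divide_right_mono mult_left_mono)
 show "AE z in lborel. norm ((bump r z / ?I) *\<^sub>R s (x + z)) \<le> norm (bump r z / ?I * C)"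
  by (intro AE_I2 order_trans[OF b]) (simp only: real_norm_def abs_ge_self)
qed auto

lemma mollify_diff:
 fixes s k :: "real^'d => 'b::{banach, second_countable_topology}"
 assumes "r > 0" "s \<in> Borel" "\<And>x. norm (s x) \<le> C"
  "k \<in> Borel" "\<And>x. norm (k x) \<le> C'"
 shows "mollify r (\<lambda>x. s x - k x) x = mollify r s x - mollify r k x"
 unfolding mollify_def
 using mollify_integrable[OF assms(1,2,3), of x] mollify_integrable[OF assms(1,4,5), of x]
 by (simp add: scaleR_diff_right)

lemma mollify_const:
 fixes a :: "'b::{banach, second_countable_topology}"
 assumes "r > 0" shows "mollify r (\<lambda>_. a) (x::real^'d) = a"
proof -
 have "(LBINT z. (bump r (z::real^'d) / (LBINT z. bump r (z::real^'d))) *\<^sub>R a)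
   = (LBINT z. bump r (z::real^'d) / (LBINT z. bump r (z::real^'d))) *\<^sub>R a"
  by (rule integral_scaleR_left) (use bump_integrable[OF assms] in auto)
 thus ?thesis
  using bump_integral_pos[OF assms, where 'd='d] by (simp add: mollify_def)
qed

lemma mollify_measurable:
 fixes s :: "real^'d => real"
 assumes "r > 0" "s \<in> Borel" "\<And>x. \<bar>s x\<bar> \<le> C" "bounded S" "\<And>x. s x \<noteq> 0 ==> x \<in> S"
 shows "mollify r s \<in> Borel"
 using C1_grad_measurable(1) C1_grad_mollify[of r s C S] assms by blast

lemma mollify_bounded_support:
 fixes s :: "real^'d => real"
 assumes r: "0 < r" "r \<le> 1" and S: "\<And>x. s x \<noteq> 0 ==> x \<in> cball c R" and x: "mollify r s x \<noteq> 0"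
 shows "x \<in> cball c (R + 1)"
proof (rule ccontr)
 assume nx: "x \<notin> cball c (R + 1)"
 have "(bump r z / (LBINT z. bump r (z::real^'d))) *\<^sub>R s (x + z) = 0" for z
 proof (cases "bump r z = 0")
  case False
  hence "norm z < 1" using bump_support[of r z] r by simp
  hence "x + z \<notin> cball c R"
   using nx dist_triangle[of c x "x + z"] by (auto simp: dist_norm)
  thus ?thesis using S[of "x + z"] by auto
 qed simp
 hence "mollify r s x = 0"
  unfolding mollify_def by (simp only: lint_zero)
 with x show False by simp
qed

text \<open>The absolute value goes under the integral, and after Fubini each translate contributes
  the full norm of \<open>s\<close>, weighted by a kernel of mass 1.\<close>

lemma mollify_L1_contraction:
 fixes s :: "real^'d => real"
 assumes r: "0 < r" "r \<le> 1" and s[measurable]: "s \<in> Borel" and C: "\<And>x. \<bar>s x\<bar> \<le> C"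
  and S: "\<And>x. s x \<noteq> 0 ==> x \<in> cball c R"
 shows "(LBINT x. \<bar>mollify r s x\<bar>) \<le> (LBINT x. \<bar>s x\<bar>)"
proof -
 define I where "I = (LBINT z. bump r (z::real^'d))"
 have I: "I > 0" unfolding I_def using r by (intro bump_integral_pos)
 have C0: "0 \<le> C" using C[of 0] by linarith
 have b[measurable]: "mollify r s \<in> Borel"
  using r(1) s C bounded_cball S by (rule mollify_measurable)
 have le: "\<bar>mollify r s x\<bar> \<le> (LBINT z. (bump r z / I) * \<bar>s (x + z)\<bar>)" for x
 proof -
  have "norm (mollify r s x) \<le> (LBINT z. norm ((bump r z / I) *\<^sub>R s (x + z)))"
   unfolding mollify_def I_def[symmetric] by (rule integral_norm_bound)
  thus ?thesis using I by (simp add: bump_nonneg abs_mult)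
 qed
 have "(LBINT x. \<bar>mollify r s x\<bar>) \<le> (LBINT x. mollify r (\<lambda>x. \<bar>s x\<bar>) x)"
 proof (rule integral_mono)
  show "integrable lborel (\<lambda>x. \<bar>mollify r s x\<bar>)"
  proof (rule integrable_bounded_support)
   show "norm \<bar>mollify r s x\<bar> \<le> C" for x
    using mollify_norm_bound[OF r(1) s, of x C] C by simp
   show "\<bar>mollify r s x\<bar> \<noteq> 0 ==> x \<in> cball c (R + 1)" for x
    using mollify_bounded_support[of r s c R x] r S by auto
  qed auto
  have S': "\<bar>s x\<bar> \<noteq> 0 ==> x \<in> cball c R" for x using S[of x] by auto
  show "integrable lborel (mollify r (\<lambda>x. \<bar>s x\<bar>))"
  proof (rule integrable_bounded_support)
   show "mollify r (\<lambda>x. \<bar>s x\<bar>) \<in> Borel"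
    by (rule mollify_measurable[where C=C and S="cball c R"]) (use r C S' in auto)
   show "norm (mollify r (\<lambda>x. \<bar>s x\<bar>) x) \<le> C" for x
    by (rule mollify_norm_bound[OF r(1)]) (use C in auto)
   show "x \<in> cball c (R + 1)" if "mollify r (\<lambda>x. \<bar>s x\<bar>) x \<noteq> 0" for x
    using r S' that by (rule mollify_bounded_support)
  qed auto
  show "\<bar>mollify r s x\<bar> \<le> mollify r (\<lambda>x. \<bar>s x\<bar>) x" for x
   using le[of x] by (simp add: mollify_def I_def)
 qed
 also have "... = (\<integral>x. \<integral>z. (bump r z / I) * \<bar>s (x + z)\<bar> \<partial>lborel \<partial>lborel)"
  by (simp add: mollify_def I_def)
 also have "... = (\<integral>z. \<integral>x. (bump r z / I) * \<bar>s (x + z)\<bar> \<partial>lborel \<partial>lborel)"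
 proof (rule Fubini_bounded_support[where S="cball c (R + 1)" and T="cball 0 1" and C="r^4 / I * C"])
  show "norm (bump r z / I * \<bar>s (x + z)\<bar>) \<le> r ^ 4 / I * C" for x z
   unfolding norm_mult using bump_bounds(1)[OF r(1), of z] bump_nonneg[of r z] I C[of "x + z"] C0
   by (intro mult_mono) (auto simp: abs_divide divide_right_mono)
  show "(\<lambda>(x, z). bump r z / I * \<bar>s (x + z)\<bar>) \<in> Borel"
   unfolding borel_prod[symmetric] by measurable
  fix x z :: "real^'d"
  assume nz: "bump r z / I * \<bar>s (x + z)\<bar> \<noteq> 0"
  hence z: "norm z < 1" using bump_support[of r z] r by simp
  moreover have "x + z \<in> cball c R" using nz S by auto
  hence "dist c x \<le> R + 1"
   using dist_triangle[of c x "x + z"] z by (auto simp: dist_norm)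
  ultimately show "x \<in> cball c (R + 1) \<and> z \<in> cball 0 1" by auto
 qed auto
 also have "... = (\<integral>z. (bump r z / I) * (LBINT x. \<bar>s x\<bar>) \<partial>(lborel :: (real^'d) measure))"
  using integral_lborel_translate[of "\<lambda>x. \<bar>s x\<bar>"] by simp
 also have "... = (LBINT x. \<bar>s x\<bar>)"
  using I by (simp add: I_def)
 finally show ?thesis .
qed

text \<open>Measurability provides continuous functions converging almost everywhere. Truncation to
  [-C, C] and a cutoff that is 1 on the support of \<open>s\<close> keep this limit and supply the
  dominating function.\<close>

lemma continuous_L1_approximation:
 fixes s :: "real^'d => real"
 assumes s[measurable]: "s \<in> Borel" and C: "\<And>x. \<bar>s x\<bar> \<le> C"
  and S: "\<And>x. s x \<noteq> 0 ==> x \<in> cball c R" and e: "e > 0"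
 obtains k where "continuous_on UNIV k" "\<And>x. \<bar>k x\<bar> \<le> C" "\<And>x. k x \<noteq> 0 ==> x \<in> cball c (R + 1)"
  "(LBINT x. \<bar>s x - k x\<bar>) < e"
proof -
 have C0: "0 \<le> C" using C[of 0] by linarith
 have "s measurable_on UNIV"
  by (rule lebesgue_measurable_imp_measurable_on_real) (auto intro: measurable_completion)
 then obtain N g where N: "negligible N" and g: "\<And>n. continuous_on UNIV (g n)"
  "\<And>x. x \<notin> N ==> (\<lambda>n. g n x) \<longlonglongrightarrow> s x"
  unfolding measurable_on_def by auto
 define cut where "cut x = max 0 (min 1 (R + 1 - dist c x))" for x
 define k where "k n x = cut x * max (- C) (min C (g n x))" for n x
 have cut: "0 \<le> cut x" "cut x \<le> 1" "cut x \<noteq> 0 ==> x \<in> cball c (R + 1)" "s x \<noteq> 0 ==> cut x = 1" for x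
  using S[of x] by (auto simp: cut_def split: if_splits)
 have kc: "continuous_on UNIV (k n)" for n
  unfolding k_def cut_def by (intro continuous_intros g)
 hence [measurable]: "k n \<in> Borel" for n
  by (rule borel_measurable_continuous_onI)
 have kb: "\<bar>k n x\<bar> \<le> C" for n x
 proof -
  have "\<bar>k n x\<bar> \<le> 1 * C"
   unfolding k_def abs_mult using cut[of x] C0 by (intro mult_mono) auto
  thus ?thesis by simp
 qed
 have ks: "k n x \<noteq> 0 ==> x \<in> cball c (R + 1)" for n x
  using cut(3)[of x] by (auto simp: k_def)
 have "(\<lambda>n. \<integral>x. \<bar>s x - k n x\<bar> \<partial>lborel) \<longlonglongrightarrow> (\<integral>x. 0 \<partial>(lborel :: (real^'d) measure))"
 proof (rule integral_dominated_convergence[where w="\<lambda>x. 2 * C * ind (cball c (R + 1)) x"])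
  show "integrable lborel (\<lambda>x. 2 * C * ind (cball c (R + 1)) x)"
   by (rule integrable_bounded_support[where C="2 * C" and S="cball c (R + 1)"])
    (use C0 in \<open>auto simp: indicator_def\<close>)
  have "N \<in> null_sets lebesgue" using N negligible_iff_null_sets by blast
  hence "AE x in lebesgue. x \<notin> N" by (rule AE_not_in)
  hence "AE x in lborel. x \<notin> N" by (rule AE_completion_iff[THEN iffD1])
  thus "AE x in lborel. (\<lambda>n. \<bar>s x - k n x\<bar>) \<longlonglongrightarrow> 0"
  proof eventually_elim
   case (elim x)
   have "(\<lambda>n. \<bar>s x - k n x\<bar>) \<longlonglongrightarrow> \<bar>s x - cut x * max (- C) (min C (s x))\<bar>"
    unfolding k_def by (intro tendsto_intros g(2)[OF elim])
   moreover have "max (- C) (min C (s x)) = s x"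
    using C[of x] by auto
   moreover have "cut x * s x = s x"
    using cut(4)[of x] by (cases "s x = 0") auto
   ultimately show ?case by simp
  qed
  have "\<bar>s x - k n x\<bar> \<le> 2 * C * ind (cball c (R + 1)) x" for n x
  proof (cases "x \<in> cball c (R + 1)")
   case True
   thus ?thesis using C[of x] kb[of n x] by auto
  next
   case False
   hence "s x = 0" "k n x = 0" using S[of x] ks[of n x] by auto
   thus ?thesis using C0 by simp
  qed
  thus "AE x in lborel. norm \<bar>s x - k n x\<bar> \<le> 2 * C * ind (cball c (R + 1)) x" for n
   by auto
 qed auto
 hence "\<forall>\<^sub>F n in sequentially. (LBINT x. \<bar>s x - k n x\<bar>) < e"
  using e by (intro order_tendstoD) auto
 then obtain n where "(LBINT x. \<bar>s x - k n x\<bar>) < e"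
  by (auto simp: eventually_sequentially)
 thus ?thesis using that[of "k n"] kc kb ks by blast
qed

lemma mollify_uniform:
 fixes k :: "real^'d => real"
 assumes k: "continuous_on UNIV k" "\<And>x. k x \<noteq> 0 ==> x \<in> cball c R" and e: "e > 0"
 obtains d where "d > 0" "\<And>r x. 0 < r ==> r < d ==> \<bar>mollify r k x - k x\<bar> \<le> e"
proof -
 obtain C where C: "\<And>x. norm (k x) \<le> C"
  using k(1) compact_cball[of c R] k(2) by (rule bounded_of_compact_support) (assumption | rule that)+
 have [measurable]: "k \<in> Borel"
  using k(1) by (rule borel_measurable_continuous_onI)
 obtain d where d: "d > 0" "\<And>x y. dist x y < d ==> norm (k x - k y) < e"
  using k(1) compact_cball[of c R] k(2) e by (rule uniformly_continuous_of_compact_support) (assumption | rule that)+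
 have "\<bar>mollify r k x - k x\<bar> \<le> e" if r: "0 < r" "r < d" for r x
 proof -
  have "mollify r k x - k x = mollify r (\<lambda>y. k y - k x) x"
   using mollify_diff[of r k C "\<lambda>_. k x" "norm (k x)" x] r(1) C mollify_const[OF r(1), of "k x" x] by simp
  moreover have "norm (mollify r (\<lambda>y. k y - k x) x) \<le> e"
  proof (rule mollify_norm_bound[OF r(1)])
   show "norm (k (x + z) - k x) \<le> e" if "norm z < r" for z
    using d(2)[of "x + z" x] that r by (auto simp: dist_norm)
  qed auto
  ultimately show ?thesis by simp
 qed
 with d(1) show ?thesis using that by blast
qed

text \<open>With \<open>k\<close> continuous and close to \<open>s\<close> and u = s - k, the error
  splits into the mollification of u, the error of mollifying \<open>k\<close>, and -u: the
  contraction property handles the first, uniform convergence on a bounded set the second.\<close>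

lemma mollify_tendsto_L1:
 fixes s :: "real^'d => real"
 assumes s[measurable]: "s \<in> Borel" and C: "\<And>x. \<bar>s x\<bar> \<le> C"
  and S: "\<And>x. s x \<noteq> 0 ==> x \<in> cball c R" and e: "e > 0"
 obtains d where "d > 0" "\<And>r. 0 < r ==> r < d ==> (LBINT x. \<bar>mollify r s x - s x\<bar>) < e"
proof -
 have e3: "e / 3 > 0" using e by simp
 obtain k where k: "continuous_on UNIV k" "\<And>x. \<bar>k x\<bar> \<le> C" "\<And>x. k x \<noteq> 0 ==> x \<in> cball c (R + 1)"
  "(LBINT x. \<bar>s x - k x\<bar>) < e / 3"
  using s C S e3 by (rule continuous_L1_approximation) (assumption | rule that)+
 have [measurable]: "k \<in> Borel"
  using k(1) by (rule borel_measurable_continuous_onI)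
 let ?B = "cball c (R + 2)"
 define V where "V = measure lborel ?B"
 have V: "0 \<le> V" by (simp add: V_def)
 define e' where "e' = e / (3 * (V + 1))"
 have e': "e' > 0" using e V by (simp add: e'_def)
 obtain d0 where d0: "d0 > 0" "\<And>r x. 0 < r ==> r < d0 ==> \<bar>mollify r k x - k x\<bar> \<le> e'"
  using k(1) k(3) e' by (rule mollify_uniform) (assumption | rule that)+
 have main: "(LBINT x. \<bar>mollify r s x - s x\<bar>) < e" if r: "0 < r" "r < min d0 1" for r
 proof -
  have r1: "r \<le> 1" using r by simp
  define u where "u = (\<lambda>x. s x - k x)"
  have u[measurable]: "u \<in> Borel" unfolding u_def by measurable
  have uC: "\<bar>u x\<bar> \<le> 2 * C" for x using C[of x] k(2)[of x] by (simp add: u_def)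
  have sS: "s x \<noteq> 0 ==> x \<in> cball c (R + 1)" for x using S[of x] by auto
  have uS: "u x \<noteq> 0 ==> x \<in> cball c (R + 1)" for x
   using sS[of x] k(3)[of x] by (cases "s x = 0") (auto simp: u_def)
  have mm[measurable]: "mollify r s \<in> Borel"
   using r(1) s C bounded_cball sS by (rule mollify_measurable)
  have mk[measurable]: "mollify r k \<in> Borel"
   using r(1) \<open>k \<in> Borel\<close> k(2) bounded_cball k(3) by (rule mollify_measurable)
  have mu[measurable]: "mollify r u \<in> Borel"
   using r(1) u uC bounded_cball uS by (rule mollify_measurable)
  have split: "mollify r s x - s x = mollify r u x + (mollify r k x - k x) - u x" for x
   using mollify_diff[of r s C k C x] r C k(2) by (simp add: u_def)
  have int_u: "integrable lborel u"
   by (rule integrable_bounded_support[where C="2 * C" and S="cball c (R + 1)"]) (use u uC uS in auto)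
  have muS: "x \<in> ?B" if "mollify r u x \<noteq> 0" for x
   using mollify_bounded_support[of r u c "R + 1" x] r(1) r1 uS that by (simp add: algebra_simps)
  have "norm (mollify r u x) \<le> 2 * C" for x
   by (rule mollify_norm_bound[OF r(1) u]) (use uC in auto)
  from mu this bounded_cball muS have int_mu: "integrable lborel (mollify r u)"
   by (rule integrable_bounded_support)
  have kS: "\<bar>mollify r k x - k x\<bar> \<le> e' * ind ?B x" for x
  proof (cases "x \<in> ?B")
   case True
   thus ?thesis using d0(2)[OF r(1)] r(2) by simp
  next
   case False
   hence "mollify r k x = 0"
    using mollify_bounded_support[of r k c "R + 1" x] r(1) r1 k(3) by (auto simp: algebra_simps)
   moreover have "k x = 0"
   proof (rule ccontr)
    assume "k x \<noteq> 0"
    from k(3)[OF this] False show False by simp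
   qed
   ultimately show ?thesis using e' by simp
  qed
  have int_B: "integrable lborel (\<lambda>x. e' * ind ?B x)"
   by (rule integrable_bounded_support[where C=e' and S="?B"]) (use e' in \<open>auto simp: indicator_def\<close>)
  have int_k: "integrable lborel (\<lambda>x. \<bar>mollify r k x - k x\<bar>)"
   by (rule lintegrable_bound[OF int_B]) (use kS e' in auto)
  have "(LBINT x. \<bar>mollify r s x - s x\<bar>)
    \<le> (LBINT x. \<bar>mollify r u x\<bar> + \<bar>mollify r k x - k x\<bar> + \<bar>u x\<bar>)"
  proof (rule integral_mono')
   show "integrable lborel (\<lambda>x. \<bar>mollify r u x\<bar> + \<bar>mollify r k x - k x\<bar> + \<bar>u x\<bar>)"
    using int_u int_mu int_k by (intro lintegrable_add) auto
  qed (auto simp: split)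
  also have "... = (LBINT x. \<bar>mollify r u x\<bar>) + (LBINT x. \<bar>mollify r k x - k x\<bar>) + (LBINT x. \<bar>u x\<bar>)"
   using int_u int_mu int_k by simp
  also have "(LBINT x. \<bar>mollify r u x\<bar>) \<le> (LBINT x. \<bar>u x\<bar>)"
   using r(1) r1 u uC uS by (rule mollify_L1_contraction)
  also have "(LBINT x. \<bar>mollify r k x - k x\<bar>) \<le> (LBINT x. e' * ind ?B x)"
   using int_B kS e' by (intro integral_mono') auto
  also have "... = e' * V"
   by (simp add: V_def)
  also have "e' * V \<le> e / 3"
   using V e by (simp add: e'_def field_simps)
  finally show ?thesis
   using k(4) by (simp add: u_def)
 qed
 show ?thesis
  using main d0(1) by (intro that[of "min d0 1"]) auto
qed

section \<open>Total variation and translations\<close>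

text \<open>The real-valued form of TV \<le> M for Borel functions on the whole space. The
  divergence of a compactly supported field vanishes outside the domain, so the integral carries no
  restriction; \<open>TV_le_iff_tv_le\<close> is the link to \<open>TV\<close>.\<close>

definition tv_le :: "(real^'d) set => (real^'d => real) => real => bool" where
 "tv_le \<O> v M \<longleftrightarrow> (\<forall>\<phi>\<in>C1c \<O>. (\<forall>x\<in>\<O>. norm (\<phi> x) \<le> 1) --> (LBINT x. v x * divergence \<phi> x) \<le> M)"

lemma C1_grad_cmult:
 assumes "C1_grad f Df" shows "C1_grad (\<lambda>x. a * f x) (\<lambda>x. a *\<^sub>R Df x)"
 using assms unfolding C1_grad_def
 by (auto intro!: continuous_intros derivative_eq_intros)

lemma C1_grad_sum:
 assumes "\<And>i. i \<in> I ==> C1_grad (f i) (Df i)"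
 shows "C1_grad (\<lambda>x. \<Sum>i\<in>I. f i x) (\<lambda>x. \<Sum>i\<in>I. Df i x)"
 unfolding C1_grad_def
proof (intro conjI allI continuous_on_sum)
 show "continuous_on UNIV (Df i)" if "i \<in> I" for i
  using assms[OF that] by (simp add: C1_grad_def)
 show "((\<lambda>x. \<Sum>i\<in>I. f i x) has_derivative (\<bullet>) (\<Sum>i\<in>I. Df i x)) (at x)" for x
 proof -
  have "((\<lambda>x. \<Sum>i\<in>I. f i x) has_derivative (\<lambda>h. \<Sum>i\<in>I. Df i x \<bullet> h)) (at x)"
   using assms by (intro has_derivative_sum) (auto simp: C1_grad_def)
  thus ?thesis by (simp add: inner_sum_left[abs_def])
 qed
qed

lemma integral_bump_grad_segment:
 "(LBINT t. ind {0..1} t * (bump_grad r (u + t *\<^sub>R y) \<bullet> y)) = bump r (u + y) - bump r (u::real^'d)"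
proof -
 have "((\<lambda>t. bump r (u + t *\<^sub>R y)) has_vector_derivative (bump_grad r (u + t *\<^sub>R y) \<bullet> y)) (at t within {0..1})" for t
 proof -
  have "(bump r has_derivative (\<lambda>h. bump_grad r (u + t *\<^sub>R y) \<bullet> h)) (at (u + t *\<^sub>R y))"
   using C1_grad_bump by (auto simp: C1_grad_def)
  moreover have "((\<lambda>t. u + t *\<^sub>R y) has_derivative (\<lambda>h. h *\<^sub>R y)) (at t within {0..1})"
   by (auto intro!: derivative_eq_intros)
  ultimately have "((\<lambda>t. bump r (u + t *\<^sub>R y)) has_derivative (\<lambda>h. bump_grad r (u + t *\<^sub>R y) \<bullet> (h *\<^sub>R y))) (at t within {0..1})"
   by (rule has_derivative_compose[rotated])
  thus ?thesis by (simp add: has_vector_derivative_def)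
 qed
 moreover have "continuous_on {0..1} (\<lambda>t. bump_grad r (u + t *\<^sub>R y) \<bullet> y)"
  by (intro continuous_intros continuous_on_compose2[OF bump_grad_continuous]) auto
 ultimately have "(LBINT t. indicator {0..1} t *\<^sub>R (bump_grad r (u + t *\<^sub>R y) \<bullet> y))
   = bump r (u + 1 *\<^sub>R y) - bump r (u + 0 *\<^sub>R y)"
  by (intro integral_FTC_atLeastAtMost) auto
 thus ?thesis by simp
qed

text \<open>The mean of \<open>s\<close> over the segment from x - y to x. For smooth
  \<open>s\<close> its derivative in direction \<open>y\<close> is s(x) - s(x - y), so it is a
  primitive of a translation difference.\<close>

definition segment_avg :: "(real^'d => real) => real^'d => real^'d => real" where
 "segment_avg s y x = (LBINT t. ind {0..1} t * s (x - t *\<^sub>R y))"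

lemma segment_avg_measurable[measurable]:
 assumes [measurable]: "s \<in> Borel"
 shows "segment_avg s y \<in> Borel"
proof -
 have "(\<lambda>x. \<integral>t. ind {0..1} t * s (x - t *\<^sub>R y) \<partial>lborel) \<in> borel_measurable lborel"
  by measurable
 thus ?thesis unfolding segment_avg_def[abs_def] by simp
qed

lemma segment_avg_bound:
 assumes C: "\<And>x. \<bar>s x\<bar> \<le> C" and s[measurable]: "s \<in> Borel"
 shows "\<bar>segment_avg s y x\<bar> \<le> C"
proof -
 have C0: "0 \<le> C" using C[of 0] by linarith
 have i: "integrable lborel (\<lambda>t::real. ind {0..1} t * C)"
 proof (rule integrable_bounded_support[where C=C and S="{0..1}"])
  show "bounded {0..1::real}" by (intro compact_imp_bounded compact_Icc)
 qed (use C0 in \<open>auto simp: indicator_def split: if_splits\<close>)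
 have b: "norm (ind {0..1} t * s (x - t *\<^sub>R y)) \<le> ind {0..1} t * C" for t
  using C by (auto simp: indicator_def)
 have "norm (segment_avg s y x) \<le> (LBINT t. ind {0..1::real} t * C)"
  unfolding segment_avg_def
 proof (rule lint_norm_bound_lint[OF _ i])
  show "integrable lborel (\<lambda>t. ind {0..1} t * s (x - t *\<^sub>R y))"
  proof (rule lintegrable_bound[OF i])
   show "AE t in lborel. norm (ind {0..1} t * s (x - t *\<^sub>R y)) \<le> norm (ind {0..1} t * C)"
    by (intro AE_I2 order_trans[OF b]) (simp only: real_norm_def abs_ge_self)
  qed auto
 qed (use b in auto)
 thus ?thesis by simp
qed

lemma segment_avg_support:
 assumes "segment_avg s y x \<noteq> 0"
 obtains t where "t \<in> {0..1}" "s (x - t *\<^sub>R y) \<noteq> 0"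
proof -
 have "\<exists>t\<in>{0..1}. s (x - t *\<^sub>R y) \<noteq> 0"
 proof (rule ccontr)
  assume "\<not> ?thesis"
  hence "ind {0..1} t * s (x - t *\<^sub>R y) = 0" for t
   by (auto simp: indicator_def)
  hence "segment_avg s y x = 0"
   unfolding segment_avg_def by (simp only: lint_zero)
  with assms show False by simp
 qed
 with that show ?thesis by blast
qed

text \<open>The weight is not smooth, so the derivative is moved to the kernel: Fubini and the
  substitution w + t y turn the mean over the segment into an integral of the kernel gradient along
  a segment, which the fundamental theorem of calculus evaluates.\<close>

lemma mollify_grad_segment_avg:
 fixes s :: "real^'d => real"
 assumes r: "r > 0" and s[measurable]: "s \<in> Borel" and C: "\<And>x. \<bar>s x\<bar> \<le> C"
  and S: "bounded S" "\<And>x. s x \<noteq> 0 ==> x \<in> S"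
 shows "mollify_grad r (segment_avg s y) x \<bullet> y = mollify r s x - mollify r s (x - y)"
proof -
 define I where "I = (LBINT z. bump r (z::real^'d))"
 have I: "I > 0" unfolding I_def using r by (rule bump_integral_pos)
 have C0: "0 \<le> C" using C[of 0] by linarith
 obtain c R where cR: "S \<subseteq> cball c R" using S(1) bounded_subset_cball by blast
 define T where "T = cball c (R + norm y)"
 have T: "w \<in> T" if "w - t *\<^sub>R y \<in> S" "t \<in> {0..1}" for w t
 proof -
  have "dist c w \<le> dist c (w - t *\<^sub>R y) + dist (w - t *\<^sub>R y) w" by (rule dist_triangle)
  also have "... \<le> R + norm y"
   using that cR by (intro add_mono) (auto simp: dist_norm mult_left_le_one_le)
  finally show ?thesis by (simp add: T_def)
 qed
 have avg[measurable]: "segment_avg s y \<in> Borel"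
  using s by (rule segment_avg_measurable)
 have avgC: "\<bar>segment_avg s y w\<bar> \<le> C" for w
  using C s by (rule segment_avg_bound)
 have avgT: "w \<in> T" if "segment_avg s y w \<noteq> 0" for w
  using segment_avg_support[OF that] T S(2) by metis
 define k where "k w t = (- 1 / I) * (ind {0..1} t * s (w - t *\<^sub>R y)) * (bump_grad r (w - x) \<bullet> y)" for w t
 define k' where "k' w t = (- 1 / I) * (ind {0..1} t * s w) * (bump_grad r (w - x + t *\<^sub>R y) \<bullet> y)" for w t
 define K where "K = (1 / I) * C * (4 * r^3 * norm y)"
 have ip: "\<bar>bump_grad r w \<bullet> y\<bar> \<le> 4 * r^3 * norm y" for w :: "real^'d"
  using Cauchy_Schwarz_ineq2[of "bump_grad r w" y] bump_bounds(2)[OF r, of w]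
  by (meson mult_right_mono norm_ge_zero order_trans)
 have bk: "norm (k w t) \<le> K" "norm (k' w t) \<le> K" for w t
  unfolding k_def k'_def K_def norm_mult using I C0 C ip r
  by (intro mult_mono; auto simp: indicator_def abs_divide)+
 have T0: "S \<subseteq> T" using T[of _ 0] by auto
 have supk: "w \<in> T \<and> t \<in> {0..1}" if "k w t \<noteq> 0" for w t
  using that T S(2) by (auto simp: k_def indicator_def split: if_splits)
 have supk': "w \<in> T \<and> t \<in> {0..1}" if "k' w t \<noteq> 0" for w t
  using that T0 S(2) by (auto simp: k'_def indicator_def split: if_splits)
 have bT: "bounded T" "bounded {0..1::real}" by (auto simp: T_def)
 have mk: "case_prod k \<in> Borel" "case_prod k' \<in> Borel"
  unfolding k_def k'_def borel_prod[symmetric] by measurable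
 have int2: "integrable lborel (\<lambda>w. (- segment_avg s y w / I) *\<^sub>R bump_grad r (w - x))"
 proof (rule integrable_bounded_support[OF _ _ bT(1)])
  show "norm ((- segment_avg s y w / I) *\<^sub>R bump_grad r (w - x)) \<le> C / I * (4 * r^3)" for w
   unfolding norm_scaleR using avgC[of w] bump_bounds(2)[OF r, of "w - x"] I C0
   by (intro mult_mono) (auto simp: abs_divide divide_right_mono)
  show "w \<in> T" if "(- segment_avg s y w / I) *\<^sub>R bump_grad r (w - x) \<noteq> 0" for w
   using that avgT[of w] by auto
 qed auto
 have "mollify_grad r (segment_avg s y) x \<bullet> y
   = (LBINT w. ((- segment_avg s y w / I) *\<^sub>R bump_grad r (w - x)) \<bullet> y)"
  unfolding mollify_grad_def I_def[symmetric] using int2 by (intro integral_inner_left[symmetric])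
 also have "... = (LBINT w. (LBINT t. k w t))"
 proof (rule lint_cong[OF refl])
  fix w
  have "(LBINT t. k w t) = (- 1 / I) * segment_avg s y w * (bump_grad r (w - x) \<bullet> y)"
   unfolding k_def segment_avg_def by simp
  thus "((- segment_avg s y w / I) *\<^sub>R bump_grad r (w - x)) \<bullet> y = (LBINT t. k w t)"
   by simp
 qed
 also have "... = (LBINT t. (LBINT w. k w t))"
  by (rule Fubini_bounded_support[of k K T "{0..1}"]) (use mk bk bT supk in blast)+
 also have "... = (LBINT t. (LBINT w. k' w t))"
 proof (rule lint_cong[OF refl])
  fix t
  have [measurable]: "(\<lambda>w. k w t) \<in> Borel" unfolding k_def by measurable
  have "(LBINT w. k w t) = (LBINT w. k (w + t *\<^sub>R y) t)"
   by (rule integral_lborel_translate[symmetric]) measurable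
  thus "(LBINT w. k w t) = (LBINT w. k' w t)"
   by (simp add: k_def k'_def algebra_simps)
 qed
 also have "... = (LBINT w. (LBINT t. k' w t))"
  by (rule Fubini_bounded_support[of k' K T "{0..1}", symmetric]) (use mk bk bT supk' in blast)+
 also have "... = (LBINT w. s w * (bump r (w - x) / I) - s w * (bump r (w - (x - y)) / I))"
 proof (rule lint_cong[OF refl])
  fix w
  have "(LBINT t. k' w t) = (LBINT t. (- s w / I) * (ind {0..1} t * (bump_grad r ((w - x) + t *\<^sub>R y) \<bullet> y)))"
   by (simp add: k'_def mult_ac)
  also have "... = (- s w / I) * (bump r ((w - x) + y) - bump r (w - x))"
   by (simp add: integral_bump_grad_segment)
  finally show "(LBINT t. k' w t) = s w * (bump r (w - x) / I) - s w * (bump r (w - (x - y)) / I)"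
   by (simp add: algebra_simps diff_divide_distrib)
 qed
 also have "... = mollify r s x - mollify r s (x - y)"
 proof -
  have "integrable lborel (\<lambda>w. s w * (bump r (w - x) / I))" for x
  proof (rule integrable_bounded_support[OF _ _ S(1)])
   show "norm (s w * (bump r (w - x) / I)) \<le> C * (r^4 / I)" for w
    unfolding norm_mult using C[of w] C0 bump_bounds(1)[OF r, of "w - x"] bump_nonneg[of r "w - x"] I
    by (intro mult_mono) (auto simp: divide_right_mono abs_divide)
  qed (use S in auto)
  thus ?thesis
   using mollify_alt[of r s C S] assms by (simp add: I_def)
 qed
 finally show ?thesis .
qed

text \<open>These are the points whose distance to the complement is at least \<open>d\<close>; such
  sets serve as supports of test fields and as a measurable exhaustion of the domain.\<close>

lemma closed_inner_parallel: "closed {x :: 'a::metric_space. ball x d \<subseteq> S}"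
proof -
 have "{x. ball x d \<subseteq> S} = (\<Inter>y\<in>- S. {x. d \<le> dist x y})"
  by (auto simp: subset_iff) (meson ComplI not_le)+
 moreover have "closed {x. d \<le> dist x y}" for y :: 'a
  by (intro closed_Collect_le continuous_intros)
 ultimately show ?thesis by auto
qed

text \<open>
 Mollifying the segment averages of the weights yields an admissible test field whose divergence is
 the translation difference of the mollified weights.
\<close>

lemma translation_duality_mollified:
 fixes s :: "'i::finite => real^'d => real" and y :: "'i => real^'d"
 assumes \<O>: "bounded \<O>" and v[measurable]: "v \<in> Borel" and Cv: "\<And>x. \<bar>v x\<bar> \<le> Cv"
  and tv: "tv_le \<O> v M"
  and s[measurable]: "\<And>i. s i \<in> Borel" and Cs: "\<And>i x. \<bar>s i x\<bar> \<le> Cs"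
  and \<rho>: "0 < r" "r < \<rho>" and supp: "\<And>i x t. s i x \<noteq> 0 ==> t \<in> {0..1} ==> cball (x + t *\<^sub>R y i) \<rho> \<subseteq> \<O>"
  and B: "\<And>x. norm (\<Sum>i\<in>UNIV. segment_avg (s i) (y i) x *\<^sub>R y i) \<le> B" "B > 0"
 shows "(\<Sum>i\<in>UNIV. \<integral>x. mollify r (s i) x * (v (x + y i) - v x) \<partial>lborel) \<le> B * M"
proof -
 let ?S = "\<lambda>i. segment_avg (s i) (y i)"
 let ?m = "\<lambda>i. mollify r (s i)"
 let ?g = "\<lambda>i. mollify_grad r (?S i)"
 have S[measurable]: "?S i \<in> Borel" for i
  using s by (rule segment_avg_measurable)
 have SC: "\<bar>?S i x\<bar> \<le> Cs" for i x
  using Cs s by (rule segment_avg_bound)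
 have S\<O>: "cball x \<rho> \<subseteq> \<O>" if "?S i x \<noteq> 0" for i x
  using segment_avg_support[OF that] supp by (metis diff_add_cancel)
 have S\<O>': "x \<in> \<O>" if "?S i x \<noteq> 0" for i x
  using S\<O>[OF that] \<rho> by (auto simp: subset_iff)
 have s\<O>: "x \<in> \<O>" if "s i x \<noteq> 0" for i x
  using supp[OF that, of 0] \<rho> by (auto simp: subset_iff)
 \<comment> \<open>Where an average is nonzero a ball of radius \<rho> fits into the domain;
   mollification moves points by less than \<open>r\<close>, so a ball of radius \<rho> - r
   remains.\<close>
 define K where "K = {x. ball x (\<rho> - r) \<subseteq> \<O>}"
 have K\<O>: "K \<subseteq> \<O>" using \<rho> by (auto simp: K_def subset_iff)
 hence K: "compact K"
  using closed_inner_parallel[of "\<rho> - r" \<O>] bounded_subset[OF \<O>] by (auto simp: K_def compact_eq_bounded_closed)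
 have mK: "x \<in> K" if nz: "mollify r (?S i) x \<noteq> 0" for i x
 proof -
  obtain z where z: "norm z < r" "?S i (x + z) \<noteq> 0"
   using mollify_support[of r "?S i" Cs \<O> x] \<rho>(1) S SC \<O> S\<O>' nz by blast
  have "ball x (\<rho> - r) \<subseteq> cball (x + z) \<rho>"
  proof
   fix w assume "w \<in> ball x (\<rho> - r)"
   thus "w \<in> cball (x + z) \<rho>"
    using dist_triangle[of "x + z" w x] z(1) by (auto simp: dist_norm)
  qed
  thus ?thesis using S\<O>[OF z(2)] by (auto simp: K_def)
 qed
 have gr: "C1_grad (mollify r (?S i)) (?g i)" for i
  using \<rho>(1) S SC \<O> S\<O>' by (rule C1_grad_mollify)
 have grs: "C1_grad (?m i) (mollify_grad r (s i))" for i
  using \<rho>(1) s Cs \<O> s\<O> by (rule C1_grad_mollify)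
 have key: "?g i x \<bullet> y i = ?m i x - ?m i (x - y i)" for i x
  using \<rho>(1) s Cs \<O> s\<O> by (rule mollify_grad_segment_avg)
 \<comment> \<open>Components of -1/B times the sum of the mollified averages times
   \<open>y i\<close>. Dividing by \<open>B\<close> makes the field admissible; the sign makes its
   pairing with \<open>v\<close> the sum of the forward differences v(x + y i) - v(x).\<close>
 define f where "f j x = (\<Sum>i\<in>UNIV. (- y i $ j / B) * mollify r (?S i) x)" for j x
 define Df where "Df j x = (\<Sum>i\<in>UNIV. (- y i $ j / B) *\<^sub>R ?g i x)" for j x
 have fD: "C1_grad (f j) (Df j)" for j
  unfolding f_def[abs_def] Df_def[abs_def] by (intro C1_grad_sum C1_grad_cmult gr)
 have fK: "x \<in> K" if "f j x \<noteq> 0" for j x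
 proof (rule ccontr)
  assume "x \<notin> K"
  hence "mollify r (?S i) x = 0" for i using mK[of i x] by blast
  with that show False by (simp add: f_def)
 qed
 let ?\<phi> = "\<lambda>x. \<chi> j. f j x"
 have \<phi>: "?\<phi> \<in> C1c \<O>" using fD K K\<O> fK by (rule C1c_vecI)
 have div: "divergence ?\<phi> x = - (1 / B) * (\<Sum>i\<in>UNIV. ?m i x - ?m i (x - y i))" for x
 proof -
  have "divergence ?\<phi> x = (\<Sum>j\<in>UNIV. Df j x $ j)"
   using fD K K\<O> fK by (rule C1c_vecI)
  also have "... = (\<Sum>j\<in>UNIV. \<Sum>i\<in>UNIV. - (1 / B) * (?g i x $ j * y i $ j))"
   by (simp add: Df_def mult.commute)
  also have "... = (\<Sum>i\<in>UNIV. \<Sum>j\<in>UNIV. - (1 / B) * (?g i x $ j * y i $ j))"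
   by (rule sum.swap)
  also have "... = - (1 / B) * (\<Sum>i\<in>UNIV. ?g i x \<bullet> y i)"
   by (simp add: inner_vec_def sum_distrib_left)
  finally show ?thesis by (simp add: key)
 qed
 \<comment> \<open>The whole vector sum is mollified at once, so the Euclidean bound
   \<open>B\<close> of the unmollified sum carries over.\<close>
 have \<phi>1: "norm (?\<phi> x) \<le> 1" for x
 proof -
  have int: "integrable lborel (\<lambda>z. (bump r z / (LBINT z. bump r (z::real^'d))) *\<^sub>R ?S i (x + z))" for i
   by (rule mollify_integrable[OF \<rho>(1) S]) (use SC in auto)
  have "?\<phi> x = (- (1 / B)) *\<^sub>R (\<Sum>i\<in>UNIV. mollify r (?S i) x *\<^sub>R y i)"
   by (simp add: vec_eq_iff f_def sum_distrib_left sum_negf mult_ac)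
  also have "(\<Sum>i\<in>UNIV. mollify r (?S i) x *\<^sub>R y i) = mollify r (\<lambda>x. \<Sum>i\<in>UNIV. ?S i x *\<^sub>R y i) x"
  proof -
   let ?b = "\<lambda>z. bump r z / (LBINT z. bump r (z::real^'d))"
   have "(\<Sum>i\<in>UNIV. mollify r (?S i) x *\<^sub>R y i) = (\<Sum>i\<in>UNIV. \<integral>z. (?b z *\<^sub>R ?S i (x + z)) *\<^sub>R y i \<partial>lborel)"
    unfolding mollify_def by (intro sum.cong refl integral_scaleR_left[symmetric] int)
   also have "... = (LBINT z. (\<Sum>i\<in>UNIV. (?b z *\<^sub>R ?S i (x + z)) *\<^sub>R y i))"
    by (intro lint_sum[symmetric] integrable_scaleR_left int)
   also have "... = mollify r (\<lambda>x. \<Sum>i\<in>UNIV. ?S i x *\<^sub>R y i) x"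
    unfolding mollify_def by (simp only: scaleR_sum_right scaleR_scaleR real_scaleR_def)
   finally show ?thesis .
  qed
  finally have "norm (?\<phi> x) = (1 / B) * norm (mollify r (\<lambda>x. \<Sum>i\<in>UNIV. ?S i x *\<^sub>R y i) x)"
   using B(2) by simp
  also have "... \<le> 1"
  proof -
   have "(\<lambda>x. \<Sum>i\<in>UNIV. ?S i x *\<^sub>R y i) \<in> Borel"
    by measurable
   hence "norm (mollify r (\<lambda>x. \<Sum>i\<in>UNIV. ?S i x *\<^sub>R y i) x) \<le> B"
    using B(1) by (rule mollify_norm_bound[OF \<rho>(1)])
   thus ?thesis using B(2) by (simp add: pos_divide_le_eq)
  qed
  finally show ?thesis .
 qed
 obtain R where R: "\<And>x. x \<in> \<O> ==> norm x \<le> R"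
  using \<O> by (auto simp: bounded_iff)
 have mR: "x \<in> cball 0 (R + r)" if nz: "?m i x \<noteq> 0" for i x
 proof -
  obtain z where z: "norm z < r" "s i (x + z) \<noteq> 0"
   using \<rho>(1) s Cs \<O> s\<O> nz by (rule mollify_support) (assumption | rule that)+
  have "norm (x + z) \<le> R" using R[OF s\<O>[OF z(2)]] .
  thus ?thesis using norm_triangle_ineq4[of "x + z" z] z(1) by simp
 qed
 have mC: "\<bar>?m i x\<bar> \<le> Cs" for i x
  using mollify_norm_bound[OF \<rho>(1) s[of i], of x Cs] Cs by simp
 have mm[measurable]: "?m i \<in> Borel" for i
  using grs[of i] by (rule C1_grad_measurable)
 have int1: "integrable lborel (\<lambda>x. u x * ?m i (x - a))"
  if u[measurable]: "u \<in> Borel" and Cu: "\<And>x. \<bar>u x\<bar> \<le> Cv" for u i a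
 proof -
  have "integrable lborel (\<lambda>x. u (x + a) * ?m i x)"
  proof (rule integrable_bounded_support)
   show "norm (u (x + a) * ?m i x) \<le> Cv * Cs" for x
    unfolding norm_mult using Cu[of "x + a"] mC[of i x] by (intro mult_mono) auto
   show "x \<in> cball 0 (R + r)" if "u (x + a) * ?m i x \<noteq> 0" for x
    using that mR[of i x] by (cases "?m i x = 0") auto
  qed auto
  thus ?thesis
   using integrable_lborel_translate[of "\<lambda>x. u x * ?m i (x - a)" a] by simp
 qed
 have "(\<Sum>i\<in>UNIV. \<integral>x. ?m i x * (v (x + y i) - v x) \<partial>lborel)
   = (\<Sum>i\<in>UNIV. (LBINT x. v x * ?m i (x - y i)) - (LBINT x. v x * ?m i x))"
 proof (intro sum.cong refl)
  fix i
  have "(LBINT x. ?m i x * (v (x + y i) - v x)) = (LBINT x. v (x + y i) * ?m i x - v x * ?m i x)"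
   by (simp add: algebra_simps)
  also have "... = (LBINT x. v (x + y i) * ?m i x) - (LBINT x. v x * ?m i x)"
   using int1[of v i 0] int1[of "\<lambda>x. v (x + y i)" i 0] Cv by simp
  also have "(LBINT x. v (x + y i) * ?m i x) = (LBINT x. v x * ?m i (x - y i))"
   using integral_lborel_translate[of "\<lambda>x. v x * ?m i (x - y i)" "y i"] by simp
  finally show "(LBINT x. ?m i x * (v (x + y i) - v x))
   = (LBINT x. v x * ?m i (x - y i)) - (LBINT x. v x * ?m i x)" .
 qed
 also have "... = (LBINT x. (\<Sum>i\<in>UNIV. v x * ?m i (x - y i) - v x * ?m i x))"
  using int1[of v _ 0] int1[of v] Cv by (simp add: lint_sum)
 also have "... = (LBINT x. B * (v x * divergence ?\<phi> x))"
  unfolding div using B(2)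
  by (intro lint_cong refl)
   (simp add: sum_distrib_left[symmetric] right_diff_distrib[symmetric] sum_subtractf, simp add: algebra_simps)
 also have "... = B * (LBINT x. v x * divergence ?\<phi> x)"
  by simp
 also have "... \<le> B * M"
  using tv \<phi> \<phi>1 B(2) unfolding tv_le_def by (intro mult_left_mono) auto
 finally show ?thesis .
qed

lemma tv_le_nonneg:
 assumes "tv_le \<O> v M" shows "0 \<le> M"
proof -
 have z: "C1_grad (\<lambda>_::real^'a. 0) (\<lambda>_. 0)"
  by (auto simp: C1_grad_def)
 have "(\<lambda>x::real^'a. (\<chi> i. 0) :: real^'a) \<in> C1c \<O>" "divergence (\<lambda>x. \<chi> i. 0) (x::real^'a) = 0" for x
  using C1c_vecI[of "\<lambda>i x. 0" "\<lambda>i x. 0" "{}" \<O>] z by auto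
 moreover have "(\<chi> i. 0) = (0 :: real^'a)" by (simp add: vec_eq_iff)
 ultimately show ?thesis
  using assms unfolding tv_le_def by (metis (mono_tags, lifting) lint_zero
    mult_zero_right norm_zero zero_le_one lint_cong)
qed

text \<open>Here the weights are arbitrary bounded Borel functions: their mollifications converge in
  L1, and the differences of \<open>v\<close> are bounded by 2 Cv.\<close>

lemma translation_duality:
 fixes s :: "'i::finite => real^'d => real" and y :: "'i => real^'d"
 assumes \<O>: "bounded \<O>" and v[measurable]: "v \<in> Borel" and Cv: "\<And>x. \<bar>v x\<bar> \<le> Cv"
  and tv: "tv_le \<O> v M"
  and s[measurable]: "\<And>i. s i \<in> Borel" and Cs: "\<And>i x. \<bar>s i x\<bar> \<le> Cs"
  and \<rho>: "0 < \<rho>" and supp: "\<And>i x t. s i x \<noteq> 0 ==> t \<in> {0..1} ==> cball (x + t *\<^sub>R y i) \<rho> \<subseteq> \<O>"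
  and B: "\<And>x. norm (\<Sum>i\<in>UNIV. segment_avg (s i) (y i) x *\<^sub>R y i) \<le> B"
 shows "(\<Sum>i\<in>UNIV. \<integral>x. s i x * (v (x + y i) - v x) \<partial>lborel) \<le> B * M"
proof -
 have M: "0 \<le> M" using tv by (rule tv_le_nonneg)
 have Cv0: "0 \<le> Cv" using Cv[of 0] by linarith
 have B0: "0 \<le> B" using B[of 0] norm_ge_zero order_trans by blast
 define N where "N = real CARD('i)"
 have N: "N \<ge> 0" by (simp add: N_def)
 have s\<O>: "x \<in> \<O>" if "s i x \<noteq> 0" for i x
  using supp[OF that, of 0] \<rho> by (auto simp: subset_iff)
 obtain c R where cR: "\<O> \<subseteq> cball c R" using \<O> bounded_subset_cball by blast
 have sR: "x \<in> cball c R" if "s i x \<noteq> 0" for i x using s\<O>[OF that] cR by blast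
 have "(\<Sum>i\<in>UNIV. \<integral>x. s i x * (v (x + y i) - v x) \<partial>lborel) \<le> B * M + e" if e: "e > 0" for e
 proof -
  \<comment> \<open>Each of the \<open>N\<close> weights costs at most \<delta> times 2 Cv, and
    \<open>D\<close> is at least N times 2 Cv, so the total cost is at most e / 2.\<close>
  define D where "D = (N + 1) * (2 * Cv + 1)"
  have D: "D > 0" unfolding D_def using N Cv0 by (intro mult_pos_pos) auto
  define \<delta> where "\<delta> = e / (2 * D)"
  have \<delta>: "\<delta> > 0" using e D by (simp add: \<delta>_def)
  have "\<exists>d>0. \<forall>r. 0 < r --> r < d --> (LBINT x. \<bar>mollify r (s i) x - s i x\<bar>) < \<delta>" for i
   by (rule mollify_tendsto_L1[OF s[of i] Cs[of i] sR[of i] \<delta>]) (assumption, blast)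
  then obtain d where d: "\<And>i. d i > 0" "\<And>i r. 0 < r ==> r < d i ==> (LBINT x. \<bar>mollify r (s i) x - s i x\<bar>) < \<delta>"
   by metis
  define d' where "d' = Min (insert \<rho> (insert 1 (range d)))"
  have d': "d' > 0" unfolding d'_def using d(1) \<rho> by (subst Min_gr_iff) auto
  have d'_le: "d' \<le> \<rho>" "d' \<le> 1" "d' \<le> d i" for i unfolding d'_def by (rule Min_le; blast | rule Min_le; simp)+
  define r where "r = d' / 2"
  have r: "0 < r" "r < \<rho>" "r \<le> 1"
   using d' d'_le(1,2) by (auto simp: r_def)
  have rd: "r < d i" for i
   using d' d'_le(3)[of i] by (simp add: r_def)
  \<comment> \<open>Enlarged because the mollified version divides by the bound, which may be 0; the
    surplus times \<open>M\<close> is at most e / 2.\<close>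
  define B' where "B' = B + e / (2 * (M + 1))"
  have B': "B' > 0" "\<And>x. norm (\<Sum>i\<in>UNIV. segment_avg (s i) (y i) x *\<^sub>R y i) \<le> B'"
   using B B0 e M by (auto simp: B'_def add_nonneg_pos intro: order_trans[OF B])
  have m[measurable]: "mollify r (s i) \<in> Borel" for i
   using r(1) s Cs \<O> s\<O> by (rule mollify_measurable)
  have mC: "\<bar>mollify r (s i) x\<bar> \<le> Cs" for i x
   using mollify_norm_bound[OF r(1) s[of i], of x Cs] Cs by simp
  have mS: "x \<in> cball c (R + 1)" if "mollify r (s i) x \<noteq> 0" for i x
   using r(1,3) sR that by (rule mollify_bounded_support)
  have close: "(LBINT x. s i x * (v (x + y i) - v x)) \<le> (LBINT x. mollify r (s i) x * (v (x + y i) - v x)) + \<delta> * (2 * Cv)" for i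
  proof -
   have q: "\<bar>v (x + y i) - v x\<bar> \<le> 2 * Cv" for x
    using Cv[of x] Cv[of "x + y i"] by linarith
   have i1: "integrable lborel (\<lambda>x. s i x * (v (x + y i) - v x))"
   proof (rule integrable_bounded_support)
    show "norm (s i x * (v (x + y i) - v x)) \<le> Cs * (2 * Cv)" for x
     unfolding norm_mult using Cs[of i x] q[of x] by (intro mult_mono) auto
    show "x \<in> cball c R" if "s i x * (v (x + y i) - v x) \<noteq> 0" for x
     using that sR[of i x] by (cases "s i x = 0") auto
   qed auto
   have i2: "integrable lborel (\<lambda>x. mollify r (s i) x * (v (x + y i) - v x))"
   proof (rule integrable_bounded_support)
    show "norm (mollify r (s i) x * (v (x + y i) - v x)) \<le> Cs * (2 * Cv)" for x
     unfolding norm_mult using mC[of i x] q[of x] by (intro mult_mono) auto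
    show "x \<in> cball c (R + 1)" if "mollify r (s i) x * (v (x + y i) - v x) \<noteq> 0" for x
     using that mS[of i x] by (cases "mollify r (s i) x = 0") auto
   qed auto
   have i3: "integrable lborel (\<lambda>x. \<bar>mollify r (s i) x - s i x\<bar>)"
   proof (rule integrable_bounded_support)
    show "norm \<bar>mollify r (s i) x - s i x\<bar> \<le> 2 * Cs" for x
     using mC[of i x] Cs[of i x] by simp
    show "x \<in> cball c (R + 1)" if "\<bar>mollify r (s i) x - s i x\<bar> \<noteq> 0" for x
    proof (cases "s i x = 0")
     case True
     thus ?thesis using that mS[of i x] by auto
    next
     case False
     thus ?thesis using sR[of i x] by auto
    qed
   qed auto
   have "(LBINT x. s i x * (v (x + y i) - v x)) - (LBINT x. mollify r (s i) x * (v (x + y i) - v x))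
    = (LBINT x. s i x * (v (x + y i) - v x) - mollify r (s i) x * (v (x + y i) - v x))"
    using i1 i2 by simp
   also have "... \<le> (LBINT x. \<bar>mollify r (s i) x - s i x\<bar> * (2 * Cv))"
   proof (rule integral_mono)
    show "integrable lborel (\<lambda>x. s i x * (v (x + y i) - v x) - mollify r (s i) x * (v (x + y i) - v x))"
     using i1 i2 by (rule lintegrable_diff)
    show "integrable lborel (\<lambda>x. \<bar>mollify r (s i) x - s i x\<bar> * (2 * Cv))"
     by (intro integrable_mult_left i3)
    fix x
    have "s i x * (v (x + y i) - v x) - mollify r (s i) x * (v (x + y i) - v x)
      = - (mollify r (s i) x - s i x) * (v (x + y i) - v x)" by (simp add: algebra_simps)
    also have "... \<le> \<bar>- (mollify r (s i) x - s i x)\<bar> * \<bar>v (x + y i) - v x\<bar>"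
     by (metis abs_ge_self abs_mult)
    also have "... \<le> \<bar>mollify r (s i) x - s i x\<bar> * (2 * Cv)"
     unfolding abs_minus_cancel using q[of x] by (intro mult_left_mono) auto
    finally show "s i x * (v (x + y i) - v x) - mollify r (s i) x * (v (x + y i) - v x)
     \<le> \<bar>mollify r (s i) x - s i x\<bar> * (2 * Cv)" .
   qed
   also have "... = (LBINT x. \<bar>mollify r (s i) x - s i x\<bar>) * (2 * Cv)"
    by simp
   also have "... \<le> \<delta> * (2 * Cv)"
    using d(2)[OF r(1) rd, of i] Cv0 by (intro mult_right_mono) auto
   finally show ?thesis by linarith
  qed
  have "(\<Sum>i\<in>UNIV. \<integral>x. s i x * (v (x + y i) - v x) \<partial>lborel)
   \<le> (\<Sum>i\<in>UNIV. (LBINT x. mollify r (s i) x * (v (x + y i) - v x)) + \<delta> * (2 * Cv))"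
   using close by (intro sum_mono)
  also have "... = (\<Sum>i\<in>UNIV. \<integral>x. mollify r (s i) x * (v (x + y i) - v x) \<partial>lborel) + N * (\<delta> * (2 * Cv))"
   by (simp add: sum.distrib N_def)
  also have "(\<Sum>i\<in>UNIV. \<integral>x. mollify r (s i) x * (v (x + y i) - v x) \<partial>lborel) \<le> B' * M"
   using \<O> v Cv tv s Cs r(1,2) supp B'(2,1) by (rule translation_duality_mollified)
  also have "B' * M \<le> B * M + e / 2"
   using e M by (simp add: B'_def field_simps)
  also have "N * (\<delta> * (2 * Cv)) \<le> e / 2"
  proof -
   have "N * (2 * Cv) \<le> D"
    unfolding D_def using N Cv0 by (intro mult_mono) auto
   hence "(N * (2 * Cv)) * (e / (2 * D)) \<le> D * (e / (2 * D))"
    using e D by (intro mult_right_mono) auto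
   also have "... = e / 2" using D by simp
   finally show ?thesis by (simp add: \<delta>_def mult_ac)
  qed
  finally show ?thesis by simp
 qed
 thus ?thesis by (rule field_le_epsilon)
qed

text \<open>Duality with the weights sgn(v(x + y i) - v(x)) on \<open>A i\<close>. All displacements
  are treated at once, so \<open>B\<close> bounds the norm of their combinations with coefficients
  in [-1, 1], which is sharper than the sum of the norms.\<close>

lemma translation_variation:
 fixes y :: "'i::finite => real^'d"
 assumes \<O>: "bounded \<O>" "open \<O>" and v[measurable]: "v \<in> Borel" and Cv: "\<And>x. \<bar>v x\<bar> \<le> Cv"
  and tv: "tv_le \<O> v M"
  and A: "\<And>i. A i \<in> sets borel" and seg: "\<And>i x t. x \<in> A i ==> t \<in> {0..1} ==> x + t *\<^sub>R y i \<in> \<O>"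
  and B: "\<And>\<theta>. (\<And>i. \<bar>\<theta> i\<bar> \<le> 1) ==> norm (\<Sum>i\<in>UNIV. \<theta> i *\<^sub>R y i) \<le> B"
 shows "(\<Sum>i\<in>UNIV. \<integral>x. ind (A i) x * \<bar>v (x + y i) - v x\<bar> \<partial>lborel) \<le> B * M"
proof -
 have Cv0: "0 \<le> Cv" using Cv[of 0] by linarith
 \<comment> \<open>The duality asks for segments at a uniform distance from the boundary.
   \<open>P n i\<close> provides the distance 1/(n + 1) and is closed; each point of
   \<open>A i\<close> lies in it eventually, because its segment is compact in an open set.\<close>
 define P where "P n i = {x. \<forall>t\<in>{0..1}. ball (x + t *\<^sub>R y i) (1 / real (Suc n)) \<subseteq> \<O>}" for n i
 have [measurable]: "P n i \<in> sets borel" for n i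
 proof -
  have "P n i = (\<Inter>t\<in>{0..1}. (\<lambda>x. x + t *\<^sub>R y i) -` {x. ball x (1 / real (Suc n)) \<subseteq> \<O>})"
   by (auto simp: P_def)
  moreover have "closed ..."
   by (intro closed_INT ballI closed_vimage closed_inner_parallel continuous_intros)
  ultimately show ?thesis by simp
 qed
 note A[measurable]
 have q: "\<bar>v (x + y i) - v x\<bar> \<le> 2 * Cv" for x i
  using Cv[of x] Cv[of "x + y i"] by linarith
 have bound: "(\<Sum>i\<in>UNIV. \<integral>x. ind (A i \<inter> P n i) x * \<bar>v (x + y i) - v x\<bar> \<partial>lborel) \<le> B * M" for n
 proof -
  let ?s = "\<lambda>i x. ind (A i \<inter> P n i) x * sgn (v (x + y i) - v x)"
  have s1: "\<bar>?s i x\<bar> \<le> 1" for i x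
   by (auto simp: indicator_def sgn_if)
  have sm: "?s i \<in> Borel" for i
   by measurable
  have "(\<Sum>i\<in>UNIV. \<integral>x. ?s i x * (v (x + y i) - v x) \<partial>lborel) \<le> B * M"
  proof (rule translation_duality[OF \<O>(1) v Cv tv sm s1])
   show "0 < 1 / (2 * real (Suc n))" by simp
   show "cball (x + t *\<^sub>R y i) (1 / (2 * real (Suc n))) \<subseteq> \<O>" if "?s i x \<noteq> 0" "t \<in> {0..1}" for i x t
   proof -
    have "x \<in> P n i" using that(1) by (auto simp: indicator_def split: if_splits)
    hence "ball (x + t *\<^sub>R y i) (1 / real (Suc n)) \<subseteq> \<O>" using that(2) by (auto simp: P_def)
    moreover have "cball (x + t *\<^sub>R y i) (1 / (2 * real (Suc n))) \<subseteq> ball (x + t *\<^sub>R y i) (1 / real (Suc n))"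
     by (intro cball_subset_ball_iff[THEN iffD2] disjI1) (simp add: field_simps)
    ultimately show ?thesis by blast
   qed
   show "norm (\<Sum>i\<in>UNIV. segment_avg (?s i) (y i) x *\<^sub>R y i) \<le> B" for x
    by (intro B segment_avg_bound s1 sm)
  qed
  moreover have "?s i x * (v (x + y i) - v x) = ind (A i \<inter> P n i) x * \<bar>v (x + y i) - v x\<bar>" for i x
   by (simp add: abs_sgn mult.commute mult.left_commute)
  ultimately show ?thesis by simp
 qed
 have lim: "(\<lambda>n. \<integral>x. ind (A i \<inter> P n i) x * \<bar>v (x + y i) - v x\<bar> \<partial>lborel)
   \<longlonglongrightarrow> (LBINT x. ind (A i) x * \<bar>v (x + y i) - v x\<bar>)" for i
 proof (rule integral_dominated_convergence[where w="\<lambda>x. ind (A i) x * (2 * Cv)"])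
  show "integrable lborel (\<lambda>x. ind (A i) x * (2 * Cv))"
  proof (rule integrable_bounded_support[OF _ _ \<O>(1)])
   show "norm (ind (A i) x * (2 * Cv)) \<le> 2 * Cv" for x
    using Cv0 by (auto simp: indicator_def)
   show "x \<in> \<O>" if "ind (A i) x * (2 * Cv) \<noteq> 0" for x
    using that seg[of x i 0] by (auto simp: indicator_def split: if_splits)
  qed auto
  show "AE x in lborel. (\<lambda>n. ind (A i \<inter> P n i) x * \<bar>v (x + y i) - v x\<bar>)
    \<longlonglongrightarrow> ind (A i) x * \<bar>v (x + y i) - v x\<bar>"
  proof (rule AE_I2)
   fix x
   have "(\<lambda>n. ind (A i \<inter> P n i) x) \<longlonglongrightarrow> ind (A i) x"
   proof (cases "x \<in> A i")
    case True
    have "compact ((\<lambda>t. x + t *\<^sub>R y i) ` {0..1})"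
     by (intro compact_continuous_image continuous_intros) auto
    moreover have "(\<lambda>t. x + t *\<^sub>R y i) ` {0..1} \<subseteq> \<O>"
     using seg[OF True] by auto
    ultimately obtain e where e: "e > 0" "(\<Union>z\<in>(\<lambda>t. x + t *\<^sub>R y i) ` {0..1}. ball z e) \<subseteq> \<O>"
     using compact_subset_open_imp_ball_epsilon_subset \<O>(2) by metis
    obtain m where m: "1 / real (Suc m) < e"
     using e(1) reals_Archimedean by (auto simp: inverse_eq_divide)
    have "x \<in> P n i" if "n \<ge> m" for n
    proof -
     have "1 / real (Suc n) \<le> 1 / real (Suc m)" using that by (simp add: frac_le)
     hence "ball (x + t *\<^sub>R y i) (1 / real (Suc n)) \<subseteq> ball (x + t *\<^sub>R y i) e" for t
      using m by (intro subset_ball) simp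
     thus ?thesis using e(2) by (auto simp: P_def)
    qed
    hence "\<forall>\<^sub>F n in sequentially. ind (A i \<inter> P n i) x = ind (A i) x"
     unfolding eventually_sequentially using True by (intro exI[of _ m]) (auto simp: indicator_def)
    thus ?thesis by (rule tendsto_eventually)
   qed simp
   thus "(\<lambda>n. ind (A i \<inter> P n i) x * \<bar>v (x + y i) - v x\<bar>)
    \<longlonglongrightarrow> ind (A i) x * \<bar>v (x + y i) - v x\<bar>"
    by (intro tendsto_intros)
  qed
  show "AE x in lborel. norm (ind (A i \<inter> P n i) x * \<bar>v (x + y i) - v x\<bar>)
    \<le> ind (A i) x * (2 * Cv)" for n
   using q Cv0 by (intro AE_I2) (auto simp: indicator_def)
 qed auto
 show ?thesis
  by (rule LIMSEQ_le_const2[OF tendsto_sum[OF lim]]) (use bound in auto)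
qed

section \<open>Meshes are lattices\<close>

definition lcorner :: "real^'d => real => int^'d => real^'d" where
 "lcorner a h k = (\<chi> i. a $ i + h * real_of_int (k $ i))"

definition lcell :: "real^'d => real => int^'d => (real^'d) set" where
 "lcell a h k = box (lcorner a h k) (lcorner a h k + (\<chi> i. h))"

definition ccell :: "real^'d => real => int^'d => (real^'d) set" where
 "ccell a h k = cbox (lcorner a h k) (lcorner a h k + (\<chi> i. h))"

text \<open>Total on the whole space; a point of the null set \<open>grid\<close> is assigned to the
  cell above it.\<close>

definition lindex :: "real^'d => real => real^'d => int^'d" where
 "lindex a h x = (\<chi> i. \<lfloor>(x $ i - a $ i) / h\<rfloor>)"

definition grid :: "real^'d => real => (real^'d) set" where
 "grid a h = {x. \<exists>i. (x $ i - a $ i) / h \<in> \<int>}"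

text \<open>The clause on neighbouring cells says that their open common face belongs to the domain,
  which excludes slits; it makes the segments between neighbouring cells admissible for
  translations.\<close>

definition lattice_mesh :: "(real^'d) set => real => (real^'d) set set => real^'d => (int^'d) set => bool" where
 "lattice_mesh \<O> h \<Q> a X \<longleftrightarrow> h > 0 \<and> finite X \<and> \<Q> = ccell a h ` X \<and>
   (\<forall>k\<in>X. lcell a h k \<subseteq> \<O>) \<and> (\<forall>x\<in>\<O>. \<forall>k. x \<in> lcell a h k --> k \<in> X) \<and>
   (\<forall>k\<in>X. \<forall>i. k + axis i 1 \<in> X -->
    box (lcorner a h k) (lcorner a h k + (\<chi> j. h) + axis i h) \<subseteq> \<O>) \<and>
   closure \<O> = \<Union>(ccell a h ` X)"

lemma mem_lcell:
 assumes "h > 0"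
 shows "x \<in> lcell a h k \<longleftrightarrow> (\<forall>i. real_of_int (k $ i) < (x $ i - a $ i) / h \<and> (x $ i - a $ i) / h < real_of_int (k $ i) + 1)"
 using assms unfolding lcell_def mem_box_cart lcorner_def
 by (simp add: pos_less_divide_eq pos_divide_less_eq algebra_simps)

lemma mem_ccell:
 assumes "h > 0"
 shows "x \<in> ccell a h k \<longleftrightarrow> (\<forall>i. real_of_int (k $ i) \<le> (x $ i - a $ i) / h \<and> (x $ i - a $ i) / h \<le> real_of_int (k $ i) + 1)"
 using assms unfolding ccell_def mem_box_cart lcorner_def
 by (simp add: pos_le_divide_eq pos_divide_le_eq algebra_simps)

lemma lcell_subset_ccell: "lcell a h k \<subseteq> ccell a h k"
 unfolding lcell_def ccell_def by (rule box_subset_cbox)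

lemma lcell_lindex:
 assumes "h > 0" "x \<in> lcell a h k" shows "lindex a h x = k"
proof -
 have "\<lfloor>(x $ i - a $ i) / h\<rfloor> = k $ i" for i
  using assms(2) mem_lcell[OF assms(1)] by (intro floor_unique) (auto intro: less_imp_le)
 thus ?thesis by (simp add: lindex_def vec_eq_iff)
qed

lemma mem_lcell_lindex:
 assumes "h > 0" "x \<notin> grid a h" shows "x \<in> lcell a h (lindex a h x)"
proof -
 have "real_of_int \<lfloor>u\<rfloor> < u \<and> u < real_of_int \<lfloor>u\<rfloor> + 1" if "u \<notin> \<int>" for u :: real
 proof -
  have "real_of_int \<lfloor>u\<rfloor> \<noteq> u" using that by (metis Ints_of_int)
  thus ?thesis using of_int_floor_le[of u] floor_correct[of u] by linarith
 qed
 thus ?thesis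
  using assms by (auto simp: mem_lcell grid_def lindex_def)
qed

lemma negligible_grid:
 assumes "h > 0" shows "negligible (grid a h :: (real^'d) set)"
proof -
 have "(x $ i - a $ i) / h \<in> \<int> \<longleftrightarrow> (\<exists>m::int. x $ i = a $ i + h * real_of_int m)" for x :: "real^'d" and i
 proof
  assume "(x $ i - a $ i) / h \<in> \<int>"
  then obtain m where "(x $ i - a $ i) / h = real_of_int m" by (rule Ints_cases)
  hence "x $ i = a $ i + h * real_of_int m" using assms by (simp add: field_simps)
  thus "\<exists>m::int. x $ i = a $ i + h * real_of_int m" ..
 next
  assume "\<exists>m::int. x $ i = a $ i + h * real_of_int m"
  then obtain m :: int where "x $ i = a $ i + h * real_of_int m" ..
  hence "(x $ i - a $ i) / h = real_of_int m" using assms by simp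
  thus "(x $ i - a $ i) / h \<in> \<int>" by simp
 qed
 hence "grid a h = (\<Union>i. \<Union>m::int. {x::real^'d. x $ i = a $ i + h * real_of_int m})"
  by (auto simp: grid_def)
 moreover have "{x::real^'d. x $ i = c} \<in> null_sets lebesgue" for i c
  using negligible_hyperplane[of "axis i 1 :: real^'d" c]
  by (simp add: negligible_iff_null_sets[symmetric] inner_axis' axis_eq_0_iff)
 hence "(\<Union>i. \<Union>m::int. {x::real^'d. x $ i = a $ i + h * real_of_int m}) \<in> null_sets lebesgue"
  by (intro null_sets_UN') auto
 ultimately show ?thesis by (simp add: negligible_iff_null_sets)
qed

lemma AE_not_grid:
 assumes "h > 0" shows "AE x in lborel. x \<notin> grid a h"
proof -
 have "AE x in lebesgue. x \<notin> grid a h"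
  using negligible_grid[OF assms] by (intro AE_not_in) (simp add: negligible_iff_null_sets)
 thus ?thesis by (rule AE_completion_iff[THEN iffD1])
qed

lemma inj_ccell:
 assumes "h > 0" shows "ccell a h k = ccell a h k' \<longleftrightarrow> k = k'"
proof
 assume eq: "ccell a h k = ccell a h k'"
 have m: "lcorner a h k1 \<in> ccell a h k2 \<longleftrightarrow> (\<forall>i. real_of_int (k2 $ i) \<le> real_of_int (k1 $ i) \<and> real_of_int (k1 $ i) \<le> real_of_int (k2 $ i) + 1)"
  for k1 k2
  using assms by (simp add: mem_ccell lcorner_def del: of_int_le_iff)
 have "lcorner a h k1 \<in> ccell a h k1" for k1 by (simp add: m)
 hence 1: "lcorner a h k \<in> ccell a h k'" "lcorner a h k' \<in> ccell a h k"
  using eq by blast+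
 have "k $ i = k' $ i" for i
  using 1(1)[unfolded m, rule_format, of i] 1(2)[unfolded m, rule_format, of i] by linarith
 thus "k = k'" by (simp add: vec_eq_iff)
qed simp

text \<open>At a boundary point the points just above the graph form an open set disjoint from the
  domain, hence from its closure, so no ball around the point lies in the closure. The domain
  therefore has no slits.\<close>

lemma lipschitz_domain_regular:
 assumes "bounded_lipschitz_domain \<O>"
 shows "interior (closure \<O>) = \<O>"
proof
 have op: "open \<O>" and lip: "lipschitz_boundary \<O>"
  using assms by (auto simp: bounded_lipschitz_domain_def)
 show "\<O> \<subseteq> interior (closure \<O>)"
  by (rule interior_maximal[OF closure_subset op])
 show "interior (closure \<O>) \<subseteq> \<O>"
 proof (rule ccontr)
  assume "\<not> interior (closure \<O>) \<subseteq> \<O>"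
  then obtain x0 where x0: "x0 \<in> interior (closure \<O>)" "x0 \<notin> \<O>" by blast
  hence "x0 \<in> frontier \<O>"
   using op interior_subset by (auto simp: frontier_def interior_open)
  then obtain \<nu> r L g where g: "norm \<nu> = 1" "r > 0" "L-lipschitz_on {y. y \<bullet> \<nu> = 0} g"
   "\<And>x. x \<in> ball x0 r ==> x \<in> \<O> \<longleftrightarrow> x \<bullet> \<nu> < g (x - (x \<bullet> \<nu>) *\<^sub>R \<nu>)"
   using lip unfolding lipschitz_boundary_def by metis
  define p where "p x = x - (x \<bullet> \<nu>) *\<^sub>R \<nu>" for x
  have nn: "\<nu> \<bullet> \<nu> = 1" using g(1) by (simp add: dot_square_norm)
  have p0: "p x \<bullet> \<nu> = 0" for x by (simp add: p_def inner_diff_left nn)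
  have pt: "p (x + t *\<^sub>R \<nu>) = p x" for x t
   by (simp add: p_def inner_add_left nn algebra_simps)
  have "continuous_on UNIV (\<lambda>x. g (p x))"
   by (rule continuous_on_compose2[OF lipschitz_on_continuous_on[OF g(3)]])
    (use p0 in \<open>auto simp: p_def intro!: continuous_intros\<close>)
  hence "open {x. g (p x) < x \<bullet> \<nu>}"
   by (intro open_Collect_less continuous_intros)
  hence U: "open ({x. g (p x) < x \<bullet> \<nu>} \<inter> ball x0 r)" (is "open ?U") by blast
  have "?U \<inter> \<O> = {}" using g(4) by (auto simp: p_def)
  hence U2: "?U \<inter> closure \<O> = {}" using U by (simp add: open_Int_closure_eq_empty)
  obtain d where d: "d > 0" "ball x0 d \<subseteq> closure \<O>"
   using x0(1) by (meson mem_interior)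
  define t where "t = min d r / 2"
  have t: "t > 0" "t < d" "t < r" using d(1) g(2) by (auto simp: t_def)
  \<comment> \<open>Moving along \<nu> leaves the projection \<open>p\<close>, and with it the
    height of the graph, unchanged while the coordinate along \<nu> grows.\<close>
  let ?z = "x0 + t *\<^sub>R \<nu>"
  have "g (p x0) \<le> x0 \<bullet> \<nu>"
   using g(2) g(4)[of x0] x0(2) by (auto simp: p_def)
  hence "g (p ?z) < ?z \<bullet> \<nu>"
   using t by (simp add: pt inner_add_left nn)
  moreover have "dist x0 ?z = t" using t g(1) by (simp add: dist_norm)
  ultimately have "?z \<in> ?U" "?z \<in> ball x0 d" using t by auto
  with U2 d(2) show False by blast
 qed
qed

text \<open>A face contains every segment of the cube that it meets in a relative interior point of
  the segment. If \<open>b $ i\<close> lay strictly inside the i-th side, a common point with this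
  i-th coordinate would be the midpoint of a segment in direction i whose lower end is outside the
  second cube.\<close>

lemma face_of_cube_no_overlap:
 fixes a b :: "real^'d"
 assumes ne: "cbox a (a + (\<chi> i. h)) \<inter> cbox b (b + (\<chi> i. h)) \<noteq> {}"
  and face: "(cbox a (a + (\<chi> i. h)) \<inter> cbox b (b + (\<chi> i. h))) face_of cbox a (a + (\<chi> i. h))"
 shows "\<not> (a $ i < b $ i \<and> b $ i < a $ i + h)"
proof
 assume i: "a $ i < b $ i \<and> b $ i < a $ i + h"
 let ?Q = "cbox a (a + (\<chi> i. h))" and ?R = "cbox b (b + (\<chi> i. h))"
 obtain w where w: "w \<in> ?Q" "w \<in> ?R" using ne by blast
 define x where "x = (\<chi> j. if j = i then b $ i else w $ j)"
 define \<delta> where "\<delta> = min (b $ i - a $ i) (a $ i + h - b $ i)"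
 have \<delta>: "\<delta> > 0" "a $ i + \<delta> \<le> b $ i" "b $ i + \<delta> \<le> a $ i + h" using i by (auto simp: \<delta>_def)
 let ?p = "x - \<delta> *\<^sub>R axis i 1" and ?q = "x + \<delta> *\<^sub>R axis i 1"
 have x: "x \<in> ?Q" "x \<in> ?R"
  using w i unfolding mem_box_cart by (auto simp: x_def)
 have pq: "?p \<in> ?Q" "?q \<in> ?Q"
  using w(1) \<delta> unfolding mem_box_cart by (auto simp: x_def axis_def)
 have "?p \<noteq> ?q" using \<delta>(1) by (simp add: vec_eq_iff axis_def)
 moreover have "x = (1 - 1/2) *\<^sub>R ?p + (1/2) *\<^sub>R ?q"
  by (simp add: vec_eq_iff algebra_simps)
 ultimately have "x \<in> open_segment ?p ?q"
  unfolding in_segment by (intro conjI exI[of _ "1/2"]) auto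
 hence "?p \<in> ?R"
  using face_ofD[OF face _ pq] x by blast
 hence "b $ i \<le> ?p $ i" unfolding mem_box_cart by blast
 thus False using \<delta>(1) by (simp add: x_def)
qed

text \<open>Open null sets are empty: this removes the null set from the mesh condition, once for
  the domain minus the closed union of the cells and once for open cells minus the closure of the
  domain.\<close>

lemma mesh_union:
 fixes \<O> :: "(real^'d) set"
 assumes op: "open \<O>" and mesh: "mesh \<O> h \<Q>"
 shows "\<Union>\<Q> = closure \<O>"
proof -
 have h: "h > 0" and fin: "finite \<Q>" and cubes: "\<And>Q. Q \<in> \<Q> ==> cube h Q"
  and neg: "negligible ((\<Union>\<Q> - \<O>) \<union> (\<O> - \<Union>\<Q>))"
  using mesh by (auto simp: mesh_def)
 have cl: "closed Q" if "Q \<in> \<Q>" for Q using cubes[OF that] by (auto simp: cube_def)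
 have clU: "closed (\<Union>\<Q>)" using fin cl by (intro closed_Union) auto
 have "negligible (\<O> - \<Union>\<Q>)" using neg by (rule negligible_subset) blast
 moreover have "open (\<O> - \<Union>\<Q>)" using op clU by (rule open_Diff)
 ultimately have "\<O> - \<Union>\<Q> = {}" using open_not_negligible by blast
 hence 1: "closure \<O> \<subseteq> \<Union>\<Q>" using clU by (intro closure_minimal) auto
 have "Q \<subseteq> closure \<O>" if Q: "Q \<in> \<Q>" for Q
 proof -
  obtain a where a: "Q = cbox a (a + (\<chi> i. h))" using cubes[OF Q] by (auto simp: cube_def)
  have "negligible (box a (a + (\<chi> i. h)) - closure \<O>)"
   using neg by (rule negligible_subset) (use a Q closure_subset box_subset_cbox in blast)
  moreover have "open (box a (a + (\<chi> i. h)) - closure \<O>)" by (intro open_Diff open_box closed_closure)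
  ultimately have "box a (a + (\<chi> i. h)) \<subseteq> closure \<O>" using open_not_negligible by blast
  hence "closure (box a (a + (\<chi> i. h))) \<subseteq> closure \<O>" by (intro closure_minimal closed_closure)
  moreover have "box a (a + (\<chi> i. h)) \<noteq> {}"
   using h by (auto simp: interval_ne_empty_cart)
  ultimately show ?thesis by (simp add: a closure_box)
 qed
 with 1 show ?thesis by blast
qed

text \<open>Touching cells of a conforming mesh differ in each coordinate by -h, 0 or h. The cells
  on the lattice of one fixed cell and the remaining ones thus have disjoint closed unions, and the
  closure of the domain is connected.\<close>

lemma mesh_lattice:
 fixes \<O> :: "(real^'d) set"
 assumes dom: "bounded_lipschitz_domain \<O>" and mesh: "mesh \<O> h \<Q>"
 obtains a X where "lattice_mesh \<O> h \<Q> a X"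
proof -
 have op: "open \<O>" and con: "connected \<O>" and ne: "\<O> \<noteq> {}"
  using dom by (auto simp: bounded_lipschitz_domain_def)
 have h: "h > 0" and fin: "finite \<Q>" and cubes: "\<And>Q. Q \<in> \<Q> ==> cube h Q"
  and conf: "\<And>Q R. Q \<in> \<Q> ==> R \<in> \<Q> ==> Q \<noteq> R ==> Q \<inter> R = {} \<or> (Q \<inter> R face_of Q \<and> Q \<inter> R face_of R)"
  using mesh by (auto simp: mesh_def)
 have U: "\<Union>\<Q> = closure \<O>" using op mesh by (rule mesh_union)
 have reg: "interior (closure \<O>) = \<O>" using dom by (rule lipschitz_domain_regular)
 let ?c = "\<lambda>b::real^'d. cbox b (b + (\<chi> i. h))"
 have step: "\<exists>k'. b = lcorner a h k'" if ab: "?c (lcorner a h k) \<in> \<Q>" "?c b \<in> \<Q>" "?c (lcorner a h k) \<inter> ?c b \<noteq> {}" for a b k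
 proof (cases "?c (lcorner a h k) = ?c b")
  case True
  have "box b (b + (\<chi> i. h)) \<noteq> {}" using h by (auto simp: interval_ne_empty_cart)
  hence "cbox b (b + (\<chi> i. h)) \<noteq> {}" using box_subset_cbox by blast
  thus ?thesis using True by (auto simp: eq_cbox)
 next
  case False
  let ?a = "lcorner a h k"
  have f: "(?c ?a \<inter> ?c b) face_of ?c ?a" "(?c b \<inter> ?c ?a) face_of ?c b"
   using conf[OF ab(1,2) False] ab(3) by (auto simp: Int_commute)
  have "\<exists>m::int. b $ i = ?a $ i + h * real_of_int m" for i
  proof -
   obtain w where w: "w \<in> ?c ?a" "w \<in> ?c b" using ab(3) by blast
   hence "?a $ i \<le> w $ i" "w $ i \<le> ?a $ i + h" "b $ i \<le> w $ i" "w $ i \<le> b $ i + h"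
    unfolding mem_box_cart by (metis vec_lambda_beta vector_add_component)+
   moreover have "\<not> (?a $ i < b $ i \<and> b $ i < ?a $ i + h)"
    using ab(3) f(1) by (rule face_of_cube_no_overlap)
   moreover have "\<not> (b $ i < ?a $ i \<and> ?a $ i < b $ i + h)"
    using ab(3) f(2) by (intro face_of_cube_no_overlap) (auto simp: Int_commute)
   \<comment> \<open>Touching bounds the offset by \<open>h\<close>, and conformity excludes offsets
     strictly between 0 and \<open>h\<close> in absolute value.\<close>
   ultimately have "b $ i = ?a $ i + h * real_of_int 0 \<or> b $ i = ?a $ i + h * real_of_int 1 \<or> b $ i = ?a $ i + h * real_of_int (- 1)"
    by simp linarith
   thus ?thesis by blast
  qed
  then obtain m where m: "\<And>i. b $ i = ?a $ i + h * real_of_int (m i)" by metis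
  have "b = lcorner a h (\<chi> i. k $ i + m i)"
   by (simp add: vec_eq_iff lcorner_def m algebra_simps)
  thus ?thesis by blast
 qed
 obtain Q0 where Q0: "Q0 \<in> \<Q>" using ne U closure_subset by fastforce
 then obtain a where a: "Q0 = ?c a" using cubes by (auto simp: cube_def)
 have l0: "lcorner a h 0 = a" by (simp add: lcorner_def vec_eq_iff)
 define S1 where "S1 = {Q \<in> \<Q>. \<exists>k. Q = ccell a h k}"
 have Q0S: "Q0 \<in> S1" using Q0 a l0 by (auto simp: S1_def ccell_def intro!: exI[of _ 0])
 have neQ: "Q \<noteq> {}" if Q: "Q \<in> \<Q>" for Q
 proof -
  obtain b where b: "Q = ?c b" using cubes[OF Q] by (auto simp: cube_def)
  have "b \<in> ?c b" using h by (auto simp: mem_box_cart)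
  thus ?thesis using b by blast
 qed
 have disj: "\<Union>S1 \<inter> \<Union>(\<Q> - S1) = {}"
 proof (rule ccontr)
  assume "\<not> ?thesis"
  then obtain Q R where QR: "Q \<in> S1" "R \<in> \<Q>" "R \<notin> S1" "Q \<inter> R \<noteq> {}" by blast
  then obtain k where k: "Q \<in> \<Q>" "Q = ?c (lcorner a h k)" by (auto simp: S1_def ccell_def)
  obtain b where b: "R = ?c b" using cubes[OF QR(2)] by (auto simp: cube_def)
  obtain k' where "b = lcorner a h k'" using step[of a k b] k b QR by blast
  thus False using QR(2,3) b by (auto simp: S1_def ccell_def)
 qed
 have "\<Q> - S1 = {}"
 proof (rule ccontr)
  assume "\<Q> - S1 \<noteq> {}"
  hence ne2: "\<Union>(\<Q> - S1) \<noteq> {}" using neQ by blast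
  have ne1: "\<Union>S1 \<noteq> {}" using neQ[OF Q0] Q0S by blast
  have clQ: "closed Q" if "Q \<in> \<Q>" for Q using cubes[OF that] by (auto simp: cube_def)
  have cl: "closed (\<Union>S1)" "closed (\<Union>(\<Q> - S1))"
   by (rule closed_Union; use fin clQ in \<open>auto simp: S1_def\<close>)+
  have "S1 \<subseteq> \<Q>" by (auto simp: S1_def)
  hence "\<Union>\<Q> = \<Union>S1 \<union> \<Union>(\<Q> - S1)" by blast
  hence U': "closure \<O> = \<Union>S1 \<union> \<Union>(\<Q> - S1)" using U by simp
  have "\<exists>A B. closed A \<and> closed B \<and> closure \<O> \<subseteq> A \<union> B \<and> A \<inter> B \<inter> closure \<O> = {} \<and>
    A \<inter> closure \<O> \<noteq> {} \<and> B \<inter> closure \<O> \<noteq> {}"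
  proof (intro exI conjI)
   show "closure \<O> \<subseteq> \<Union>S1 \<union> \<Union>(\<Q> - S1)" using U' by (rule equalityD1)
   show "\<Union>S1 \<inter> \<Union>(\<Q> - S1) \<inter> closure \<O> = {}" unfolding disj by (rule Int_empty_left)
   have "\<Union>S1 \<inter> closure \<O> = \<Union>S1" unfolding U' by (rule Un_Int_eq)
   thus "\<Union>S1 \<inter> closure \<O> \<noteq> {}" using ne1 by (rule ssubst)
   have "\<Union>(\<Q> - S1) \<inter> closure \<O> = \<Union>(\<Q> - S1)" unfolding U' by (rule Un_Int_eq)
   thus "\<Union>(\<Q> - S1) \<inter> closure \<O> \<noteq> {}" using ne2 by (rule ssubst)
  qed (rule cl)+
  thus False using connected_imp_connected_closure[OF con] unfolding connected_closed by blast
 qed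
 hence S1: "S1 = \<Q>" by (auto simp: S1_def)
 define X where "X = {k. ccell a h k \<in> \<Q>}"
 have "\<exists>k. Q = ccell a h k" if "Q \<in> \<Q>" for Q
  using that S1 unfolding S1_def by blast
 hence \<Q>: "\<Q> = ccell a h ` X"
  unfolding X_def by blast
 have finX: "finite X"
 proof -
  have "inj (ccell a h)" using inj_ccell[OF h] by (auto simp: inj_def)
  thus ?thesis using finite_vimageI[OF fin] by (simp add: X_def vimage_def)
 qed
 have UX: "closure \<O> = \<Union>(ccell a h ` X)" using U \<Q> by simp
 have c1: "lcell a h k \<subseteq> \<O>" if "k \<in> X" for k
 proof -
  have "lcell a h k \<subseteq> closure \<O>" using lcell_subset_ccell UX that by blast
  hence "lcell a h k \<subseteq> interior (closure \<O>)"
   by (intro interior_maximal) (auto simp: lcell_def open_box)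
  thus ?thesis by (simp add: reg)
 qed
 have c2: "k \<in> X" if x: "x \<in> \<O>" "x \<in> lcell a h k" for x k
 proof -
  obtain k' where k': "k' \<in> X" "x \<in> ccell a h k'" using UX x(1) closure_subset by blast
  have "k' $ i = k $ i" for i
  proof -
   have "real_of_int (k $ i) < real_of_int (k' $ i) + 1" "real_of_int (k' $ i) < real_of_int (k $ i) + 1"
    using x(2) k'(2) unfolding mem_lcell[OF h] mem_ccell[OF h] by (meson le_less_trans less_le_trans)+
   thus ?thesis by linarith
  qed
  hence "k' = k" by (simp add: vec_eq_iff)
  with k' show ?thesis by simp
 qed
 \<comment> \<open>The box is covered by the two closed cells, hence an open subset of the closure
   of the domain; the regularity of the domain puts it inside.\<close>
 have c3: "box (lcorner a h k) (lcorner a h k + (\<chi> j. h) + axis i h) \<subseteq> \<O>" if k: "k \<in> X" "k + axis i 1 \<in> X" for k i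
 proof -
  have "box (lcorner a h k) (lcorner a h k + (\<chi> j. h) + axis i h) \<subseteq> ccell a h k \<union> ccell a h (k + axis i 1)"
  proof
   fix x assume "x \<in> box (lcorner a h k) (lcorner a h k + (\<chi> j. h) + axis i h)"
   hence x: "lcorner a h k $ j < x $ j" "x $ j < lcorner a h k $ j + h + (if j = i then h else 0)" for j
    unfolding mem_box_cart by (auto simp: axis_def)
   have l: "lcorner a h (k + axis i 1) $ j = lcorner a h k $ j + (if j = i then h else 0)" for j
    by (simp add: lcorner_def axis_def algebra_simps)
   show "x \<in> ccell a h k \<union> ccell a h (k + axis i 1)"
   proof (cases "x $ i \<le> lcorner a h k $ i + h")
    case True
    have "x \<in> ccell a h k"
     unfolding ccell_def mem_box_cart
    proof (intro allI conjI)
     fix j show "lcorner a h k $ j \<le> x $ j" using x(1)[of j] by simp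
     show "x $ j \<le> (lcorner a h k + (\<chi> i. h)) $ j" using x(2)[of j] True by (cases "j = i") auto
    qed
    thus ?thesis by blast
   next
    case False
    have "x \<in> ccell a h (k + axis i 1)"
     unfolding ccell_def mem_box_cart
    proof (intro allI conjI)
     fix j show "lcorner a h (k + axis i 1) $ j \<le> x $ j" using x(1)[of j] False by (cases "j = i") (auto simp: l)
     show "x $ j \<le> (lcorner a h (k + axis i 1) + (\<chi> i. h)) $ j" using x(2)[of j] by (cases "j = i") (auto simp: l)
    qed
    thus ?thesis by blast
   qed
  qed
  also have "... \<subseteq> closure \<O>" using UX k by blast
  finally have "box (lcorner a h k) (lcorner a h k + (\<chi> j. h) + axis i h) \<subseteq> interior (closure \<O>)"
   by (intro interior_maximal open_box)
  thus ?thesis by (simp add: reg)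
 qed
 have "lattice_mesh \<O> h \<Q> a X"
  unfolding lattice_mesh_def
  by (intro conjI ballI allI impI h finX \<Q> UX; (rule c1 | rule c3 | erule c2); assumption)
 thus ?thesis by (rule that)
qed

section \<open>The Poincare inequality on mesh cells\<close>

lemma norm_le_sqrt_dim:
 fixes x :: "real^'d"
 assumes "\<And>i. \<bar>x $ i\<bar> \<le> c" shows "norm x \<le> sqrt (real CARD('d)) * c"
proof -
 have c0: "0 \<le> c" using assms[of undefined] by linarith
 have "(norm x)\<^sup>2 = (\<Sum>i\<in>UNIV. (x $ i)\<^sup>2)"
  by (simp add: norm_vec_def L2_set_def sum_nonneg)
 also have "... \<le> (\<Sum>i\<in>(UNIV::'d set). c\<^sup>2)"
  by (intro sum_mono abs_le_square_iff[THEN iffD1]) (use assms c0 in auto)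
 also have "... = (sqrt (real CARD('d)) * c)\<^sup>2" by (simp add: power_mult_distrib)
 finally show ?thesis by (rule power2_le_imp_le) (simp add: c0)
qed

text \<open>Substituting z = x + y turns the double integrals into an integral over displacements
  \<open>y\<close> in a cube of side 2h. For fixed \<open>y\<close> the pairs within one cell have
  segments in the domain by convexity, so the differences in all cells together cost at most |y| M,
  with |y| \<le> sqrt d h.\<close>

lemma poincare_cells:
 fixes \<O> :: "(real^'d) set"
 assumes \<O>: "bounded \<O>" "open \<O>" and v[measurable]: "v \<in> Borel" and Cv: "\<And>x. \<bar>v x\<bar> \<le> Cv"
  and tv: "tv_le \<O> v M" and lm: "lattice_mesh \<O> h \<Q> a X"
 shows "(\<Sum>k\<in>X. \<integral>x. (LBINT z. ind (lcell a h k) x * ind (lcell a h k) z * \<bar>v z - v x\<bar>) \<partial>lborel)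
  \<le> (2 * h)^CARD('d) * (sqrt (real CARD('d)) * h) * M"
proof -
 have h: "h > 0" and X: "finite X" "\<And>k. k \<in> X ==> lcell a h k \<subseteq> \<O>" using lm by (auto simp: lattice_mesh_def)
 have M: "0 \<le> M" using tv by (rule tv_le_nonneg)
 have Cv0: "0 \<le> Cv" using Cv[of 0] by linarith
 have q: "\<bar>v z - v x\<bar> \<le> 2 * Cv" for x z using Cv[of x] Cv[of z] by linarith
 let ?D = "cbox (\<chi> i. - h) (\<chi> i. h) :: (real^'d) set"
 have [measurable]: "lcell a h k \<in> sets borel" for k by (simp add: lcell_def)
 define g where "g k x y = ind (lcell a h k) x * ind (lcell a h k) (x + y) * \<bar>v (x + y) - v x\<bar>" for k x y
 have g_bound: "norm (g k x y) \<le> 2 * Cv" for k x y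
  using q[of "x + y" x] Cv0 by (auto simp: g_def indicator_def)
 have g_supp: "x \<in> lcell a h k \<and> y \<in> ?D" if "g k x y \<noteq> 0" for k x y
 proof -
  have xy: "x \<in> lcell a h k" "x + y \<in> lcell a h k" using that by (auto simp: g_def indicator_def split: if_splits)
  have "- h \<le> y $ i \<and> y $ i \<le> h" for i
  proof -
   have "lcorner a h k $ i < x $ i" "x $ i < lcorner a h k $ i + h"
    "lcorner a h k $ i < x $ i + y $ i" "x $ i + y $ i < lcorner a h k $ i + h"
    using xy unfolding lcell_def mem_box_cart by auto
   thus ?thesis by linarith
  qed
  with xy(1) show ?thesis by (auto simp: mem_box_cart)
 qed
 have bl: "bounded (lcell a h k)" for k by (simp add: lcell_def bounded_box)
 have gm[measurable]: "case_prod (g k) \<in> Borel" for k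
  unfolding g_def borel_prod[symmetric] by measurable
 have gx: "(\<lambda>x. g k x y) \<in> Borel" for k y unfolding g_def by measurable
 define \<phi> where "\<phi> k y = (LBINT x. g k x y)" for k y
 have \<phi>m[measurable]: "\<phi> k \<in> Borel" for k
 proof -
  have "(\<lambda>y. \<integral>x. g k x y \<partial>lborel) \<in> borel_measurable lborel" unfolding g_def by measurable
  thus ?thesis by (simp add: \<phi>_def[abs_def])
 qed
 have ig: "integrable lborel (\<lambda>x. g k x y)" for k y
  using gx g_bound bl by (rule integrable_bounded_support) (use g_supp in blast)
 have "(\<Sum>k\<in>X. \<integral>x. (LBINT z. ind (lcell a h k) x * ind (lcell a h k) z * \<bar>v z - v x\<bar>) \<partial>lborel)
  = (\<Sum>k\<in>X. \<integral>x. (LBINT y. g k x y) \<partial>lborel)"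
 proof (rule sum.cong[OF refl], rule lint_cong[OF refl])
  fix k and x :: "real^'d"
  have "(LBINT z. ind (lcell a h k) x * ind (lcell a h k) z * \<bar>v z - v x\<bar>)
   = (LBINT y. ind (lcell a h k) x * ind (lcell a h k) (y + x) * \<bar>v (y + x) - v x\<bar>)"
   by (rule integral_lborel_translate[symmetric]) measurable
  thus "(LBINT z. ind (lcell a h k) x * ind (lcell a h k) z * \<bar>v z - v x\<bar>)
   = (LBINT y. g k x y)" by (simp add: g_def add.commute)
 qed
 also have "... = (\<Sum>k\<in>X. \<integral>y. \<phi> k y \<partial>lborel)"
 proof (rule sum.cong[OF refl])
  fix k
  show "(LBINT x. (LBINT y. g k x y)) = (LBINT y. \<phi> k y)"
   unfolding \<phi>_def using gm g_bound bl bounded_cbox g_supp by (rule Fubini_bounded_support)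
 qed
 also have "... = (LBINT y. (\<Sum>k\<in>X. \<phi> k y))"
 proof (rule lint_sum[symmetric])
  fix k
  show "integrable lborel (\<phi> k)"
  proof (rule integrable_bounded_support[OF _ _ bounded_cbox])
   show "norm (\<phi> k y) \<le> (LBINT x. ind (lcell a h k) x * (2 * Cv))" for y
    unfolding \<phi>_def
   proof (rule lint_norm_bound_lint[OF ig])
    show "integrable lborel (\<lambda>x. ind (lcell a h k) x * (2 * Cv))"
     by (rule integrable_bounded_support[OF _ _ bl[of k], where C="2 * Cv"]) (use Cv0 in \<open>auto simp: indicator_def split: if_splits\<close>)
    show "norm (g k x y) \<le> ind (lcell a h k) x * (2 * Cv)" for x
     using g_bound[of k x y] g_supp[of k x y] by (cases "g k x y = 0") (auto simp: Cv0)
   qed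
   show "y \<in> ?D" if "\<phi> k y \<noteq> 0" for y
   proof (rule ccontr)
    assume "y \<notin> ?D"
    hence "g k x y = 0" for x using g_supp[of k x y] by blast
    with that show False by (simp add: \<phi>_def)
   qed
  qed simp
 qed
 also have "... \<le> (LBINT y. ind ?D y * (sqrt (real CARD('d)) * h * M))"
 proof (rule integral_mono')
  show "integrable lborel (\<lambda>y. ind ?D y * (sqrt (real CARD('d)) * h * M))"
   by (rule integrable_bounded_support[OF _ _ bounded_cbox, where C="\<bar>sqrt (real CARD('d)) * h * M\<bar>"])
    (auto simp: indicator_def split: if_splits)
  show "0 \<le> ind ?D y * (sqrt (real CARD('d)) * h * M)" for y using h M by auto
  fix y :: "real^'d"
  define A where "A = (\<Union>k\<in>X. lcell a h k \<inter> {x. x + y \<in> lcell a h k})"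
  have mA: "A \<in> sets borel"
  proof -
   have "{x. x + y \<in> lcell a h k} \<in> sets borel" for k by measurable
   thus ?thesis unfolding A_def using X(1) by (intro sets.finite_UN) auto
  qed
  have "(\<Sum>k\<in>X. \<phi> k y) = (LBINT x. (\<Sum>k\<in>X. g k x y))"
   unfolding \<phi>_def by (intro lint_sum[symmetric] ig)
  also have "... = (LBINT x. ind A x * \<bar>v (x + y) - v x\<bar>)"
  proof (rule lint_cong[OF refl])
   fix x
   show "(\<Sum>k\<in>X. g k x y) = ind A x * \<bar>v (x + y) - v x\<bar>"
   proof (cases "x \<in> A")
    case True
    then obtain k where k: "k \<in> X" "x \<in> lcell a h k" "x + y \<in> lcell a h k" by (auto simp: A_def)
    have "g k' x y = 0" if "k' \<noteq> k" for k'
     using that lcell_lindex[OF h k(2)] lcell_lindex[OF h, of x a k'] by (auto simp: g_def indicator_def)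
    hence "(\<Sum>k\<in>X. g k x y) = (\<Sum>k\<in>{k}. g k x y)"
     using X(1) k(1) by (intro sum.mono_neutral_right) auto
    thus ?thesis using k True by (simp add: g_def)
   next
    case False
    hence "g k x y = 0" if "k \<in> X" for k
     using that by (auto simp: g_def indicator_def A_def)
    thus ?thesis using False by simp
   qed
  qed
  also have "... \<le> norm y * M"
  proof -
   \<comment> \<open>A single displacement, so the index type is \<open>unit\<close>.\<close>
   have "(\<Sum>i\<in>(UNIV::unit set). \<integral>x. ind A x * \<bar>v (x + y) - v x\<bar> \<partial>lborel) \<le> norm y * M"
   proof (rule translation_variation[where A="\<lambda>_. A" and y="\<lambda>_. y", OF \<O> v Cv tv mA])
    show "x + t *\<^sub>R y \<in> \<O>" if xA: "x \<in> A" and t: "t \<in> {0..1}" for x t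
    proof -
     obtain k where k: "k \<in> X" "x \<in> lcell a h k" "x + y \<in> lcell a h k" using xA unfolding A_def by blast
     have "convex (lcell a h k)" by (simp add: lcell_def convex_box)
     hence "(1 - t) *\<^sub>R x + t *\<^sub>R (x + y) \<in> lcell a h k"
      using k t by (intro convexD_alt) auto
     thus ?thesis using X(2)[OF k(1)] by (auto simp: algebra_simps)
    qed
    show "norm (\<Sum>i\<in>(UNIV::unit set). \<theta> i *\<^sub>R y) \<le> norm y" if "\<And>i. \<bar>\<theta> i\<bar> \<le> 1" for \<theta> :: "unit => real"
     using that[of "()"] by (simp add: UNIV_unit mult_left_le_one_le)
   qed
   thus ?thesis by (simp add: UNIV_unit)
  qed
  finally have le: "(\<Sum>k\<in>X. \<phi> k y) \<le> norm y * M" .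
  show "(\<Sum>k\<in>X. \<phi> k y) \<le> ind ?D y * (sqrt (real CARD('d)) * h * M)"
  proof (cases "y \<in> ?D")
   case True
   hence "\<bar>y $ i\<bar> \<le> h" for i by (auto simp: mem_box_cart abs_le_iff) (metis minus_le_iff)
   hence "norm y \<le> sqrt (real CARD('d)) * h" by (rule norm_le_sqrt_dim)
   hence "norm y * M \<le> sqrt (real CARD('d)) * h * M" using M by (rule mult_right_mono)
   thus ?thesis using le True by simp
  next
   case False
   hence "g k x y = 0" for k x using g_supp[of k x y] by blast
   thus ?thesis using False by (simp add: \<phi>_def)
  qed
 qed
 also have "... = (2 * h)^CARD('d) * (sqrt (real CARD('d)) * h * M)"
 proof -
  have "?D \<noteq> {}" using h by (auto simp: interval_ne_empty_cart)
  hence "measure lborel ?D = (2 * h)^CARD('d)"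
   by (simp add: content_cbox_cart)
  thus ?thesis by simp
 qed
 finally show ?thesis by (simp add: mult_ac)
qed

section \<open>Structure of Raviart-Thomas fields\<close>

text \<open>Otherwise the positive set contains a compact set \<open>T\<close> of positive measure.
  Mollified indicators of shrinking neighbourhoods of \<open>T\<close> are test functions converging
  to the indicator of \<open>T\<close>, so the integral of \<open>w\<close> over \<open>T\<close>
  vanishes although \<open>w\<close> is positive there.\<close>

lemma fundamental_lemma_pos:
 fixes w :: "real^'d => real"
 assumes U: "open U" "bounded U" and w: "integrable lebesgue w" "\<And>x. x \<notin> U ==> w x = 0"
  and zero: "\<And>f. f \<in> C1c U ==> (\<integral>x. w x * f x \<partial>lebesgue) = 0"
 shows "negligible {x. w x > 0}"
proof (rule ccontr)
 let ?A = "{x. w x > 0}"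
 assume nn: "\<not> negligible ?A"
 have wm[measurable]: "w \<in> borel_measurable lebesgue" using w(1) by auto
 have AU: "?A \<subseteq> U" using w(2) by force
 have "{x \<in> space lebesgue. w x > 0} \<in> sets lebesgue" by measurable
 hence A: "?A \<in> sets lebesgue" by simp
 have Al: "?A \<in> lmeasurable" using A bounded_subset[OF U(2) AU] by (intro bounded_set_imp_lmeasurable)
 have mA: "measure lebesgue ?A > 0"
  using nn Al by (metis less_le measure_nonneg negligible_iff_measure)
 obtain T where T: "closed T" "T \<subseteq> ?A" "emeasure lebesgue (?A - T) < ennreal (measure lebesgue ?A)"
  using sets_lebesgue_inner_closed[OF A mA] by metis
 have Tc: "compact T"
  using T(1,2) AU bounded_subset[OF U(2)] by (auto simp: compact_eq_bounded_closed)
 have Tm: "T \<in> sets lebesgue" using T(1) by simp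
 have Tn: "\<not> negligible T"
 proof
  assume "negligible T"
  hence "T \<in> null_sets lebesgue" by (simp add: negligible_iff_null_sets)
  hence "emeasure lebesgue (?A - T) = emeasure lebesgue ?A"
   using A by (rule emeasure_Diff_null_set)
  thus False using T(3) Al by (simp add: emeasure_eq_measure2)
 qed
 hence Tne: "T \<noteq> {}" by auto
 obtain e where e: "e > 0" "(\<Union>x\<in>T. ball x e) \<subseteq> U"
  using compact_subset_open_imp_ball_epsilon_subset[OF Tc U(1)] T(2) AU by blast
 \<comment> \<open>The indicator of the r-neighbourhood of \<open>T\<close> will be mollified at the
   same radius: the result is 1 on \<open>T\<close> and supported within 2r of it, and 2r must stay
   below \<open>e\<close>.\<close>
 define r where "r n = e / (2 * real (n + 2))" for n
 have r: "r n > 0" "2 * r n < e" for n using e(1) by (auto simp: r_def field_simps add_pos_nonneg)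
 have r0: "r \<longlonglongrightarrow> 0"
  unfolding r_def by (intro real_tendsto_divide_at_top tendsto_const filterlim_tendsto_pos_mult_at_top[OF tendsto_const] filterlim_compose[OF filterlim_real_sequentially] filterlim_add_const_nat_at_top) auto
 let ?s = "\<lambda>n. ind {x. infdist x T \<le> r n}"
 have clo: "closed {x. infdist x T \<le> c}" for c
  by (intro closed_Collect_le continuous_intros)
 have s[measurable]: "?s n \<in> Borel" for n
  using clo by (intro borel_measurable_indicator) (rule borel_closed)
 have near: "x \<in> U" if x: "infdist x T < e" for x
 proof -
  obtain y where y: "y \<in> T" "infdist x T = dist x y"
   using infdist_attains_inf[OF T(1) Tne] by metis
  hence "x \<in> ball y e" using x by (simp add: dist_commute)
  thus ?thesis using e(2) y(1) by blast
 qed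
 have sU: "x \<in> U" if "?s n x \<noteq> 0" for n x
  using that r[of n] near[of x] by (auto simp: indicator_def split: if_splits)
 have s1: "\<bar>?s n x\<bar> \<le> 1" for n x by (simp add: indicator_def)
 define f where "f n = mollify (r n) (?s n)" for n
 have fc: "C1_grad (f n) (mollify_grad (r n) (?s n))" for n
  unfolding f_def using r(1) s s1 U(2) sU by (rule C1_grad_mollify)
 have fsup: "infdist x T \<le> 2 * r n" if nz: "f n x \<noteq> 0" for n x
 proof -
  obtain z where z: "norm z < r n" "?s n (x + z) \<noteq> 0"
   using r(1) s s1 U(2) sU nz[unfolded f_def] by (rule mollify_support) (assumption | rule that)+
  hence "infdist (x + z) T \<le> r n" by (auto simp: indicator_def split: if_splits)
  moreover have "infdist x T \<le> infdist (x + z) T + dist x (x + z)"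
   by (rule infdist_triangle)
  ultimately show ?thesis using z(1) by (simp add: dist_norm)
 qed
 have f1: "\<bar>f n x\<bar> \<le> 1" for n x
  unfolding f_def real_norm_def[symmetric] by (rule mollify_norm_bound[OF r(1) s]) (simp add: indicator_def)
 have fC: "f n \<in> C1c U" for n
 proof (rule C1cI[OF fc])
  show sub: "{x. infdist x T \<le> 2 * r n} \<subseteq> U" using near r(2)[of n] by force
  show "compact {x. infdist x T \<le> 2 * r n}"
   using clo bounded_subset[OF U(2) sub] by (simp add: compact_eq_bounded_closed)
  show "x \<in> {x. infdist x T \<le> 2 * r n}" if "f n x \<noteq> 0" for x using fsup[OF that] by simp
 qed
 have fT: "f n x = 1" if xT: "x \<in> T" for n x
 proof -
  have "norm (mollify (r n) (\<lambda>y. ?s n y - 1) x) \<le> 0"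
  proof (rule mollify_norm_bound[OF r(1)])
   show "norm (?s n (x + z) - 1) \<le> 0" if "norm z < r n" for z
   proof -
    have "infdist (x + z) T \<le> dist (x + z) x" by (rule infdist_le[OF xT])
    thus ?thesis using that by (simp add: dist_norm)
   qed
  qed auto
  moreover have "mollify (r n) (\<lambda>y. ?s n y - 1) x = f n x - 1"
   using mollify_diff[of "r n" "?s n" 1 "\<lambda>_. 1" 1 x] mollify_const[of "r n" "1::real" x] r(1) s s1
   by (simp add: f_def)
  ultimately show ?thesis by simp
 qed
 have fm: "f n \<in> borel_measurable lebesgue" for n
  using C1_grad_measurable(1)[OF fc] by (simp add: measurable_completion)
 have lim: "(\<lambda>n. \<integral>x. w x * f n x \<partial>lebesgue) \<longlonglongrightarrow> (\<integral>x. w x * ind T x \<partial>lebesgue)"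
 proof (rule integral_dominated_convergence[where w="\<lambda>x. \<bar>w x\<bar>"])
  show "(\<lambda>x. w x * ind T x) \<in> borel_measurable lebesgue" using Tm by measurable
  show "(\<lambda>x. w x * f n x) \<in> borel_measurable lebesgue" for n using fm by measurable
  show "AE x in lebesgue. (\<lambda>n. w x * f n x) \<longlonglongrightarrow> w x * ind T x"
  proof (intro AE_I2 tendsto_mult tendsto_const)
   fix x
   show "(\<lambda>n. f n x) \<longlonglongrightarrow> ind T x"
   proof (cases "x \<in> T")
    case True thus ?thesis by (simp add: fT)
   next
    case False
    hence "infdist x T > 0"
     using T(1) Tne by (meson infdist_pos_not_in_closed)
    moreover have "(\<lambda>n. 2 * r n) \<longlonglongrightarrow> 2 * 0" by (intro tendsto_intros r0)
    ultimately have "\<forall>\<^sub>F n in sequentially. 2 * r n < infdist x T" by (intro order_tendstoD) auto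
    hence "\<forall>\<^sub>F n in sequentially. f n x = ind T x"
     by eventually_elim (use fsup False in force)
    thus ?thesis by (rule tendsto_eventually)
   qed
  qed
  show "AE x in lebesgue. norm (w x * f n x) \<le> \<bar>w x\<bar>" for n
   using f1 by (intro AE_I2) (simp add: abs_mult mult_left_le)
 qed (use w(1) in auto)
 have "(\<integral>x. w x * ind T x \<partial>lebesgue) = 0"
  using lim zero[OF fC] by (simp add: LIMSEQ_const_iff)
 moreover have "integrable lebesgue (\<lambda>x. w x * ind T x)"
  using integrable_mult_indicator[OF Tm w(1)] by (simp add: mult.commute)
 moreover have "0 \<le> w x * ind T x" for x
  using T(2) by (auto simp: indicator_def intro: less_imp_le)
 ultimately have "AE x in lebesgue. w x * ind T x = 0"
  by (subst (asm) integral_nonneg_eq_0_iff_AE) auto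
 hence "AE x in lebesgue. x \<notin> T"
  by eventually_elim (use T(2) in force)
 hence "T \<in> null_sets lebesgue" using Tm by (simp add: AE_iff_null_sets)
 with Tn show False by (simp add: negligible_iff_null_sets)
qed

lemma fundamental_lemma:
 fixes w :: "real^'d => real"
 assumes U: "open U" "bounded U" and w: "integrable lebesgue w" "\<And>x. x \<notin> U ==> w x = 0"
  and zero: "\<And>f. f \<in> C1c U ==> (\<integral>x. w x * f x \<partial>lebesgue) = 0"
 shows "AE x in lebesgue. w x = 0"
proof -
 have 1: "negligible {x. w x > 0}"
  using U w zero by (rule fundamental_lemma_pos)
 have "negligible {x. - w x > 0}"
  by (rule fundamental_lemma_pos[OF U]) (use w zero in auto)
 with 1 have "negligible ({x. w x > 0} \<union> {x. - w x > 0})" by (rule negligible_Un)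
 hence "AE x in lebesgue. x \<notin> {x. w x > 0} \<union> {x. - w x > 0}"
  by (intro AE_not_in) (simp add: negligible_iff_null_sets)
 thus ?thesis by eventually_elim auto
qed

lemma integrable_of_L2:
 fixes g :: "real^'d => real"
 assumes \<O>: "open \<O>" "bounded \<O>" and g: "g \<in> L2 \<O>"
 shows "integrable (lebesgue_on \<O>) g" "integrable lebesgue (\<lambda>x. ind \<O> x * g x)"
proof -
 have gm: "g \<in> borel_measurable (lebesgue_on \<O>)" "integrable (lebesgue_on \<O>) (\<lambda>x. (norm (g x))\<^sup>2)"
  using g by (auto simp: L2_def)
 have "\<O> \<in> lmeasurable" using \<O> by (intro lmeasurable_open)
 hence "integrable (lebesgue_on \<O>) (\<lambda>x. 1::real)"
  by (intro finite_measure.integrable_const finite_measure_lebesgue_on)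
 hence "integrable (lebesgue_on \<O>) (\<lambda>x. 1 + (norm (g x))\<^sup>2)"
  using gm(2) by (rule lintegrable_add)
 thus 1: "integrable (lebesgue_on \<O>) g"
 proof (rule lintegrable_bound[OF _ gm(1)])
  have "\<bar>u\<bar> \<le> 1 + u\<^sup>2" for u :: real
   using zero_le_power2[of "\<bar>u\<bar> - 1"] by (simp add: power2_diff)
  thus "AE x in lebesgue_on \<O>. norm (g x) \<le> norm (1 + (norm (g x))\<^sup>2)"
   by (intro AE_I2) simp
 qed
 have "\<O> \<inter> space lebesgue \<in> sets lebesgue" using \<O> by simp
 thus "integrable lebesgue (\<lambda>x. ind \<O> x * g x)"
  using 1 by (simp add: integrable_restrict_space)
qed

lemma integral_lebesgue_on_eq:
 fixes u :: "real^'d => real"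
 assumes \<O>: "open \<O>"
 shows "(\<integral>x. u x \<partial>lebesgue_on \<O>) = (\<integral>x. ind \<O> x * u x \<partial>lebesgue)"
 using \<O> by (subst integral_restrict_space) auto

lemma AE_lebesgue_on_iff:
 assumes "open \<O>"
 shows "(AE x in lebesgue_on \<O>. P x) \<longleftrightarrow> (AE x in lebesgue. x \<in> \<O> --> P x)"
 using assms by (subst AE_restrict_space_iff) auto

text \<open>Continuous with a break at \<open>P\<close>, where it vanishes: up to a constant, the
  shape of a normal component across a face once its jump has been split off.\<close>

definition kink :: "real => real => real => real => real" where
 "kink P b b' s = (if s < P then b * (s - P) else b' * (s - P))"

text \<open>The step is split into the parts on either side of \<open>P\<close>, each at most |t|
  long.\<close>

lemma kink_lipschitz: "\<bar>kink P b b' (s + t) - kink P b b' s\<bar> \<le> (\<bar>b\<bar> + \<bar>b'\<bar>) * \<bar>t\<bar>"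
proof -
 have "\<exists>t1 t2. kink P b b' (s + t) - kink P b b' s = b * t1 + b' * t2 \<and> \<bar>t1\<bar> \<le> \<bar>t\<bar> \<and> \<bar>t2\<bar> \<le> \<bar>t\<bar>"
 proof -
  consider "s < P" "s + t < P" | "s \<ge> P" "s + t \<ge> P" | "s < P" "s + t \<ge> P" | "s \<ge> P" "s + t < P" by linarith
  thus ?thesis
  proof cases
   case 1 thus ?thesis by (intro exI[of _ t] exI[of _ 0]) (simp add: kink_def algebra_simps)
  next
   case 2 thus ?thesis by (intro exI[of _ 0] exI[of _ t]) (simp add: kink_def algebra_simps)
  next
   case 3 thus ?thesis by (intro exI[of _ "P - s"] exI[of _ "s + t - P"]) (simp add: kink_def algebra_simps)
  next
   case 4 thus ?thesis by (intro exI[of _ "s + t - P"] exI[of _ "P - s"]) (simp add: kink_def algebra_simps)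
  qed
 qed
 then obtain t1 t2 where t: "kink P b b' (s + t) - kink P b b' s = b * t1 + b' * t2" "\<bar>t1\<bar> \<le> \<bar>t\<bar>" "\<bar>t2\<bar> \<le> \<bar>t\<bar>"
  by blast
 have "\<bar>b * t1 + b' * t2\<bar> \<le> \<bar>b\<bar> * \<bar>t1\<bar> + \<bar>b'\<bar> * \<bar>t2\<bar>"
  by (metis abs_mult abs_triangle_ineq)
 also have "... \<le> \<bar>b\<bar> * \<bar>t\<bar> + \<bar>b'\<bar> * \<bar>t\<bar>"
  using t by (intro add_mono mult_left_mono) auto
 finally show ?thesis by (simp add: t(1) distrib_right)
qed

lemma kink_deriv:
 assumes "s \<noteq> P" shows "(kink P b b' has_real_derivative (if s < P then b else b')) (at s)"
proof (cases "s < P")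
 case True
 have "((\<lambda>s. b * (s - P)) has_real_derivative b) (at s)" by (auto intro!: derivative_eq_intros)
 hence "(kink P b b' has_real_derivative b) (at s)"
  by (rule has_field_derivative_transform_within_open[of _ _ _ "{..<P}"]) (use True in \<open>auto simp: kink_def\<close>)
 thus ?thesis using True by simp
next
 case False
 have "((\<lambda>s. b' * (s - P)) has_real_derivative b') (at s)" by (auto intro!: derivative_eq_intros)
 hence "(kink P b b' has_real_derivative b') (at s)"
  by (rule has_field_derivative_transform_within_open[of _ _ _ "{P<..}"]) (use False assms in \<open>auto simp: kink_def\<close>)
 thus ?thesis using False by simp
qed

text \<open>The two kinds of components of a field that is affine on each side of a face orthogonal
  to axis \<open>i\<close>: the normal one is continuous with a kink, while the tangential ones jump
  across the face but are affine along the axis in which they are differentiated.\<close>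

lemma integration_by_parts_piecewise:
 fixes f :: "real^'d => real"
 assumes f: "C1_grad f Df" "compact K" "\<And>x. f x \<noteq> 0 ==> x \<in> K"
 shows "(LBINT x. (c + kink P b b' (x $ i)) * Df x $ i)
   = - (LBINT x. (if x $ i < P then b else b') * f x)"
  and "j \<noteq> i ==> (LBINT x. (if x $ i < P then c + b * x $ j else c' + b' * x $ j) * Df x $ j)
   = - (LBINT x. (if x $ i < P then b else b') * f x)"
proof -
 have kink_m[measurable]: "kink P b b' \<in> Borel"
  unfolding kink_def by measurable
 have kb: "\<bar>kink P b b' s\<bar> \<le> (\<bar>b\<bar> + \<bar>b'\<bar>) * \<bar>s - P\<bar>" for s
  using kink_lipschitz[of P b b' P "s - P"] by (simp add: kink_def)
 have "(LBINT x. (c + kink P b b' (x $ i)) * (Df x \<bullet> axis i 1))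
   = - (LBINT x. (if x $ i < P then b else b') * f x)"
 proof (rule integration_by_parts_lipschitz[OF _ _ _ _ _ f, where L="\<bar>b\<bar> + \<bar>b'\<bar>"])
  show "\<exists>B. \<forall>x\<in>S. \<bar>c + kink P b b' (x $ i)\<bar> \<le> B" if S: "bounded S" for S :: "(real^'d) set"
  proof -
   obtain R where R: "\<And>x. x \<in> S ==> norm x \<le> R" using S by (auto simp: bounded_iff)
   have "\<bar>c + kink P b b' (x $ i)\<bar> \<le> \<bar>c\<bar> + (\<bar>b\<bar> + \<bar>b'\<bar>) * (R + \<bar>P\<bar>)" if x: "x \<in> S" for x
   proof -
    have "\<bar>x $ i - P\<bar> \<le> R + \<bar>P\<bar>" using R[OF x] component_le_norm_cart[of x i] by linarith
    hence "(\<bar>b\<bar> + \<bar>b'\<bar>) * \<bar>x $ i - P\<bar> \<le> (\<bar>b\<bar> + \<bar>b'\<bar>) * (R + \<bar>P\<bar>)" by (intro mult_left_mono) auto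
    thus ?thesis using kb[of "x $ i"] by linarith
   qed
   thus ?thesis by blast
  qed
  show "\<bar>(c + kink P b b' ((x + t *\<^sub>R axis i 1) $ i)) - (c + kink P b b' (x $ i))\<bar> \<le> (\<bar>b\<bar> + \<bar>b'\<bar>) * \<bar>t\<bar>" for x :: "real^'d" and t
   using kink_lipschitz[of P b b' "x $ i" t] by simp
  have "AE x in lborel. x \<notin> {x::real^'d. x $ i = P}"
  proof -
   have "negligible {x::real^'d. x $ i = P}"
    using negligible_hyperplane[of "axis i 1 :: real^'d" P] by (simp add: inner_axis' axis_eq_0_iff)
   hence "AE x in lebesgue. x \<notin> {x::real^'d. x $ i = P}"
    by (intro AE_not_in) (simp add: negligible_iff_null_sets)
   thus ?thesis by (rule AE_completion_iff[THEN iffD1])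
  qed
  thus "AE x in lborel. ((\<lambda>t. c + kink P b b' ((x + t *\<^sub>R axis i 1) $ i)) has_real_derivative (if x $ i < P then b else b')) (at 0)"
  proof eventually_elim
   case (elim x)
   hence "(kink P b b' has_real_derivative (if x $ i < P then b else b')) (at (0 + x $ i))"
    using kink_deriv[of "x $ i" P b b'] by simp
   hence "((\<lambda>t. kink P b b' (t + x $ i)) has_real_derivative (if x $ i < P then b else b')) (at 0)"
    by (simp only: DERIV_shift)
   hence "((\<lambda>t. c + kink P b b' (t + x $ i)) has_real_derivative 0 + (if x $ i < P then b else b')) (at 0)"
    by (intro DERIV_add DERIV_const)
   thus ?case by (simp add: add.commute)
  qed
 qed measurable
 thus "(LBINT x. (c + kink P b b' (x $ i)) * Df x $ i)
   = - (LBINT x. (if x $ i < P then b else b') * f x)"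
  by (simp add: inner_axis)
 assume j: "j \<noteq> i"
 have "(LBINT x. (if x $ i < P then c + b * x $ j else c' + b' * x $ j) * (Df x \<bullet> axis j 1))
   = - (LBINT x. (if x $ i < P then b else b') * f x)"
 proof (rule integration_by_parts_lipschitz[OF _ _ _ _ _ f, where L="\<bar>b\<bar> + \<bar>b'\<bar>"])
  show "\<exists>B. \<forall>x\<in>S. \<bar>if x $ i < P then c + b * x $ j else c' + b' * x $ j\<bar> \<le> B" if S: "bounded S" for S :: "(real^'d) set"
  proof -
   obtain R where R: "\<And>x. x \<in> S ==> norm x \<le> R" using S by (auto simp: bounded_iff)
   have "\<bar>if x $ i < P then c + b * x $ j else c' + b' * x $ j\<bar> \<le> \<bar>c\<bar> + \<bar>c'\<bar> + \<bar>b\<bar> * R + \<bar>b'\<bar> * R" if x: "x \<in> S" for x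
   proof -
    have xj: "\<bar>x $ j\<bar> \<le> R" using R[OF x] component_le_norm_cart[of x j] by linarith
    hence "\<bar>b * x $ j\<bar> \<le> \<bar>b\<bar> * R" "\<bar>b' * x $ j\<bar> \<le> \<bar>b'\<bar> * R" by (auto simp: abs_mult intro: mult_left_mono)
    moreover have "0 \<le> R" using xj by linarith
    hence "0 \<le> \<bar>b\<bar> * R" "0 \<le> \<bar>b'\<bar> * R" by auto
    ultimately show ?thesis by (cases "x $ i < P") (simp_all, linarith+)
   qed
   thus ?thesis by blast
  qed
  show "\<bar>(if (x + t *\<^sub>R axis j 1) $ i < P then c + b * (x + t *\<^sub>R axis j 1) $ j else c' + b' * (x + t *\<^sub>R axis j 1) $ j)
    - (if x $ i < P then c + b * x $ j else c' + b' * x $ j)\<bar> \<le> (\<bar>b\<bar> + \<bar>b'\<bar>) * \<bar>t\<bar>" for x :: "real^'d" and t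
   using j by (auto simp: axis_def algebra_simps abs_mult)
  show "AE x in lborel. ((\<lambda>t. if (x + t *\<^sub>R axis j 1) $ i < P then c + b * (x + t *\<^sub>R axis j 1) $ j else c' + b' * (x + t *\<^sub>R axis j 1) $ j)
    has_real_derivative (if x $ i < P then b else b')) (at 0)"
   using j by (intro AE_I2) (auto simp: axis_def intro!: derivative_eq_intros)
 qed measurable
 thus "(LBINT x. (if x $ i < P then c + b * x $ j else c' + b' * x $ j) * Df x $ j)
   = - (LBINT x. (if x $ i < P then b else b') * f x)"
  by (simp add: inner_axis)
qed

lemma measurable_vec_nth_comp[measurable (raw)]:
 fixes f :: "'a => real^'d"
 assumes "f \<in> borel_measurable M" shows "(\<lambda>x. f x $ i) \<in> borel_measurable M"
 using measurable_compose[OF assms borel_measurable_continuous_onI[of "\<lambda>v. v $ i"]]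
 by (simp add: continuous_on_component continuous_on_id)

lemma norm_axis: "norm (axis i c :: real^'d) = \<bar>c\<bar>"
proof -
 have "(axis i c :: real^'d) = c *\<^sub>R axis i 1" by (simp add: vec_eq_iff axis_def)
 thus ?thesis by (simp add: norm_axis_1)
qed

lemma integrable_compact_support:
 fixes u :: "real^'d => real"
 assumes u: "continuous_on UNIV u" and K: "compact K" "\<And>x. u x \<noteq> 0 ==> x \<in> K"
 shows "integrable lborel u"
proof -
 obtain C where C: "C > 0" "\<And>x. norm (u x) \<le> C"
  using u K by (rule bounded_of_compact_support) (assumption | rule that)+
 show ?thesis
  using borel_measurable_continuous_onI[OF u] C(2) compact_imp_bounded[OF K(1)] K(2)
  by (rule integrable_bounded_support)
qed

lemma C1_grad_shifted_bump: "C1_grad (\<lambda>x. bump r (x - p)) (\<lambda>x. bump_grad r (x - p))"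
 unfolding C1_grad_def
proof (intro conjI allI)
 fix x :: "real^'a"
 have "(bump r has_derivative (\<lambda>h. bump_grad r (x - p) \<bullet> h)) (at (x - p))"
  using C1_grad_bump by (auto simp: C1_grad_def)
 moreover have "((\<lambda>x. x - p) has_derivative (\<lambda>h. h)) (at x)"
  by (auto intro!: derivative_eq_intros)
 ultimately show "((\<lambda>x. bump r (x - p)) has_derivative (\<lambda>h. bump_grad r (x - p) \<bullet> h)) (at x)"
  by (rule has_derivative_compose[rotated])
next
 show "continuous_on UNIV (\<lambda>x. bump_grad r (x - p))"
  by (intro continuous_on_compose2[OF bump_grad_continuous] continuous_intros) auto
qed

text \<open>On the half space above \<open>p\<close> the i-th component of the kernel gradient has
  one sign. The integral is the factor multiplying a possible jump of a normal component in
  \<open>RT_face_values\<close>.\<close>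

lemma half_bump_flux:
 fixes p :: "real^'d"
 assumes r: "r > 0"
 shows "(LBINT x. (if x $ i < p $ i then 0 else 1) * bump_grad r (x - p) $ i) \<noteq> 0"
proof
 let ?u = "\<lambda>x. (if x $ i < p $ i then 0 else 1) * bump_grad r (x - p) $ i"
 assume 0: "(LBINT x. ?u x) = 0"
 have neg: "?u x \<le> 0" for x
  by (simp add: bump_grad_def mult_nonpos_nonneg)
 have um[measurable]: "?u \<in> Borel" by measurable
 have "integrable lborel ?u"
 proof (rule integrable_bounded_support[OF um])
  show "norm (?u x) \<le> 4 * r^3" for x
  proof -
   have "norm (?u x) \<le> \<bar>bump_grad r (x - p) $ i\<bar>" by simp
   also have "... \<le> 4 * r^3"
    using component_le_norm_cart[of "bump_grad r (x - p)" i] bump_bounds(2)[OF r, of "x - p"] by linarith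
   finally show ?thesis .
  qed
  show "x \<in> cball p r" if nz: "?u x \<noteq> 0" for x
  proof -
   have "bump_grad r (x - p) \<noteq> 0" using nz by auto
   thus ?thesis using bump_grad_support[OF _ r] by (force simp: dist_norm norm_minus_commute)
  qed
 qed auto
 hence "AE x in lborel. - ?u x = 0"
  using 0 neg by (subst integral_nonneg_eq_0_iff_AE[symmetric]) auto
 hence "AE x in lborel. x \<notin> {x. ?u x \<noteq> 0}" by eventually_elim simp
 moreover have "{x \<in> space lborel. ?u x \<noteq> 0} \<in> sets lborel" by measurable
 ultimately have "{x. ?u x \<noteq> 0} \<in> null_sets lborel" by (subst AE_iff_null_sets) auto
 hence "negligible {x. ?u x \<noteq> 0}"
  using null_sets_completionI negligible_iff_null_sets by blast
 moreover have "ball p r \<inter> {x. p $ i < x $ i} \<subseteq> {x. ?u x \<noteq> 0}"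
 proof
  fix x assume x: "x \<in> ball p r \<inter> {x. p $ i < x $ i}"
  hence "norm (x - p) < r" by (simp add: dist_norm norm_minus_commute)
  hence "(x - p) \<bullet> (x - p) < r\<^sup>2" by (simp add: dot_square_norm power_strict_mono)
  thus "x \<in> {x. ?u x \<noteq> 0}" using x by (simp add: bump_grad_def)
 qed
 ultimately have "negligible (ball p r \<inter> {x. p $ i < x $ i})" by (rule negligible_subset)
 moreover have "open (ball p r \<inter> {x. p $ i < x $ i})"
  by (intro open_Int open_ball open_Collect_less continuous_intros)
 moreover have "p + axis i (r / 2) \<in> ball p r \<inter> {x. p $ i < x $ i}"
  using r by (simp add: dist_norm norm_axis)
 ultimately show False using open_not_negligible by blast
qed

lemma weak_divergence_test:
 assumes op: "open \<O>" and wd: "has_weak_divergence \<O> \<phi> g"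
  and f: "C1_grad f Df" "compact K" "K \<subseteq> \<O>" "\<And>x. f x \<noteq> 0 ==> x \<in> K"
 shows "(\<integral>x. ind \<O> x * (\<phi> x \<bullet> Df x) \<partial>lebesgue) = - (\<integral>x. ind \<O> x * (g x * f x) \<partial>lebesgue)"
proof -
 have "f \<in> C1c \<O>" using f by (rule C1cI)
 moreover have "(\<chi> i. partial_deriv i f x) = Df x" for x
  using C1_grad_partial_deriv[OF f(1)] by (simp add: vec_eq_iff)
 ultimately show ?thesis
  using wd unfolding has_weak_divergence_def integral_lebesgue_on_eq[OF op] by auto
qed

lemma integral_lebesgue_AE_eq:
 fixes F R :: "real^'d => real"
 assumes R: "R \<in> borel_measurable lborel" and eq: "AE x in lebesgue. F x = R x"
 shows "(\<integral>x. F x \<partial>lebesgue) = (LBINT x. R x)"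
proof -
 have "AE x in lebesgue. R x = F x" using eq by eventually_elim simp
 with measurable_completion[OF R] have "F \<in> borel_measurable lebesgue" by (rule borel_measurable_AE)
 hence "(\<integral>x. F x \<partial>lebesgue) = (\<integral>x. R x \<partial>lebesgue)"
  using measurable_completion[OF R] eq by (rule integral_cong_AE)
 also have "... = (LBINT x. R x)" using R by (rule integral_completion)
 finally show ?thesis .
qed

text \<open>Within a cell, component \<open>i\<close> of a Raviart-Thomas field depends on the i-th
  coordinate only, so it is constant on the faces orthogonal to that axis. \<open>N i k\<close> is
  its value on the lower such face of cell \<open>k\<close>, and 0 unless both adjacent cells belong
  to the mesh. The numbers \<theta> in the norm bound are relative coordinates in the cell.\<close>

lemma RT_face_values:
 fixes \<O> :: "(real^'d) set"
 assumes \<O>: "open \<O>" "bounded \<O>" and lm: "lattice_mesh \<O> h \<Q> a X"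
  and \<phi>: "\<phi> \<in> RT0_0 \<O> \<Q>" and g: "g \<in> L2 \<O>" "has_weak_divergence \<O> \<phi> g" and le1: "Linf_norm \<O> \<phi> \<le> 1"
 obtains N :: "'d => int^'d => real" where
  "\<And>i k. N i k \<noteq> 0 ==> k \<in> X \<and> k - axis i 1 \<in> X"
  "\<And>k \<theta>. k \<in> X ==> (\<And>i. 0 \<le> \<theta> i \<and> \<theta> i \<le> 1) ==>
    norm ((\<chi> i. (1 - \<theta> i) * N i k + \<theta> i * N i (k + axis i 1)) :: real^'d) \<le> 1"
  "AE x in lebesgue. \<forall>k\<in>X. x \<in> lcell a h k --> g x = (\<Sum>i\<in>UNIV. (N i (k + axis i 1) - N i k) / h)"
proof -
 have h: "h > 0" and X: "finite X" and \<Q>: "\<Q> = ccell a h ` X"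
  and cell\<O>: "\<And>k. k \<in> X ==> lcell a h k \<subseteq> \<O>"
  and inX: "\<And>x k. x \<in> \<O> ==> x \<in> lcell a h k ==> k \<in> X"
  and two: "\<And>k i. k \<in> X ==> k + axis i 1 \<in> X ==> box (lcorner a h k) (lcorner a h k + (\<chi> j. h) + axis i h) \<subseteq> \<O>"
  and cl: "closure \<O> = \<Union>(ccell a h ` X)"
  using lm unfolding lattice_mesh_def by blast+
 have int_c: "interior (ccell a h k) = lcell a h k" for k
  unfolding ccell_def lcell_def by (rule interior_cbox)
 have opc: "open (lcell a h k)" and bdc: "bounded (lcell a h k)" and cellm[measurable]: "lcell a h k \<in> sets borel" for k
  by (auto simp: lcell_def bounded_box)
 have "\<forall>k\<in>X. \<exists>A C. \<forall>x\<in>lcell a h k. \<phi> x = (\<chi> i. A $ i + C $ i * x $ i)"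
  using \<phi> unfolding RT0_0_def RT0_def \<Q> by (auto simp: int_c)
 then obtain \<alpha> \<beta> where ab: "\<And>k x. k \<in> X ==> x \<in> lcell a h k ==> \<phi> x = (\<chi> i. \<alpha> k $ i + \<beta> k $ i * x $ i)"
  by metis
 have memc: "x \<in> lcell a h k \<longleftrightarrow> (\<forall>j. lcorner a h k $ j < x $ j \<and> x $ j < lcorner a h k $ j + h)" for x k
  unfolding lcell_def mem_box_cart by simp
 have lc: "lcorner a h (k + axis i m) $ j = lcorner a h k $ j + (if j = i then h * real_of_int m else 0)" for k i m j
  by (simp add: lcorner_def axis_def algebra_simps)
 have gi: "integrable lebesgue (\<lambda>x. ind \<O> x * g x)" using \<O> g(1) by (rule integrable_of_L2)
 \<comment> \<open>The sum of the slopes is the classical divergence of the affine field; test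
   functions supported in the cell and the fundamental lemma identify it with \<open>g\<close>
   there.\<close>
 have div: "AE x in lebesgue. x \<in> lcell a h k --> g x = (\<Sum>i\<in>UNIV. \<beta> k $ i)" if k: "k \<in> X" for k
 proof -
  let ?b = "\<Sum>i\<in>UNIV. \<beta> k $ i"
  define w where "w x = ind (lcell a h k) x * (ind \<O> x * g x - ?b)" for x
  have "AE x in lebesgue. w x = 0"
  proof (rule fundamental_lemma[OF opc bdc])
   have 1: "integrable lebesgue (\<lambda>x. ind (lcell a h k) x *\<^sub>R (ind \<O> x * g x))"
    using gi by (intro integrable_mult_indicator) (auto simp: opc)
   have 2: "integrable lebesgue (\<lambda>x. ind (lcell a h k) x * ?b)"
    using lmeasurable_open[OF bdc opc] by (intro integrable_mult_left) (simp add: fmeasurable_def)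
   show "integrable lebesgue w"
    using lintegrable_diff[OF 1 2] by (simp add: w_def[abs_def] right_diff_distrib)
   show "w x = 0" if "x \<notin> lcell a h k" for x using that by (simp add: w_def)
   fix f :: "real^'d => real" assume "f \<in> C1c (lcell a h k)"
   then obtain Df K where f: "C1_grad f Df" "compact K" "K \<subseteq> lcell a h k" "\<And>x. f x \<noteq> 0 ==> x \<in> K"
    "\<And>x. Df x \<noteq> 0 ==> x \<in> K"
    by (rule C1cE) (assumption | rule that)+
   have K\<O>: "K \<subseteq> \<O>" using f(3) cell\<O>[OF k] by blast
   have Dc: "continuous_on UNIV Df" using f(1) by (simp add: C1_grad_def)
   have fm: "f \<in> Borel" using C1_grad_measurable[OF f(1)] by simp
   have fi: "integrable lborel f"
    using C1_grad_continuous[OF f(1)] f(2,4) by (rule integrable_compact_support)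
   have DiC: "continuous_on UNIV (\<lambda>x. (\<alpha> k $ i + \<beta> k $ i * x $ i) * Df x $ i)" for i
    using Dc by (intro continuous_intros)
   have Di: "integrable lborel (\<lambda>x. (\<alpha> k $ i + \<beta> k $ i * x $ i) * Df x $ i)" for i
    by (rule integrable_compact_support[OF DiC f(2)]) (use f(5) in force)
   have "(\<integral>x. ind \<O> x * (\<phi> x \<bullet> Df x) \<partial>lebesgue)
     = (\<integral>x. (\<Sum>i\<in>UNIV. (\<alpha> k $ i + \<beta> k $ i * x $ i) * Df x $ i) \<partial>lebesgue)"
   proof (rule lint_cong[OF refl])
    fix x
    show "ind \<O> x * (\<phi> x \<bullet> Df x) = (\<Sum>i\<in>UNIV. (\<alpha> k $ i + \<beta> k $ i * x $ i) * Df x $ i)"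
    proof (cases "Df x = 0")
     case False
     hence "x \<in> K" by (rule f(5))
     hence "x \<in> lcell a h k" "x \<in> \<O>" using f(3) K\<O> by blast+
     thus ?thesis using ab[OF k, of x] by (simp add: inner_vec_def)
    qed simp
   qed
   also have "... = (LBINT x. (\<Sum>i\<in>UNIV. (\<alpha> k $ i + \<beta> k $ i * x $ i) * Df x $ i))"
    using borel_measurable_continuous_onI[OF DiC] by (intro integral_completion borel_measurable_sum) auto
   also have "... = (\<Sum>i\<in>UNIV. \<integral>x. (\<alpha> k $ i + \<beta> k $ i * x $ i) * Df x $ i \<partial>lborel)"
    using Di by (rule lint_sum)
   also have "... = (\<Sum>i\<in>UNIV. - \<beta> k $ i * (LBINT x. f x))"
   proof (rule sum.cong[OF refl])
    fix i
    \<comment> \<open>A kink with equal slopes is a linear function.\<close>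
    have "(LBINT x. (\<alpha> k $ i + kink 0 (\<beta> k $ i) (\<beta> k $ i) (x $ i)) * Df x $ i)
     = - (LBINT x. (if x $ i < 0 then \<beta> k $ i else \<beta> k $ i) * f x)"
     using f(1,2,4) by (rule integration_by_parts_piecewise)
    thus "(LBINT x. (\<alpha> k $ i + \<beta> k $ i * x $ i) * Df x $ i) = - \<beta> k $ i * (LBINT x. f x)"
     by (simp add: kink_def)
   qed
   finally have 3: "(\<integral>x. ind \<O> x * (g x * f x) \<partial>lebesgue) = ?b * (LBINT x. f x)"
    using weak_divergence_test[OF \<O>(1) g(2) f(1,2) K\<O>] f(4) by (simp add: sum_negf sum_distrib_right)
   obtain C where C: "C > 0" "\<And>x. norm (f x) \<le> C"
    using C1_grad_continuous[OF f(1)] f(2,4) by (rule bounded_of_compact_support) (assumption | rule that)+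
   have "integrable lebesgue (\<lambda>x. ind \<O> x * g x * f x)"
   proof (rule lintegrable_bound)
    show "integrable lebesgue (\<lambda>x. C * (ind \<O> x * g x))" using gi by (rule integrable_mult_right)
    show "(\<lambda>x. ind \<O> x * g x * f x) \<in> borel_measurable lebesgue"
     using borel_measurable_integrable[OF gi] measurable_completion[of f lborel borel] fm
     by (intro borel_measurable_times[of "\<lambda>x. ind \<O> x * g x"]) auto
    have "\<bar>u * f x\<bar> \<le> C * \<bar>u\<bar>" for u x
     using mult_left_mono[OF C(2)[of x], of "\<bar>u\<bar>"] by (simp add: abs_mult mult.commute)
    thus "AE x in lebesgue. norm (ind \<O> x * g x * f x) \<le> norm (C * (ind \<O> x * g x))"
     using C(1) by (intro AE_I2) (simp add: abs_mult[of C])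
   qed
   moreover have "integrable lebesgue (\<lambda>x. ?b * f x)"
    using fi fm by (simp add: integrable_completion)
   ultimately have "(\<integral>x. ind \<O> x * g x * f x - ?b * f x \<partial>lebesgue)
     = (\<integral>x. ind \<O> x * (g x * f x) \<partial>lebesgue) - (\<integral>x. ?b * f x \<partial>lebesgue)"
    by (simp add: mult.assoc)
   also have "(\<integral>x. ?b * f x \<partial>lebesgue) = ?b * (LBINT x. f x)"
    using fm by (subst integral_completion) auto
   finally have "(\<integral>x. ind \<O> x * g x * f x - ?b * f x \<partial>lebesgue) = 0" using 3 by simp
   moreover have "w x * f x = ind \<O> x * g x * f x - ?b * f x" for x
    using f(3) f(4)[of x] by (cases "f x = 0") (auto simp: w_def left_diff_distrib)
   ultimately show "(\<integral>x. w x * f x \<partial>lebesgue) = 0" by simp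
  qed
  thus ?thesis
   by eventually_elim (use cell\<O>[OF k] in \<open>auto simp: w_def\<close>)
 qed
 \<comment> \<open>A bump centered on the common face tests the weak divergence. Up to the jump
   \<open>J\<close> on the upper side the field equals \<Psi>, which integrates by parts without a
   face term, so \<open>J\<close> times the flux of the half bump must vanish.\<close>
 have jump: "\<alpha> k $ i + \<beta> k $ i * (lcorner a h k $ i + h) = \<alpha> (k + axis i 1) $ i + \<beta> (k + axis i 1) $ i * (lcorner a h k $ i + h)"
  if k: "k \<in> X" and k': "k + axis i 1 \<in> X" for k i
 proof -
  let ?k' = "k + axis i 1"
  define p where "p = lcorner a h k + (\<chi> j. if j = i then h else h / 2)"
  define r where "r = h / 4"
  define P where "P = lcorner a h k $ i + h"
  have r: "r > 0" and pP: "p $ i = P" using h by (auto simp: r_def p_def P_def)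
  define f where "f x = bump r (x - p)" for x :: "real^'d"
  define Df where "Df x = bump_grad r (x - p)" for x :: "real^'d"
  have fD: "C1_grad f Df" unfolding f_def[abs_def] Df_def[abs_def] by (rule C1_grad_shifted_bump)
  have fK: "x \<in> cball p r" if "f x \<noteq> 0" for x
   using bump_support[of r "x - p"] that r by (simp add: f_def dist_norm norm_minus_commute)
  have DfK: "x \<in> cball p r" if "Df x \<noteq> 0" for x
   using bump_grad_support[of r "x - p"] that r by (simp add: Df_def dist_norm norm_minus_commute)
  have xj: "x $ j - p $ j \<le> h / 4" "p $ j - x $ j \<le> h / 4" if "x \<in> cball p r" for x j
   using component_le_norm_cart[of "x - p" j] that by (auto simp: r_def dist_norm norm_minus_commute abs_le_iff)
  have pj: "p $ j = lcorner a h k $ j + (if j = i then h else h / 2)" for j by (simp add: p_def)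
  have inlo: "x \<in> lcell a h k" if x: "x \<in> cball p r" "x $ i < P" for x
   unfolding memc
  proof
   fix j show "lcorner a h k $ j < x $ j \<and> x $ j < lcorner a h k $ j + h"
    using xj[OF x(1), of j] x(2) h pj[of j] by (cases "j = i") (auto simp: P_def)
  qed
  have inhi: "x \<in> lcell a h ?k'" if x: "x \<in> cball p r" "x $ i > P" for x
   unfolding memc
  proof
   fix j show "lcorner a h ?k' $ j < x $ j \<and> x $ j < lcorner a h ?k' $ j + h"
    using xj[OF x(1), of j] x(2) h pj[of j] by (cases "j = i") (auto simp: P_def lc)
  qed
  have K\<O>: "cball p r \<subseteq> \<O>"
  proof
   fix x assume x: "x \<in> cball p r"
   have "x \<in> box (lcorner a h k) (lcorner a h k + (\<chi> j. h) + axis i h)"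
    unfolding mem_box_cart
   proof
    fix j show "lcorner a h k $ j < x $ j \<and> x $ j < (lcorner a h k + (\<chi> j. h) + axis i h) $ j"
     using xj[OF x, of j] h pj[of j] by (cases "j = i") (auto simp: axis_def)
   qed
   thus "x \<in> \<O>" using two[OF k k'] by blast
  qed
  define J where "J = \<alpha> ?k' $ i + \<beta> ?k' $ i * P - (\<alpha> k $ i + \<beta> k $ i * P)"
  define b where "b j x = (if x $ i < P then \<beta> k $ j else \<beta> ?k' $ j)" for j and x :: "real^'d"
  define \<Psi> where "\<Psi> j x = (if j = i then \<alpha> k $ i + \<beta> k $ i * P + kink P (\<beta> k $ i) (\<beta> ?k' $ i) (x $ i)
   else if x $ i < P then \<alpha> k $ j + \<beta> k $ j * x $ j else \<alpha> ?k' $ j + \<beta> ?k' $ j * x $ j)" for j and x :: "real^'d"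
  have [measurable]: "kink P (\<beta> k $ i) (\<beta> ?k' $ i) \<in> Borel" unfolding kink_def by measurable
  have \<Psi>m[measurable]: "\<Psi> j \<in> Borel" for j unfolding \<Psi>_def by measurable
  have [measurable]: "f \<in> Borel" "Df \<in> Borel" using C1_grad_measurable[OF fD] by auto
  have bm[measurable]: "b j \<in> Borel" for j unfolding b_def by measurable
  have AEP: "AE x in lborel. x $ i \<noteq> P"
  proof -
   have "negligible {x::real^'d. x $ i = P}"
    using negligible_hyperplane[of "axis i 1 :: real^'d" P] by (simp add: inner_axis' axis_eq_0_iff)
   hence "AE x in lebesgue. x \<notin> {x::real^'d. x $ i = P}"
    by (intro AE_not_in) (simp add: negligible_iff_null_sets)
   thus ?thesis using AE_completion_iff by fastforce
  qed
  define CD where "CD = 4 * r^3"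
  have CD: "CD > 0" "\<And>x. norm (Df x) \<le> CD"
   using r bump_bounds(2)[OF r] by (auto simp: CD_def Df_def)
  have I\<Psi>: "integrable lborel (\<lambda>x. \<Psi> j x * Df x $ j)" for j
  proof -
   have "\<exists>M. \<forall>x\<in>cball p r. \<bar>\<Psi> j x\<bar> \<le> M"
   proof (cases "j = i")
    case True
    let ?M = "\<bar>\<alpha> k $ i + \<beta> k $ i * P\<bar> + (\<bar>\<beta> k $ i\<bar> + \<bar>\<beta> ?k' $ i\<bar>) * r"
    have "\<bar>\<Psi> j x\<bar> \<le> ?M" if x: "x \<in> cball p r" for x
    proof -
     have "\<bar>x $ i - P\<bar> \<le> r" unfolding r_def using xj[OF x, of i] pP by linarith
     hence "(\<bar>\<beta> k $ i\<bar> + \<bar>\<beta> ?k' $ i\<bar>) * \<bar>x $ i - P\<bar> \<le> (\<bar>\<beta> k $ i\<bar> + \<bar>\<beta> ?k' $ i\<bar>) * r"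
      by (rule mult_left_mono) simp
     moreover have "\<bar>kink P (\<beta> k $ i) (\<beta> ?k' $ i) (x $ i)\<bar> \<le> (\<bar>\<beta> k $ i\<bar> + \<bar>\<beta> ?k' $ i\<bar>) * \<bar>x $ i - P\<bar>"
      using kink_lipschitz[of P "\<beta> k $ i" "\<beta> ?k' $ i" P "x $ i - P"] by (simp add: kink_def)
     moreover have "\<Psi> j x = \<alpha> k $ i + \<beta> k $ i * P + kink P (\<beta> k $ i) (\<beta> ?k' $ i) (x $ i)"
      using True by (simp add: \<Psi>_def)
     ultimately show ?thesis by linarith
    qed
    thus ?thesis by blast
   next
    case False
    let ?M = "\<bar>\<alpha> k $ j\<bar> + \<bar>\<alpha> ?k' $ j\<bar> + \<bar>\<beta> k $ j\<bar> * (norm p + r) + \<bar>\<beta> ?k' $ j\<bar> * (norm p + r)"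
    have "\<bar>\<Psi> j x\<bar> \<le> ?M" if x: "x \<in> cball p r" for x
    proof -
     have nx: "norm x \<le> norm p + r" using x norm_triangle_ineq2[of x p] by (simp add: dist_norm norm_minus_commute)
     hence "\<bar>x $ j\<bar> \<le> norm p + r" using component_le_norm_cart[of x j] by linarith
     hence 1: "\<bar>\<beta> k $ j * x $ j\<bar> \<le> \<bar>\<beta> k $ j\<bar> * (norm p + r)" "\<bar>\<beta> ?k' $ j * x $ j\<bar> \<le> \<bar>\<beta> ?k' $ j\<bar> * (norm p + r)"
      unfolding abs_mult by (rule mult_left_mono; simp)+
     have 2: "0 \<le> \<bar>\<beta> k $ j\<bar> * (norm p + r)" "0 \<le> \<bar>\<beta> ?k' $ j\<bar> * (norm p + r)"
      using r by simp_all
     show ?thesis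
     proof (cases "x $ i < P")
      case True
      hence "\<Psi> j x = \<alpha> k $ j + \<beta> k $ j * x $ j" using False by (simp add: \<Psi>_def)
      thus ?thesis using 1 2 by linarith
     next
      case nP: False
      hence "\<Psi> j x = \<alpha> ?k' $ j + \<beta> ?k' $ j * x $ j" using False by (simp add: \<Psi>_def)
      thus ?thesis using 1 2 by linarith
     qed
    qed
    thus ?thesis by blast
   qed
   then obtain M where M: "\<And>x. x \<in> cball p r ==> \<bar>\<Psi> j x\<bar> \<le> M" by blast
   have "\<bar>\<Psi> j p\<bar> \<le> M" using r by (intro M) simp
   hence M0: "0 \<le> M" by linarith
   show ?thesis
   proof (rule integrable_bounded_support[OF _ _ bounded_cball[of p r]])
    show "(\<lambda>x. \<Psi> j x * Df x $ j) \<in> Borel" by measurable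
    show "x \<in> cball p r" if "\<Psi> j x * Df x $ j \<noteq> 0" for x
     using that by (intro DfK) auto
    show "norm (\<Psi> j x * Df x $ j) \<le> M * CD" for x
    proof (cases "Df x = 0")
     case True
     thus ?thesis using M0 CD(1) by simp
    next
     case False
     have "\<bar>Df x $ j\<bar> \<le> CD" using component_le_norm_cart[of "Df x" j] CD(2)[of x] by linarith
     thus ?thesis unfolding norm_mult using M[OF DfK[OF False]] M0 by (intro mult_mono) auto
    qed
   qed
  qed
  let ?H = "\<lambda>x::real^'d. if x $ i < P then 0 else (1::real)"
  have IH: "integrable lborel (\<lambda>x. ?H x * Df x $ i)"
  proof (rule integrable_bounded_support[OF _ _ bounded_cball[of p r]])
   show "(\<lambda>x. ?H x * Df x $ i) \<in> Borel" by measurable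
   show "norm (?H x * Df x $ i) \<le> CD" for x
    using component_le_norm_cart[of "Df x" i] CD(2)[of x] CD(1) by simp
   show "x \<in> cball p r" if "?H x * Df x $ i \<noteq> 0" for x
    using that by (intro DfK) auto
  qed
  have Ib: "integrable lborel (\<lambda>x. b j x * f x)" for j
  proof (rule integrable_bounded_support[OF _ _ bounded_cball[of p r]])
   show "norm (b j x * f x) \<le> (\<bar>\<beta> k $ j\<bar> + \<bar>\<beta> ?k' $ j\<bar>) * r^4" for x
    unfolding norm_mult using bump_bounds(1)[OF r, of "x - p"] bump_nonneg[of r "x - p"]
    by (intro mult_mono) (auto simp: b_def f_def)
   show "x \<in> cball p r" if "b j x * f x \<noteq> 0" for x
    using that by (intro fK) auto
  qed measurable
  have AEpt: "AE x in lborel. ind \<O> x * (\<phi> x \<bullet> Df x) = (\<Sum>j\<in>UNIV. \<Psi> j x * Df x $ j) + J * (?H x * Df x $ i)"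
   using AEP
  proof eventually_elim
   case (elim x)
   show ?case
   proof (cases "Df x = 0")
    case False
    hence x: "x \<in> cball p r" by (rule DfK)
    have "\<phi> x $ j * Df x $ j = \<Psi> j x * Df x $ j + (if j = i then J * (?H x * Df x $ i) else 0)" for j
    proof (cases "x $ i < P")
     case True
     thus ?thesis using ab[OF k inlo[OF x True]] by (auto simp: \<Psi>_def kink_def algebra_simps)
    next
     case False
     hence "P < x $ i" using elim by simp
     thus ?thesis using ab[OF k' inhi[OF x]] False by (auto simp: \<Psi>_def kink_def J_def algebra_simps)
    qed
    hence "\<phi> x \<bullet> Df x = (\<Sum>j\<in>UNIV. \<Psi> j x * Df x $ j + (if j = i then J * (?H x * Df x $ i) else 0))"
     by (simp add: inner_vec_def)
    moreover have "x \<in> \<O>" using K\<O> x by blast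
    ultimately show ?thesis by (simp add: sum.distrib)
   qed simp
  qed
  have AEg: "AE x in lebesgue. ind \<O> x * (g x * f x) = (\<Sum>j\<in>UNIV. b j x * f x)"
  proof -
   have "AE x in lebesgue. x $ i \<noteq> P" using AEP by (rule AE_completion)
   thus ?thesis using div[OF k] div[OF k']
   proof eventually_elim
    case (elim x)
    show ?case
    proof (cases "f x = 0")
     case False
     hence x: "x \<in> cball p r" by (rule fK)
     have "g x = (\<Sum>j\<in>UNIV. b j x)"
     proof (cases "x $ i < P")
      case True
      thus ?thesis using elim(2) inlo[OF x] by (simp add: b_def)
     next
      case False
      hence "P < x $ i" using elim(1) by simp
      thus ?thesis using elim(3) inhi[OF x] False by (simp add: b_def)
     qed
     moreover have "x \<in> \<O>" using K\<O> x by blast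
     ultimately show ?thesis by (simp add: sum_distrib_right)
    qed simp
   qed
  qed
  have "(\<integral>x. ind \<O> x * (\<phi> x \<bullet> Df x) \<partial>lebesgue)
   = (LBINT x. (\<Sum>j\<in>UNIV. \<Psi> j x * Df x $ j) + J * (?H x * Df x $ i))"
   by (rule integral_lebesgue_AE_eq[OF _ AE_completion[OF AEpt]]) measurable
  also have "... = (\<Sum>j\<in>UNIV. \<integral>x. \<Psi> j x * Df x $ j \<partial>lborel) + J * (LBINT x. ?H x * Df x $ i)"
   using I\<Psi> IH by (simp add: lint_sum)
  also have "(\<Sum>j\<in>UNIV. \<integral>x. \<Psi> j x * Df x $ j \<partial>lborel) = (\<Sum>j\<in>UNIV. - (LBINT x. b j x * f x))"
  proof (rule sum.cong[OF refl])
   fix j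
   show "(LBINT x. \<Psi> j x * Df x $ j) = - (LBINT x. b j x * f x)"
   proof (cases "j = i")
    case True
    show ?thesis unfolding True \<Psi>_def b_def
     using integration_by_parts_piecewise(1)[of f Df "cball p r" "\<alpha> k $ i + \<beta> k $ i * P" P "\<beta> k $ i" "\<beta> ?k' $ i" i] fD fK
     by simp
   next
    case False
    show ?thesis unfolding \<Psi>_def b_def
     using integration_by_parts_piecewise(2)[of f Df "cball p r" j i P "\<alpha> k $ j" "\<beta> k $ j" "\<alpha> ?k' $ j" "\<beta> ?k' $ j"] fD fK False
     by simp
   qed
  qed
  finally have e1: "(\<integral>x. ind \<O> x * (\<phi> x \<bullet> Df x) \<partial>lebesgue)
   = - (\<Sum>j\<in>UNIV. \<integral>x. b j x * f x \<partial>lborel) + J * (LBINT x. ?H x * Df x $ i)"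
   by (simp add: sum_negf)
  have "(\<integral>x. ind \<O> x * (g x * f x) \<partial>lebesgue) = (LBINT x. (\<Sum>j\<in>UNIV. b j x * f x))"
   by (rule integral_lebesgue_AE_eq[OF _ AEg]) measurable
  also have "... = (\<Sum>j\<in>UNIV. \<integral>x. b j x * f x \<partial>lborel)"
   using Ib by (rule lint_sum)
  finally have e2: "(\<integral>x. ind \<O> x * (g x * f x) \<partial>lebesgue) = (\<Sum>j\<in>UNIV. \<integral>x. b j x * f x \<partial>lborel)" .
  have "(\<integral>x. ind \<O> x * (\<phi> x \<bullet> Df x) \<partial>lebesgue) = - (\<integral>x. ind \<O> x * (g x * f x) \<partial>lebesgue)"
   using \<O>(1) g(2) fD compact_cball K\<O> fK by (rule weak_divergence_test)
  hence "J * (LBINT x. ?H x * Df x $ i) = 0" using e1 e2 by simp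
  moreover have "(LBINT x. ?H x * Df x $ i) \<noteq> 0"
   using half_bump_flux[OF r, of i p] by (simp add: Df_def pP)
  ultimately have "J = 0" by simp
  thus ?thesis by (simp add: J_def P_def)
 qed
 \<comment> \<open>Lower and upper faces are treated together, with \<sigma> = -1 or 1. At the
   center of a boundary face the axis direction is the outer unit normal, and the limit of the
   normal component from within the cell is both 0 and, up to sign, the affine value.\<close>
 have bdry: "\<alpha> k $ i + \<beta> k $ i * (lcorner a h k $ i + (if \<sigma> = 1 then h else 0)) = 0"
  if k: "k \<in> X" and k': "k + axis i \<sigma> \<notin> X" and \<sigma>: "\<sigma> = 1 \<or> \<sigma> = - 1" for k i \<sigma>
 proof -
  let ?l = "lcorner a h k" and ?s = "real_of_int \<sigma>"
  define p where "p = ?l + (\<chi> j. if j = i then (if \<sigma> = 1 then h else 0) else h / 2)"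
  define n where "n = (axis i ?s :: real^'d)"
  have pj: "p $ j = ?l $ j + (if j = i then (if \<sigma> = 1 then h else 0) else h / 2)" for j by (simp add: p_def)
  have near: "y $ j - p $ j < h / 2" "p $ j - y $ j < h / 2" if "y \<in> ball p (h / 2)" for y j
   using component_le_norm_cart[of "y - p" j] that by (auto simp: dist_norm norm_minus_commute)
  have yn: "(y - p) \<bullet> n = ?s * (y $ i - p $ i)" for y by (simp add: n_def inner_axis mult.commute)
  have lo: "y \<in> lcell a h k" if y: "y \<in> ball p (h / 2)" "(y - p) \<bullet> n < 0" for y
   unfolding memc
  proof
   fix j show "?l $ j < y $ j \<and> y $ j < ?l $ j + h"
    using near[OF y(1), of j] y(2)[unfolded yn] h pj[of j] \<sigma> by (cases "j = i") auto
  qed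
  have hi: "y \<in> lcell a h (k + axis i \<sigma>)" if y: "y \<in> ball p (h / 2)" "(y - p) \<bullet> n > 0" for y
   unfolding memc
  proof
   fix j show "lcorner a h (k + axis i \<sigma>) $ j < y $ j \<and> y $ j < lcorner a h (k + axis i \<sigma>) $ j + h"
    using near[OF y(1), of j] y(2)[unfolded yn] h pj[of j] \<sigma> by (cases "j = i") (auto simp: lc)
  qed
  have hi\<O>: "y \<notin> \<O>" if "y \<in> ball p (h / 2)" "(y - p) \<bullet> n > 0" for y
   using hi[OF that] inX k' by blast
  have "p \<in> ccell a h k"
   unfolding ccell_def mem_box_cart using pj h by auto
  hence pcl: "p \<in> closure \<O>" using cl k by blast
  \<comment> \<open>A neighbourhood of \<open>p\<close> in the domain would contain points across
    the face, in a cell missing from the mesh.\<close>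
  have "p \<notin> \<O>"
  proof
   assume "p \<in> \<O>"
   then obtain e where e: "e > 0" "ball p e \<subseteq> \<O>" using \<O>(1) by (meson openE)
   define t where "t = min e (h / 2) / 2"
   have t: "t > 0" "t < e" "t < h / 2" using e(1) h by (auto simp: t_def)
   let ?y = "p + axis i (?s * t)"
   have s1: "\<bar>?s\<bar> = 1" "?s * ?s = 1" using \<sigma> by auto
   hence d: "dist p ?y = t" using t(1) by (simp add: dist_norm norm_axis abs_mult)
   have "(?y - p) \<bullet> n > 0" unfolding yn using s1(2) t(1) by (simp add: mult.assoc[symmetric])
   hence "?y \<notin> \<O>" using hi\<O>[of ?y] d t by simp
   moreover have "?y \<in> ball p e" using d t by simp
   ultimately show False using e(2) by blast
  qed
  hence fr: "p \<in> frontier \<O>" using pcl \<O>(1) by (simp add: frontier_def interior_open)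
  have "outer_unit_normal \<O> p n"
   unfolding outer_unit_normal_def
  proof (intro conjI allI impI fr)
   show "norm n = 1" using \<sigma> by (auto simp: n_def norm_axis)
   fix \<epsilon> :: real assume \<epsilon>: "\<epsilon> > 0"
   show "\<exists>r>0. \<forall>y\<in>ball p r. ((y - p) \<bullet> n < - \<epsilon> * norm (y - p) --> y \<in> \<O>) \<and> (\<epsilon> * norm (y - p) < (y - p) \<bullet> n --> y \<notin> \<O>)"
   proof (intro exI[of _ "h / 2"] conjI ballI impI)
    fix y assume y: "y \<in> ball p (h / 2)"
    have nn: "0 \<le> \<epsilon> * norm (y - p)" using \<epsilon> by simp
    show "y \<in> \<O>" if "(y - p) \<bullet> n < - \<epsilon> * norm (y - p)"
     using lo[OF y] that nn cell\<O>[OF k] by auto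
    show "y \<notin> \<O>" if "\<epsilon> * norm (y - p) < (y - p) \<bullet> n"
     using hi\<O>[OF y] that nn by simp
   qed (use h in simp)
  qed
  hence lim0: "((\<lambda>y. \<phi> y \<bullet> n) \<longlongrightarrow> 0) (at p within lcell a h k)"
   using \<phi> k unfolding RT0_0_def \<Q> by (auto simp: int_c)
  have "((\<lambda>y. ?s * (\<alpha> k $ i + \<beta> k $ i * y $ i)) \<longlongrightarrow> ?s * (\<alpha> k $ i + \<beta> k $ i * p $ i)) (at p within lcell a h k)"
   by (intro tendsto_intros)
  hence lim1: "((\<lambda>y. \<phi> y \<bullet> n) \<longlongrightarrow> ?s * (\<alpha> k $ i + \<beta> k $ i * p $ i)) (at p within lcell a h k)"
  proof (rule Lim_transform_eventually)
   show "\<forall>\<^sub>F y in at p within lcell a h k. ?s * (\<alpha> k $ i + \<beta> k $ i * y $ i) = \<phi> y \<bullet> n"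
    unfolding eventually_at_topological using ab[OF k]
    by (intro exI[of _ UNIV]) (auto simp: n_def inner_axis mult.commute)
  qed
  have "p \<in> closure (lcell a h k)"
  proof -
   have "lcell a h k \<noteq> {}" unfolding lcell_def interval_ne_empty_cart using h by simp
   hence "closure (lcell a h k) = ccell a h k" unfolding lcell_def ccell_def by (rule closure_box)
   with \<open>p \<in> ccell a h k\<close> show ?thesis by simp
  qed
  moreover have "p \<notin> lcell a h k" using cell\<O>[OF k] \<open>p \<notin> \<O>\<close> by blast
  ultimately have "at p within lcell a h k \<noteq> bot"
   by (simp add: trivial_limit_within closure_def)
  hence "?s * (\<alpha> k $ i + \<beta> k $ i * p $ i) = 0" using lim1 lim0 by (rule tendsto_unique)
  thus ?thesis using \<sigma> pj[of i] by auto
 qed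
 define N where "N i k = (if k \<in> X \<and> k - axis i 1 \<in> X then \<alpha> k $ i + \<beta> k $ i * lcorner a h k $ i else 0)" for i k
 have low: "\<alpha> k $ i + \<beta> k $ i * lcorner a h k $ i = N i k" if k: "k \<in> X" for k i
 proof (cases "k - axis i 1 \<in> X")
  case False
  moreover have "k + axis i (- 1) = k - axis i 1" by (simp add: vec_eq_iff axis_def)
  ultimately show ?thesis using bdry[OF k, of i "- 1"] by (simp add: N_def)
 qed (simp add: N_def k)
 have high: "\<alpha> k $ i + \<beta> k $ i * (lcorner a h k $ i + h) = N i (k + axis i 1)" if k: "k \<in> X" for k i
 proof (cases "k + axis i 1 \<in> X")
  case True
  thus ?thesis using jump[OF k True] k by (simp add: N_def lc)
 next
  case False
  thus ?thesis using bdry[OF k, of i 1] by (simp add: N_def)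
 qed
 have slope: "\<beta> k $ i = (N i (k + axis i 1) - N i k) / h" if k: "k \<in> X" for k i
  using low[OF k, of i] high[OF k, of i] h by (simp add: field_simps)
 \<comment> \<open>The points of the open cell violating the bound form an open null set; continuity
   then extends the bound to the faces, where the values \<open>N\<close> live.\<close>
 have bound: "norm ((\<chi> i. \<alpha> k $ i + \<beta> k $ i * x $ i) :: real^'d) \<le> 1" if k: "k \<in> X" and x: "x \<in> ccell a h k" for k x
 proof -
  let ?\<psi> = "\<lambda>x. (\<chi> i. \<alpha> k $ i + \<beta> k $ i * x $ i) :: real^'d"
  have \<psi>c: "continuous_on UNIV ?\<psi>" by (intro continuous_on_vec_lambda continuous_intros)
  have "AE x in lebesgue_on \<O>. ereal (norm (\<phi> x)) \<le> 1"
   using esssup_AE[of "\<lambda>x. ereal (norm (\<phi> x))" "lebesgue_on \<O>"]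
  proof eventually_elim
   case (elim x) thus ?case using le1 unfolding Linf_norm_def by (rule order_trans)
  qed
  hence "AE x in lebesgue. x \<notin> lcell a h k \<inter> {x. 1 < norm (?\<psi> x)}"
   unfolding AE_lebesgue_on_iff[OF \<O>(1)]
  proof eventually_elim
   case (elim x)
   thus ?case using cell\<O>[OF k] ab[OF k, of x] by auto
  qed
  moreover have o: "open (lcell a h k \<inter> {x. 1 < norm (?\<psi> x)})"
   using \<psi>c by (intro open_Int opc open_Collect_less continuous_intros)
  hence "lcell a h k \<inter> {x. 1 < norm (?\<psi> x)} \<in> sets lebesgue" by simp
  ultimately have "negligible (lcell a h k \<inter> {x. 1 < norm (?\<psi> x)})"
   by (simp add: AE_iff_null_sets negligible_iff_null_sets)
  hence "lcell a h k \<inter> {x. 1 < norm (?\<psi> x)} = {}" using o open_not_negligible by blast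
  hence "lcell a h k \<subseteq> {x. norm (?\<psi> x) \<le> 1}" by force
  moreover have "closed {x. norm (?\<psi> x) \<le> 1}"
   using \<psi>c by (intro closed_Collect_le continuous_intros)
  ultimately have "closure (lcell a h k) \<subseteq> {x. norm (?\<psi> x) \<le> 1}" by (rule closure_minimal)
  moreover have "lcell a h k \<noteq> {}" unfolding lcell_def interval_ne_empty_cart using h by simp
  hence "closure (lcell a h k) = ccell a h k" unfolding lcell_def ccell_def by (rule closure_box)
  ultimately show ?thesis using x by blast
 qed
 show ?thesis
 proof (rule that[of N])
  show "N i k \<noteq> 0 ==> k \<in> X \<and> k - axis i 1 \<in> X" for i k by (auto simp: N_def split: if_splits)
  show "norm ((\<chi> i. (1 - \<theta> i) * N i k + \<theta> i * N i (k + axis i 1)) :: real^'d) \<le> 1"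
   if k: "k \<in> X" and \<theta>: "\<And>i. 0 \<le> \<theta> i \<and> \<theta> i \<le> 1" for k \<theta>
  proof -
   define x where "x = lcorner a h k + (\<chi> i. h * \<theta> i)"
   have "x \<in> ccell a h k" unfolding ccell_def mem_box_cart x_def using h \<theta> by (auto simp: mult_left_le)
   moreover have "(1 - \<theta> i) * N i k + \<theta> i * N i (k + axis i 1) = \<alpha> k $ i + \<beta> k $ i * x $ i" for i
    unfolding low[OF k, symmetric] high[OF k, symmetric] x_def by (simp add: algebra_simps)
   ultimately show ?thesis using bound[OF k, of x] by simp
  qed
  have "AE x in lebesgue. \<forall>k\<in>X. x \<in> lcell a h k --> g x = (\<Sum>i\<in>UNIV. \<beta> k $ i)"
   using X div by (intro AE_finite_allI)
  thus "AE x in lebesgue. \<forall>k\<in>X. x \<in> lcell a h k --> g x = (\<Sum>i\<in>UNIV. (N i (k + axis i 1) - N i k) / h)"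
   by eventually_elim (simp add: slope)
 qed
qed

section \<open>Summation by parts on the lattice\<close>

lemma lindex_line:
 assumes h: "h > 0" and t: "0 \<le> t" "t \<le> (1::real)"
 shows "lindex a h (x - t *\<^sub>R axis i h) = lindex a h x \<or> lindex a h (x - t *\<^sub>R axis i h) = lindex a h x - axis i 1"
proof -
 have o: "lindex a h (x - t *\<^sub>R axis i h) $ j = lindex a h x $ j" if "j \<noteq> i" for j
  using that by (simp add: lindex_def axis_def)
 have "((x - t *\<^sub>R axis i h) $ i - a $ i) / h = (x $ i - a $ i) / h - t"
  using h by (simp add: axis_def field_simps)
 hence e: "lindex a h (x - t *\<^sub>R axis i h) $ i = \<lfloor>(x $ i - a $ i) / h - t\<rfloor>"
  by (simp add: lindex_def)
 have l: "lindex a h x $ i = \<lfloor>(x $ i - a $ i) / h\<rfloor>" by (simp add: lindex_def)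
 have "\<lfloor>(x $ i - a $ i) / h - t\<rfloor> = \<lfloor>(x $ i - a $ i) / h\<rfloor> \<or> \<lfloor>(x $ i - a $ i) / h - t\<rfloor> = \<lfloor>(x $ i - a $ i) / h\<rfloor> - 1"
  using t by linarith
 thus ?thesis
 proof
  assume "\<lfloor>(x $ i - a $ i) / h - t\<rfloor> = \<lfloor>(x $ i - a $ i) / h\<rfloor>"
  hence "lindex a h (x - t *\<^sub>R axis i h) $ j = lindex a h x $ j" for j
   using o e l by (cases "j = i") auto
  thus ?thesis by (simp add: vec_eq_iff)
 next
  assume "\<lfloor>(x $ i - a $ i) / h - t\<rfloor> = \<lfloor>(x $ i - a $ i) / h\<rfloor> - 1"
  hence "lindex a h (x - t *\<^sub>R axis i h) $ j = (lindex a h x - axis i 1) $ j" for j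
   using o e l by (cases "j = i") (auto simp: axis_def)
  thus ?thesis by (simp only: vec_eq_iff) blast
 qed
qed

lemma lcorner_axis:
 "lcorner a h (k + axis i 1) = lcorner a h k + axis i h"
 by (simp add: lcorner_def vec_eq_iff axis_def algebra_simps)

lemma lcell_axis: "x + axis i h \<in> lcell a h (k + axis i 1) \<longleftrightarrow> x \<in> lcell a h k"
 unfolding lcell_def lcorner_axis mem_box_cart by (simp add: algebra_simps)

lemma indicator_lcell_eq:
 assumes "h > 0" "x \<in> lcell a h k"
 shows "ind (lcell a h k') x = (if k' = k then 1 else 0)"
proof (cases "k' = k")
 case False
 hence "x \<notin> lcell a h k'"
  using lcell_lindex[OF assms] lcell_lindex[OF assms(1), of x a k'] by blast
 thus ?thesis using False by simp
qed (use assms(2) in simp)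

text \<open>
 Summation by parts turns the pairing of \<open>v\<close> with the divergence of a Raviart-Thomas field into
 translation differences of \<open>v\<close>; the segment averages of the resulting weights are the field itself.
 The weights are cut off near the grid because they must be supported away from the boundary.
\<close>

lemma RT_pairing_le:
 fixes \<O> :: "(real^'d) set" and N :: "'d => int^'d => real"
 assumes \<O>: "bounded \<O>" "open \<O>" and v[measurable]: "v \<in> Borel" and Cv: "\<And>x. \<bar>v x\<bar> \<le> Cv"
  and tv: "tv_le \<O> v M" and lm: "lattice_mesh \<O> h \<Q> a X"
  and N0: "\<And>i k. N i k \<noteq> 0 ==> k \<in> X \<and> k - axis i 1 \<in> X"
  and N1: "\<And>k \<theta>. k \<in> X ==> (\<And>i. 0 \<le> \<theta> i \<and> \<theta> i \<le> 1) ==>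
    norm ((\<chi> i. (1 - \<theta> i) * N i k + \<theta> i * N i (k + axis i 1)) :: real^'d) \<le> 1"
 shows "(\<Sum>k\<in>X. (\<Sum>i\<in>UNIV. (N i (k + axis i 1) - N i k) / h) * (LBINT x. ind (lcell a h k) x * v x)) \<le> M"
proof -
 have h: "h > 0" and X: "finite X"
  and two: "\<And>k i. k \<in> X ==> k + axis i 1 \<in> X ==> box (lcorner a h k) (lcorner a h k + (\<chi> j. h) + axis i h) \<subseteq> \<O>"
  using lm unfolding lattice_mesh_def by blast+
 have [measurable]: "lcell a h k \<in> sets borel" for k by (simp add: lcell_def)
 have bl: "bounded (lcell a h k)" for k by (simp add: lcell_def bounded_box)
 have Cv0: "0 \<le> Cv" using Cv[of 0] by linarith
 have q: "\<bar>v (x + y) - v x\<bar> \<le> 2 * Cv" for x y using Cv[of x] Cv[of "x + y"] by linarith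
 define m where "m k = (LBINT x. ind (lcell a h k) x * v x)" for k
 \<comment> \<open>The weight on a cell is minus the normal value on its upper face divided by
   \<open>h\<close>. Averaging over the segment back to the previous cell mixes the values on the
   upper and the lower face of the cell, which reproduces the field up to sign.\<close>
 define S where "S i x = (\<Sum>k\<in>X. - (N i (k + axis i 1) / h) * ind (lcell a h k) x)" for i x
 have Sm[measurable]: "S i \<in> Borel" for i unfolding S_def by measurable
 have iv: "integrable lborel (\<lambda>x. ind (lcell a h k) x * u x)"
  if [measurable]: "u \<in> Borel" and "\<And>x. \<bar>u x\<bar> \<le> C" for u C k
 proof (rule integrable_bounded_support[OF _ _ bl[of k]])
  show "norm (ind (lcell a h k) x * u x) \<le> C" for x
   using that(2)[of x] by (auto simp: indicator_def)
 qed (auto simp: indicator_def split: if_splits)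
 have part: "(\<Sum>k\<in>X. (N i (k + axis i 1) - N i k) / h * m k) = (LBINT x. S i x * (v (x + axis i h) - v x))" for i
 proof -
  let ?Y = "{k \<in> X. k + axis i 1 \<in> X}"
  have shift: "m (k + axis i 1) = (LBINT x. ind (lcell a h k) x * v (x + axis i h))" for k
  proof -
   have "(LBINT x. ind (lcell a h (k + axis i 1)) (x + axis i h) * v (x + axis i h)) = m (k + axis i 1)"
    unfolding m_def by (rule integral_lborel_translate) measurable
   thus ?thesis by (simp add: indicator_def lcell_axis)
  qed
  have N0': "N i (k + axis i 1) \<noteq> 0 ==> k + axis i 1 \<in> X" for k using N0[of i "k + axis i 1"] by simp
  \<comment> \<open>\<open>N\<close> vanishes unless both adjacent cells belong to the mesh, so both
    sums can be written over pairs of neighbouring cells.\<close>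
  have a1: "(\<Sum>k\<in>X. N i (k + axis i 1) * m k) = (\<Sum>k\<in>?Y. N i (k + axis i 1) * m k)"
   using N0' by (intro sum.mono_neutral_right X) auto
  have a2: "(\<Sum>k\<in>X. N i k * m k) = (\<Sum>k\<in>{k \<in> X. k - axis i 1 \<in> X}. N i k * m k)"
   using N0[of i] by (intro sum.mono_neutral_right X) auto
  have a3: "(\<Sum>k\<in>{k \<in> X. k - axis i 1 \<in> X}. N i k * m k) = (\<Sum>k\<in>?Y. N i (k + axis i 1) * m (k + axis i 1))"
   by (rule sum.reindex_bij_witness[of _ "\<lambda>k. k + axis i 1" "\<lambda>k. k - axis i 1"]) auto
  have "(\<Sum>k\<in>X. (N i (k + axis i 1) - N i k) / h * m k) = ((\<Sum>k\<in>X. N i (k + axis i 1) * m k) - (\<Sum>k\<in>X. N i k * m k)) / h"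
   by (simp add: sum_subtractf[symmetric] sum_divide_distrib left_diff_distrib diff_divide_distrib)
  also have "... = (\<Sum>k\<in>?Y. - (N i (k + axis i 1) / h) * (m (k + axis i 1) - m k))"
   unfolding a1 a2 a3 by (simp add: sum_subtractf[symmetric] sum_divide_distrib algebra_simps diff_divide_distrib)
  also have "... = (\<Sum>k\<in>X. - (N i (k + axis i 1) / h) * (m (k + axis i 1) - m k))"
   using N0' by (intro sum.mono_neutral_left X) auto
  also have "... = (\<Sum>k\<in>X. \<integral>x. - (N i (k + axis i 1) / h) * (ind (lcell a h k) x * (v (x + axis i h) - v x)) \<partial>lborel)"
  proof (rule sum.cong[OF refl])
   fix k
   have "m (k + axis i 1) - m k = (LBINT x. ind (lcell a h k) x * (v (x + axis i h) - v x))"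
    unfolding shift using iv[of "\<lambda>x. v (x + axis i h)" Cv k] iv[of v Cv k] Cv
    by (simp add: m_def right_diff_distrib)
   thus "- (N i (k + axis i 1) / h) * (m (k + axis i 1) - m k)
    = (LBINT x. - (N i (k + axis i 1) / h) * (ind (lcell a h k) x * (v (x + axis i h) - v x)))"
    by (simp only: integral_mult_right_zero)
  qed
  also have "... = (LBINT x. (\<Sum>k\<in>X. - (N i (k + axis i 1) / h) * (ind (lcell a h k) x * (v (x + axis i h) - v x))))"
   using q by (intro lint_sum[symmetric] integrable_mult_right iv[where C="2 * Cv"]) auto
  also have "... = (LBINT x. S i x * (v (x + axis i h) - v x))"
   by (simp add: S_def sum_distrib_right mult.assoc)
  finally show ?thesis .
 qed
 have lhs: "(\<Sum>k\<in>X. (\<Sum>i\<in>UNIV. (N i (k + axis i 1) - N i k) / h) * m k)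
   = (\<Sum>i\<in>UNIV. \<integral>x. S i x * (v (x + axis i h) - v x) \<partial>lborel)"
  unfolding part[symmetric] sum_distrib_right by (rule sum.swap)
 define CS where "CS = (\<Sum>i\<in>UNIV. \<Sum>k\<in>X. \<bar>N i (k + axis i 1) / h\<bar>)"
 have SC: "\<bar>S i x\<bar> \<le> CS" for i x
 proof -
  have "\<bar>S i x\<bar> \<le> (\<Sum>k\<in>X. \<bar>- (N i (k + axis i 1) / h) * ind (lcell a h k) x\<bar>)"
   unfolding S_def by (rule sum_abs)
  also have "... \<le> (\<Sum>k\<in>X. \<bar>N i (k + axis i 1) / h\<bar>)"
   by (intro sum_mono) (auto simp: indicator_def)
  also have "... \<le> CS" unfolding CS_def by (rule member_le_sum) (auto intro: sum_nonneg)
  finally show ?thesis .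
 qed
 have Sval: "S i x = - (N i (lindex a h x + axis i 1) / h)" if x: "x \<in> lcell a h (lindex a h x)" for i x
 proof -
  have N0': "N i (lindex a h x + axis i 1) = 0" if "lindex a h x \<notin> X"
   using N0[of i "lindex a h x + axis i 1"] that by auto
  have "S i x = (\<Sum>k\<in>X. if k = lindex a h x then - (N i (k + axis i 1) / h) else 0)"
   unfolding S_def by (intro sum.cong refl) (simp add: indicator_lcell_eq[OF h x])
  also have "... = - (N i (lindex a h x + axis i 1) / h)"
   using X N0' by (simp add: sum.delta)
  finally show ?thesis .
 qed
 define away where "away \<epsilon> = {x. \<forall>j. \<epsilon> \<le> (x $ j - a $ j) / h - real_of_int \<lfloor>(x $ j - a $ j) / h\<rfloor> \<and>
   (x $ j - a $ j) / h - real_of_int \<lfloor>(x $ j - a $ j) / h\<rfloor> \<le> 1 - \<epsilon>}" for \<epsilon> :: real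
 have awm[measurable]: "away \<epsilon> \<in> sets borel" for \<epsilon>
 proof -
  have "{x \<in> space (borel :: (real^'d) measure). \<forall>j. \<epsilon> \<le> (x $ j - a $ j) / h - real_of_int \<lfloor>(x $ j - a $ j) / h\<rfloor> \<and>
   (x $ j - a $ j) / h - real_of_int \<lfloor>(x $ j - a $ j) / h\<rfloor> \<le> 1 - \<epsilon>} \<in> sets borel"
   by measurable
  thus ?thesis by (simp add: away_def)
 qed
 have aw: "lcorner a h (lindex a h x) $ j + h * \<epsilon> \<le> x $ j" "x $ j \<le> lcorner a h (lindex a h x) $ j + h - h * \<epsilon>"
  if x: "x \<in> away \<epsilon>" for x \<epsilon> j
 proof -
  let ?u = "(x $ j - a $ j) / h"
  have "x $ j = a $ j + h * ?u" using h by simp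
  moreover have "real_of_int \<lfloor>?u\<rfloor> + \<epsilon> \<le> ?u" "?u \<le> real_of_int \<lfloor>?u\<rfloor> + 1 - \<epsilon>"
   using x[unfolded away_def mem_Collect_eq, rule_format, of j] by linarith+
  hence "h * (real_of_int \<lfloor>?u\<rfloor> + \<epsilon>) \<le> h * ?u" "h * ?u \<le> h * (real_of_int \<lfloor>?u\<rfloor> + 1 - \<epsilon>)"
   using h by (intro mult_left_mono; simp)+
  ultimately show "lcorner a h (lindex a h x) $ j + h * \<epsilon> \<le> x $ j" "x $ j \<le> lcorner a h (lindex a h x) $ j + h - h * \<epsilon>"
   by (simp_all add: lcorner_def lindex_def algebra_simps)
 qed
 have aw_cell: "x \<in> lcell a h (lindex a h x)" if "x \<in> away \<epsilon>" "\<epsilon> > 0" for x \<epsilon>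
  unfolding lcell_def mem_box_cart
 proof
  fix j
  have "h * \<epsilon> > 0" using that(2) h by simp
  thus "lcorner a h (lindex a h x) $ j < x $ j \<and> x $ j < (lcorner a h (lindex a h x) + (\<chi> i. h)) $ j"
   using aw[OF that(1), of j] by simp
 qed
 have bound: "(\<Sum>i\<in>UNIV. \<integral>x. (S i x * ind (away \<epsilon>) x) * (v (x + axis i h) - v x) \<partial>lborel) \<le> 1 * M"
  if \<epsilon>: "\<epsilon> > 0" for \<epsilon>
 proof (rule translation_duality[OF \<O>(1) v Cv tv])
  show sm: "(\<lambda>x. S i x * ind (away \<epsilon>) x) \<in> Borel" for i by measurable
  show "\<bar>S i x * ind (away \<epsilon>) x\<bar> \<le> CS" for i x
   using SC[of i x] by (auto simp: indicator_def)
  show "0 < h * \<epsilon> / 2" using h \<epsilon> by simp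
  show "cball (x + t *\<^sub>R axis i h) (h * \<epsilon> / 2) \<subseteq> \<O>" if nz: "S i x * ind (away \<epsilon>) x \<noteq> 0" and t: "t \<in> {0..1}" for i x t
  proof -
   have x: "x \<in> away \<epsilon>" "S i x \<noteq> 0" using nz by (auto simp: indicator_def split: if_splits)
   let ?k = "lindex a h x"
   have "N i (?k + axis i 1) \<noteq> 0" using x(2) Sval[OF aw_cell[OF x(1) \<epsilon>]] by auto
   hence k: "?k \<in> X" "?k + axis i 1 \<in> X" using N0[of i "?k + axis i 1"] by auto
   have "cball (x + t *\<^sub>R axis i h) (h * \<epsilon> / 2) \<subseteq> box (lcorner a h ?k) (lcorner a h ?k + (\<chi> j. h) + axis i h)"
   proof
    fix y assume y: "y \<in> cball (x + t *\<^sub>R axis i h) (h * \<epsilon> / 2)"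
    show "y \<in> box (lcorner a h ?k) (lcorner a h ?k + (\<chi> j. h) + axis i h)"
     unfolding mem_box_cart
    proof
     fix j
     define s s' where "s = (if j = i then t * h else 0)" and "s' = (if j = i then h else 0)"
     have "\<bar>(y - (x + t *\<^sub>R axis i h)) $ j\<bar> \<le> h * \<epsilon> / 2"
      using component_le_norm_cart[of "y - (x + t *\<^sub>R axis i h)" j] y by (simp add: dist_norm norm_minus_commute)
     hence "\<bar>y $ j - x $ j - s\<bar> \<le> h * \<epsilon> / 2" by (cases "j = i") (simp_all add: s_def axis_def diff_diff_eq)
     moreover have "h * \<epsilon> > 0" "0 \<le> s" "s \<le> s'" using h \<epsilon> t by (auto simp: s_def s'_def mult_left_le_one_le)
     moreover have "(lcorner a h ?k + (\<chi> j. h) + axis i h) $ j = lcorner a h ?k $ j + h + s'"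
      by (simp add: s'_def axis_def)
     ultimately show "lcorner a h ?k $ j < y $ j \<and> y $ j < (lcorner a h ?k + (\<chi> j. h) + axis i h) $ j"
      using aw[OF x(1), of j] by linarith
    qed
   qed
   thus ?thesis using two[OF k] by blast
  qed
  show "norm (\<Sum>i\<in>UNIV. segment_avg (\<lambda>x. S i x * ind (away \<epsilon>) x) (axis i h) x *\<^sub>R (axis i h :: real^'d)) \<le> 1" for x
  proof -
   let ?k = "lindex a h x"
   define c where "c i = h * segment_avg (\<lambda>x. S i x * ind (away \<epsilon>) x) (axis i h) x" for i
   \<comment> \<open>\<open>l\<close> and \<open>m\<close> measure the parts of the segment from
     \<open>x\<close> backwards that lie in its own cell and in the preceding one; the cutoff may
     make their sum smaller than 1.\<close>
   have "\<exists>l m. 0 \<le> l \<and> 0 \<le> m \<and> l + m \<le> 1 \<and> c i = - (l * N i (?k + axis i 1) + m * N i ?k)" for i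
   proof -
    define L where "L t = ind {0..1} t * ind (away \<epsilon>) (x - t *\<^sub>R axis i h) * ind (lcell a h ?k) (x - t *\<^sub>R axis i h)" for t
    define R where "R t = ind {0..1} t * ind (away \<epsilon>) (x - t *\<^sub>R axis i h) * ind (lcell a h (?k - axis i 1)) (x - t *\<^sub>R axis i h)" for t
    have [measurable]: "L \<in> Borel" "R \<in> Borel"
     unfolding L_def R_def by measurable
    have LR0: "0 \<le> L t" "0 \<le> R t" for t by (auto simp: L_def R_def)
    have "?k \<noteq> ?k - axis i 1" by (simp add: vec_eq_iff axis_def)
    hence dis: "ind (lcell a h ?k) z + ind (lcell a h (?k - axis i 1)) z \<le> 1" for z
     using lcell_lindex[OF h, of z a ?k] lcell_lindex[OF h, of z a "?k - axis i 1"]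
     by (auto simp: indicator_def axis_eq_0_iff)
    have LR: "L t + R t \<le> ind {0..1} t" for t
     using dis[of "x - t *\<^sub>R axis i h"] by (auto simp: L_def R_def indicator_def)
    have i01: "integrable lborel (ind {0..1::real})" by simp
    have iL: "integrable lborel L" "integrable lborel R"
     by (rule lintegrable_bound[OF i01]; use LR LR0 in \<open>auto intro!: AE_I2 simp: abs_le_iff\<close>; metis add_increasing add_increasing2 LR LR0 order_trans le_add_same_cancel1 le_add_same_cancel2)+
    have pt: "ind {0..1} t * (S i (x - t *\<^sub>R axis i h) * ind (away \<epsilon>) (x - t *\<^sub>R axis i h))
     = - (N i (?k + axis i 1) / h) * L t - (N i ?k / h) * R t" for t
    proof (cases "t \<in> {0..1} \<and> x - t *\<^sub>R axis i h \<in> away \<epsilon>")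
     case True
     let ?z = "x - t *\<^sub>R axis i h"
     have z: "?z \<in> lcell a h (lindex a h ?z)" using True \<epsilon> by (intro aw_cell) auto
     consider "lindex a h ?z = ?k" | "lindex a h ?z = ?k - axis i 1"
      using lindex_line[OF h, of t a x i] True by auto
     thus ?thesis
     proof cases
      case 1
      thus ?thesis using Sval[OF z, of i] True indicator_lcell_eq[OF h z] \<open>?k \<noteq> ?k - axis i 1\<close>
       by (auto simp: L_def R_def)
     next
      case 2
      thus ?thesis using Sval[OF z, of i] True indicator_lcell_eq[OF h z] \<open>?k \<noteq> ?k - axis i 1\<close>
       by (auto simp: L_def R_def)
     qed
    qed (auto simp: L_def R_def indicator_def)
    have "segment_avg (\<lambda>x. S i x * ind (away \<epsilon>) x) (axis i h) x
      = (LBINT t. - (N i (?k + axis i 1) / h) * L t - (N i ?k / h) * R t)"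
     unfolding segment_avg_def pt ..
    also have "... = - (N i (?k + axis i 1) / h) * (LBINT t. L t) - (N i ?k / h) * (LBINT t. R t)"
     using iL by simp
    finally have "c i = - ((LBINT t. L t) * N i (?k + axis i 1) + (LBINT t. R t) * N i ?k)"
     using h by (simp add: c_def field_simps)
    moreover have "(LBINT t. L t) + (LBINT t. R t) \<le> 1"
    proof -
     have "(LBINT t. L t) + (LBINT t. R t) = (LBINT t. L t + R t)" using iL by simp
     also have "... \<le> (LBINT t. ind {0..1::real} t)"
      using iL i01 LR by (intro integral_mono) auto
     finally show ?thesis by simp
    qed
    moreover have "0 \<le> (LBINT t. L t)" "0 \<le> (LBINT t. R t)" using LR0 by auto
    ultimately show ?thesis by blast
   qed
   then obtain l m where lm: "\<And>i. 0 \<le> l i" "\<And>i. 0 \<le> m i" "\<And>i. l i + m i \<le> 1"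
    "\<And>i. c i = - (l i * N i (?k + axis i 1) + m i * N i ?k)" by metis
   have "(\<Sum>i\<in>UNIV. segment_avg (\<lambda>x. S i x * ind (away \<epsilon>) x) (axis i h) x *\<^sub>R (axis i h :: real^'d)) = (\<chi> i. c i)"
    by (simp add: vec_eq_iff c_def axis_def if_distrib cong: if_cong)
   moreover have "norm ((\<chi> i. c i) :: real^'d) \<le> 1"
   proof (cases "?k \<in> X")
    case False
    hence "N i ?k = 0" "N i (?k + axis i 1) = 0" for i
     using N0[of i ?k] N0[of i "?k + axis i 1"] by auto
    hence "c i = 0" for i using lm(4)[of i] by simp
    hence "(\<chi> i. c i) = (0 :: real^'d)" by (simp add: vec_eq_iff)
    thus ?thesis by simp
   next
    case True
    \<comment> \<open>Normalizing \<open>l\<close> and \<open>m\<close> gives a value of the field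
      in the cell; the factor l + m \<le> 1 only shrinks each component. If both vanish the
      component is 0 for any choice of \<theta>.\<close>
    define \<theta> where "\<theta> i = (if l i + m i = 0 then 0 else l i / (l i + m i))" for i
    have \<theta>: "0 \<le> \<theta> i \<and> \<theta> i \<le> 1" for i using lm(1)[of i] lm(2)[of i] by (auto simp: \<theta>_def divide_le_eq)
    let ?z = "(\<chi> i. (1 - \<theta> i) * N i ?k + \<theta> i * N i (?k + axis i 1)) :: real^'d"
    have "norm ((\<chi> i. c i) :: real^'d) \<le> norm ?z"
    proof (rule norm_le_componentwise_cart)
     fix i
     have "c i = - ((l i + m i) * (?z $ i))"
     proof (cases "l i + m i = 0")
      case True
      hence "l i = 0" "m i = 0" using lm(1)[of i] lm(2)[of i] by linarith+
      thus ?thesis using lm(4)[of i] by simp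
     next
      case False
      hence "(l i + m i) * \<theta> i = l i" by (simp add: \<theta>_def)
      hence e: "(l i + m i) * \<theta> i * u = l i * u" for u by simp
      have "(l i + m i) * (?z $ i) = (l i + m i) * N i ?k - (l i + m i) * \<theta> i * N i ?k
        + (l i + m i) * \<theta> i * N i (?k + axis i 1)"
       by (simp add: algebra_simps)
      also have "... = m i * N i ?k + l i * N i (?k + axis i 1)"
       unfolding e by (simp add: algebra_simps)
      finally have "(l i + m i) * (?z $ i) = m i * N i ?k + l i * N i (?k + axis i 1)" .
      thus ?thesis using lm(4)[of i] by simp
     qed
     hence "\<bar>c i\<bar> = (l i + m i) * \<bar>?z $ i\<bar>" using lm(1)[of i] lm(2)[of i] by (simp add: abs_mult)
     also have "... \<le> 1 * \<bar>?z $ i\<bar>" using lm(3)[of i] by (intro mult_right_mono) auto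
     finally show "norm ((\<chi> i. c i) $ i) \<le> norm (?z $ i)" by simp
    qed
    also have "norm ?z \<le> 1" using True \<theta> by (rule N1)
    finally show ?thesis .
   qed
   ultimately show ?thesis by simp
  qed
 qed
 \<comment> \<open>A null sequence of cutoffs: almost every point lies off the grid and is
   eventually kept.\<close>
 define e where "e n = 1 / real (n + 3)" for n
 have e: "e n > 0" for n by (simp add: e_def)
 have e0: "e \<longlonglongrightarrow> 0"
  unfolding e_def using LIMSEQ_ignore_initial_segment[OF lim_1_over_n, of 3] by simp
 have lim: "(\<lambda>n. \<integral>x. (S i x * ind (away (e n)) x) * (v (x + axis i h) - v x) \<partial>lborel)
   \<longlonglongrightarrow> (LBINT x. S i x * (v (x + axis i h) - v x))" for i
 proof (rule integral_dominated_convergence[where w="\<lambda>x. \<bar>S i x\<bar> * (2 * Cv)"])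
  have "integrable lborel (S i)"
   unfolding S_def using iv[of "\<lambda>_. 1" 1] by (intro lintegrable_sum integrable_mult_right) simp
  thus "integrable lborel (\<lambda>x. \<bar>S i x\<bar> * (2 * Cv))" by (intro integrable_mult_left integrable_abs)
  show "AE x in lborel. (\<lambda>n. (S i x * ind (away (e n)) x) * (v (x + axis i h) - v x)) \<longlonglongrightarrow> S i x * (v (x + axis i h) - v x)"
   using AE_not_grid[OF h, of a]
  proof eventually_elim
   case (elim x)
   let ?f = "\<lambda>j. (x $ j - a $ j) / h - real_of_int \<lfloor>(x $ j - a $ j) / h\<rfloor>"
   have "0 < ?f j \<and> ?f j < 1" for j
   proof -
    have "(x $ j - a $ j) / h \<noteq> real_of_int \<lfloor>(x $ j - a $ j) / h\<rfloor>"
     using elim unfolding grid_def by (metis (mono_tags, lifting) Ints_of_int mem_Collect_eq)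
    thus ?thesis by linarith
   qed
   hence "\<forall>\<^sub>F n in sequentially. \<forall>j. e n < ?f j \<and> e n < 1 - ?f j"
    using order_tendstoD(2)[OF e0] by (intro eventually_all_finite eventually_conj) auto
   hence "\<forall>\<^sub>F n in sequentially. ind (away (e n)) x = 1"
   proof eventually_elim
    case (elim n)
    hence "x \<in> away (e n)" unfolding away_def mem_Collect_eq by (intro allI) (smt (verit))
    thus ?case by simp
   qed
   hence "(\<lambda>n. ind (away (e n)) x) \<longlonglongrightarrow> 1" by (rule tendsto_eventually)
   hence "(\<lambda>n. (S i x * ind (away (e n)) x) * (v (x + axis i h) - v x)) \<longlonglongrightarrow> (S i x * 1) * (v (x + axis i h) - v x)"
    by (intro tendsto_intros)
   thus ?case by simp
  qed
  show "AE x in lborel. norm ((S i x * ind (away (e n)) x) * (v (x + axis i h) - v x)) \<le> \<bar>S i x\<bar> * (2 * Cv)" for n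
  proof (rule AE_I2)
   fix x
   have "\<bar>S i x * ind (away (e n)) x\<bar> * \<bar>v (x + axis i h) - v x\<bar> \<le> \<bar>S i x\<bar> * (2 * Cv)"
    using q[of x "axis i h"] by (intro mult_mono) (auto simp: indicator_def)
   thus "norm ((S i x * ind (away (e n)) x) * (v (x + axis i h) - v x)) \<le> \<bar>S i x\<bar> * (2 * Cv)"
    by (simp add: abs_mult)
  qed
 qed measurable
 have "(\<Sum>i\<in>UNIV. \<integral>x. S i x * (v (x + axis i h) - v x) \<partial>lborel) \<le> 1 * M"
  by (rule LIMSEQ_le_const2[OF tendsto_sum[OF lim]]) (use bound[OF e] in blast)
 thus ?thesis using lhs by (simp add: m_def)
qed

text \<open>The pairing of the divergence with \<open>v\<close> is at most \<open>M\<close>.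
  Replacing \<open>v\<close> by \<open>u\<close> costs the L1 distance times the maximal divergence:
  the face values are bounded by 1, so each of the d difference quotients is at most 2 / h. For u =
  v this is TVh \<le> TV.\<close>

lemma TVh_le:
 fixes \<O> :: "(real^'d) set"
 assumes \<O>: "bounded \<O>" "open \<O>" and v[measurable]: "v \<in> Borel" and Cv: "\<And>x. \<bar>v x\<bar> \<le> Cv"
  and tv: "tv_le \<O> v M" and lm: "lattice_mesh \<O> h \<Q> a X"
  and u[measurable]: "u \<in> Borel" and Cu: "\<And>x. \<bar>u x\<bar> \<le> Cu"
 shows "TVh \<O> \<Q> u \<le> ereal (M + 2 * real CARD('d) / h * (LBINT x. ind \<O> x * \<bar>u x - v x\<bar>))"
proof -
 have h: "h > 0" and X: "finite X" and cell\<O>: "\<And>k. k \<in> X ==> lcell a h k \<subseteq> \<O>"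
  and inX: "\<And>x k. x \<in> \<O> ==> x \<in> lcell a h k ==> k \<in> X"
  using lm unfolding lattice_mesh_def by blast+
 have [measurable]: "lcell a h k \<in> sets borel" for k by (simp add: lcell_def)
 have [measurable]: "\<O> \<in> sets borel" using \<O>(2) by simp
 have ib: "integrable lborel (\<lambda>x. ind B x * w x)"
  if [measurable]: "w \<in> Borel" "B \<in> sets borel" and C: "\<And>x. \<bar>w x\<bar> \<le> C" and B: "bounded B" for w C and B :: "(real^'d) set"
 proof (rule integrable_bounded_support[OF _ _ B])
  show "norm (ind B x * w x) \<le> C" for x using C[of x] by (auto simp: indicator_def)
 qed (auto simp: indicator_def split: if_splits)
 have bl: "bounded (lcell a h k)" for k by (simp add: lcell_def bounded_box)
 let ?E = "\<integral>x. ind \<O> x * \<bar>u x - v x\<bar> \<partial>lborel"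
 have uv: "\<bar>\<bar>u x - v x\<bar>\<bar> \<le> Cu + Cv" for x using Cu[of x] Cv[of x] by linarith
 have "(\<integral>x. u x * g x \<partial>lebesgue_on \<O>) \<le> M + 2 * real CARD('d) / h * ?E"
  if \<phi>: "\<phi> \<in> RT0_0 \<O> \<Q>" "g \<in> L2 \<O>" "has_weak_divergence \<O> \<phi> g" "Linf_norm \<O> \<phi> \<le> 1" for \<phi> g
 proof (rule RT_face_values[OF \<O>(2,1) lm \<phi>])
  fix N :: "'d => int^'d => real"
  assume N0: "\<And>i k. N i k \<noteq> 0 ==> k \<in> X \<and> k - axis i 1 \<in> X" and
   N1: "\<And>k \<theta>. k \<in> X ==> (\<And>i. 0 \<le> \<theta> i \<and> \<theta> i \<le> 1) ==>
     norm ((\<chi> i. (1 - \<theta> i) * N i k + \<theta> i * N i (k + axis i 1)) :: real^'d) \<le> 1" and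
   Ng: "AE x in lebesgue. \<forall>k\<in>X. x \<in> lcell a h k --> g x = (\<Sum>i\<in>UNIV. (N i (k + axis i 1) - N i k) / h)"
  define D where "D k = (\<Sum>i\<in>UNIV. (N i (k + axis i 1) - N i k) / h)" for k
  have Db: "\<bar>D k\<bar> \<le> 2 * real CARD('d) / h" if k: "k \<in> X" for k
  proof -
   have lo: "\<bar>N i k\<bar> \<le> 1" for i
    using N1[OF k, of "\<lambda>_. 0"] component_le_norm_cart[of "(\<chi> i. N i k) :: real^'d" i] by simp
   have hi: "\<bar>N i (k + axis i 1)\<bar> \<le> 1" for i
    using N1[OF k, of "\<lambda>_. 1"] component_le_norm_cart[of "(\<chi> i. N i (k + axis i 1)) :: real^'d" i] by simp
   have "\<bar>D k\<bar> \<le> (\<Sum>i\<in>UNIV. \<bar>(N i (k + axis i 1) - N i k) / h\<bar>)" unfolding D_def by (rule sum_abs)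
   also have "... \<le> (\<Sum>i\<in>(UNIV::'d set). 2 / h)"
   proof (rule sum_mono)
    fix i
    have "\<bar>N i (k + axis i 1) - N i k\<bar> \<le> 2" using lo[of i] hi[of i] by linarith
    thus "\<bar>(N i (k + axis i 1) - N i k) / h\<bar> \<le> 2 / h" using h by (simp add: abs_divide divide_right_mono)
   qed
   finally show ?thesis by (simp add: mult.commute)
  qed
  have "(\<integral>x. u x * g x \<partial>lebesgue_on \<O>) = (\<integral>x. ind \<O> x * (u x * g x) \<partial>lebesgue)"
   using \<O>(2) by (rule integral_lebesgue_on_eq)
  also have "... = (\<integral>x. (\<Sum>k\<in>X. D k * (ind (lcell a h k) x * u x)) \<partial>lebesgue)"
  proof -
   let ?R = "\<lambda>x. (\<Sum>k\<in>X. D k * (ind (lcell a h k) x * u x))"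
   have Rm: "?R \<in> borel_measurable lebesgue" by (intro measurable_completion) measurable
   have "AE x in lebesgue. x \<notin> grid a h" using AE_not_grid[OF h] by (rule AE_completion)
   hence AEl: "AE x in lebesgue. ?R x = ind \<O> x * (u x * g x)"
    using Ng
   proof eventually_elim
    case (elim x)
    let ?k = "lindex a h x"
    have c: "x \<in> lcell a h ?k" using h elim(1) by (rule mem_lcell_lindex)
    have "?R x = (\<Sum>k\<in>X. if k = ?k then D k * u x else 0)"
     by (intro sum.cong refl) (simp add: indicator_lcell_eq[OF h c])
    also have "... = (if ?k \<in> X then D ?k * u x else 0)" using X by (simp add: sum.delta)
    also have "... = ind \<O> x * (u x * g x)"
    proof (cases "?k \<in> X")
     case True
     hence "x \<in> \<O>" "g x = D ?k" using cell\<O>[OF True] c elim(2) by (auto simp: D_def)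
     thus ?thesis using True by simp
    next
     case False
     hence "x \<notin> \<O>" using inX[OF _ c] by blast
     thus ?thesis using False by simp
    qed
    finally show ?case .
   qed
   have "(\<lambda>x. ind \<O> x * (u x * g x)) \<in> borel_measurable lebesgue"
    using Rm AEl by (rule borel_measurable_AE)
   thus ?thesis using AEl Rm by (intro integral_cong_AE) (auto elim: eventually_mono)
  qed
  also have "... = (LBINT x. (\<Sum>k\<in>X. D k * (ind (lcell a h k) x * u x)))"
   by (rule integral_completion) measurable
  also have "... = (\<Sum>k\<in>X. D k * (LBINT x. ind (lcell a h k) x * u x))"
   using ib[OF u _ Cu bl] by (subst lint_sum) (auto intro!: integrable_mult_right)
  also have "... \<le> (\<Sum>k\<in>X. D k * (LBINT x. ind (lcell a h k) x * v x)
    + 2 * real CARD('d) / h * (LBINT x. ind (lcell a h k) x * \<bar>u x - v x\<bar>))"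
  proof (rule sum_mono)
   fix k assume k: "k \<in> X"
   let ?i = "\<lambda>w. \<integral>x. ind (lcell a h k) x * w x \<partial>lborel"
   have iu: "integrable lborel (\<lambda>x. ind (lcell a h k) x * u x)" and ivv: "integrable lborel (\<lambda>x. ind (lcell a h k) x * v x)"
    using ib[OF u _ Cu bl] ib[OF v _ Cv bl] by auto
   have "?i u - ?i v = (LBINT x. ind (lcell a h k) x * (u x - v x))"
    using iu ivv by (simp add: right_diff_distrib)
   hence "\<bar>?i u - ?i v\<bar> \<le> (LBINT x. \<bar>ind (lcell a h k) x * (u x - v x)\<bar>)"
    using integral_abs_bound[of lborel "\<lambda>x. ind (lcell a h k) x * (u x - v x)"] by simp
   hence d: "\<bar>?i u - ?i v\<bar> \<le> ?i (\<lambda>x. \<bar>u x - v x\<bar>)" by (simp add: abs_mult)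
   have "D k * ?i u = D k * ?i v + D k * (?i u - ?i v)" by (simp add: algebra_simps)
   also have "D k * (?i u - ?i v) \<le> \<bar>D k\<bar> * \<bar>?i u - ?i v\<bar>" unfolding abs_mult[symmetric] by (rule abs_ge_self)
   also have "... \<le> (2 * real CARD('d) / h) * ?i (\<lambda>x. \<bar>u x - v x\<bar>)"
    using Db[OF k] d h by (intro mult_mono) auto
   finally show "D k * ?i u \<le> D k * ?i v + 2 * real CARD('d) / h * ?i (\<lambda>x. \<bar>u x - v x\<bar>)" by simp
  qed
  also have "... = (\<Sum>k\<in>X. D k * (LBINT x. ind (lcell a h k) x * v x))
    + 2 * real CARD('d) / h * (\<Sum>k\<in>X. \<integral>x. ind (lcell a h k) x * \<bar>u x - v x\<bar> \<partial>lborel)"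
   by (simp add: sum.distrib sum_distrib_left)
  also have "... \<le> M + 2 * real CARD('d) / h * ?E"
  proof (intro add_mono mult_left_mono)
  show "(\<Sum>k\<in>X. D k * (LBINT x. ind (lcell a h k) x * v x)) \<le> M"
   unfolding D_def using \<O> v Cv tv lm N0 N1 by (rule RT_pairing_le)
  show "(\<Sum>k\<in>X. \<integral>x. ind (lcell a h k) x * \<bar>u x - v x\<bar> \<partial>lborel) \<le> ?E"
  proof -
   have "(\<Sum>k\<in>X. \<integral>x. ind (lcell a h k) x * \<bar>u x - v x\<bar> \<partial>lborel)
    = (LBINT x. (\<Sum>k\<in>X. ind (lcell a h k) x * \<bar>u x - v x\<bar>))"
    using ib[OF _ _ uv bl] by (intro lint_sum[symmetric]) auto
   also have "... \<le> ?E"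
   proof (rule integral_mono)
    show "integrable lborel (\<lambda>x. \<Sum>k\<in>X. ind (lcell a h k) x * \<bar>u x - v x\<bar>)"
     using ib[OF _ _ uv bl] by (intro lintegrable_sum) auto
    show "integrable lborel (\<lambda>x. ind \<O> x * \<bar>u x - v x\<bar>)"
     by (rule ib[OF _ _ uv \<O>(1)]) measurable
    fix x
    show "(\<Sum>k\<in>X. ind (lcell a h k) x * \<bar>u x - v x\<bar>) \<le> ind \<O> x * \<bar>u x - v x\<bar>"
    proof (cases "\<exists>k\<in>X. x \<in> lcell a h k")
     case True
     then obtain k0 where k0: "k0 \<in> X" "x \<in> lcell a h k0" by blast
     have "(\<Sum>k\<in>X. ind (lcell a h k) x * \<bar>u x - v x\<bar>) = (\<Sum>k\<in>X. if k = k0 then \<bar>u x - v x\<bar> else 0)"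
      by (intro sum.cong refl) (simp add: indicator_lcell_eq[OF h k0(2)])
     also have "... = \<bar>u x - v x\<bar>" using X k0(1) by (simp add: sum.delta)
     finally show ?thesis using cell\<O>[OF k0(1)] k0(2) by (simp add: subsetD)
    next
     case False
     hence "(\<Sum>k\<in>X. ind (lcell a h k) x * \<bar>u x - v x\<bar>) = 0" by (intro sum.neutral) auto
     thus ?thesis by simp
    qed
   qed
   finally show ?thesis .
  qed
  qed (use h in simp)
  finally show ?thesis .
 qed
 thus ?thesis unfolding TVh_def by (intro SUP_least) auto
qed

section \<open>Recovery sequences\<close>

lemma measure_lcell:
 assumes h: "h > 0"
 shows "measure lborel (lcell a h k :: (real^'d) set) = h^CARD('d)"
proof -
 have "measure lborel (lcell a h k) = measure lborel (ccell a h k)"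
  unfolding lcell_def ccell_def by (simp add: measure_lborel_box_eq measure_lborel_cbox_eq)
 also have "lcorner a h k \<in> cbox (lcorner a h k) (lcorner a h k + (\<chi> i. h))" using h by (simp add: mem_box_cart)
 hence "measure lborel (ccell a h k) = h^CARD('d)"
  unfolding ccell_def by (subst content_cbox_cart) auto
 finally show ?thesis .
qed

lemma integrable_cell:
 assumes u: "u \<in> Borel" "\<And>x. \<bar>u x\<bar> \<le> C"
 shows "integrable lborel (\<lambda>x. ind (lcell a h k :: (real^'d) set) x * u x)"
proof -
 note [measurable] = u(1)
 have [measurable]: "lcell a h k \<in> sets borel" by (simp add: lcell_def)
 show ?thesis
 proof (rule integrable_bounded_support[where S="lcell a h k"])
  show "norm (ind (lcell a h k) x * u x) \<le> C" for x using u(2)[of x] by (auto simp: indicator_def)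
 qed (auto simp: indicator_def lcell_def bounded_box split: if_splits)
qed

lemma integral_cells:
 fixes \<O> :: "(real^'d) set"
 assumes \<O>: "bounded \<O>" "open \<O>" and lm: "lattice_mesh \<O> h \<Q> a X"
  and u[measurable]: "u \<in> Borel" and C: "\<And>x. \<bar>u x\<bar> \<le> C"
 shows "(LBINT x. ind \<O> x * u x) = (\<Sum>k\<in>X. \<integral>x. ind (lcell a h k) x * u x \<partial>lborel)"
proof -
 have h: "h > 0" and X: "finite X" and cell\<O>: "\<And>k. k \<in> X ==> lcell a h k \<subseteq> \<O>"
  and inX: "\<And>x k. x \<in> \<O> ==> x \<in> lcell a h k ==> k \<in> X"
  using lm unfolding lattice_mesh_def by blast+
 have [measurable]: "\<O> \<in> sets borel" using \<O> by (auto intro: borel_open)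
 have [measurable]: "lcell a h k \<in> sets borel" for k by (simp add: lcell_def)
 have "(LBINT x. ind \<O> x * u x) = (LBINT x. (\<Sum>k\<in>X. ind (lcell a h k) x * u x))"
 proof (rule integral_cong_AE)
  show "AE x in lborel. ind \<O> x * u x = (\<Sum>k\<in>X. ind (lcell a h k) x * u x)"
   using AE_not_grid[OF h, of a]
  proof eventually_elim
   case (elim x)
   let ?k = "lindex a h x"
   have c: "x \<in> lcell a h ?k" using h elim by (rule mem_lcell_lindex)
   have "(\<Sum>k\<in>X. ind (lcell a h k) x * u x) = (\<Sum>k\<in>X. if k = ?k then u x else 0)"
    by (intro sum.cong refl) (simp add: indicator_lcell_eq[OF h c])
   also have "... = (if ?k \<in> X then u x else 0)" using X by (simp add: sum.delta)
   also have "?k \<in> X \<longleftrightarrow> x \<in> \<O>" using cell\<O>[of ?k] inX[OF _ c] c by blast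
   finally show ?case by (simp add: indicator_def)
  qed
 qed measurable
 also have "... = (\<Sum>k\<in>X. \<integral>x. ind (lcell a h k) x * u x \<partial>lborel)"
  by (intro lint_sum integrable_cell[OF u C])
 finally show ?thesis .
qed

lemma lcorner_lindex_measurable[measurable]:
 "(\<lambda>x. lcorner a h (lindex a h x)) \<in> borel_measurable (borel :: (real^'d) measure)"
proof (rule borel_measurable_euclidean_space[THEN iffD2], rule ballI)
 fix b :: "real^'d" assume "b \<in> Basis"
 then obtain i where b: "b = axis i 1" by (auto simp: Basis_vec_def)
 have "(\<lambda>x::real^'d. a $ i + h * real_of_int \<lfloor>(x $ i - a $ i) / h\<rfloor>) \<in> Borel"
  by measurable
 thus "(\<lambda>x. lcorner a h (lindex a h x) \<bullet> b) \<in> Borel"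
  by (simp add: b inner_axis lcorner_def lindex_def)
qed

lemma axis_component: "(axis i s :: real^'d) $ j = (if j = i then s else (0::real))"
 by (simp add: axis_def)

text \<open>The bound is the sum of the jumps times the face areas, obtained without traces:
  difference quotients of the test field are moved onto \<open>w\<close>, and a difference of
  \<open>w\<close> under a step t along an axis vanishes inside the domain except in slabs of
  thickness t above interior faces. The volumes of the slabs divided by t are the areas of the
  faces.\<close>

lemma tv_le_piecewise_constant:
 fixes \<O> :: "(real^'d) set"
 assumes \<O>: "bounded \<O>" "open \<O>" and lm: "lattice_mesh \<O> \<tau> \<Q> a X"
  and w[measurable]: "w \<in> Borel" and Cw: "\<And>x. \<bar>w x\<bar> \<le> Cw"
  and V: "\<And>x. w x = V (lindex a \<tau> x)"
 shows "tv_le \<O> w (\<Sum>i\<in>UNIV. \<Sum>k\<in>{k \<in> X. k + axis i 1 \<in> X}. \<tau>^(CARD('d) - 1) * \<bar>V (k + axis i 1) - V k\<bar>)"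
 unfolding tv_le_def
proof (intro ballI impI)
 fix \<phi> :: "real^'d => real^'d" assume \<phi>: "\<phi> \<in> C1c \<O>" and \<phi>1: "\<forall>x\<in>\<O>. norm (\<phi> x) \<le> 1"
 have \<tau>: "\<tau> > 0" and X: "finite X" and inX: "\<And>x k. x \<in> \<O> ==> x \<in> lcell a \<tau> k ==> k \<in> X"
  using lm unfolding lattice_mesh_def by blast+
 obtain Df K where D: "\<And>i. C1_grad (\<lambda>x. \<phi> x $ i) (Df i)" and K: "compact K" "K \<subseteq> \<O>"
  and \<phi>K: "\<And>x. \<phi> x \<noteq> 0 ==> x \<in> K" and DK: "\<And>i x. Df i x \<noteq> 0 ==> x \<in> K"
  and div: "\<And>x. divergence \<phi> x = (\<Sum>i\<in>UNIV. Df i x $ i)"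
  using \<phi> by (rule C1c_vecE) (assumption | rule that)+
 obtain \<rho> where \<rho>: "\<rho> > 0" "(\<Union>x\<in>K. ball x \<rho>) \<subseteq> \<O>"
  using compact_subset_open_imp_ball_epsilon_subset[OF K(1) \<O>(2) K(2)] by blast
 \<comment> \<open>Steps below \<tau> cross at most one face, and steps below \<rho> keep the
   shifted point in the domain, so both cells belong to the mesh; 1 is the bound required by
   \<open>difference_quotient_limit\<close>.\<close>
 define c where "c = min 1 (min \<tau> \<rho>) / 2"
 have c: "0 < c" "c < 1" "c < \<tau>" "c < \<rho>" using \<tau> \<rho>(1) by (auto simp: c_def)
 define t where "t n = c * inverse (real (Suc n))" for n
 have t: "0 < t n" "t n \<le> c" for n
  using c(1) by (auto simp: t_def mult_le_cancel_left1 inverse_le_1_iff)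
 have t0: "t \<longlonglongrightarrow> 0"
  unfolding t_def using tendsto_mult[OF tendsto_const[of c] LIMSEQ_inverse_real_of_nat] by simp
 have Cw0: "0 \<le> Cw" using Cw[of 0] by linarith
 let ?Y = "\<lambda>i. {k \<in> X. k + axis i 1 \<in> X}"
 have Y: "finite (?Y i)" for i using X by simp
 have main: "(LBINT x. w x * Df i x $ i) \<le> (\<Sum>k\<in>?Y i. \<tau>^(CARD('d) - 1) * \<bar>V (k + axis i 1) - V k\<bar>)" for i
 proof -
  let ?f = "\<lambda>x. \<phi> x $ i" and ?e = "axis i 1 :: real^'d"
  have fK: "x \<in> K" if "?f x \<noteq> 0" for x using \<phi>K[of x] that by force
  have [measurable]: "?f \<in> Borel" using C1_grad_measurable[OF D[of i]] by simp
  have f1: "\<bar>?f x\<bar> \<le> 1" for x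
  proof (cases "?f x = 0")
   case False
   hence "x \<in> \<O>" using fK K(2) by blast
   thus ?thesis using \<phi>1 component_le_norm_cart[of "\<phi> x" i] by force
  qed simp
  obtain R where R: "\<And>x. x \<in> K ==> norm x \<le> R" using compact_imp_bounded[OF K(1)] by (auto simp: bounded_iff)
  have "(\<lambda>n. \<integral>x. w x * ((?f (x + t n *\<^sub>R ?e) - ?f x) / t n) \<partial>lborel) \<longlonglongrightarrow> (LBINT x. w x * (Df i x \<bullet> ?e))"
  proof (rule difference_quotient_limit[OF w _ D K(1) fK])
   show "\<exists>B. \<forall>x\<in>S. \<bar>w x\<bar> \<le> B" for S using Cw by blast
  qed (use t t0 c in \<open>auto intro: order_trans[OF t(2)]\<close>)
  moreover have "(LBINT x. w x * ((?f (x + t n *\<^sub>R ?e) - ?f x) / t n))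
    \<le> (\<Sum>k\<in>?Y i. \<tau>^(CARD('d) - 1) * \<bar>V (k + axis i 1) - V k\<bar>)" for n
  proof -
   let ?t = "t n"
   have tc: "0 < ?t" "?t < 1" "?t < \<tau>" "?t < \<rho>" using t[of n] c by auto
   have int: "integrable lborel (\<lambda>x. u x * ?f x)" if [measurable]: "u \<in> Borel" and "\<And>x. \<bar>u x\<bar> \<le> Cw" for u
   proof (rule integrable_bounded_support[OF _ _ compact_imp_bounded[OF K(1)]])
    show "norm (u x * ?f x) \<le> Cw * 1" for x
     unfolding norm_mult using that(2)[of x] f1[of x] Cw0 by (intro mult_mono) auto
    show "x \<in> K" if "u x * ?f x \<noteq> 0" for x using that by (intro fK) auto
   qed measurable
   have i1: "integrable lborel (\<lambda>x. w (x - ?t *\<^sub>R ?e) * ?f x)" using Cw by (intro int) auto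
   have i2: "integrable lborel (\<lambda>x. w x * ?f x)" using Cw by (intro int) auto
   have i3: "integrable lborel (\<lambda>x. w x * ?f (x + ?t *\<^sub>R ?e))"
    using integrable_lborel_translate[of "\<lambda>x. w (x - ?t *\<^sub>R ?e) * ?f x" "?t *\<^sub>R ?e"] i1 by simp
   have "(LBINT x. w x * ((?f (x + ?t *\<^sub>R ?e) - ?f x) / ?t))
     = ((LBINT x. w x * ?f (x + ?t *\<^sub>R ?e)) - (LBINT x. w x * ?f x)) / ?t"
    using i2 i3 by (simp add: right_diff_distrib diff_divide_distrib)
   also have "(LBINT x. w x * ?f (x + ?t *\<^sub>R ?e)) = (LBINT x. w (x - ?t *\<^sub>R ?e) * ?f x)"
    using integral_lborel_translate[of "\<lambda>x. w (x - ?t *\<^sub>R ?e) * ?f x" "?t *\<^sub>R ?e"] by simp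
   also have "((LBINT x. w (x - ?t *\<^sub>R ?e) * ?f x) - (LBINT x. w x * ?f x)) / ?t
     = (LBINT x. (w (x - ?t *\<^sub>R ?e) - w x) * ?f x / ?t)"
    using i1 i2 by (simp add: left_diff_distrib)
   also have "... \<le> (\<integral>x. (\<Sum>k\<in>?Y i. \<bar>V (k + axis i 1) - V k\<bar> / ?t *
     ind (cbox (lcorner a \<tau> (k + axis i 1)) (lcorner a \<tau> (k + axis i 1) + (\<chi> j. if j = i then ?t else \<tau>))) x) \<partial>lborel)"
   proof (rule integral_mono_AE)
    show "integrable lborel (\<lambda>x. (w (x - ?t *\<^sub>R ?e) - w x) * ?f x / ?t)"
     using i1 i2 by (simp add: left_diff_distrib)
    show "integrable lborel (\<lambda>x. \<Sum>k\<in>?Y i. \<bar>V (k + axis i 1) - V k\<bar> / ?t *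
     ind (cbox (lcorner a \<tau> (k + axis i 1)) (lcorner a \<tau> (k + axis i 1) + (\<chi> j. if j = i then ?t else \<tau>))) x)"
     by (intro lintegrable_sum integrable_mult_right integrable_real_indicator)
      (auto simp: emeasure_lborel_cbox_eq)
    have "AE x in lborel. x - ?t *\<^sub>R ?e \<notin> grid a \<tau>"
    proof -
     have e: "(\<lambda>x::real^'d. - (?t *\<^sub>R ?e) + 1 *\<^sub>R x) = (\<lambda>x. x - ?t *\<^sub>R ?e)" by auto
     have "distr lborel borel (\<lambda>x::real^'d. - (?t *\<^sub>R ?e) + x) = lborel" by (rule lborel_distr_plus)
     hence d: "distr lborel borel (\<lambda>x::real^'d. x - ?t *\<^sub>R ?e) = lborel" by (simp add: add.commute)
     have "AE x in distr lborel borel (\<lambda>x::real^'d. x - ?t *\<^sub>R ?e). x \<notin> grid a \<tau>"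
      unfolding d by (rule AE_not_grid[OF \<tau>])
     thus ?thesis by (rule AE_distrD[rotated]) measurable
    qed
    thus "AE x in lborel. (w (x - ?t *\<^sub>R ?e) - w x) * ?f x / ?t \<le> (\<Sum>k\<in>?Y i. \<bar>V (k + axis i 1) - V k\<bar> / ?t *
     ind (cbox (lcorner a \<tau> (k + axis i 1)) (lcorner a \<tau> (k + axis i 1) + (\<chi> j. if j = i then ?t else \<tau>))) x)"
     using AE_not_grid[OF \<tau>, of a]
    proof eventually_elim
     case (elim x)
     let ?y = "x - ?t *\<^sub>R ?e" and ?k = "lindex a \<tau> (x - ?t *\<^sub>R ?e)"
     let ?g = "\<lambda>k. \<bar>V (k + axis i 1) - V k\<bar> / ?t *
      ind (cbox (lcorner a \<tau> (k + axis i 1)) (lcorner a \<tau> (k + axis i 1) + (\<chi> j. if j = i then ?t else \<tau>))) x"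
     have g0: "0 \<le> ?g k" for k using tc(1) by simp
     have "(w ?y - w x) * ?f x / ?t \<le> sum ?g (?Y i)"
     proof (cases "?f x = 0 \<or> ?k = lindex a \<tau> x")
      case True
      hence "(w ?y - w x) * ?f x / ?t = 0" using V by auto
      thus ?thesis using g0 by (simp only:) (rule sum_nonneg)
     next
      case False
      hence xK: "x \<in> K" using fK by blast
      have cx: "x \<in> lcell a \<tau> (lindex a \<tau> x)" using \<tau> elim(2) by (rule mem_lcell_lindex)
      have cy: "?y \<in> lcell a \<tau> ?k" using \<tau> elim(1) by (rule mem_lcell_lindex)
      have "x - (?t / \<tau>) *\<^sub>R axis i \<tau> = ?y" using \<tau> by (simp add: vec_eq_iff axis_def)
      hence k: "?k = lindex a \<tau> x - axis i 1"
       using lindex_line[OF \<tau>, of "?t / \<tau>" a x i] False tc \<tau> by auto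
      hence k': "?k + axis i 1 = lindex a \<tau> x" by simp
      have "x \<in> \<O>" using xK K(2) by blast
      moreover have "?y \<in> ball x \<rho>" using tc by (simp add: dist_norm)
      hence "?y \<in> \<O>" using \<rho>(2) xK by blast
      ultimately have kY: "?k \<in> ?Y i" using inX[OF _ cx] inX[OF _ cy] k' by simp
      \<comment> \<open>The shifted point is still in the lower cell, so \<open>x\<close> exceeds
        the common face by less than the step.\<close>
      have "x \<in> cbox (lcorner a \<tau> (?k + axis i 1)) (lcorner a \<tau> (?k + axis i 1) + (\<chi> j. if j = i then ?t else \<tau>))"
       unfolding mem_box_cart
      proof
       fix j
       have 1: "lcorner a \<tau> (?k + axis i 1) $ j < x $ j" "x $ j < lcorner a \<tau> (?k + axis i 1) $ j + \<tau>"
        using cx unfolding k' lcell_def mem_box_cart by auto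
       have "x $ i - ?t < lcorner a \<tau> ?k $ i + \<tau>"
        using cy unfolding lcell_def mem_box_cart by (auto dest!: spec[of _ i])
       hence "x $ i < lcorner a \<tau> (?k + axis i 1) $ i + ?t" unfolding lcorner_axis by simp
       with 1 show "lcorner a \<tau> (?k + axis i 1) $ j \<le> x $ j \<and>
        x $ j \<le> (lcorner a \<tau> (?k + axis i 1) + (\<chi> j. if j = i then ?t else \<tau>)) $ j"
        by auto
      qed
      hence gk: "?g ?k = \<bar>V (lindex a \<tau> x) - V ?k\<bar> / ?t" using k' by simp
      have "(w ?y - w x) * ?f x \<le> \<bar>w ?y - w x\<bar> * \<bar>?f x\<bar>" unfolding abs_mult[symmetric] by (rule abs_ge_self)
      also have "... \<le> \<bar>w ?y - w x\<bar> * 1" using f1 by (intro mult_left_mono) auto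
      also have "... = \<bar>V (lindex a \<tau> x) - V ?k\<bar>" unfolding V by (simp add: abs_minus_commute)
      finally have "(w ?y - w x) * ?f x / ?t \<le> ?g ?k" unfolding gk using tc(1) by (intro divide_right_mono) auto
      also have "... \<le> sum ?g (?Y i)" using kY Y g0 by (intro member_le_sum) auto
      finally show ?thesis .
     qed
     thus ?case .
    qed
   qed
   also have "... = (\<Sum>k\<in>?Y i. \<bar>V (k + axis i 1) - V k\<bar> / ?t * (?t * \<tau>^(CARD('d) - 1)))"
   proof -
    have "measure lborel (cbox b (b + (\<chi> j. if j = i then ?t else \<tau>))) = ?t * \<tau>^(CARD('d) - 1)" for b :: "real^'d"
    proof -
     have "b \<in> cbox b (b + (\<chi> j. if j = i then ?t else \<tau>))" using tc \<tau> by (auto simp: mem_box_cart)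
     hence "measure lborel (cbox b (b + (\<chi> j. if j = i then ?t else \<tau>))) = (\<Prod>j\<in>UNIV. if j = i then ?t else \<tau>)"
      by (subst content_cbox_cart) auto
     also have "... = ?t * (\<Prod>j\<in>UNIV - {i}. if j = i then ?t else \<tau>)"
      by (subst prod.remove[of UNIV i]) auto
     also have "(\<Prod>j\<in>UNIV - {i}. if j = i then ?t else \<tau>) = (\<Prod>j\<in>UNIV - {i}. \<tau>)"
      by (rule prod.cong) auto
     finally show ?thesis by (simp add: card_Diff_singleton)
    qed
    thus ?thesis
     by (subst lint_sum) (auto intro!: integrable_real_indicator simp: emeasure_lborel_cbox_eq)
   qed
   also have "... = (\<Sum>k\<in>?Y i. \<tau>^(CARD('d) - 1) * \<bar>V (k + axis i 1) - V k\<bar>)"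
    using tc(1) by (intro sum.cong refl) (simp add: mult.commute)
   finally show ?thesis .
  qed
  ultimately have "(LBINT x. w x * (Df i x \<bullet> ?e)) \<le> (\<Sum>k\<in>?Y i. \<tau>^(CARD('d) - 1) * \<bar>V (k + axis i 1) - V k\<bar>)"
   by - (rule LIMSEQ_le_const2, assumption, auto)
  thus ?thesis by (simp add: inner_axis)
 qed
 have "integrable lborel (\<lambda>x. w x * Df i x $ i)" for i
 proof -
  have Dc: "continuous_on UNIV (Df i)" using D[of i] by (simp add: C1_grad_def)
  obtain C where C: "C > 0" "\<And>x. norm (Df i x) \<le> C"
   using Dc K(1) DK by (rule bounded_of_compact_support) (assumption | rule that)+
  have [measurable]: "Df i \<in> Borel" using Dc by (rule borel_measurable_continuous_onI)
  show ?thesis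
  proof (rule integrable_bounded_support[OF _ _ compact_imp_bounded[OF K(1)]])
   show "norm (w x * Df i x $ i) \<le> Cw * C" for x
    unfolding norm_mult using Cw[of x] C(2)[of x] component_le_norm_cart[of "Df i x" i] Cw0
    by (intro mult_mono) auto
   show "x \<in> K" if "w x * Df i x $ i \<noteq> 0" for x using that by (intro DK[of i]) auto
  qed measurable
 qed
 hence "(LBINT x. w x * divergence \<phi> x) = (\<Sum>i\<in>UNIV. \<integral>x. w x * Df i x $ i \<partial>lborel)"
  by (simp add: div sum_distrib_left lint_sum)
 also have "... \<le> (\<Sum>i\<in>UNIV. \<Sum>k\<in>?Y i. \<tau>^(CARD('d) - 1) * \<bar>V (k + axis i 1) - V k\<bar>)"
  using main by (rule sum_mono)
 finally show "(LBINT x. w x * divergence \<phi> x) \<le> (\<Sum>i\<in>UNIV. \<Sum>k\<in>?Y i. \<tau>^(CARD('d) - 1) * \<bar>V (k + axis i 1) - V k\<bar>)" .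
qed

text \<open>Otherwise f - L would be positive on a set of positive measure and yet have a
  nonpositive integral.\<close>

lemma exists_le_average:
 fixes f :: "'a => real"
 assumes D: "D \<in> sets M" "0 < measure M D" and f: "integrable M (\<lambda>x. ind D x * f x)"
  and le: "(\<integral>x. ind D x * f x \<partial>M) \<le> L * measure M D"
 shows "\<exists>z\<in>D. f z \<le> L"
proof (rule ccontr)
 assume "\<not> ?thesis"
 hence gt: "f z > L" if "z \<in> D" for z using that by force
 have fin: "emeasure M D < \<infinity>"
 proof (rule ccontr)
  assume "\<not> ?thesis"
  hence "emeasure M D = top" by (simp add: less_top[symmetric])
  thus False using D(2) by (simp add: measure_def)
 qed
 hence iD: "integrable M (ind D)" using D(1) by simp
 hence "(\<integral>x. ind D x * f x - L * ind D x \<partial>M) \<le> 0"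
  using f le D(1) by simp
 moreover have nn: "0 \<le> ind D x * f x - L * ind D x" for x
  using gt[of x] by (auto simp: indicator_def)
 hence "0 \<le> (\<integral>x. ind D x * f x - L * ind D x \<partial>M)"
  by (rule lint_nonneg)
 ultimately have "(\<integral>x. ind D x * f x - L * ind D x \<partial>M) = 0" by simp
 hence "AE x in M. ind D x * f x - L * ind D x = 0"
  using f iD nn by (subst (asm) integral_nonneg_eq_0_iff_AE) auto
 hence "AE x in M. x \<notin> D"
 proof eventually_elim
  case (elim x)
  thus ?case using gt[of x] by (auto simp: indicator_def split: if_splits)
 qed
 hence "D \<in> null_sets M" using D(1) by (simp add: AE_iff_null_sets)
 thus False using D(2) by (simp add: measure_def null_setsD1)
qed

text \<open>
 The value on a cell is that of \<open>v\<close> at a sample point with the same random offset \<open>z\<close> in all cells;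
 on average over \<open>z\<close> the jumps cost the anisotropic variation of \<open>v\<close>, which is at most
 \<open>sqrt d\<close> times its total variation.
\<close>

lemma sampling:
 fixes \<O> :: "(real^'d) set"
 assumes \<O>: "bounded \<O>" "open \<O>" and v[measurable]: "v \<in> Borel" and Cv: "\<And>x. \<bar>v x\<bar> \<le> Cv"
  and tv: "tv_le \<O> v M" and lm: "lattice_mesh \<O> \<tau> \<Q> a X" and \<delta>: "\<delta> > 0"
 obtains z where
  "tv_le \<O> (\<lambda>x. v (lcorner a \<tau> (lindex a \<tau> x) + z)) ((sqrt (real CARD('d)) + \<delta> * (2^CARD('d) * sqrt (real CARD('d)))) * M)"
  "(LBINT x. ind \<O> x * \<bar>v (lcorner a \<tau> (lindex a \<tau> x) + z) - v x\<bar>)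
    \<le> \<tau> * ((sqrt (real CARD('d)) + \<delta> * (2^CARD('d) * sqrt (real CARD('d)))) * M) / \<delta>"
proof -
 have \<tau>: "\<tau> > 0" and X: "finite X" and cell\<O>: "\<And>k. k \<in> X ==> lcell a \<tau> k \<subseteq> \<O>"
  and inX: "\<And>x k. x \<in> \<O> ==> x \<in> lcell a \<tau> k ==> k \<in> X"
  and two: "\<And>k i. k \<in> X ==> k + axis i 1 \<in> X ==> box (lcorner a \<tau> k) (lcorner a \<tau> k + (\<chi> j. \<tau>) + axis i \<tau>) \<subseteq> \<O>"
  using lm unfolding lattice_mesh_def by blast+
 let ?d = "CARD('d)" and ?sd = "sqrt (real CARD('d))"
 define L where "L = (?sd + \<delta> * (2^?d * ?sd)) * M"
 have [measurable]: "\<O> \<in> sets borel" using \<O> by (auto intro: borel_open)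
 have M0: "0 \<le> M" using tv by (rule tv_le_nonneg)
 have Cv0: "0 \<le> Cv" using Cv[of 0] by linarith
 have q: "\<bar>v x - v y\<bar> \<le> 2 * Cv" for x y using Cv[of x] Cv[of y] by linarith
 have cm[measurable]: "lcell a \<tau> k \<in> sets borel" for k by (simp add: lcell_def)
 have bl: "bounded (lcell a \<tau> k)" for k by (simp add: lcell_def bounded_box)
 define D where "D = box (0::real^'d) (\<chi> i. \<tau>)"
 have Dm[measurable]: "D \<in> sets borel" and bD: "bounded D" by (auto simp: D_def bounded_box)
 have Dc: "z + lcorner a \<tau> k \<in> lcell a \<tau> k \<longleftrightarrow> z \<in> D" for z k
  unfolding D_def lcell_def mem_box_cart by (simp add: algebra_simps)
 have mD: "measure lborel D = \<tau>^?d"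
 proof -
  have "measure lborel D = measure lborel (cbox (0::real^'d) (\<chi> i. \<tau>))"
   unfolding D_def by (simp add: measure_lborel_box_eq measure_lborel_cbox_eq)
  also have "(0::real^'d) \<in> cbox 0 (\<chi> i. \<tau>)" using \<tau> by (simp add: mem_box_cart)
  hence "measure lborel (cbox (0::real^'d) (\<chi> i. \<tau>)) = \<tau>^?d"
   by (subst content_cbox_cart) auto
  finally show ?thesis .
 qed
 let ?Y = "\<lambda>i. {k \<in> X. k + axis i 1 \<in> X}"
 define S where "S z x = v (lcorner a \<tau> (lindex a \<tau> x) + z)" for z x
 have Sm[measurable]: "S z \<in> Borel" for z unfolding S_def by measurable
 define J where "J z = (\<Sum>i\<in>UNIV. \<Sum>k\<in>?Y i. \<tau>^(?d - 1) * \<bar>v (lcorner a \<tau> (k + axis i 1) + z) - v (lcorner a \<tau> k + z)\<bar>)" for z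
 have tvS: "tv_le \<O> (S z) (J z)" for z
  unfolding J_def by (rule tv_le_piecewise_constant[OF \<O> lm Sm, where Cw=Cv]) (auto simp: S_def Cv)
 define e where "e k z = (LBINT x. ind (lcell a \<tau> k) x * \<bar>v (lcorner a \<tau> k + z) - v x\<bar>)" for k z
 have em[measurable]: "e k \<in> Borel" for k
 proof -
  have "(\<lambda>z. \<integral>x. ind (lcell a \<tau> k) x * \<bar>v (lcorner a \<tau> k + z) - v x\<bar> \<partial>lborel) \<in> borel_measurable lborel"
   by measurable
  thus ?thesis by (simp add: e_def[abs_def])
 qed
 have i1: "integrable lborel (\<lambda>x. ind B x * u x)"
  if [measurable]: "u \<in> Borel" "B \<in> sets borel" and C: "\<And>x. \<bar>u x\<bar> \<le> C" and B: "bounded B" for u C and B :: "(real^'d) set"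
 proof (rule integrable_bounded_support[OF _ _ B])
  show "norm (ind B x * u x) \<le> C" for x using C[of x] by (auto simp: indicator_def)
 qed (auto simp: indicator_def split: if_splits)
 have e_bound: "\<bar>e k z\<bar> \<le> (LBINT x. ind (lcell a \<tau> k) x * (2 * Cv))" for k z
  unfolding e_def real_norm_def[symmetric]
 proof (rule lint_norm_bound_lint)
  show "integrable lborel (\<lambda>x. ind (lcell a \<tau> k) x * norm (v (lcorner a \<tau> k + z) - v x))"
   using q by (intro i1[where C="2 * Cv"] bl) auto
  show "integrable lborel (\<lambda>x. ind (lcell a \<tau> k) x * (2 * Cv))"
   using Cv0 by (intro i1[where C="2 * Cv"] bl) auto
  show "norm (ind (lcell a \<tau> k) x * norm (v (lcorner a \<tau> k + z) - v x)) \<le> ind (lcell a \<tau> k) x * (2 * Cv)" for x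
   using q[of "lcorner a \<tau> k + z" x] by (auto simp: indicator_def)
 qed
 have E: "(LBINT x. ind \<O> x * \<bar>S z x - v x\<bar>) = (\<Sum>k\<in>X. e k z)" for z
 proof -
  have "(LBINT x. ind \<O> x * \<bar>S z x - v x\<bar>) = (\<Sum>k\<in>X. \<integral>x. ind (lcell a \<tau> k) x * \<bar>S z x - v x\<bar> \<partial>lborel)"
  proof (rule integral_cells[OF \<O> lm])
   show "\<bar>\<bar>S z x - v x\<bar>\<bar> \<le> 2 * Cv" for x using q by (simp add: S_def)
  qed measurable
  also have "... = (\<Sum>k\<in>X. e k z)"
   unfolding e_def by (intro sum.cong refl lint_cong) (auto simp: S_def indicator_def dest: lcell_lindex[OF \<tau>])
  finally show ?thesis .
 qed
 \<comment> \<open>One functional controls both targets. The Poincare inequality makes the mean of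
   the second sum of order \<tau> M, so the weight \<delta> / \<tau> puts it on the scale of the
   jumps.\<close>
 define f where "f z = J z + \<delta> / \<tau> * (\<Sum>k\<in>X. e k z)" for z
 have ij: "integrable lborel (\<lambda>z. ind D z * \<bar>v (lcorner a \<tau> k' + z) - v (lcorner a \<tau> k + z)\<bar>)" for k k'
  using q by (intro i1[where C="2 * Cv"] bD) auto
 have ie: "integrable lborel (\<lambda>z. ind D z * e k z)" for k
  using e_bound by (intro i1 bD) auto
 have f_eq: "ind D z * f z = (\<Sum>i\<in>UNIV. \<Sum>k\<in>?Y i. \<tau>^(?d - 1) * (ind D z * \<bar>v (lcorner a \<tau> (k + axis i 1) + z) - v (lcorner a \<tau> k + z)\<bar>))
   + \<delta> / \<tau> * (\<Sum>k\<in>X. ind D z * e k z)" for z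
  by (simp add: f_def J_def distrib_left sum_distrib_left mult_ac)
 have int_f: "integrable lborel (\<lambda>z. ind D z * f z)"
  unfolding f_eq by (intro lintegrable_add lintegrable_sum integrable_mult_right ij ie)
 have "(LBINT z. ind D z * f z)
   = (\<Sum>i\<in>UNIV. \<Sum>k\<in>?Y i. \<tau>^(?d - 1) * (LBINT z. ind D z * \<bar>v (lcorner a \<tau> (k + axis i 1) + z) - v (lcorner a \<tau> k + z)\<bar>))
   + \<delta> / \<tau> * (\<Sum>k\<in>X. \<integral>z. ind D z * e k z \<partial>lborel)"
  unfolding f_eq
  by (subst lint_add)
   (intro lintegrable_sum integrable_mult_right ij ie |
    simp add: lint_sum ij ie lintegrable_sum)+
 also have "(\<Sum>i\<in>UNIV. \<Sum>k\<in>?Y i. \<tau>^(?d - 1) * (LBINT z. ind D z * \<bar>v (lcorner a \<tau> (k + axis i 1) + z) - v (lcorner a \<tau> k + z)\<bar>))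
   = \<tau>^(?d - 1) * (\<Sum>i\<in>UNIV. \<integral>x. ind (\<Union>k\<in>?Y i. lcell a \<tau> k) x * \<bar>v (x + axis i \<tau>) - v x\<bar> \<partial>lborel)"
 proof -
  \<comment> \<open>With x = corner + z the integral of one jump over the offsets becomes an
    integral over the cell; summed over the cells this is a translation difference by one cell
    width.\<close>
  have 1: "(LBINT z. ind D z * \<bar>v (lcorner a \<tau> (k + axis i 1) + z) - v (lcorner a \<tau> k + z)\<bar>)
    = (LBINT x. ind (lcell a \<tau> k) x * \<bar>v (x + axis i \<tau>) - v x\<bar>)" for i k
  proof -
   have "(LBINT z. ind (lcell a \<tau> k) (z + lcorner a \<tau> k) * \<bar>v (z + lcorner a \<tau> k + axis i \<tau>) - v (z + lcorner a \<tau> k)\<bar>)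
    = (LBINT x. ind (lcell a \<tau> k) x * \<bar>v (x + axis i \<tau>) - v x\<bar>)"
    by (rule integral_lborel_translate) measurable
   thus ?thesis by (simp add: indicator_def Dc lcorner_axis add_ac)
  qed
  have 2: "(\<Sum>k\<in>?Y i. \<integral>x. ind (lcell a \<tau> k) x * \<bar>v (x + axis i \<tau>) - v x\<bar> \<partial>lborel)
    = (LBINT x. ind (\<Union>k\<in>?Y i. lcell a \<tau> k) x * \<bar>v (x + axis i \<tau>) - v x\<bar>)" for i
  proof -
   have dj: "disjoint_family_on (lcell a \<tau>) (?Y i)"
    unfolding disjoint_family_on_def using lcell_lindex[OF \<tau>, of _ a] by blast
   have "(\<Sum>k\<in>?Y i. \<integral>x. ind (lcell a \<tau> k) x * \<bar>v (x + axis i \<tau>) - v x\<bar> \<partial>lborel)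
    = (LBINT x. (\<Sum>k\<in>?Y i. ind (lcell a \<tau> k) x * \<bar>v (x + axis i \<tau>) - v x\<bar>))"
    using q by (intro lint_sum[symmetric] i1[where C="2 * Cv"] bl) auto
   also have "... = (LBINT x. ind (\<Union>k\<in>?Y i. lcell a \<tau> k) x * \<bar>v (x + axis i \<tau>) - v x\<bar>)"
    using X by (subst indicator_UN_disjoint[OF _ dj]) (auto simp: sum_distrib_right)
   finally show ?thesis .
  qed
  show ?thesis unfolding 1 sum_distrib_left[symmetric] 2 ..
 qed
 \<comment> \<open>Displacements along all axes at once: combinations of the vectors
   \<open>axis i \<tau>\<close> with coefficients in [-1, 1] have norm at most sqrt d \<tau>, and
   this is the source of the factor sqrt d.\<close>
 also have "(\<Sum>i\<in>UNIV. \<integral>x. ind (\<Union>k\<in>?Y i. lcell a \<tau> k) x * \<bar>v (x + axis i \<tau>) - v x\<bar> \<partial>lborel) \<le> (?sd * \<tau>) * M"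
 proof (rule translation_variation[OF \<O> v Cv tv])
  show "(\<Union>k\<in>?Y i. lcell a \<tau> k) \<in> sets borel" for i using X by (intro sets.finite_UN) auto
  show "x + t *\<^sub>R axis i \<tau> \<in> \<O>" if x: "x \<in> (\<Union>k\<in>?Y i. lcell a \<tau> k)" and t: "t \<in> {0..1}" for i x t
  proof -
   obtain k where k: "k \<in> X" "k + axis i 1 \<in> X" "x \<in> lcell a \<tau> k" using x by blast
   have tt: "0 \<le> t * \<tau>" "t * \<tau> \<le> \<tau>" using t \<tau> by (auto simp: mult_left_le_one_le)
   have "x + t *\<^sub>R axis i \<tau> \<in> box (lcorner a \<tau> k) (lcorner a \<tau> k + (\<chi> j. \<tau>) + axis i \<tau>)"
    unfolding mem_box_cart
   proof
    fix j
    have "lcorner a \<tau> k $ j < x $ j" "x $ j < lcorner a \<tau> k $ j + \<tau>"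
     using k(3) unfolding lcell_def mem_box_cart by auto
    thus "lcorner a \<tau> k $ j < (x + t *\<^sub>R axis i \<tau>) $ j \<and> (x + t *\<^sub>R axis i \<tau>) $ j < (lcorner a \<tau> k + (\<chi> j. \<tau>) + axis i \<tau>) $ j"
     unfolding vector_add_component vector_scaleR_component axis_component real_scaleR_def vec_lambda_beta
     using tt \<tau> by (cases "j = i") (simp only: if_True if_False refl simp_thms, intro conjI, linarith, linarith)+
   qed
   thus ?thesis using two[OF k(1,2)] by blast
  qed
  show "norm (\<Sum>i\<in>UNIV. \<theta> i *\<^sub>R (axis i \<tau> :: real^'d)) \<le> ?sd * \<tau>" if \<theta>: "\<And>i. \<bar>\<theta> i\<bar> \<le> 1" for \<theta>
  proof (rule norm_le_sqrt_dim)
   fix j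
   have "(\<Sum>i\<in>UNIV. \<theta> i *\<^sub>R (axis i \<tau> :: real^'d)) $ j = (\<Sum>i\<in>UNIV. if i = j then \<theta> i * \<tau> else 0)"
    unfolding sum_component by (intro sum.cong refl) (simp add: axis_def)
   also have "... = \<theta> j * \<tau>" by simp
   finally show "\<bar>(\<Sum>i\<in>UNIV. \<theta> i *\<^sub>R (axis i \<tau> :: real^'d)) $ j\<bar> \<le> \<tau>"
    using \<theta>[of j] \<tau> by (simp add: abs_mult mult_left_le_one_le)
  qed
 qed
 also have "(\<Sum>k\<in>X. \<integral>z. ind D z * e k z \<partial>lborel)
   = (\<Sum>k\<in>X. \<integral>x. (LBINT z. ind (lcell a \<tau> k) x * ind (lcell a \<tau> k) z * \<bar>v z - v x\<bar>) \<partial>lborel)"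
 proof (rule sum.cong[OF refl])
  fix k
  let ?g = "\<lambda>y. ind (lcell a \<tau> k) y * (LBINT x. ind (lcell a \<tau> k) x * \<bar>v x - v y\<bar>)"
  have gm: "?g \<in> Borel"
  proof -
   have "?g \<in> borel_measurable lborel" by measurable
   thus ?thesis by simp
  qed
  have "(LBINT z. ind D z * e k z) = (LBINT z. ?g (z + lcorner a \<tau> k))"
   by (simp add: e_def indicator_def Dc abs_minus_commute add.commute)
  also have "... = (LBINT y. ?g y)" using gm by (rule integral_lborel_translate)
  also have "... = (LBINT x. (LBINT z. ind (lcell a \<tau> k) x * ind (lcell a \<tau> k) z * \<bar>v z - v x\<bar>))"
   by (simp add: mult.assoc)
  finally show "(LBINT z. ind D z * e k z) = (LBINT x. (LBINT z. ind (lcell a \<tau> k) x * ind (lcell a \<tau> k) z * \<bar>v z - v x\<bar>))" .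
 qed
 also have "... \<le> (2 * \<tau>)^?d * (?sd * \<tau>) * M"
  using \<O> v Cv tv lm by (rule poincare_cells)
 finally have le: "(LBINT z. ind D z * f z) \<le> \<tau>^(?d - 1) * ((?sd * \<tau>) * M) + \<delta> / \<tau> * ((2 * \<tau>)^?d * (?sd * \<tau>) * M)"
  by this (use \<tau> \<delta> in \<open>auto intro!: mult_left_mono add_mono divide_right_mono\<close>)
 \<comment> \<open>Both terms contain the volume \<tau>^d of the offset cube: the first through
   \<tau>^(d - 1) times \<tau>, the second through (2 \<tau>)^d.\<close>
 also have "... = L * measure lborel D"
 proof -
  have "\<tau>^(?d - 1) * \<tau> = \<tau>^?d" using zero_less_card_finite[where 'a='d] by (metis One_nat_def Suc_pred mult.commute power_Suc)
  thus ?thesis using \<tau> by (simp add: L_def mD power_mult_distrib algebra_simps)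
 qed
 finally have "\<exists>z\<in>D. f z \<le> L"
  using mD \<tau> int_f by (intro exists_le_average[where M=lborel]) auto
 then obtain z where z: "f z \<le> L" by blast
 have J0: "0 \<le> J z" unfolding J_def using \<tau> by (intro sum_nonneg) auto
 have e0: "0 \<le> (\<Sum>k\<in>X. e k z)" unfolding e_def by (intro sum_nonneg lint_nonneg) auto
 \<comment> \<open>Both summands of \<open>f z\<close> are nonnegative, so each of them is bounded
   by \<open>L\<close>.\<close>
 have "J z \<le> L"
  using z e0 \<delta> \<tau> unfolding f_def by (smt (verit) divide_nonneg_nonneg mult_nonneg_nonneg)
 hence 1: "tv_le \<O> (S z) L"
  using tvS[of z] unfolding tv_le_def by (meson order_trans)
 have "\<delta> / \<tau> * (\<Sum>k\<in>X. e k z) \<le> L" using z J0 unfolding f_def by linarith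
 hence "(\<Sum>k\<in>X. e k z) \<le> \<tau> * L / \<delta>"
  using \<delta> \<tau> by (simp add: field_simps)
 hence 2: "(LBINT x. ind \<O> x * \<bar>S z x - v x\<bar>) \<le> \<tau> * L / \<delta>" unfolding E .
 show ?thesis
  by (rule that[of z]) (use 1 2 in \<open>simp_all add: S_def[abs_def] L_def\<close>)
qed

lemma divergence_bounded:
 fixes \<phi> :: "real^'d => real^'d"
 assumes \<phi>: "\<phi> \<in> C1c \<O>"
 obtains C where "0 \<le> C" "\<And>x. \<bar>divergence \<phi> x\<bar> \<le> C" "divergence \<phi> \<in> Borel"
  "\<And>x. x \<notin> \<O> ==> divergence \<phi> x = 0"
proof -
 obtain Df K where D: "\<And>i. C1_grad (\<lambda>x. \<phi> x $ i) (Df i)" and K: "compact K" "K \<subseteq> \<O>" and \<phi>K: "\<And>x. \<phi> x \<noteq> 0 ==> x \<in> K"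
  and DK: "\<And>i x. Df i x \<noteq> 0 ==> x \<in> K" and div: "\<And>x. divergence \<phi> x = (\<Sum>i\<in>UNIV. Df i x $ i)"
  using \<phi> by (rule C1c_vecE) (assumption | rule that)+
 have m: "divergence \<phi> \<in> Borel"
 proof -
  note [measurable] = C1_grad_measurable(2)[OF D]
  have "(\<lambda>x. \<Sum>i\<in>UNIV. Df i x $ i) \<in> Borel" by measurable
  thus ?thesis by (simp add: div[abs_def])
 qed
 have "\<exists>C. \<forall>x. norm (Df i x) \<le> C" for i
  by (rule bounded_of_compact_support[OF _ K(1) DK[of i]]) (use D[of i] in \<open>auto simp: C1_grad_def\<close>)
 then obtain C where C: "\<And>i x. norm (Df i x) \<le> C i" by metis
 have b: "\<bar>divergence \<phi> x\<bar> \<le> (\<Sum>i\<in>UNIV. C i)" for x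
  unfolding div by (rule order_trans[OF sum_abs sum_mono]) (use C component_le_norm_cart order_trans in blast)
 have z: "divergence \<phi> x = 0" if "x \<notin> \<O>" for x
 proof -
  have "Df i x = 0" for i using DK[of i x] K(2) that by blast
  thus ?thesis by (simp add: div)
 qed
 have "0 \<le> (\<Sum>i\<in>UNIV. C i)" by (rule order_trans[OF abs_ge_zero b[of 0]])
 thus ?thesis using b m z by (rule that)
qed

section \<open>Interpolation by Raviart-Thomas fields\<close>

text \<open>The piecewise linear interpolant of values given at the integers.\<close>

definition interp :: "(int => real) => real => real" where
 "interp n u = (1 - (u - real_of_int \<lfloor>u\<rfloor>)) * n \<lfloor>u\<rfloor> + (u - real_of_int \<lfloor>u\<rfloor>) * n (\<lfloor>u\<rfloor> + 1)"

lemma int_sequence_lipschitz: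
 fixes n :: "int => real"
 assumes L: "\<And>m. \<bar>n (m + 1) - n m\<bar> \<le> L"
 shows "\<bar>n (p + int k) - n p\<bar> \<le> L * real k"
proof (induction k)
 case (Suc k)
 have "\<bar>n (p + int k + 1) - n (p + int k)\<bar> \<le> L" by (rule L)
 hence "\<bar>n (p + int (Suc k)) - n (p + int k)\<bar> \<le> L" by (simp add: add_ac)
 thus ?case using Suc by (simp add: distrib_left)
qed simp

lemma interp_lipschitz:
 assumes L: "\<And>m. \<bar>n (m + 1) - n m\<bar> \<le> L"
 shows "\<bar>interp n u - interp n v\<bar> \<le> L * \<bar>u - v\<bar>"
proof -
 have L0: "0 \<le> L" using L[of 0] by linarith
 have "\<bar>interp n u - interp n v\<bar> \<le> L * (v - u)" if uv: "u \<le> v" for u v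
 proof (cases "\<lfloor>u\<rfloor> = \<lfloor>v\<rfloor>")
  case True
  have "interp n u - interp n v = (u - v) * (n (\<lfloor>v\<rfloor> + 1) - n \<lfloor>v\<rfloor>)"
   by (simp add: interp_def True algebra_simps)
  hence "\<bar>interp n u - interp n v\<bar> = (v - u) * \<bar>n (\<lfloor>v\<rfloor> + 1) - n \<lfloor>v\<rfloor>\<bar>"
   using uv by (simp add: abs_mult)
  also have "... \<le> (v - u) * L" using L uv by (intro mult_left_mono) auto
  finally show ?thesis by (simp add: mult.commute)
 next
  \<comment> \<open>Different unit intervals: the estimate passes through the nodes floor u + 1 and
    floor v.\<close>
  case False
  hence fl: "\<lfloor>u\<rfloor> + 1 \<le> \<lfloor>v\<rfloor>" using floor_mono[OF uv] by linarith
  have 1: "\<bar>interp n u - n (\<lfloor>u\<rfloor> + 1)\<bar> \<le> L * (real_of_int \<lfloor>u\<rfloor> + 1 - u)"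
  proof -
   have "interp n u - n (\<lfloor>u\<rfloor> + 1) = - (real_of_int \<lfloor>u\<rfloor> + 1 - u) * (n (\<lfloor>u\<rfloor> + 1) - n \<lfloor>u\<rfloor>)"
    by (simp add: interp_def algebra_simps)
   moreover have "0 \<le> real_of_int \<lfloor>u\<rfloor> + 1 - u" by linarith
   ultimately have "\<bar>interp n u - n (\<lfloor>u\<rfloor> + 1)\<bar> = (real_of_int \<lfloor>u\<rfloor> + 1 - u) * \<bar>n (\<lfloor>u\<rfloor> + 1) - n \<lfloor>u\<rfloor>\<bar>"
    by (metis abs_minus_cancel abs_mult abs_of_nonneg)
   also have "... \<le> (real_of_int \<lfloor>u\<rfloor> + 1 - u) * L"
    using L \<open>0 \<le> real_of_int \<lfloor>u\<rfloor> + 1 - u\<close> by (intro mult_left_mono) auto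
   finally show ?thesis by (simp add: mult.commute)
  qed
  have 2: "\<bar>n \<lfloor>v\<rfloor> - n (\<lfloor>u\<rfloor> + 1)\<bar> \<le> L * real_of_int (\<lfloor>v\<rfloor> - (\<lfloor>u\<rfloor> + 1))"
   using int_sequence_lipschitz[of n L "\<lfloor>u\<rfloor> + 1" "nat (\<lfloor>v\<rfloor> - (\<lfloor>u\<rfloor> + 1))", OF L] fl by simp
  have 3: "\<bar>interp n v - n \<lfloor>v\<rfloor>\<bar> \<le> L * (v - real_of_int \<lfloor>v\<rfloor>)"
  proof -
   have "interp n v - n \<lfloor>v\<rfloor> = (v - real_of_int \<lfloor>v\<rfloor>) * (n (\<lfloor>v\<rfloor> + 1) - n \<lfloor>v\<rfloor>)"
    by (simp add: interp_def algebra_simps)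
   moreover have v0: "0 \<le> v - real_of_int \<lfloor>v\<rfloor>" by linarith
   ultimately have "\<bar>interp n v - n \<lfloor>v\<rfloor>\<bar> = (v - real_of_int \<lfloor>v\<rfloor>) * \<bar>n (\<lfloor>v\<rfloor> + 1) - n \<lfloor>v\<rfloor>\<bar>"
    by (simp add: abs_mult)
   also have "... \<le> (v - real_of_int \<lfloor>v\<rfloor>) * L"
    using L v0 by (intro mult_left_mono) auto
   finally show ?thesis by (simp add: mult.commute)
  qed
  have "L * (real_of_int \<lfloor>u\<rfloor> + 1 - u) + L * real_of_int (\<lfloor>v\<rfloor> - (\<lfloor>u\<rfloor> + 1)) + L * (v - real_of_int \<lfloor>v\<rfloor>) = L * (v - u)"
   by (simp add: algebra_simps)
  thus ?thesis using 1 2 3 by linarith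
 qed
 from this[of u v] this[of v u] show ?thesis by (cases "u \<le> v") (auto simp: abs_minus_commute)
qed

lemma interp_deriv:
 assumes "u \<notin> \<int>"
 shows "(interp n has_real_derivative (n (\<lfloor>u\<rfloor> + 1) - n \<lfloor>u\<rfloor>)) (at u)"
proof -
 let ?m = "\<lfloor>u\<rfloor>"
 have "real_of_int ?m \<noteq> u" using assms by (metis Ints_of_int)
 hence u: "u \<in> {real_of_int ?m<..<real_of_int ?m + 1}" using floor_correct[of u]
  by - (rule greaterThanLessThan_iff[THEN iffD2], rule conjI, linarith, linarith)
 have "((\<lambda>v. (1 - (v - real_of_int ?m)) * n ?m + (v - real_of_int ?m) * n (?m + 1)) has_real_derivative (n (?m + 1) - n ?m)) (at u)"
  by (auto intro!: derivative_eq_intros)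
 thus ?thesis
 proof (rule has_field_derivative_transform_within_open[OF _ _ u])
  fix v assume "v \<in> {real_of_int ?m<..<real_of_int ?m + 1}"
  hence "\<lfloor>v\<rfloor> = ?m" by (intro floor_unique) auto
  thus "(1 - (v - real_of_int ?m)) * n ?m + (v - real_of_int ?m) * n (?m + 1) = interp n v"
   by (simp add: interp_def)
 qed simp
qed

lemma interp_convex:
 assumes "\<bar>n \<lfloor>u\<rfloor> - c\<bar> \<le> e" "\<bar>n (\<lfloor>u\<rfloor> + 1) - c\<bar> \<le> e"
 shows "\<bar>interp n u - c\<bar> \<le> e"
proof -
 define s where "s = u - real_of_int \<lfloor>u\<rfloor>"
 have s: "0 \<le> s" "0 \<le> 1 - s" unfolding s_def by linarith+
 have "interp n u - c = (1 - s) * (n \<lfloor>u\<rfloor> - c) + s * (n (\<lfloor>u\<rfloor> + 1) - c)"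
  by (simp add: interp_def s_def algebra_simps)
 also have "\<bar>...\<bar> \<le> \<bar>(1 - s) * (n \<lfloor>u\<rfloor> - c)\<bar> + \<bar>s * (n (\<lfloor>u\<rfloor> + 1) - c)\<bar>" by (rule abs_triangle_ineq)
 also have "... \<le> (1 - s) * e + s * e"
  unfolding abs_mult using s assms by (intro add_mono mult_mono) auto
 finally show ?thesis by (simp add: algebra_simps)
qed

text \<open>The center of a face orthogonal to the \<open>i\<close>-th axis.\<close>

definition face_point :: "real^'d => real => 'd => real^'d => int => real^'d" where
 "face_point a h i x m = (\<chi> j. a $ j + h * (if j = i then real_of_int m else real_of_int \<lfloor>(x $ j - a $ j) / h\<rfloor> + 1 / 2))"

definition face_val :: "real^'d => real => (real^'d => real^'d) => 'd => real^'d => int => real" where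
 "face_val a h \<phi> i x m = \<phi> (face_point a h i x m) $ i"

text \<open>The Raviart-Thomas interpolant with face averages replaced by values at the face
  centers; for continuously differentiable fields this suffices for uniform convergence and avoids
  surface integrals.\<close>

definition RT_interp :: "real^'d => real => (real^'d => real^'d) => real^'d => real^'d" where
 "RT_interp a h \<phi> x = (\<chi> i. interp (face_val a h \<phi> i x) ((x $ i - a $ i) / h))"

text \<open>Away from the grid this is the derivative of component \<open>i\<close> along its own
  axis; the sum over \<open>i\<close> is the divergence of the interpolant.\<close>

definition RT_slope :: "real^'d => real => (real^'d => real^'d) => 'd => real^'d => real" where
 "RT_slope a h \<phi> i x = (face_val a h \<phi> i x (\<lfloor>(x $ i - a $ i) / h\<rfloor> + 1) - face_val a h \<phi> i x \<lfloor>(x $ i - a $ i) / h\<rfloor>) / h"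

text \<open>In every coordinate the points differ by at most \<open>h\<close>. The intermediate
  parameter \<open>s\<close> is there for the mean value theorem, which picks an unknown point
  between two opposite face centers.\<close>

lemma face_point_near:
 assumes h: "h > 0" and m: "m = \<lfloor>(x $ i - a $ i) / h\<rfloor> \<or> m = \<lfloor>(x $ i - a $ i) / h\<rfloor> + 1" and s: "0 \<le> s" "s \<le> 1"
 shows "dist (face_point a h i x \<lfloor>(x $ i - a $ i) / h\<rfloor> + axis i (s * h)) (x::real^'d) \<le> sqrt (real CARD('d)) * h"
  and "dist (face_point a h i x m) x \<le> sqrt (real CARD('d)) * h"
proof -
 have *: "dist (face_point a h i x \<lfloor>(x $ i - a $ i) / h\<rfloor> + axis i (s * h)) (x::real^'d) \<le> sqrt (real CARD('d)) * h"
  if s: "0 \<le> s" "s \<le> 1" for s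
  unfolding dist_norm
 proof (rule norm_le_sqrt_dim)
  fix j
  let ?u = "(x $ j - a $ j) / h" and ?y = "face_point a h i x \<lfloor>(x $ i - a $ i) / h\<rfloor> + axis i (s * h) - x"
  define r where "r = (if j = i then s else 1 / 2)"
  have r: "0 \<le> r" "r \<le> 1" using s by (auto simp: r_def)
  have "x $ j = a $ j + h * ?u" using h by simp
  hence "?y $ j = h * (real_of_int \<lfloor>?u\<rfloor> + r - ?u)"
   by (auto simp: face_point_def axis_def r_def algebra_simps)
  moreover have "\<bar>real_of_int \<lfloor>?u\<rfloor> + r - ?u\<bar> \<le> 1" using r by linarith
  ultimately show "\<bar>?y $ j\<bar> \<le> h" using h by (simp add: abs_mult)
 qed
 thus "dist (face_point a h i x \<lfloor>(x $ i - a $ i) / h\<rfloor> + axis i (s * h)) (x::real^'d) \<le> sqrt (real CARD('d)) * h"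
  using s by blast
 have "face_point a h i x m = face_point a h i x \<lfloor>(x $ i - a $ i) / h\<rfloor> + axis i ((real_of_int (m - \<lfloor>(x $ i - a $ i) / h\<rfloor>)) * h)"
  by (simp add: vec_eq_iff face_point_def axis_def algebra_simps)
 thus "dist (face_point a h i x m) x \<le> sqrt (real CARD('d)) * h"
  using *[of "real_of_int (m - \<lfloor>(x $ i - a $ i) / h\<rfloor>)"] m by auto
qed

lemma face_val_measurable[measurable]:
 fixes \<phi> :: "real^'d => real^'d"
 assumes [measurable]: "\<phi> \<in> Borel"
 shows "(\<lambda>x. face_val a h \<phi> i x (\<lfloor>(x $ i - a $ i) / h\<rfloor> + c)) \<in> Borel"
proof -
 have [measurable]: "(\<lambda>x. face_point a h i x (\<lfloor>(x $ i - a $ i) / h\<rfloor> + c)) \<in> Borel"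
 proof (rule borel_measurable_euclidean_space[THEN iffD2], rule ballI)
  fix b :: "real^'d" assume "b \<in> Basis"
  then obtain j where b: "b = axis j 1" by (auto simp: Basis_vec_def)
  have "(\<lambda>x::real^'d. a $ j + h * (if j = i then real_of_int \<lfloor>(x $ i - a $ i) / h\<rfloor> + real_of_int c else real_of_int \<lfloor>(x $ j - a $ j) / h\<rfloor> + 1 / 2)) \<in> Borel"
   by measurable
  thus "(\<lambda>x. face_point a h i x (\<lfloor>(x $ i - a $ i) / h\<rfloor> + c) \<bullet> b) \<in> Borel"
   by (simp add: b inner_axis face_point_def)
 qed
 show ?thesis unfolding face_val_def by measurable
qed

lemma RT_interp_measurable:
 fixes \<phi> :: "real^'d => real^'d"
 assumes [measurable]: "\<phi> \<in> Borel"
 shows "RT_slope a h \<phi> i \<in> Borel" "(\<lambda>x. RT_interp a h \<phi> x $ i) \<in> Borel"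
  "RT_interp a h \<phi> \<in> Borel"
proof -
 note [measurable] = face_val_measurable[OF assms, of a h i 0, simplified]
 show "RT_slope a h \<phi> i \<in> Borel" unfolding RT_slope_def by measurable
 have *: "(\<lambda>x. RT_interp a h \<phi> x $ i) \<in> Borel" for i
 proof -
  note [measurable] = face_val_measurable[OF assms, of a h i 0, simplified]
  show ?thesis unfolding RT_interp_def interp_def by simp measurable
 qed
 thus "(\<lambda>x. RT_interp a h \<phi> x $ i) \<in> Borel" .
 show "RT_interp a h \<phi> \<in> Borel"
 proof (rule borel_measurable_euclidean_space[THEN iffD2], rule ballI)
  fix b :: "real^'d" assume "b \<in> Basis"
  then obtain j where b: "b = axis j 1" by (auto simp: Basis_vec_def)
  show "(\<lambda>x. RT_interp a h \<phi> x \<bullet> b) \<in> Borel" using *[of j] by (simp add: b inner_axis)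
 qed
qed

lemma bounded_measurable_L2:
 fixes u :: "real^'d => 'b::{real_normed_vector, second_countable_topology}"
 assumes \<O>: "open \<O>" "bounded \<O>" and u: "u \<in> Borel" and C: "\<And>x. norm (u x) \<le> C"
 shows "u \<in> L2 \<O>"
proof -
 have m: "u \<in> borel_measurable (lebesgue_on \<O>)"
  using u by (intro measurable_restrict_space1 measurable_completion) simp
 have fin: "finite_measure (lebesgue_on \<O>)"
  using \<O> by (intro finite_measure_lebesgue_on lmeasurable_open)
 have "integrable (lebesgue_on \<O>) (\<lambda>x. (norm (u x))\<^sup>2)"
 proof (rule finite_measure.integrable_const_bound[OF fin, where B="C\<^sup>2"])
  show "AE x in lebesgue_on \<O>. norm ((norm (u x))\<^sup>2) \<le> C\<^sup>2"
   using C by (intro AE_I2) (simp add: power_mono)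
 qed (use m in measurable)
 with m show ?thesis by (simp add: L2_def)
qed

text \<open>Along axis \<open>i\<close> the i-th component is a piecewise linear function with fixed
  nodes, hence Lipschitz, which is enough for integration by parts. Interpolation spreads the
  support by at most sqrt d h, so the field vanishes near the boundary and the normal condition
  holds there.\<close>

lemma RT_interp_in_RT0_0:
 fixes \<O> :: "(real^'d) set"
 assumes \<O>: "open \<O>" "bounded \<O>" and lm: "lattice_mesh \<O> h \<Q> a X"
  and \<phi>[measurable]: "\<phi> \<in> Borel" and C: "\<And>x. norm (\<phi> x) \<le> C"
  and K: "\<And>x. \<phi> x \<noteq> 0 ==> x \<in> K" and \<rho>: "(\<Union>x\<in>K. ball x \<rho>) \<subseteq> \<O>" "2 * (sqrt (real CARD('d)) * h) < \<rho>"
 shows "RT_interp a h \<phi> \<in> RT0_0 \<O> \<Q>" "(\<lambda>x. \<Sum>i\<in>UNIV. RT_slope a h \<phi> i x) \<in> L2 \<O>"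
  "has_weak_divergence \<O> (RT_interp a h \<phi>) (\<lambda>x. \<Sum>i\<in>UNIV. RT_slope a h \<phi> i x)"
proof -
 have h: "h > 0" and \<Q>: "\<Q> = ccell a h ` X" using lm unfolding lattice_mesh_def by blast+
 let ?\<psi> = "RT_interp a h \<phi>" and ?g = "\<lambda>x. \<Sum>i\<in>UNIV. RT_slope a h \<phi> i x"
 have C0: "0 \<le> C" using C[of 0] norm_ge_zero order_trans by blast
 note [measurable] = RT_interp_measurable[OF \<phi>]
 have fC: "\<bar>face_val a h \<phi> i x m\<bar> \<le> C" for i x m
  unfolding face_val_def using component_le_norm_cart[of "\<phi> (face_point a h i x m)" i] C order_trans by blast
 have iC: "\<bar>?\<psi> x $ i\<bar> \<le> C" for x i
  using interp_convex[of "face_val a h \<phi> i x" "(x $ i - a $ i) / h" 0 C] fC by (simp add: RT_interp_def)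
 have sC: "\<bar>RT_slope a h \<phi> i x\<bar> \<le> 2 * C / h" for x i
 proof -
  have "\<bar>face_val a h \<phi> i x (\<lfloor>(x $ i - a $ i) / h\<rfloor> + 1) - face_val a h \<phi> i x \<lfloor>(x $ i - a $ i) / h\<rfloor>\<bar> \<le> 2 * C"
   using fC[of i x "\<lfloor>(x $ i - a $ i) / h\<rfloor> + 1"] fC[of i x "\<lfloor>(x $ i - a $ i) / h\<rfloor>"] by linarith
  thus ?thesis using h by (simp add: RT_slope_def abs_divide divide_right_mono)
 qed
 have supp: "x \<in> \<O> \<and> (\<exists>y\<in>K. dist y x \<le> sqrt (real CARD('d)) * h)"
  if nz: "?\<psi> x $ i \<noteq> 0 \<or> RT_slope a h \<phi> i x \<noteq> 0" for x i
 proof -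
  let ?m = "\<lfloor>(x $ i - a $ i) / h\<rfloor>"
  have "face_val a h \<phi> i x ?m \<noteq> 0 \<or> face_val a h \<phi> i x (?m + 1) \<noteq> 0"
   using nz by (auto simp: RT_interp_def interp_def RT_slope_def)
  then obtain m where m: "m = ?m \<or> m = ?m + 1" "face_val a h \<phi> i x m \<noteq> 0" by blast
  hence "\<phi> (face_point a h i x m) \<noteq> 0" by (auto simp: face_val_def)
  hence y: "face_point a h i x m \<in> K" by (rule K)
  have d: "dist (face_point a h i x m) x \<le> sqrt (real CARD('d)) * h"
   using face_point_near(2)[OF h m(1), of 0] by simp
  have "0 \<le> sqrt (real CARD('d)) * h" using h by simp
  hence "x \<in> ball (face_point a h i x m) \<rho>" using d \<rho>(2) by simp
  hence "x \<in> \<O>" using \<rho>(1) y by blast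
  with y d show ?thesis by blast
 qed
 show gL2: "?g \<in> L2 \<O>"
 proof (rule bounded_measurable_L2[OF \<O>])
  show "norm (?g x) \<le> (\<Sum>i\<in>(UNIV::'d set). 2 * C / h)" for x
   unfolding real_norm_def by (rule order_trans[OF sum_abs sum_mono]) (rule sC)
 qed measurable
 have \<psi>L2: "?\<psi> \<in> L2 \<O>"
 proof (rule bounded_measurable_L2[OF \<O>])
  show "norm (?\<psi> x) \<le> sqrt (real CARD('d)) * C" for x
   using iC by (rule norm_le_sqrt_dim)
 qed measurable
 show wd: "has_weak_divergence \<O> ?\<psi> ?g"
  unfolding has_weak_divergence_def
 proof
  fix f :: "real^'d => real" assume f: "f \<in> C1c \<O>"
  obtain Df Kf where D: "C1_grad f Df" "compact Kf" "Kf \<subseteq> \<O>" "\<And>x. f x \<noteq> 0 ==> x \<in> Kf" "\<And>x. Df x \<noteq> 0 ==> x \<in> Kf"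
   using f by (rule C1cE) (assumption | rule that)+
  have Dfm[measurable]: "Df \<in> Borel" "f \<in> Borel" using C1_grad_measurable[OF D(1)] by auto
  have Dc: "continuous_on UNIV Df" using D(1) by (simp add: C1_grad_def)
  obtain C1 where C1: "C1 > 0" "\<And>x. norm (Df x) \<le> C1"
   using Dc D(2,5) by (rule bounded_of_compact_support) (assumption | rule that)+
  obtain C2 where C2: "C2 > 0" "\<And>x. norm (f x) \<le> C2"
   using C1_grad_continuous[OF D(1)] D(2,4) by (rule bounded_of_compact_support) (assumption | rule that)+
  have ibp: "(LBINT x. ?\<psi> x $ i * (Df x \<bullet> axis i 1)) = - (LBINT x. RT_slope a h \<phi> i x * f x)" for i
  proof (rule integration_by_parts_lipschitz[OF _ _ _ _ _ D(1,2,4), where L="2 * C / h"])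
   show "\<exists>B. \<forall>x\<in>S. \<bar>?\<psi> x $ i\<bar> \<le> B" for S using iC by blast
   \<comment> \<open>The centers of the faces orthogonal to axis \<open>i\<close> do not move when
     \<open>x\<close> moves along this axis.\<close>
   have fv: "face_val a h \<phi> i (x + t *\<^sub>R axis i 1) = face_val a h \<phi> i x" for x :: "real^'d" and t
    by (auto simp: face_val_def face_point_def axis_def fun_eq_iff intro!: arg_cong[where f="\<lambda>v. \<phi> v $ i"])
   have u: "((x + t *\<^sub>R axis i 1) $ i - a $ i) / h = (x $ i - a $ i) / h + t / h" for x :: "real^'d" and t
    by (simp add: add_divide_distrib diff_divide_distrib)
   show "\<bar>?\<psi> (x + t *\<^sub>R axis i 1) $ i - ?\<psi> x $ i\<bar> \<le> 2 * C / h * \<bar>t\<bar>" for x t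
   proof -
    have "\<bar>face_val a h \<phi> i x (m + 1) - face_val a h \<phi> i x m\<bar> \<le> 2 * C" for m
     using fC[of i x "m + 1"] fC[of i x m] by linarith
    hence "\<bar>interp (face_val a h \<phi> i x) ((x $ i - a $ i) / h + t / h) - interp (face_val a h \<phi> i x) ((x $ i - a $ i) / h)\<bar>
      \<le> 2 * C * \<bar>(x $ i - a $ i) / h + t / h - (x $ i - a $ i) / h\<bar>" by (rule interp_lipschitz)
    thus ?thesis using h unfolding RT_interp_def vec_lambda_beta fv u by (simp add: abs_divide)
   qed
   show "AE x in lborel. ((\<lambda>t. ?\<psi> (x + t *\<^sub>R axis i 1) $ i) has_real_derivative RT_slope a h \<phi> i x) (at 0)"
    using AE_not_grid[OF h, of a]
   proof eventually_elim
    case (elim x)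
    let ?n = "face_val a h \<phi> i x" and ?u = "(x $ i - a $ i) / h"
    have "?u \<notin> \<int>" using elim by (auto simp: grid_def)
    hence "(interp ?n has_real_derivative (?n (\<lfloor>?u\<rfloor> + 1) - ?n \<lfloor>?u\<rfloor>)) (at (?u + 0 / h))"
     using interp_deriv by simp
    moreover have "((\<lambda>t. ?u + t / h) has_real_derivative 1 / h) (at 0)" using h by (auto intro!: derivative_eq_intros)
    ultimately have "((\<lambda>t. interp ?n (?u + t / h)) has_real_derivative (?n (\<lfloor>?u\<rfloor> + 1) - ?n \<lfloor>?u\<rfloor>) * (1 / h)) (at 0)"
     by (rule DERIV_chain2)
    thus ?case unfolding RT_interp_def vec_lambda_beta fv u RT_slope_def by simp
   qed
  qed measurable
  have i1: "integrable lborel (\<lambda>x. ?\<psi> x $ i * (Df x \<bullet> axis i 1))" for i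
  proof (rule integrable_bounded_support[OF _ _ compact_imp_bounded[OF D(2)]])
   show "norm (?\<psi> x $ i * (Df x \<bullet> axis i 1)) \<le> C * C1" for x
    unfolding norm_mult using iC[of x i] C1(2)[of x] component_le_norm_cart[of "Df x" i] C0
    by (intro mult_mono) (auto simp: inner_axis)
   show "x \<in> Kf" if "?\<psi> x $ i * (Df x \<bullet> axis i 1) \<noteq> 0" for x using that by (intro D(5)) auto
  qed measurable
  have i2: "integrable lborel (\<lambda>x. RT_slope a h \<phi> i x * f x)" for i
  proof (rule integrable_bounded_support[OF _ _ compact_imp_bounded[OF D(2)]])
   show "norm (RT_slope a h \<phi> i x * f x) \<le> (2 * C / h) * C2" for x
    unfolding norm_mult using sC[of i x] C2(2)[of x] C0 h by (intro mult_mono) auto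
   show "x \<in> Kf" if "RT_slope a h \<phi> i x * f x \<noteq> 0" for x using that by (intro D(4)) auto
  qed measurable
  have conv: "(\<integral>x. u x \<partial>lebesgue_on \<O>) = (LBINT x. u x)"
   if [measurable]: "u \<in> Borel" and 0: "\<And>x. u x \<noteq> 0 ==> x \<in> Kf" for u :: "real^'d => real"
  proof -
   have "ind \<O> x * u x = u x" for x using 0[of x] D(3) by (auto simp: indicator_def)
   hence "(\<integral>x. u x \<partial>lebesgue_on \<O>) = (\<integral>x. u x \<partial>lebesgue)"
    unfolding integral_lebesgue_on_eq[OF \<O>(1)] by presburger
   also have "... = (LBINT x. u x)" by (rule integral_completion) measurable
   finally show ?thesis .
  qed
  have "(\<integral>x. ?\<psi> x \<bullet> (\<chi> i. partial_deriv i f x) \<partial>lebesgue_on \<O>) = (\<integral>x. (\<Sum>i\<in>UNIV. ?\<psi> x $ i * (Df x \<bullet> axis i 1)) \<partial>lebesgue_on \<O>)"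
   unfolding inner_vec_def[of "?\<psi> _"] C1_grad_partial_deriv[OF D(1)] by (simp add: inner_axis)
  also have "... = (LBINT x. (\<Sum>i\<in>UNIV. ?\<psi> x $ i * (Df x \<bullet> axis i 1)))"
  proof (rule conv)
   show "x \<in> Kf" if "(\<Sum>i\<in>UNIV. ?\<psi> x $ i * (Df x \<bullet> axis i 1)) \<noteq> 0" for x
    using that by (intro D(5)) auto
  qed measurable
  also have "... = (\<Sum>i\<in>UNIV. - (LBINT x. RT_slope a h \<phi> i x * f x))"
   using i1 by (simp add: lint_sum ibp)
  also have "... = - (LBINT x. ?g x * f x)"
   using i2 by (simp add: sum_negf sum_distrib_right lint_sum)
  also have "(LBINT x. ?g x * f x) = (\<integral>x. ?g x * f x \<partial>lebesgue_on \<O>)"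
  proof (rule conv[symmetric])
   show "x \<in> Kf" if "?g x * f x \<noteq> 0" for x using that by (intro D(4)) auto
  qed measurable
  finally show "(\<integral>x. ?\<psi> x \<bullet> (\<chi> i. partial_deriv i f x) \<partial>lebesgue_on \<O>) = - (\<integral>x. ?g x * f x \<partial>lebesgue_on \<O>)" .
 qed
 have cell: "\<exists>A B. \<forall>x\<in>lcell a h k. ?\<psi> x = (\<chi> i. A $ i + B $ i * x $ i)" for k
 proof -
  define c where "c i m = \<phi> (\<chi> j. a $ j + h * (if j = i then real_of_int m else real_of_int (k $ j) + 1 / 2)) $ i" for i m
  define A where "A = (\<chi> i. (1 + a $ i / h + real_of_int (k $ i)) * c i (k $ i) - (a $ i / h + real_of_int (k $ i)) * c i (k $ i + 1))"
  define B where "B = (\<chi> i. (c i (k $ i + 1) - c i (k $ i)) / h)"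
  have "?\<psi> x = (\<chi> i. A $ i + B $ i * x $ i)" if x: "x \<in> lcell a h k" for x
  proof -
   have fl: "\<lfloor>(x $ j - a $ j) / h\<rfloor> = k $ j" for j
    using lcell_lindex[OF h x] by (simp add: lindex_def vec_eq_iff)
   have "face_val a h \<phi> i x m = c i m" for i m
    by (simp add: face_val_def face_point_def c_def fl cong: if_cong)
   thus ?thesis
    using h by (simp add: vec_eq_iff RT_interp_def interp_def fl A_def B_def field_simps)
  qed
  thus ?thesis by blast
 qed
 have RT0: "?\<psi> \<in> RT0 \<O> \<Q>"
 proof -
  have "interior (ccell a h k) = lcell a h k" for k
   unfolding ccell_def lcell_def by (rule interior_cbox)
  thus ?thesis unfolding RT0_def Hdiv_def \<Q> using \<psi>L2 gL2 wd cell by auto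
 qed
 show "?\<psi> \<in> RT0_0 \<O> \<Q>"
  unfolding RT0_0_def
 proof (intro CollectI conjI allI impI ballI RT0)
  fix x n Q assume n: "outer_unit_normal \<O> x n"
  have x: "x \<notin> \<O>" using n \<O>(1) by (auto simp: outer_unit_normal_def frontier_def interior_open)
  \<comment> \<open>One half of the distance \<rho> is used up by \<open>y\<close>, the other half
    by the spread of the interpolation; this accounts for the factor 2 in the hypothesis on
    \<open>h\<close>.\<close>
  have "?\<psi> y = 0" if y: "dist y x < \<rho> / 2" for y
  proof (rule ccontr)
   assume "?\<psi> y \<noteq> 0"
   then obtain i where "?\<psi> y $ i \<noteq> 0" by (auto simp: vec_eq_iff)
   then obtain z where z: "z \<in> K" "dist z y \<le> sqrt (real CARD('d)) * h" using supp by blast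
   hence "dist z x < \<rho>" using y \<rho>(2) dist_triangle[of z x y] by linarith
   hence "x \<in> ball z \<rho>" by simp
   thus False using \<rho>(1) z(1) x by blast
  qed
  moreover have "0 < \<rho> / 2" using \<rho>(2) h by (smt (verit) divide_pos_pos mult_nonneg_nonneg real_sqrt_ge_zero of_nat_0_le_iff)
  ultimately have "\<forall>\<^sub>F y in at x within interior Q. ?\<psi> y \<bullet> n = 0"
   unfolding eventually_at by (intro exI[of _ "\<rho> / 2"]) auto
  thus "((\<lambda>y. ?\<psi> y \<bullet> n) \<longlongrightarrow> 0) (at x within interior Q)" by (rule tendsto_eventually)
 qed
qed

text \<open>The interpolant exceeds the norm bound by at most \<epsilon> and is divided by 1 +
  \<epsilon>; before this scaling its slopes are derivatives of \<phi> at nearby points. The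
  threshold \<open>h0\<close> depends on \<phi> and \<epsilon> but not on the mesh or on
  \<open>w\<close>, so the estimate applies along a sequence in which both vary.\<close>

lemma TVh_lower_bound:
 fixes \<O> :: "(real^'d) set"
 assumes \<O>: "open \<O>" "bounded \<O>" and \<phi>: "\<phi> \<in> C1c \<O>" "\<And>x. x \<in> \<O> ==> norm (\<phi> x) \<le> 1" and \<epsilon>: "\<epsilon> > 0"
 obtains h0 where "h0 > 0"
  "\<And>h \<Q> a X w V B. h < h0 ==> lattice_mesh \<O> h \<Q> a X ==> integrable (lebesgue_on \<O>) w ==>
    AE x in lebesgue_on \<O>. \<bar>w x\<bar> \<le> B ==> 0 \<le> B ==> TVh \<O> \<Q> w \<le> ereal V ==>
    (\<integral>x. w x * divergence \<phi> x \<partial>lebesgue_on \<O>) \<le> (1 + \<epsilon>) * V + B * \<epsilon> * measure lebesgue \<O>"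
proof -
 obtain Df K where D: "\<And>i. C1_grad (\<lambda>x. \<phi> x $ i) (Df i)" and K: "compact K" "K \<subseteq> \<O>"
  and \<phi>K: "\<And>x. \<phi> x \<noteq> 0 ==> x \<in> K" and DK: "\<And>i x. Df i x \<noteq> 0 ==> x \<in> K"
  and div: "\<And>x. divergence \<phi> x = (\<Sum>i\<in>UNIV. Df i x $ i)"
  using \<phi>(1) by (rule C1c_vecE) (assumption | rule that)+
 have \<phi>1: "norm (\<phi> x) \<le> 1" for x
 proof (cases "\<phi> x = 0")
  case False
  thus ?thesis using \<phi>(2) \<phi>K K(2) by blast
 qed simp
 have \<phi>m[measurable]: "\<phi> \<in> Borel"
 proof (rule borel_measurable_euclidean_space[THEN iffD2], rule ballI)
  fix b :: "real^'d" assume "b \<in> Basis"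
  then obtain j where b: "b = axis j 1" by (auto simp: Basis_vec_def)
  show "(\<lambda>x. \<phi> x \<bullet> b) \<in> Borel" using C1_grad_measurable(1)[OF D[of j]] by (simp add: b inner_axis)
 qed
 obtain \<rho> where \<rho>: "\<rho> > 0" "(\<Union>x\<in>K. ball x \<rho>) \<subseteq> \<O>"
  using compact_subset_open_imp_ball_epsilon_subset[OF K(1) \<O>(1) K(2)] by blast
 let ?d = "real CARD('d)"
 \<comment> \<open>Small enough for the errors of all d components to add up to at most
   \<epsilon>.\<close>
 define e where "e = \<epsilon> / ?d"
 have d1: "?d \<ge> 1" using zero_less_card_finite[where 'a='d] by linarith
 have e: "e > 0" using \<epsilon> d1 by (simp add: e_def)
 have "\<exists>r>0. \<forall>x y. dist x y < r --> \<bar>\<phi> x $ i - \<phi> y $ i\<bar> < e" for i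
  by (rule uniformly_continuous_of_compact_support[OF C1_grad_continuous[OF D[of i]] K(1) _ e])
   (use \<phi>K in force, auto)
 then obtain r1 where r1: "\<And>i. r1 i > 0" "\<And>i x y. dist x y < r1 i ==> \<bar>\<phi> x $ i - \<phi> y $ i\<bar> < e" by metis
 have "\<exists>r>0. \<forall>x y. dist x y < r --> norm (Df i x - Df i y) < e" for i
  by (rule uniformly_continuous_of_compact_support[OF _ K(1) DK[of i] e, of "Df i"])
   (use D[of i] in \<open>auto simp: C1_grad_def\<close>)
 then obtain r2 where r2: "\<And>i. r2 i > 0" "\<And>i x y. dist x y < r2 i ==> norm (Df i x - Df i y) < e" by metis
 \<comment> \<open>All moduli of continuity and half of the distance to the boundary at once;
   \<open>h0\<close> turns \<open>r\<close> into a side length through the cell diameter sqrt d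
   h.\<close>
 define r where "r = Min (insert (\<rho> / 2) (range r1 \<union> range r2))"
 have r: "r > 0" unfolding r_def using r1(1) r2(1) \<rho>(1) by (subst Min_gr_iff) auto
 have rle: "r \<le> \<rho> / 2" "r \<le> r1 i" "r \<le> r2 i" for i unfolding r_def by (rule Min_le; simp)+
 define h0 where "h0 = r / sqrt ?d"
 have h0: "h0 > 0" using r d1 by (simp add: h0_def)
 define c where "c = 1 / (1 + \<epsilon>)"
 have c: "0 < c" "c \<le> 1" "c * (1 + \<epsilon>) = 1" using \<epsilon> by (auto simp: c_def)
 define \<phi>' where "\<phi>' x = c *\<^sub>R \<phi> x" for x
 have main: "(\<integral>x. w x * divergence \<phi> x \<partial>lebesgue_on \<O>) \<le> (1 + \<epsilon>) * V + B * \<epsilon> * measure lebesgue \<O>"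
  if hh: "h < h0" and lm: "lattice_mesh \<O> h \<Q> a X" and w: "integrable (lebesgue_on \<O>) w"
   and B: "AE x in lebesgue_on \<O>. \<bar>w x\<bar> \<le> B" "0 \<le> B" and V: "TVh \<O> \<Q> w \<le> ereal V" for h \<Q> a X w V B
 proof -
  have h: "h > 0" using lm unfolding lattice_mesh_def by blast
  have hr: "sqrt ?d * h < r" using hh d1 by (simp add: h0_def pos_less_divide_eq mult.commute)
  let ?\<psi> = "RT_interp a h \<phi>'" and ?g = "\<lambda>x. \<Sum>i\<in>UNIV. RT_slope a h \<phi>' i x"
  have m'[measurable]: "\<phi>' \<in> Borel" unfolding \<phi>'_def by measurable
  have C': "norm (\<phi>' x) \<le> 1" for x
   unfolding \<phi>'_def norm_scaleR using c \<phi>1[of x] by (simp add: mult_le_one)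
  have K': "x \<in> K" if "\<phi>' x \<noteq> 0" for x using that by (intro \<phi>K) (auto simp: \<phi>'_def)
  have \<rho>': "2 * (sqrt ?d * h) < \<rho>" using hr rle(1) by linarith
  note RT = RT_interp_in_RT0_0[OF \<O> lm m' C' K' \<rho>(2) \<rho>']
  note [measurable] = RT_interp_measurable[OF m']
  have fv: "face_val a h \<phi>' i x m = c * face_val a h \<phi> i x m" for i x m by (simp add: face_val_def \<phi>'_def)
  have near: "\<bar>interp (face_val a h \<phi> i x) ((x $ i - a $ i) / h) - \<phi> x $ i\<bar> \<le> e" for i x
  proof (rule interp_convex)
   have "\<bar>face_val a h \<phi> i x m - \<phi> x $ i\<bar> \<le> e" if "m = \<lfloor>(x $ i - a $ i) / h\<rfloor> \<or> m = \<lfloor>(x $ i - a $ i) / h\<rfloor> + 1" for m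
   proof -
    have "dist (face_point a h i x m) x \<le> sqrt ?d * h" using face_point_near(2)[OF h that, of 0] by simp
    hence "dist (face_point a h i x m) x < r1 i" using hr rle(2)[of i] by linarith
    thus ?thesis unfolding face_val_def by (intro less_imp_le r1(2))
   qed
   thus "\<bar>face_val a h \<phi> i x \<lfloor>(x $ i - a $ i) / h\<rfloor> - \<phi> x $ i\<bar> \<le> e"
    "\<bar>face_val a h \<phi> i x (\<lfloor>(x $ i - a $ i) / h\<rfloor> + 1) - \<phi> x $ i\<bar> \<le> e" by blast+
  qed
  have \<psi>1: "norm (?\<psi> x) \<le> 1" for x
  proof -
   let ?p = "RT_interp a h \<phi> x"
   have "\<bar>(?p - \<phi> x) $ i\<bar> \<le> e" for i using near[of i x] by (simp add: RT_interp_def)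
   hence "norm (?p - \<phi> x) \<le> sqrt ?d * e" by (rule norm_le_sqrt_dim)
   also have "... \<le> ?d * e" using e d1 by (intro mult_right_mono real_le_lsqrt) (auto simp: power2_eq_square)
   also have "... = \<epsilon>" using d1 by (simp add: e_def)
   finally have "norm ?p \<le> 1 + \<epsilon>" using \<phi>1[of x] norm_triangle_ineq2[of ?p "\<phi> x"] by linarith
   moreover have "?\<psi> x = c *\<^sub>R ?p"
    by (simp add: vec_eq_iff RT_interp_def interp_def fv algebra_simps)
   ultimately have "norm (?\<psi> x) \<le> c * (1 + \<epsilon>)" using c(1) by (simp only: norm_scaleR abs_of_pos mult_left_mono less_imp_le)
   thus ?thesis using c(3) by simp
  qed
  have L1: "Linf_norm \<O> ?\<psi> \<le> 1"
   unfolding Linf_norm_def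
  proof (rule esssup_I)
   have "?\<psi> \<in> borel_measurable (lebesgue_on \<O>)"
    by (intro measurable_restrict_space1 measurable_completion) measurable
   thus "(\<lambda>x. ereal (norm (?\<psi> x))) \<in> borel_measurable (lebesgue_on \<O>)" by measurable
   show "AE x in lebesgue_on \<O>. ereal (norm (?\<psi> x)) \<le> 1"
    using \<psi>1 by (intro AE_I2) (simp add: one_ereal_def)
  qed
  have "ereal (\<integral>x. w x * ?g x \<partial>lebesgue_on \<O>) \<le> TVh \<O> \<Q> w"
   unfolding TVh_def using RT L1 by (intro SUP_upper2[of "(?\<psi>, ?g)"]) auto
  hence "ereal (\<integral>x. w x * ?g x \<partial>lebesgue_on \<O>) \<le> ereal V" using V by (rule order_trans)
  hence le: "(\<integral>x. w x * ?g x \<partial>lebesgue_on \<O>) \<le> V" by (simp only: ereal_less_eq)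
  \<comment> \<open>A slope is a difference quotient between the centers of opposite faces, hence by
    the mean value theorem a derivative at a point within sqrt d h of \<open>x\<close>.\<close>
  have slope: "\<bar>(1 + \<epsilon>) * ?g x - divergence \<phi> x\<bar> \<le> \<epsilon>" for x
  proof -
   have "\<bar>RT_slope a h \<phi> i x - Df i x $ i\<bar> \<le> e" for i
   proof -
    let ?p = "face_point a h i x \<lfloor>(x $ i - a $ i) / h\<rfloor>"
    define F where "F t = \<phi> (?p + t *\<^sub>R axis i 1) $ i" for t
    have "DERIV F t :> Df i (?p + t *\<^sub>R axis i 1) $ i" for t
    proof -
     have "((\<lambda>x. \<phi> x $ i) has_derivative (\<lambda>v. Df i (?p + t *\<^sub>R axis i 1) \<bullet> v)) (at (?p + t *\<^sub>R axis i 1))"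
      using D[of i] by (auto simp: C1_grad_def)
     moreover have "((\<lambda>t. ?p + t *\<^sub>R axis i 1) has_derivative (\<lambda>s. s *\<^sub>R axis i 1)) (at t)"
      by (auto intro!: derivative_eq_intros)
     ultimately have "(F has_derivative (\<lambda>s. Df i (?p + t *\<^sub>R axis i 1) \<bullet> (s *\<^sub>R axis i 1))) (at t)"
      unfolding F_def by (rule has_derivative_compose[rotated])
     moreover have "(\<lambda>s. Df i (?p + t *\<^sub>R axis i 1) \<bullet> (s *\<^sub>R axis i 1)) = (*) (Df i (?p + t *\<^sub>R axis i 1) $ i)"
      by (auto simp: inner_axis mult.commute)
     ultimately show ?thesis by (simp add: has_field_derivative_def)
    qed
    then obtain t where t: "0 < t" "t < h" "F h - F 0 = (h - 0) * Df i (?p + t *\<^sub>R axis i 1) $ i"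
     using MVT2[of 0 h F "\<lambda>t. Df i (?p + t *\<^sub>R axis i 1) $ i"] h by auto
    have "face_point a h i x (\<lfloor>(x $ i - a $ i) / h\<rfloor> + 1) = ?p + h *\<^sub>R axis i 1"
     by (simp add: vec_eq_iff face_point_def axis_def algebra_simps)
    hence "RT_slope a h \<phi> i x = (F h - F 0) / h" by (simp add: RT_slope_def face_val_def F_def)
    hence sl: "RT_slope a h \<phi> i x = Df i (?p + t *\<^sub>R axis i 1) $ i" using t(3) h by simp
    have "?p + t *\<^sub>R axis i 1 = ?p + axis i ((t / h) * h)" using h by (simp add: vec_eq_iff axis_def)
    hence "dist (?p + t *\<^sub>R axis i 1) x \<le> sqrt ?d * h"
     using face_point_near(1)[OF h, of "\<lfloor>(x $ i - a $ i) / h\<rfloor>" x i a "t / h"] t h by simp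
    hence "dist (?p + t *\<^sub>R axis i 1) x < r2 i" using hr rle(3)[of i] by linarith
    hence "norm (Df i (?p + t *\<^sub>R axis i 1) - Df i x) < e" by (rule r2(2))
    thus ?thesis unfolding sl
     using component_le_norm_cart[of "Df i (?p + t *\<^sub>R axis i 1) - Df i x" i] by simp
   qed
   hence "(\<Sum>i\<in>UNIV. \<bar>RT_slope a h \<phi> i x - Df i x $ i\<bar>) \<le> (\<Sum>i\<in>(UNIV::'d set). e)" by (intro sum_mono)
   hence "\<bar>\<Sum>i\<in>UNIV. RT_slope a h \<phi> i x - Df i x $ i\<bar> \<le> ?d * e"
    by (intro order_trans[OF sum_abs]) simp
   moreover have "(1 + \<epsilon>) * ?g x = (\<Sum>i\<in>UNIV. RT_slope a h \<phi> i x)"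
   proof -
    have "?g x = c * (\<Sum>i\<in>UNIV. RT_slope a h \<phi> i x)"
     by (simp add: RT_slope_def fv sum_distrib_left right_diff_distrib diff_divide_distrib)
    hence "(1 + \<epsilon>) * ?g x = (c * (1 + \<epsilon>)) * (\<Sum>i\<in>UNIV. RT_slope a h \<phi> i x)" by (simp only: mult_ac)
    thus ?thesis using c(3) by simp
   qed
   moreover have "?d * e = \<epsilon>" using d1 by (simp add: e_def)
   ultimately show ?thesis by (simp add: div sum_subtractf)
  qed
  obtain C where C: "\<And>x. \<bar>divergence \<phi> x\<bar> \<le> C" and "divergence \<phi> \<in> Borel"
   using \<phi>(1) by (rule divergence_bounded) blast
  hence divm: "divergence \<phi> \<in> borel_measurable (lebesgue_on \<O>)"
   by (intro measurable_restrict_space1 measurable_completion) simp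
  have gm: "?g \<in> borel_measurable (lebesgue_on \<O>)"
   by (intro measurable_restrict_space1 measurable_completion) measurable
  have wm: "w \<in> borel_measurable (lebesgue_on \<O>)" using w by (rule borel_measurable_integrable)
  have i1: "integrable (lebesgue_on \<O>) (\<lambda>x. w x * divergence \<phi> x)"
  proof (rule lintegrable_bound)
   show "integrable (lebesgue_on \<O>) (\<lambda>x. C * w x)" using w by simp
   show "AE x in lebesgue_on \<O>. norm (w x * divergence \<phi> x) \<le> norm (C * w x)"
   proof (rule AE_I2)
    fix x
    have "\<bar>w x\<bar> * \<bar>divergence \<phi> x\<bar> \<le> \<bar>w x\<bar> * \<bar>C\<bar>" using C[of x] by (intro mult_left_mono) auto
    thus "norm (w x * divergence \<phi> x) \<le> norm (C * w x)" by (simp add: abs_mult mult.commute)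
   qed
  qed (use wm divm in measurable)
  have i2: "integrable (lebesgue_on \<O>) (\<lambda>x. w x * ?g x)"
  proof (rule lintegrable_bound)
   show "integrable (lebesgue_on \<O>) (\<lambda>x. (C + \<epsilon>) * w x)" using w by simp
   show "AE x in lebesgue_on \<O>. norm (w x * ?g x) \<le> norm ((C + \<epsilon>) * w x)"
   proof (rule AE_I2)
    fix x
    have "\<bar>?g x\<bar> \<le> (1 + \<epsilon>) * \<bar>?g x\<bar>" using \<epsilon> by (simp add: algebra_simps)
    also have "... = \<bar>(1 + \<epsilon>) * ?g x\<bar>" using \<epsilon> by (simp add: abs_mult)
    also have "... \<le> C + \<epsilon>" using slope[of x] C[of x] by linarith
    finally have "\<bar>w x\<bar> * \<bar>?g x\<bar> \<le> \<bar>w x\<bar> * \<bar>C + \<epsilon>\<bar>" by (intro mult_left_mono) auto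
    thus "norm (w x * ?g x) \<le> norm ((C + \<epsilon>) * w x)" by (simp add: abs_mult mult.commute)
   qed
  qed (use wm gm in measurable)
  have fin: "finite_measure (lebesgue_on \<O>)" using \<O> by (intro finite_measure_lebesgue_on lmeasurable_open)
  have "(\<integral>x. w x * divergence \<phi> x \<partial>lebesgue_on \<O>) - (1 + \<epsilon>) * (\<integral>x. w x * ?g x \<partial>lebesgue_on \<O>)
    = (\<integral>x. w x * divergence \<phi> x - (1 + \<epsilon>) * (w x * ?g x) \<partial>lebesgue_on \<O>)"
   using i1 i2 by simp
  also have "... \<le> (\<integral>x. B * \<epsilon> \<partial>lebesgue_on \<O>)"
  proof (rule integral_mono_AE)
   show "integrable (lebesgue_on \<O>) (\<lambda>x. w x * divergence \<phi> x - (1 + \<epsilon>) * (w x * ?g x))"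
    using i1 i2 by (intro lintegrable_diff integrable_mult_right)
   show "integrable (lebesgue_on \<O>) (\<lambda>x. B * \<epsilon>)" using fin by (rule finite_measure.integrable_const)
   show "AE x in lebesgue_on \<O>. w x * divergence \<phi> x - (1 + \<epsilon>) * (w x * ?g x) \<le> B * \<epsilon>"
    using B(1)
   proof eventually_elim
    case (elim x)
    have "w x * divergence \<phi> x - (1 + \<epsilon>) * (w x * ?g x) = w x * (divergence \<phi> x - (1 + \<epsilon>) * ?g x)"
     by (simp add: algebra_simps)
    also have "... \<le> \<bar>w x\<bar> * \<bar>divergence \<phi> x - (1 + \<epsilon>) * ?g x\<bar>" unfolding abs_mult[symmetric] by (rule abs_ge_self)
    also have "... \<le> B * \<epsilon>" using elim slope[of x] B(2) by (intro mult_mono) (auto simp: abs_minus_commute)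
    finally show ?case .
   qed
  qed
  also have "... = B * \<epsilon> * measure lebesgue \<O>"
   using \<O>(1) by (simp add: measure_restrict_space)
  finally have "(\<integral>x. w x * divergence \<phi> x \<partial>lebesgue_on \<O>)
    \<le> (1 + \<epsilon>) * (\<integral>x. w x * ?g x \<partial>lebesgue_on \<O>) + B * \<epsilon> * measure lebesgue \<O>" by simp
  also have "(1 + \<epsilon>) * (\<integral>x. w x * ?g x \<partial>lebesgue_on \<O>) \<le> (1 + \<epsilon>) * V"
   using le \<epsilon> by (intro mult_left_mono) auto
  finally show ?thesis by simp
 qed
 show ?thesis by (rule that[OF h0]) (rule main)
qed

section \<open>Compactness in \<open>L\<^sup>1\<close>\<close>

lemma integral_divergence_tendsto:
 fixes \<O> :: "(real^'d) set"
 assumes \<O>: "bounded \<O>" "open \<O>" and u[measurable]: "\<And>n. u n \<in> Borel" and Bu: "\<And>n x. \<bar>u n x\<bar> \<le> B"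
  and v[measurable]: "v \<in> Borel" and Bv: "\<And>x. \<bar>v x\<bar> \<le> B"
  and lim: "(\<lambda>n. \<integral>x. ind \<O> x * \<bar>u n x - v x\<bar> \<partial>lborel) \<longlonglongrightarrow> 0"
  and g[measurable]: "g \<in> Borel" and C: "0 \<le> C" "\<And>x. \<bar>g x\<bar> \<le> C" and g0: "\<And>x. x \<notin> \<O> ==> g x = 0"
 shows "(\<lambda>n. \<integral>x. u n x * g x \<partial>lborel) \<longlonglongrightarrow> (LBINT x. v x * g x)"
proof -
 have B0: "0 \<le> B" using Bv[of 0] by linarith
 have [measurable]: "\<O> \<in> sets borel" using \<O> by (auto intro: borel_open)
 have ig: "integrable lborel (\<lambda>x. y x * g x)" if [measurable]: "y \<in> Borel" and Y: "\<And>x. \<bar>y x\<bar> \<le> B" for y :: "real^'d => real"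
 proof (rule integrable_bounded_support[OF _ _ \<O>(1)])
  show "norm (y x * g x) \<le> B * C" for x
   unfolding norm_mult using Y[of x] C(2)[of x] B0 by (intro mult_mono) auto
  show "x \<in> \<O>" if "y x * g x \<noteq> 0" for x using that g0[of x] by auto
 qed measurable
 have iu: "integrable lborel (\<lambda>x. ind \<O> x * \<bar>u n x - v x\<bar>)" for n
 proof (rule integrable_bounded_support[OF _ _ \<O>(1)])
  show "norm (ind \<O> x * \<bar>u n x - v x\<bar>) \<le> 2 * B" for x
   using Bu[of n x] Bv[of x] B0 by (auto simp: indicator_def)
 qed (auto simp: indicator_def split: if_splits)
 have "\<bar>(LBINT x. u n x * g x) - (LBINT x. v x * g x)\<bar> \<le> C * (LBINT x. ind \<O> x * \<bar>u n x - v x\<bar>)" for n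
 proof -
  have "(LBINT x. u n x * g x) - (LBINT x. v x * g x) = (LBINT x. u n x * g x - v x * g x)"
   using ig[OF u Bu] ig[OF v Bv] by simp
  also have "\<bar>...\<bar> \<le> (LBINT x. C * (ind \<O> x * \<bar>u n x - v x\<bar>))"
   unfolding real_norm_def[symmetric]
  proof (rule lint_norm_bound_lint)
   show "integrable lborel (\<lambda>x. u n x * g x - v x * g x)" using ig[OF u Bu] ig[OF v Bv] by simp
   show "integrable lborel (\<lambda>x. C * (ind \<O> x * norm (u n x - v x)))" using iu[of n] by simp
   show "norm (u n x * g x - v x * g x) \<le> C * (ind \<O> x * norm (u n x - v x))" for x
   proof (cases "x \<in> \<O>")
    case True
    have "norm (u n x * g x - v x * g x) = \<bar>g x\<bar> * \<bar>u n x - v x\<bar>"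
     by (simp add: abs_mult[symmetric] algebra_simps)
    also have "... \<le> C * \<bar>u n x - v x\<bar>" using C(2)[of x] by (intro mult_right_mono) auto
    finally show ?thesis using True by simp
   qed (simp add: g0)
  qed
  finally show ?thesis by simp
 qed
 hence "(\<lambda>n. (LBINT x. u n x * g x) - (LBINT x. v x * g x)) \<longlonglongrightarrow> 0"
  by (intro Lim_null_comparison[OF _ tendsto_mult_right_zero[OF lim, of C]]) auto
 thus ?thesis by (simp add: LIM_zero_iff)
qed

lemma tv_le_limit:
 fixes \<O> :: "(real^'d) set"
 assumes \<O>: "bounded \<O>" "open \<O>" and u: "\<And>n. u n \<in> Borel" "\<And>n x. \<bar>u n x\<bar> \<le> B"
  and tv: "\<And>n. tv_le \<O> (u n) M" and v: "v \<in> Borel" "\<And>x. \<bar>v x\<bar> \<le> B"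
  and lim: "(\<lambda>n. \<integral>x. ind \<O> x * \<bar>u n x - v x\<bar> \<partial>lborel) \<longlonglongrightarrow> 0"
 shows "tv_le \<O> v M"
 unfolding tv_le_def
proof (intro ballI impI)
 fix \<phi> :: "real^'d => real^'d" assume \<phi>: "\<phi> \<in> C1c \<O>" "\<forall>x\<in>\<O>. norm (\<phi> x) \<le> 1"
 obtain C where C: "0 \<le> C" "\<And>x. \<bar>divergence \<phi> x\<bar> \<le> C" "divergence \<phi> \<in> Borel"
  "\<And>x. x \<notin> \<O> ==> divergence \<phi> x = 0"
  using \<phi>(1) by (rule divergence_bounded) (assumption | rule that)+
 have conv: "(\<lambda>n. \<integral>x. u n x * divergence \<phi> x \<partial>lborel) \<longlonglongrightarrow> (LBINT x. v x * divergence \<phi> x)"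
  using \<O> u v lim C(3) C(1,2,4) by (rule integral_divergence_tendsto)
 have "(LBINT x. u n x * divergence \<phi> x) \<le> M" for n using tv[of n] \<phi> by (simp add: tv_le_def)
 thus "(LBINT x. v x * divergence \<phi> x) \<le> M" by (intro LIMSEQ_le_const2[OF conv]) auto
qed

text \<open>A value differs from the cell mean by at most the mean of its differences to all values
  in the cell; this brings in the double integral of \<open>poincare_cells\<close>.\<close>

lemma cell_deviation:
 fixes v :: "real^'d => real"
 assumes h: "h > 0" and v[measurable]: "v \<in> Borel" and C: "\<And>x. \<bar>v x\<bar> \<le> C"
 shows "(LBINT x. ind (lcell a h k) x * \<bar>v x - (LBINT z. ind (lcell a h k) z * v z) / h^CARD('d)\<bar>)
  \<le> (LBINT x. (LBINT z. ind (lcell a h k) x * ind (lcell a h k) z * \<bar>v z - v x\<bar>)) / h^CARD('d)"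
proof -
 let ?Q = "lcell a h k" and ?H = "h^CARD('d)"
 define m where "m = (LBINT z. ind ?Q z * v z) / ?H"
 have H: "?H > 0" using h by simp
 have C0: "0 \<le> C" using C[of 0] by linarith
 have [measurable]: "?Q \<in> sets borel" by (simp add: lcell_def)
 have iQ: "(LBINT z. ind ?Q z * b) = ?H * b" for b
  using measure_lcell[OF h, of a k] by simp
 have iv: "integrable lborel (\<lambda>z. ind ?Q z * v z)" by (rule integrable_cell[OF v C])
 have ic: "integrable lborel (\<lambda>z. ind ?Q z * b)" for b :: real
  by (rule integrable_cell[of _ "\<bar>b\<bar>"]) auto
 have q: "\<bar>\<bar>v z - v x\<bar>\<bar> \<le> 2 * C" for x z using C[of x] C[of z] by linarith
 have iq: "integrable lborel (\<lambda>z. ind ?Q z * \<bar>v z - v x\<bar>)" for x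
  by (rule integrable_cell[OF _ q]) measurable
 have dev: "\<bar>v x - m\<bar> \<le> (LBINT z. ind ?Q z * \<bar>v z - v x\<bar>) / ?H" for x
 proof -
  have "?H * (m - v x) = (LBINT z. ind ?Q z * v z) - (LBINT z. ind ?Q z * v x)"
   unfolding iQ m_def using H by (simp add: right_diff_distrib del: power_eq_0_iff)
  also have "... = (LBINT z. ind ?Q z * v z - ind ?Q z * v x)"
   using iv ic by simp
  also have "\<bar>...\<bar> \<le> (LBINT z. ind ?Q z * \<bar>v z - v x\<bar>)"
   unfolding real_norm_def[symmetric]
  proof (rule lint_norm_bound_lint)
   show "integrable lborel (\<lambda>z. ind ?Q z * v z - ind ?Q z * v x)" using iv ic by simp
   show "integrable lborel (\<lambda>z. ind ?Q z * norm (v z - v x))" using iq by simp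
  qed (auto simp: indicator_def)
  finally have "?H * \<bar>v x - m\<bar> \<le> (LBINT z. ind ?Q z * \<bar>v z - v x\<bar>)"
   using H by (simp add: abs_mult abs_minus_commute)
  thus ?thesis using H by (simp add: field_simps)
 qed
 let ?g = "\<lambda>x. \<integral>z. ind ?Q z * \<bar>v z - v x\<bar> \<partial>lborel"
 have gm: "?g \<in> Borel"
 proof -
  have "?g \<in> borel_measurable lborel" by measurable
  thus ?thesis by simp
 qed
 have gb: "\<bar>?g x\<bar> \<le> ?H * (2 * C)" for x
 proof -
  have "?g x \<le> (LBINT z. ind ?Q z * (2 * C))"
   using q[of _ x] by (intro integral_mono iq ic) (auto simp: indicator_def)
  moreover have "0 \<le> ?g x" by (intro lint_nonneg) auto
  ultimately show ?thesis unfolding iQ by linarith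
 qed
 have "(LBINT x. ind ?Q x * \<bar>v x - m\<bar>) \<le> (LBINT x. ind ?Q x * ?g x / ?H)"
 proof (rule integral_mono)
  have "\<bar>\<bar>v x - m\<bar>\<bar> \<le> C + \<bar>m\<bar>" for x using C[of x] by linarith
  thus "integrable lborel (\<lambda>x. ind ?Q x * \<bar>v x - m\<bar>)" by (intro integrable_cell) auto
  show "integrable lborel (\<lambda>x. ind ?Q x * ?g x / ?H)"
   using integrable_cell[OF gm gb, of a h k] by simp
  show "ind ?Q x * \<bar>v x - m\<bar> \<le> ind ?Q x * ?g x / ?H" for x
   using dev[of x] by (auto simp: indicator_def)
 qed
 thus ?thesis unfolding m_def by (simp add: mult.assoc)
qed

text \<open>By the Poincare inequality a function is close to its cell averages, and the averages rounded
 to a grid take finitely many values.\<close>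

lemma L1_total_boundedness:
 fixes \<O> :: "(real^'d) set" and w :: "'n => real^'d => real"
 assumes \<O>: "bounded \<O>" "open \<O>" and w[measurable]: "\<And>n. w n \<in> Borel" and B: "\<And>n x. \<bar>w n x\<bar> \<le> B"
  and tv: "\<And>n. tv_le \<O> (w n) M" and lm: "lattice_mesh \<O> h \<Q> a X"
 obtains col :: "'n => int^'d => int" where "finite (range col)"
  "\<And>m n. col m = col n ==> (LBINT x. ind \<O> x * \<bar>w m x - w n x\<bar>)
    \<le> 2 * (2^CARD('d) * (sqrt (real CARD('d)) * h) * M) + h * measure lborel \<O>"
proof -
 have h: "h > 0" and X: "finite X" using lm unfolding lattice_mesh_def by blast+
 let ?H = "h^CARD('d)"
 have H: "?H > 0" using h by simp
 have [measurable]: "lcell a h k \<in> sets borel" for k :: "int^'d" by (simp add: lcell_def)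
 define m where "m n k = (LBINT z. ind (lcell a h k) z * w n z) / ?H" for n k
 \<comment> \<open>Rounded cell means. The function is \<open>undefined\<close> outside
   \<open>X\<close>, so that the possible values form a subset of a finite product.\<close>
 define col where "col n = (\<lambda>k\<in>X. \<lfloor>m n k / h\<rfloor>)" for n
 have iQ: "(LBINT z. ind (lcell a h k) z * b) = ?H * b" for b k
  using measure_lcell[OF h, of a k] by simp
 have ic: "integrable lborel (\<lambda>z. ind (lcell a h k) z * b)" for b :: real and k :: "int^'d"
  by (rule integrable_cell[of _ "\<bar>b\<bar>"]) auto
 have mB: "\<bar>m n k\<bar> \<le> B" for n k
 proof -
  have "\<bar>\<integral>z. ind (lcell a h k) z * w n z \<partial>lborel\<bar> \<le> (LBINT z. ind (lcell a h k) z * B)"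
   unfolding real_norm_def[symmetric]
  proof (rule lint_norm_bound_lint)
   show "norm (ind (lcell a h k) x * w n x) \<le> ind (lcell a h k) x * B" for x
    using B[of n x] by (auto simp: indicator_def)
  qed (rule integrable_cell[OF w B] ic)+
  thus ?thesis unfolding iQ m_def abs_divide using H by (simp add: pos_divide_le_eq mult.commute)
 qed
 have "range col \<subseteq> (\<Pi>\<^sub>E k\<in>X. {\<lfloor>- B / h\<rfloor>..\<lfloor>B / h\<rfloor>})"
 proof
  fix f assume "f \<in> range col"
  then obtain n where f: "f = col n" by blast
  have "\<lfloor>- B / h\<rfloor> \<le> \<lfloor>m n k / h\<rfloor> \<and> \<lfloor>m n k / h\<rfloor> \<le> \<lfloor>B / h\<rfloor>" for k
   using mB[of n k] h by (intro conjI floor_mono divide_right_mono) linarith+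
  thus "f \<in> (\<Pi>\<^sub>E k\<in>X. {\<lfloor>- B / h\<rfloor>..\<lfloor>B / h\<rfloor>})" by (simp add: f col_def)
 qed
 hence fin: "finite (range col)" by (rule finite_subset) (use X in \<open>simp add: finite_PiE\<close>)
 have dev: "(\<Sum>k\<in>X. \<integral>x. ind (lcell a h k) x * \<bar>w n x - m n k\<bar> \<partial>lborel)
   \<le> 2^CARD('d) * (sqrt (real CARD('d)) * h) * M" for n
 proof -
  have "(\<Sum>k\<in>X. \<integral>x. ind (lcell a h k) x * \<bar>w n x - m n k\<bar> \<partial>lborel)
   \<le> (\<Sum>k\<in>X. (LBINT x. (LBINT z. ind (lcell a h k) x * ind (lcell a h k) z * \<bar>w n z - w n x\<bar>)) / ?H)"
   unfolding m_def by (intro sum_mono cell_deviation[OF h w B])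
  also have "... \<le> ((2 * h)^CARD('d) * (sqrt (real CARD('d)) * h) * M) / ?H"
   unfolding sum_divide_distrib[symmetric] using H poincare_cells[OF \<O> w B tv lm] by (intro divide_right_mono) auto
  also have "... = 2^CARD('d) * (sqrt (real CARD('d)) * h) * M" using H by (simp add: power_mult_distrib)
  finally show ?thesis .
 qed
 have main: "(LBINT x. ind \<O> x * \<bar>w i x - w j x\<bar>)
   \<le> 2 * (2^CARD('d) * (sqrt (real CARD('d)) * h) * M) + h * measure lborel \<O>" if eq: "col i = col j" for i j
 proof -
  have close: "\<bar>m i k - m j k\<bar> \<le> h" if "k \<in> X" for k
  proof -
   have "\<lfloor>m i k / h\<rfloor> = \<lfloor>m j k / h\<rfloor>" using fun_cong[OF eq, of k] that by (simp add: col_def)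
   hence "\<bar>m i k / h - m j k / h\<bar> \<le> 1" by linarith
   hence "\<bar>m i k - m j k\<bar> / h \<le> 1" using h by (simp add: diff_divide_distrib[symmetric] abs_divide)
   thus ?thesis using h by (simp add: pos_divide_le_eq)
  qed
  have wm: "\<bar>\<bar>w n x - m n k\<bar>\<bar> \<le> 2 * B" for n x k using B[of n x] mB[of n k] by linarith
  have id: "integrable lborel (\<lambda>x. ind (lcell a h k) x * \<bar>w n x - m n k\<bar>)" for n k
   by (rule integrable_cell[OF _ wm]) measurable
  have "\<bar>\<bar>w i x - w j x\<bar>\<bar> \<le> 2 * B" for x using B[of i x] B[of j x] by linarith
  hence "(LBINT x. ind \<O> x * \<bar>w i x - w j x\<bar>) = (\<Sum>k\<in>X. \<integral>x. ind (lcell a h k) x * \<bar>w i x - w j x\<bar> \<partial>lborel)"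
   by (intro integral_cells[OF \<O> lm]) auto
  also have "... \<le> (\<Sum>k\<in>X. (LBINT x. ind (lcell a h k) x * \<bar>w i x - m i k\<bar>)
    + (LBINT x. ind (lcell a h k) x * \<bar>w j x - m j k\<bar>) + (LBINT x. ind (lcell a h k) x * h))"
  proof (rule sum_mono)
   fix k assume k: "k \<in> X"
   have "(LBINT x. ind (lcell a h k) x * \<bar>w i x - w j x\<bar>)
    \<le> (LBINT x. ind (lcell a h k) x * \<bar>w i x - m i k\<bar> + ind (lcell a h k) x * \<bar>w j x - m j k\<bar> + ind (lcell a h k) x * h)"
   proof (rule integral_mono)
    have "\<bar>\<bar>w i x - w j x\<bar>\<bar> \<le> 2 * B" for x using B[of i x] B[of j x] by linarith
    thus "integrable lborel (\<lambda>x. ind (lcell a h k) x * \<bar>w i x - w j x\<bar>)" by (intro integrable_cell) auto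
    show "integrable lborel (\<lambda>x. ind (lcell a h k) x * \<bar>w i x - m i k\<bar> + ind (lcell a h k) x * \<bar>w j x - m j k\<bar> + ind (lcell a h k) x * h)"
     by (intro lintegrable_add id ic)
    show "ind (lcell a h k) x * \<bar>w i x - w j x\<bar>
     \<le> ind (lcell a h k) x * \<bar>w i x - m i k\<bar> + ind (lcell a h k) x * \<bar>w j x - m j k\<bar> + ind (lcell a h k) x * h" for x
     using close[OF k] by (cases "x \<in> lcell a h k") simp_all
   qed
   also have "... = (LBINT x. ind (lcell a h k) x * \<bar>w i x - m i k\<bar>)
    + (LBINT x. ind (lcell a h k) x * \<bar>w j x - m j k\<bar>) + (LBINT x. ind (lcell a h k) x * h)"
    by (simp only: lint_add id ic lintegrable_add)
   finally show "(LBINT x. ind (lcell a h k) x * \<bar>w i x - w j x\<bar>) \<le> ..." .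
  qed
  also have "... \<le> 2 * (2^CARD('d) * (sqrt (real CARD('d)) * h) * M) + (\<Sum>k\<in>X. \<integral>x. ind (lcell a h k) x * h \<partial>lborel)"
   unfolding sum.distrib using dev[of i] dev[of j] by linarith
  also have "(\<Sum>k\<in>X. \<integral>x. ind (lcell a h k) x * h \<partial>lborel) = (LBINT x. ind \<O> x * h)"
   by (rule integral_cells[OF \<O> lm, of _ "\<bar>h\<bar>", symmetric]) auto
  also have "... = h * measure lborel \<O>" using \<O> by simp
  finally show ?thesis .
 qed
 show ?thesis using fin main by (rule that)
qed

text \<open>A diagonal subsequence, with equal rounded means at every scale from some index on, has
  L1 increments at most (1/2)^n; hence the series of increments converges almost everywhere in the
  domain. The limit is formed pointwise so that it keeps the values in \<open>S\<close> and the
  bound at every point.\<close>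

lemma L1_compactness:
 fixes \<O> :: "(real^'d) set" and w :: "nat => real^'d => real"
 assumes \<O>: "bounded \<O>" "open \<O>" and w[measurable]: "\<And>n. w n \<in> Borel" and B: "\<And>n x. \<bar>w n x\<bar> \<le> B"
  and tv: "\<And>n. tv_le \<O> (w n) M" and mesh: "\<And>e. e > 0 ==> \<exists>h \<Q> a X. h < e \<and> lattice_mesh \<O> h \<Q> a X"
  and S: "closed S" "\<And>n x. w n x \<in> S"
 obtains r v where "strict_mono r" "v \<in> Borel" "\<And>x. v x \<in> S" "\<And>x. \<bar>v x\<bar> \<le> B"
  "(\<lambda>n. \<integral>x. ind \<O> x * \<bar>w (r n) x - v x\<bar> \<partial>lborel) \<longlonglongrightarrow> 0"
proof -
 have [measurable]: "\<O> \<in> sets borel" using \<O> by (auto intro: borel_open)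
 let ?D = "\<lambda>m n. \<integral>x. ind \<O> x * \<bar>w m x - w n x\<bar> \<partial>lborel"
 have M0: "0 \<le> M" using tv by (rule tv_le_nonneg)
 \<comment> \<open>The error in \<open>L1_total_boundedness\<close> is \<open>h * A\<close>.\<close>
 define A where "A = 2 * (2^CARD('d) * sqrt (real CARD('d)) * M) + measure lborel \<O>"
 have A0: "0 \<le> A" using M0 by (simp add: A_def)
 have "\<exists>col :: nat => int^'d => int. finite (range col) \<and> (\<forall>m n. col m = col n --> ?D m n \<le> (1/2)^j)" for j :: nat
 proof -
  have "(1/2)^j / (A + 1) > 0" using A0 by (intro divide_pos_pos) auto
  then obtain h \<Q> a X where h: "h < (1/2)^j / (A + 1)" and lm: "lattice_mesh \<O> h \<Q> a X" using mesh by blast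
  have h0: "h > 0" using lm unfolding lattice_mesh_def by blast
  obtain col :: "nat => int^'d => int" where col: "finite (range col)"
   "\<And>m n. col m = col n ==> ?D m n \<le> 2 * (2^CARD('d) * (sqrt (real CARD('d)) * h) * M) + h * measure lborel \<O>"
   using \<O> w B tv lm by (rule L1_total_boundedness) (assumption | rule that)+
  have "2 * (2^CARD('d) * (sqrt (real CARD('d)) * h) * M) + h * measure lborel \<O> = h * A"
   by (simp add: A_def algebra_simps)
  also have "... \<le> h * (A + 1)" using h0 by simp
  also have "... \<le> (1/2)^j" using h A0 by (simp add: pos_less_divide_eq)
  finally show ?thesis using col by (meson order_trans)
 qed
 then obtain col :: "nat => nat => int^'d => int" where col: "\<And>j. finite (range (col j))" "\<And>j m n. col j m = col j n ==> ?D m n \<le> (1/2)^j"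
  by metis
 interpret subseqs "\<lambda>j s. \<forall>m n. col j (s m) = col j (s n)"
 proof
  fix j and s :: "nat => nat" assume "strict_mono s"
  have "finite ((\<lambda>n. col j (s n)) ` UNIV)" using col(1)[of j] by (rule finite_subset[rotated]) auto
  then obtain n0 where n0: "infinite {n. col j (s n) = col j (s n0)}"
   using pigeonhole_infinite[of "UNIV :: nat set" "\<lambda>n. col j (s n)"] by auto
  let ?r = "enumerate {n. col j (s n) = col j (s n0)}"
  have "strict_mono ?r" using n0 by (rule strict_mono_enumerate)
  moreover have "col j (s (?r n)) = col j (s n0)" for n using enumerate_in_set[OF n0, of n] by simp
  ultimately have "strict_mono ?r \<and> (\<forall>m n. col j ((s \<circ> ?r) m) = col j ((s \<circ> ?r) n))" by simp
  thus "\<exists>r'::nat => nat. strict_mono r' \<and> (\<forall>m n. col j ((s \<circ> r') m) = col j ((s \<circ> r') n))" by blast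
 qed
 \<comment> \<open>Shifted by one: the property of stage n holds for the diagonal sequence from
   index Suc n on.\<close>
 define r where "r n = diagseq (Suc n)" for n
 have r: "strict_mono r"
  using subseq_diagseq by (auto simp: r_def strict_mono_def)
 have fast: "?D (r (Suc n)) (r n) \<le> (1/2)^n" for n
 proof (rule col(2))
  have "\<forall>p q. col n ((diagseq \<circ> (+) (Suc n)) p) = col n ((diagseq \<circ> (+) (Suc n)) q)"
   by (rule diagseq_holds) simp
  hence "col n (diagseq (Suc n + 1)) = col n (diagseq (Suc n + 0))" unfolding o_def by blast
  thus "col n (r (Suc n)) = col n (r n)" by (simp add: r_def)
 qed
 have iD: "integrable lborel (\<lambda>x. ind \<O> x * \<bar>w m x - w n x\<bar>)" for m n
 proof (rule integrable_bounded_support[OF _ _ \<O>(1)])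
  show "norm (ind \<O> x * \<bar>w m x - w n x\<bar>) \<le> 2 * B" for x
   using B[of m x] B[of n x] by (auto simp: indicator_def)
 qed (auto simp: indicator_def split: if_splits)
 define f where "f n x = ind \<O> x * \<bar>w (r (Suc n)) x - w (r n) x\<bar>" for n x
 have fm[measurable]: "f n \<in> Borel" for n unfolding f_def by measurable
 have f0: "0 \<le> f n x" for n x by (simp add: f_def)
 have "(\<integral>\<^sup>+x. (\<Sum>n. ennreal (f n x)) \<partial>lborel) = (\<Sum>n. \<integral>\<^sup>+x. ennreal (f n x) \<partial>lborel)"
  by (rule nn_integral_suminf) measurable
 also have "... = (\<Sum>n. ennreal (?D (r (Suc n)) (r n)))"
 proof -
  have "(\<integral>\<^sup>+x. ennreal (f n x) \<partial>lborel) = ennreal (?D (r (Suc n)) (r n))" for n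
   unfolding f_def by (rule nn_integral_eq_integral[OF iD]) simp
  thus ?thesis by (simp only:)
 qed
 also have "... \<le> (\<Sum>n. ennreal ((1/2)^n))"
  using fast by (intro suminf_le summableI ennreal_leI)
 also have "... = ennreal (\<Sum>n. (1/2)^n)" by (rule suminf_ennreal2) (auto intro: summable_geometric)
 also have "... < \<infinity>" by simp
 finally have "(\<integral>\<^sup>+x. (\<Sum>n. ennreal (f n x)) \<partial>lborel) \<noteq> \<infinity>" by (simp add: less_top)
 hence ae: "AE x in lborel. (\<Sum>n. ennreal (f n x)) \<noteq> \<infinity>"
  by (intro nn_integral_PInf_AE) measurable
 \<comment> \<open>Outside the set of convergence the value of \<open>w 0\<close> is taken, which
   also lies in \<open>S\<close> and satisfies the bound.\<close>
 define v where "v x = (if Cauchy (\<lambda>n. w (r n) x) then lim (\<lambda>n. w (r n) x) else w 0 x)" for x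
 have vm[measurable]: "v \<in> Borel"
  unfolding v_def[abs_def]
 proof (rule measurable_If)
  show "{x \<in> space borel. Cauchy (\<lambda>n. w (r n) x)} \<in> sets borel" by measurable
 qed measurable
 have conv: "(\<lambda>n. w (r n) x) \<longlonglongrightarrow> v x" if "Cauchy (\<lambda>n. w (r n) x)" for x
  using that Cauchy_convergent[OF that] by (simp add: v_def convergent_LIMSEQ_iff)
 have vS: "v x \<in> T" if T: "closed T" "\<And>n. w n x \<in> T" for T x
 proof (cases "Cauchy (\<lambda>n. w (r n) x)")
  case True
  show ?thesis by (rule closed_sequentially[where f="\<lambda>n. w (r n) x", OF T(1) T(2) conv[OF True]])
 qed (simp add: v_def T)
 have v1: "v x \<in> S" for x using S by (intro vS) auto
 have v2: "\<bar>v x\<bar> \<le> B" for x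
 proof -
  have "w n x \<in> {-B..B}" for n using B[of n x] by (simp add: abs_le_iff)
  hence "v x \<in> {-B..B}" by (intro vS) auto
  thus ?thesis by auto
 qed
 have "(\<lambda>n. \<integral>x. ind \<O> x * \<bar>w (r n) x - v x\<bar> \<partial>lborel) \<longlonglongrightarrow> (\<integral>x. (0::real) \<partial>(lborel :: (real^'d) measure))"
 proof (rule integral_dominated_convergence[where w="\<lambda>x. ind \<O> x * (2 * B)"])
  show "integrable lborel (\<lambda>x. ind \<O> x * (2 * B))"
  proof (rule integrable_bounded_support[OF _ _ \<O>(1)])
   show "norm (ind \<O> x * (2 * B)) \<le> \<bar>2 * B\<bar>" for x by (auto simp: indicator_def)
  qed (auto simp: indicator_def split: if_splits)
  show "AE x in lborel. (\<lambda>n. ind \<O> x * \<bar>w (r n) x - v x\<bar>) \<longlonglongrightarrow> 0"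
   using ae
  proof eventually_elim
   case (elim x)
   show ?case
   proof (cases "x \<in> \<O>")
    case True
    have "summable (\<lambda>n. f n x)" using f0 elim by (intro summable_suminf_not_top) auto
    hence "summable (\<lambda>n. \<bar>w (r (Suc n)) x - w (r n) x\<bar>)" using True by (simp add: f_def)
    hence "summable (\<lambda>n. w (r (Suc n)) x - w (r n) x)" by (rule summable_rabs_cancel)
    hence "(\<lambda>n. \<Sum>i<n. w (r (Suc i)) x - w (r i) x) \<longlonglongrightarrow> (\<Sum>n. w (r (Suc n)) x - w (r n) x)"
     by (rule summable_LIMSEQ)
    hence "(\<lambda>n. w (r n) x - w (r 0) x) \<longlonglongrightarrow> (\<Sum>n. w (r (Suc n)) x - w (r n) x)"
     unfolding sum_lessThan_telescope[of "\<lambda>n. w (r n) x"] .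
    hence "(\<lambda>n. (w (r n) x - w (r 0) x) + w (r 0) x) \<longlonglongrightarrow> (\<Sum>n. w (r (Suc n)) x - w (r n) x) + w (r 0) x"
     by (intro tendsto_add tendsto_const)
    hence "convergent (\<lambda>n. w (r n) x)" by (auto simp: convergent_def)
    hence "(\<lambda>n. w (r n) x) \<longlonglongrightarrow> v x" by (intro conv convergent_Cauchy)
    hence "(\<lambda>n. w (r n) x - v x) \<longlonglongrightarrow> 0" by (simp add: LIM_zero_iff)
    hence "(\<lambda>n. \<bar>w (r n) x - v x\<bar>) \<longlonglongrightarrow> 0" by (rule tendsto_rabs_zero)
    thus ?thesis using True by simp
   qed simp
  qed
  show "AE x in lborel. norm (ind \<O> x * \<bar>w (r n) x - v x\<bar>) \<le> ind \<O> x * (2 * B)" for n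
  proof (rule AE_I2)
   fix x show "norm (ind \<O> x * \<bar>w (r n) x - v x\<bar>) \<le> ind \<O> x * (2 * B)"
    using B[of "r n" x] v2[of x] by (auto simp: indicator_def)
  qed
 qed measurable
 hence lim: "(\<lambda>n. \<integral>x. ind \<O> x * \<bar>w (r n) x - v x\<bar> \<partial>lborel) \<longlonglongrightarrow> 0" by simp
 show ?thesis using r vm v1 v2 lim by (rule that)
qed

section \<open>A space-filling curve\<close>

text \<open>For digits \<open>b k\<close> in {0, 1} these are the points of the Cantor set, since
  the digits are doubled.\<close>

definition ternary :: "(nat => real) => real" where
 "ternary b = (\<Sum>k. 2 * b k / 3^Suc k)"

lemma summable_ternary:
 assumes "\<And>k. b k \<in> {0, 1}"
 shows "summable (\<lambda>k. 2 * b k / 3^Suc k :: real)"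
proof (rule summable_comparison_test')
 show "summable (\<lambda>k. 2 / 3 * (1 / 3 :: real)^k)" by (intro summable_mult summable_geometric) simp
 show "norm (2 * b k / 3^Suc k) \<le> 2 / 3 * (1 / 3)^k" if "k \<ge> 0" for k
  using assms[of k] by (auto simp: power_one_over)
qed

lemma ternary_Suc:
 assumes b: "\<And>k. b k \<in> {0, 1}"
 shows "ternary b = 2 * b 0 / 3 + ternary (\<lambda>k. b (Suc k)) / 3"
proof -
 have "(\<Sum>k. 2 * b (Suc k) / 3^Suc (Suc k)) = ternary b - 2 * b 0 / 3"
  using suminf_split_head[OF summable_ternary[OF b]] by (simp add: ternary_def)
 moreover have "(\<Sum>k. 2 * b (Suc k) / 3^Suc (Suc k)) = (\<Sum>k. 1 / 3 * (2 * b (Suc k) / 3^Suc k))" by simp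
 moreover have "... = 1 / 3 * (\<Sum>k. 2 * b (Suc k) / 3^Suc k)"
  using summable_ternary[of "\<lambda>k. b (Suc k)"] b by (intro suminf_mult) auto
 ultimately show ?thesis by (simp add: ternary_def)
qed

lemma ternary_range:
 assumes b: "\<And>k. b k \<in> {0, 1}"
 shows "0 \<le> ternary b" "ternary b \<le> 1"
proof -
 have nn: "0 \<le> 2 * b k / 3^Suc k" for k using b[of k] by auto
 show "0 \<le> ternary b" unfolding ternary_def by (intro suminf_nonneg summable_ternary b nn)
 have s: "(\<lambda>k. 2 / 3 * (1 / 3 :: real)^k) sums (2 / 3 * (1 / (1 - 1 / 3)))"
  by (intro sums_mult geometric_sums) simp
 have "ternary b \<le> (\<Sum>k. 2 / 3 * (1 / 3 :: real)^k)"
  unfolding ternary_def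
 proof (rule suminf_le)
  show "2 * b k / 3^Suc k \<le> 2 / 3 * (1 / 3)^k" for k using b[of k] by (auto simp: power_one_over)
  show "summable (\<lambda>k. 2 * b k / 3^Suc k)" using b by (rule summable_ternary)
  show "summable (\<lambda>k. 2 / 3 * (1 / 3 :: real)^k)" using s by (rule sums_summable)
 qed
 also have "... = 1" using sums_unique[OF s] by simp
 finally show "ternary b \<le> 1" .
qed

text \<open>A continuous periodic function reading off the leading ternary digit (0 or 2) of its argument.\<close>

definition read_digit :: "real => real" where
 "read_digit t = max 0 (min 1 (1 / 2 - cos (pi * t)))"

text \<open>Multiplication by 3^j shifts the digits, and the integer part is even because ternary
  digits are 0 or 2, so the periodicity of the cosine removes it. The remainder lies in [0, 1/3] or
  [2/3, 1], where cos(pi t) is at least 1/2 or at most -1/2, and the truncation yields exactly 0 or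
  1.\<close>

lemma read_digit_ternary:
 assumes b: "\<And>k. b k \<in> {0, 1}"
 shows "read_digit (3^j * ternary b) = b j"
proof -
 have "\<exists>m::int. 3^j * ternary b = 2 * real_of_int m + ternary (\<lambda>k. b (j + k))"
 proof (induction j)
  case (Suc j)
  then obtain m :: int where m: "3^j * ternary b = 2 * real_of_int m + ternary (\<lambda>k. b (j + k))" by blast
  have "ternary (\<lambda>k. b (j + k)) = 2 * b j / 3 + ternary (\<lambda>k. b (Suc j + k)) / 3"
   using ternary_Suc[of "\<lambda>k. b (j + k)"] b by simp
  hence "3^Suc j * ternary b = 6 * real_of_int m + 2 * b j + ternary (\<lambda>k. b (Suc j + k))"
   using m by simp
  moreover have "6 * real_of_int m + 2 * b j = 2 * real_of_int (3 * m + (if b j = 0 then 0 else 1))"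
   using b[of j] by auto
  ultimately have "3^Suc j * ternary b = 2 * real_of_int (3 * m + (if b j = 0 then 0 else 1)) + ternary (\<lambda>k. b (Suc j + k))"
   by linarith
  thus ?case by blast
 qed (auto intro: exI[of _ 0])
 then obtain m :: int where m: "3^j * ternary b = 2 * real_of_int m + ternary (\<lambda>k. b (j + k))" by blast
 define s where "s = ternary (\<lambda>k. b (j + k))"
 define r where "r = ternary (\<lambda>k. b (Suc j + k))"
 have s: "s = 2 * b j / 3 + r / 3"
  using ternary_Suc[of "\<lambda>k. b (j + k)"] b by (simp add: s_def r_def)
 have r: "0 \<le> r" "r \<le> 1" unfolding r_def using ternary_range[of "\<lambda>k. b (Suc j + k)"] b by auto
 have "cos (pi * (3^j * ternary b)) = cos (pi * s + 2 * pi * real_of_int m)"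
  unfolding m s_def[symmetric] by (simp add: algebra_simps)
 also have "... = cos (pi * s)" by (simp add: cos_add cos_int_2pin sin_int_2pin)
 finally have c: "cos (pi * (3^j * ternary b)) = cos (pi * s)" .
 consider "b j = 0" | "b j = 1" using b[of j] by blast
 thus ?thesis
 proof cases
  case 1
  have "cos (pi / 3) \<le> cos (pi * s)"
   using r pi_ge_zero by (intro cos_monotone_0_pi_le) (auto simp: s 1 field_simps)
  thus ?thesis unfolding read_digit_def c 1 by (simp add: cos_60)
 next
  case 2
  have "pi * 2 / 3 \<le> pi * s" "pi * s \<le> pi"
   using r pi_ge_zero by (auto simp: s 2 field_simps)
  hence "cos (pi * s) \<le> cos (2 * pi / 3)"
   using pi_ge_zero by (intro cos_monotone_0_pi_le) auto
  thus ?thesis unfolding read_digit_def c 2 by (simp add: cos_120)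
 qed
qed

text \<open>The digits are differences of consecutive dyadic floors, so the partial sums
  telescope.\<close>

lemma binary_expansion:
 fixes y :: real
 assumes y: "0 \<le> y" "y < 1"
 obtains b :: "nat => real" where "\<And>k. b k \<in> {0, 1}" "(\<lambda>k. (1/2)^Suc k * b k) sums y"
proof -
 have fl: "2 * \<lfloor>x\<rfloor> \<le> \<lfloor>2 * x\<rfloor>" "\<lfloor>2 * x\<rfloor> < 2 * \<lfloor>x\<rfloor> + 2" for x :: real by linarith+
 define b where "b k = real_of_int (\<lfloor>2^Suc k * y\<rfloor> - 2 * \<lfloor>2^k * y\<rfloor>)" for k :: nat
 have "b k \<in> {0, 1}" for k
 proof -
  have "2 * \<lfloor>2^k * y\<rfloor> \<le> \<lfloor>2^Suc k * y\<rfloor>" "\<lfloor>2^Suc k * y\<rfloor> < 2 * \<lfloor>2^k * y\<rfloor> + 2"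
   using fl[of "2^k * y"] by (simp_all add: mult.assoc)
  hence "\<lfloor>2^Suc k * y\<rfloor> - 2 * \<lfloor>2^k * y\<rfloor> = 0 \<or> \<lfloor>2^Suc k * y\<rfloor> - 2 * \<lfloor>2^k * y\<rfloor> = 1" by linarith
  thus ?thesis unfolding b_def by fastforce
 qed
 moreover have "(\<lambda>k. (1/2)^Suc k * b k) sums y"
 proof -
  have part: "(\<Sum>k<n. (1/2)^Suc k * b k) = real_of_int \<lfloor>2^n * y\<rfloor> / 2^n" for n
  proof (induction n)
   case 0
   have "\<lfloor>y\<rfloor> = 0" using y by (simp add: floor_unique)
   thus ?case by simp
  next
   case (Suc n)
   have eq: "(1/2)^Suc n * b n = real_of_int \<lfloor>2^Suc n * y\<rfloor> / 2^Suc n - real_of_int \<lfloor>2^n * y\<rfloor> / 2^n"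
    by (simp add: b_def power_one_over field_simps)
   have "s + (t - s) = t" for s t :: real by simp
   thus ?case by (simp only: sum.lessThan_Suc Suc.IH eq)
  qed
  have "(\<lambda>n. real_of_int \<lfloor>2^n * y\<rfloor> / 2^n - y) \<longlonglongrightarrow> 0"
  proof (rule Lim_null_comparison)
   show "(\<lambda>n. (1/2)^n :: real) \<longlonglongrightarrow> 0" by (rule LIMSEQ_power_zero) simp
   show "\<forall>\<^sub>F n in sequentially. norm (real_of_int \<lfloor>2^n * y\<rfloor> / 2^n - y) \<le> (1/2)^n"
   proof (rule always_eventually, rule allI)
    fix n :: nat
    have "real_of_int \<lfloor>2^n * y\<rfloor> / 2^n - y = (real_of_int \<lfloor>2^n * y\<rfloor> - 2^n * y) / 2^n"
     by (simp add: field_simps)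
    hence "norm (real_of_int \<lfloor>2^n * y\<rfloor> / 2^n - y) = \<bar>real_of_int \<lfloor>2^n * y\<rfloor> - 2^n * y\<bar> / 2^n" by simp
    also have "... \<le> 1 / 2^n" by (intro divide_right_mono) (linarith | simp)+
    finally show "norm (real_of_int \<lfloor>2^n * y\<rfloor> / 2^n - y) \<le> (1/2)^n" by (simp add: power_one_over)
   qed
  qed
  thus ?thesis unfolding sums_def part by (simp add: LIM_zero_iff)
 qed
 ultimately show ?thesis by (rule that)
qed

text \<open>Schoenberg's construction: the binary digits of the coordinates are interleaved as the ternary
 digits of the parameter.\<close>

lemma space_filling_curve:
 obtains g :: "real => real^'d" where "continuous_on UNIV g"
  "\<And>y. (\<And>i. 0 \<le> y $ i \<and> y $ i < 1) ==> \<exists>t\<in>{0..1}. g t = y"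
proof -
 obtain e :: "'d => nat" where e: "bij_betw e UNIV {0..<CARD('d)}"
  using ex_bij_betw_finite_nat[of "UNIV :: 'd set"] by auto
 let ?N = "CARD('d)"
 have eN: "e i < ?N" for i using e unfolding bij_betw_def by auto
 have ei: "inv e (e i) = i" for i using e unfolding bij_betw_def by simp
 \<comment> \<open>Coordinate \<open>i\<close>, numbered \<open>e i\<close>, reads the digits at the
   positions congruent to \<open>e i\<close> modulo the dimension.\<close>
 define F where "F i k t = (1/2)^Suc k * read_digit (3^(k * ?N + e i) * t)" for i k t
 define g :: "real => real^'d" where "g t = (\<chi> i. \<Sum>k. F i k t)" for t
 have r1: "\<bar>read_digit t\<bar> \<le> 1" for t unfolding read_digit_def by linarith
 have Fb: "norm (F i k t) \<le> (1/2)^Suc k" for i k t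
  unfolding F_def norm_mult using r1 by (simp add: mult_left_le)
 have gc: "continuous_on UNIV (\<lambda>t. \<Sum>k. F i k t)" for i
 proof (rule uniform_limit_theorem[where F=sequentially])
  have "summable (\<lambda>k. (1/2)^Suc k :: real)" by (subst summable_Suc_iff) (rule summable_geometric, simp)
  thus "uniform_limit UNIV (\<lambda>n t. \<Sum>k<n. F i k t) (\<lambda>t. \<Sum>k. F i k t) sequentially"
   by (intro Weierstrass_m_test) (rule Fb)
  show "\<forall>\<^sub>F n in sequentially. continuous_on UNIV (\<lambda>t. \<Sum>k<n. F i k t)"
   unfolding F_def read_digit_def by (intro always_eventually allI continuous_intros)
 qed simp
 have "continuous_on UNIV g" unfolding g_def[abs_def] by (intro continuous_on_vec_lambda gc)
 moreover have "\<exists>t\<in>{0..1}. g t = y" if y: "\<And>i. 0 \<le> y $ i \<and> y $ i < 1" for y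
 proof -
  have "\<exists>b. (\<forall>k. b k \<in> {0, 1}) \<and> (\<lambda>k. (1/2)^Suc k * b k) sums (y $ i)" for i
   by (rule binary_expansion[of "y $ i"]) (use y[of i] in auto)
  then obtain b where b: "\<And>i k. b i k \<in> {0, 1}" "\<And>i. (\<lambda>k. (1/2)^Suc k * b i k) sums (y $ i)" by metis
  define \<beta> where "\<beta> j = b (inv e (j mod ?N)) (j div ?N)" for j
  have \<beta>: "\<beta> j \<in> {0, 1}" for j unfolding \<beta>_def by (rule b)
  have "\<beta> (k * ?N + e i) = b i k" for k i using eN[of i] by (simp add: \<beta>_def ei)
  hence Fb: "F i k (ternary \<beta>) = (1/2)^Suc k * b i k" for i k
   unfolding F_def read_digit_ternary[OF \<beta>] by simp
  have "(\<Sum>k. F i k (ternary \<beta>)) = y $ i" for i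
   unfolding Fb using b(2)[of i] by (rule sums_unique[symmetric])
  hence "g (ternary \<beta>) = y" by (simp add: g_def vec_eq_iff)
  thus ?thesis using ternary_range[OF \<beta>] by auto
 qed
 ultimately show ?thesis by (rule that)
qed

section \<open>Weak-* convergence\<close>

text \<open>Along a space-filling curve with a Borel right inverse the measures are transported to the
 line, where Helly's selection theorem applies. The total masses are first made equal by adding
 mass outside \<open>\<O>\<close>.\<close>

lemma weak_star_compactness:
 fixes f :: "nat => real^'d => real"
 assumes \<O>: "bounded \<O>" and f[measurable]: "\<And>n. f n \<in> Borel" and f0: "\<And>n x. 0 \<le> f n x"
  and supp: "\<And>n x. x \<notin> \<O> ==> f n x = 0" and int: "\<And>n. integrable lborel (f n)" and M: "\<And>n. (LBINT x. f n x) \<le> M"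
 obtains r and \<mu> :: "(real^'d) measure" where "strict_mono r" "finite_measure \<mu>" "sets \<mu> = sets borel" "measure \<mu> (space \<mu>) \<le> M + 1"
  "\<forall>\<psi>. continuous_on UNIV \<psi> \<and> (\<forall>x. x \<notin> \<O> --> \<psi> x = 0) \<and> (\<exists>C. \<forall>x. \<bar>\<psi> x\<bar> \<le> C) -->
    (\<lambda>n. \<integral>x. \<psi> x * f (r n) x \<partial>lborel) \<longlonglongrightarrow> (\<integral>x. \<psi> x \<partial>\<mu>)"
proof -
 obtain g0 :: "real => real^'d" where g0: "continuous_on UNIV g0" "\<And>y. (\<And>i. 0 \<le> y $ i \<and> y $ i < 1) ==> \<exists>t\<in>{0..1}. g0 t = y"
  by (rule space_filling_curve) blast
 obtain R where R: "R > 0" "\<And>x. x \<in> \<O> ==> norm x \<le> R" using \<O> bounded_pos by blast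
 \<comment> \<open>Rescaled to cover the cube [-R, R + 1)^d, which contains both the domain and the
   box \<open>D\<close> chosen beside it.\<close>
 define g where "g t = (2 * R + 1) *\<^sub>R g0 t - (\<chi> i. R)" for t
 have gc: "continuous_on UNIV g" unfolding g_def by (intro continuous_intros g0)
 have gm[measurable]: "g \<in> Borel" using gc by (rule borel_measurable_continuous_onI)
 have gsurj: "y \<in> g ` {0..1}" if y: "\<And>i. - R \<le> y $ i \<and> y $ i < R + 1" for y
 proof -
  have "\<exists>t\<in>{0..1}. g0 t = (1 / (2 * R + 1)) *\<^sub>R (y + (\<chi> i. R))"
  proof (rule g0(2))
   show "0 \<le> ((1 / (2 * R + 1)) *\<^sub>R (y + (\<chi> i. R))) $ i \<and> ((1 / (2 * R + 1)) *\<^sub>R (y + (\<chi> i. R))) $ i < 1" for i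
    using y[of i] R(1) by (simp add: pos_divide_less_eq)
  qed
  then obtain t where t: "t \<in> {0..1}" "g0 t = (1 / (2 * R + 1)) *\<^sub>R (y + (\<chi> i. R))" by blast
  have "g t = y" using R(1) unfolding g_def t(2) by simp
  thus ?thesis using t(1) by blast
 qed
 \<comment> \<open>A box outside the domain that receives the mass missing to a probability
   measure.\<close>
 define D where "D = box (\<chi> i. R) (\<chi> i. R + 1 / 2 :: real^'d)"
 have Dm[measurable]: "D \<in> sets borel" and bD: "bounded D" by (auto simp: D_def bounded_box)
 have D\<O>: "x \<notin> \<O>" if "x \<in> D" for x
 proof
  assume "x \<in> \<O>"
  hence "\<bar>x $ undefined\<bar> \<le> R" using R(2) component_le_norm_cart order_trans by blast
  thus False using that by (auto simp: D_def mem_box_cart dest!: spec[of _ undefined])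
 qed
 have mD: "measure lborel D > 0"
 proof -
  have "measure lborel D = measure lborel (cbox (\<chi> i. R) (\<chi> i. R + 1 / 2 :: real^'d))"
   unfolding D_def by (simp add: measure_lborel_box_eq measure_lborel_cbox_eq)
  also have "(\<chi> i. R) \<in> cbox (\<chi> i. R) (\<chi> i. R + 1 / 2 :: real^'d)" by (simp add: mem_box_cart)
  hence "measure lborel (cbox (\<chi> i. R) (\<chi> i. R + 1 / 2 :: real^'d)) = (\<Prod>i\<in>(UNIV::'d set). 1 / 2)"
   by (subst content_cbox_cart) auto
  finally show ?thesis by simp
 qed
 have M0: "0 \<le> M" using M[of 0] f0 by (meson lint_nonneg order_trans)
 \<comment> \<open>Strictly positive even if M = 0, and large enough for the added mass
   \<open>c n\<close> to be nonnegative.\<close>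
 define K where "K = M + 1"
 have K: "K > 0" using M0 by (simp add: K_def)
 define c where "c n = (1 - (LBINT x. f n x) / K) / measure lborel D" for n
 have c0: "0 \<le> c n" for n
  unfolding c_def using M[of n] K mD by (intro divide_nonneg_pos) (auto simp: K_def)
 define F where "F n x = f n x / K + c n * ind D x" for n x
 have Fm[measurable]: "F n \<in> Borel" for n unfolding F_def by measurable
 have F0: "0 \<le> F n x" for n x unfolding F_def using f0 K c0 by (simp add: indicator_def)
 have iD: "integrable lborel (ind D)"
  using bD by (intro integrable_real_indicator emeasure_bounded_finite) auto
 have iF: "integrable lborel (F n)" for n
  unfolding F_def using int iD by simp
 have F1: "(LBINT x. F n x) = 1" for n
 proof -
  have "(LBINT x. F n x) = (LBINT x. f n x) / K + c n * measure lborel D"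
   unfolding F_def using int[of n] iD by simp
  thus ?thesis using mD by (simp add: c_def)
 qed
 define Q where "Q n = density lborel (\<lambda>x. ennreal (F n x))" for n
 have Qs[measurable_cong]: "sets (Q n) = sets borel" for n by (simp add: Q_def)
 have Qp: "prob_space (Q n)" for n
 proof
  have "emeasure (Q n) (space (Q n)) = (\<integral>\<^sup>+x. ennreal (F n x) \<partial>lborel)"
   unfolding Q_def by (subst emeasure_density) auto
  also have "... = 1" using iF F0 F1 by (subst nn_integral_eq_integral) auto
  finally show "emeasure (Q n) (space (Q n)) = 1" .
 qed
 \<comment> \<open>The least parameter of a point on the curve. Its sublevel sets below 2 are images
   of compact sets, hence closed, so it is Borel; the value 2 for points off the curve lies above
   all parameters.\<close>
 define s where "s y = (if y \<in> g ` {0..1} then Inf {t \<in> {0..1}. g t = y} else 2)" for y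
 have least: "s y \<in> {0..1} \<and> g (s y) = y" if y: "y \<in> g ` {0..1}" for y
 proof -
  have "{t \<in> {0..1}. g t = y} = {0..1} \<inter> {t. g t = y}" by auto
  also have "closed ..." by (intro closed_Int closed_atLeastAtMost closed_Collect_eq gc continuous_on_const)
  finally have "closed {t \<in> {0..1}. g t = y}" .
  moreover have "{t \<in> {0..1}. g t = y} \<noteq> {}" "bdd_below {t \<in> {0..1}. g t = y}" using y by auto
  ultimately have "Inf {t \<in> {0..1}. g t = y} \<in> {t \<in> {0..1}. g t = y}" by (intro closed_contains_Inf)
  thus ?thesis using y by (simp add: s_def)
 qed
 have sr: "0 \<le> s y" "s y \<le> 2" for y using least[of y] by (cases "y \<in> g ` {0..1}"; simp add: s_def)+
 have sm[measurable]: "s \<in> Borel"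
 proof (rule borel_measurable_iff_le[THEN iffD2], rule allI)
  fix a :: real
  show "{y \<in> space borel. s y \<le> a} \<in> sets borel"
  proof (cases "a < 2")
   case True
   have "{y \<in> space borel. s y \<le> a} = g ` ({0..1} \<inter> {..a})"
   proof (intro set_eqI iffI)
    fix y assume y: "y \<in> {y \<in> space borel. s y \<le> a}"
    hence "y \<in> g ` {0..1}" using True by (auto simp: s_def split: if_splits)
    from least[OF this] show "y \<in> g ` ({0..1} \<inter> {..a})" using y by (intro image_eqI[of _ _ "s y"]) auto
   next
    fix y assume "y \<in> g ` ({0..1} \<inter> {..a})"
    then obtain t where t: "t \<in> {0..1}" "t \<le> a" "y = g t" by auto
    hence "Inf {t \<in> {0..1}. g t = y} \<le> t" by (intro cInf_lower) auto
    thus "y \<in> {y \<in> space borel. s y \<le> a}" using t by (auto simp: s_def)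
   qed
   also have "compact ..."
    using gc by (intro compact_continuous_image compact_Int_closed) (auto intro: continuous_on_subset)
   hence "g ` ({0..1} \<inter> {..a}) \<in> sets borel" by (intro borel_closed compact_imp_closed)
   finally show ?thesis .
  next
   case False
   hence "s y \<le> a" for y using sr(2)[of y] by linarith
   hence "{y \<in> space borel. s y \<le> a} = UNIV" by auto
   thus ?thesis by simp
  qed
 qed
 define P where "P n = distr (Q n) borel s" for n
 have Pd: "real_distribution (P n)" for n
  unfolding P_def using Qp by (intro prob_space.real_distribution_distr) measurable
 have "tight P"
  unfolding tight_def
 proof (intro conjI allI impI)
  fix \<epsilon> :: real assume \<epsilon>: "\<epsilon> > 0"
  show "\<exists>a b. a < b \<and> (\<forall>n. measure (P n) {a<..b} > 1 - \<epsilon>)"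
  proof (rule exI[of _ "-1"], rule exI[of _ 2], intro conjI allI)
   fix n
   have "measure (P n) {-1<..2} = measure (Q n) (s -` {-1<..2} \<inter> space (Q n))"
    unfolding P_def by (rule measure_distr) measurable
   also have "s -` {-1<..2} \<inter> space (Q n) = space (Q n)"
   proof -
    have "-1 < s y" for y using sr(1)[of y] by linarith
    thus ?thesis using sr(2) by auto
   qed
   also have "measure (Q n) (space (Q n)) = 1" using Qp by (rule prob_space.prob_space)
   finally show "measure (P n) {-1<..2} > 1 - \<epsilon>" using \<epsilon> by simp
  qed simp
 qed (rule Pd)
 then obtain r \<rho> where r: "strict_mono r" and \<rho>: "real_distribution \<rho>" and "weak_conv_m (P \<circ> id \<circ> r) \<rho>"
  using tight_imp_convergent_subsubsequence[of P id] by (auto simp: strict_mono_id)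
 hence wc: "weak_conv_m (\<lambda>n. P (r n)) \<rho>" by (simp add: o_def)
 interpret \<rho>: real_distribution \<rho> by (rule \<rho>)
 \<comment> \<open>The limit distribution on the line is carried back by the curve, and the factor
   \<open>K\<close> undoes the normalization.\<close>
 define \<mu> where "\<mu> = density (distr \<rho> borel g) (\<lambda>_. ennreal K)"
 have \<mu>s: "sets \<mu> = sets borel" by (simp add: \<mu>_def)
 have em: "emeasure \<mu> (space \<mu>) = ennreal K"
 proof -
  have "emeasure \<mu> (space \<mu>) = ennreal K * emeasure (distr \<rho> borel g) (space (distr \<rho> borel g))"
   unfolding \<mu>_def by (subst emeasure_density) (auto simp: nn_integral_cmult_indicator)
  also have "emeasure (distr \<rho> borel g) (space (distr \<rho> borel g)) = 1"
   by (intro prob_space.emeasure_space_1 \<rho>.prob_space_distr) measurable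
  finally show ?thesis by simp
 qed
 hence \<mu>f: "finite_measure \<mu>" by (intro finite_measureI) simp
 have \<mu>m: "measure \<mu> (space \<mu>) \<le> M + 1" using em K by (simp add: measure_def K_def)
 have conv: "(\<lambda>n. \<integral>x. \<psi> x * f (r n) x \<partial>lborel) \<longlonglongrightarrow> (\<integral>x. \<psi> x \<partial>\<mu>)"
  if \<psi>: "continuous_on UNIV \<psi>" "\<And>x. x \<notin> \<O> ==> \<psi> x = 0" "\<And>x. \<bar>\<psi> x\<bar> \<le> C" for \<psi> C
 proof -
  have \<psi>m[measurable]: "\<psi> \<in> Borel" using \<psi>(1) by (rule borel_measurable_continuous_onI)
  have "continuous_on UNIV (\<lambda>t. \<psi> (g t))"
   using \<psi>(1) gc by (auto intro: continuous_on_compose2)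
  hence "isCont (\<lambda>t. \<psi> (g t)) t" for t by (simp add: continuous_on_eq_continuous_at)
  hence "(\<lambda>n. \<integral>t. \<psi> (g t) \<partial>P (r n)) \<longlonglongrightarrow> (\<integral>t. \<psi> (g t) \<partial>\<rho>)"
   using weak_conv_imp_integral_bdd_continuous_conv[OF Pd \<rho> wc, of "\<lambda>t. \<psi> (g t)" C] \<psi>(3) by simp
  moreover have "(\<integral>t. \<psi> (g t) \<partial>P n) = (LBINT x. \<psi> x * f n x) / K" for n
  proof -
   have "(\<integral>t. \<psi> (g t) \<partial>P n) = (\<integral>y. \<psi> (g (s y)) \<partial>Q n)"
    unfolding P_def by (subst integral_distr) auto
   also have "... = (LBINT y. F n y *\<^sub>R \<psi> (g (s y)))"
    unfolding Q_def using F0 by (subst integral_density) auto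
   also have "... = (LBINT y. \<psi> y * f n y / K)"
   proof (rule lint_cong[OF refl])
    fix y :: "real^'d"
    \<comment> \<open>On the domain and on \<open>D\<close> the curve inverts \<open>s\<close>, and
      on \<open>D\<close> the test function vanishes, so the added mass does not contribute.\<close>
    show "F n y *\<^sub>R \<psi> (g (s y)) = \<psi> y * f n y / K"
    proof (cases "y \<in> \<O> \<or> y \<in> D")
     case True
     have "- R \<le> y $ i \<and> y $ i < R + 1" for i
     proof (cases "y \<in> \<O>")
      case True
      hence "\<bar>y $ i\<bar> \<le> R" using R(2) component_le_norm_cart order_trans by blast
      thus ?thesis by linarith
     next
      case False
      hence "R < y $ i" "y $ i < R + 1 / 2" using True by (auto simp: D_def mem_box_cart)
      thus ?thesis using R(1) by linarith
     qed
     hence "g (s y) = y" using least[OF gsurj] by blast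
     thus ?thesis using D\<O>[of y] \<psi>(2)[of y] by (auto simp: F_def indicator_def)
    next
     case False
     thus ?thesis using supp[of y n] by (simp add: F_def)
    qed
   qed
   finally show ?thesis by simp
  qed
  ultimately have "(\<lambda>n. (LBINT x. \<psi> x * f (r n) x) / K) \<longlonglongrightarrow> (\<integral>t. \<psi> (g t) \<partial>\<rho>)" by simp
  hence "(\<lambda>n. K * ((LBINT x. \<psi> x * f (r n) x) / K)) \<longlonglongrightarrow> K * (\<integral>t. \<psi> (g t) \<partial>\<rho>)"
   by (intro tendsto_mult tendsto_const)
  moreover have "(\<integral>x. \<psi> x \<partial>\<mu>) = K * (\<integral>t. \<psi> (g t) \<partial>\<rho>)"
  proof -
   have "(\<integral>x. \<psi> x \<partial>\<mu>) = (\<integral>x. K *\<^sub>R \<psi> x \<partial>distr \<rho> borel g)"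
    unfolding \<mu>_def using K by (subst integral_density) auto
   also have "... = (\<integral>t. K *\<^sub>R \<psi> (g t) \<partial>\<rho>)" by (subst integral_distr) auto
   finally show ?thesis by simp
  qed
  ultimately show ?thesis using K by simp
 qed
 show ?thesis
  by (rule that[OF r \<mu>f \<mu>s \<mu>m]) (use conv in blast)
qed

text \<open>On inner parallel sets the difference quotients of \<open>v\<close> have L1 norm at most
  \<open>M\<close> by \<open>translation_variation\<close>. Their positive and negative parts
  converge weakly-* along a common subsequence, and the difference of the limits represents the
  distributional derivative. The surplus 1 in the masses comes from
  \<open>weak_star_compactness\<close>.\<close>

lemma derivative_measures_exist:
 fixes \<O> :: "(real^'d) set"
 assumes \<O>: "bounded \<O>" "open \<O>" and v[measurable]: "v \<in> Borel" and Cv: "\<And>x. \<bar>v x\<bar> \<le> Cv" and tv: "tv_le \<O> v M"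
 obtains \<mu> \<nu> :: "'d => (real^'d) measure" where
  "\<And>i. finite_measure (\<mu> i)" "\<And>i. sets (\<mu> i) = sets borel" "\<And>i. measure (\<mu> i) (space (\<mu> i)) \<le> M + 1"
  "\<And>i. finite_measure (\<nu> i)" "\<And>i. sets (\<nu> i) = sets borel" "\<And>i. measure (\<nu> i) (space (\<nu> i)) \<le> M + 1"
  "\<forall>i. \<forall>\<psi>\<in>C1c \<O>. (LBINT x. v x * partial_deriv i \<psi> x) = - ((\<integral>x. \<psi> x \<partial>\<mu> i) - (\<integral>x. \<psi> x \<partial>\<nu> i))"
proof -
 define good where "good i \<mu> \<nu> \<longleftrightarrow> finite_measure \<mu> \<and> sets \<mu> = sets borel \<and> measure \<mu> (space \<mu>) \<le> M + 1 \<and>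
   finite_measure \<nu> \<and> sets \<nu> = sets borel \<and> measure \<nu> (space \<nu>) \<le> M + 1 \<and>
   (\<forall>\<psi>\<in>C1c \<O>. (LBINT x. v x * partial_deriv i \<psi> x) = - ((\<integral>x. \<psi> x \<partial>\<mu>) - (\<integral>x. \<psi> x \<partial>\<nu>)))" for i and \<mu> \<nu> :: "(real^'d) measure"
 have "\<exists>p. good i (fst p) (snd p)" for i
 proof -
  let ?e = "axis i 1 :: real^'d"
  define t where "t n = 1 / real (Suc n)" for n
  have t: "0 < t n" "t n \<le> 1" for n by (auto simp: t_def)
  have t0: "t \<longlonglongrightarrow> 0" unfolding t_def by (rule LIMSEQ_Suc[OF lim_const_over_n])
  \<comment> \<open>A step of length \<open>t n\<close> from a point of this set stays inside the
    domain; the factor 2 gives room because the balls are open.\<close>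
  define A where "A n = {x. ball x (2 * t n) \<subseteq> \<O>}" for n
  have Am[measurable]: "A n \<in> sets borel" for n unfolding A_def by (intro borel_closed closed_inner_parallel)
  have A\<O>: "x \<in> \<O>" if "x \<in> A n" for x n
   using that t(1)[of n] centre_in_ball[of x "2 * t n"] by (auto simp: A_def)
  define q where "q n x = (v (x + t n *\<^sub>R ?e) - v x) / t n" for n x
  have qm[measurable]: "q n \<in> Borel" for n unfolding q_def by measurable
  have q2: "\<bar>q n x\<bar> \<le> 2 * Cv / t n" for n x
  proof -
   have "\<bar>v (x + t n *\<^sub>R ?e) - v x\<bar> \<le> 2 * Cv" using Cv[of x] Cv[of "x + t n *\<^sub>R ?e"] by linarith
   thus ?thesis using t(1)[of n] by (simp add: q_def abs_divide divide_right_mono)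
  qed
  have iq: "integrable lborel (\<lambda>x. ind (A n) x * y (q n x))"
   if [measurable]: "y \<in> Borel" and y: "\<And>a. \<bar>y a\<bar> \<le> \<bar>a\<bar>" for y :: "real => real" and n
  proof (rule integrable_bounded_support[OF _ _ \<O>(1)])
   show "norm (ind (A n) x * y (q n x)) \<le> 2 * Cv / t n" for x
    using y[of "q n x"] q2[of n x] by (auto simp: indicator_def)
   show "x \<in> \<O>" if "ind (A n) x * y (q n x) \<noteq> 0" for x
    using that A\<O>[of x n] by (auto simp: indicator_def split: if_splits)
  qed measurable
  have mass: "(LBINT x. ind (A n) x * \<bar>q n x\<bar>) \<le> M" for n
  proof -
   have "(\<Sum>j\<in>(UNIV::unit set). \<integral>x. ind (A n) x * \<bar>v (x + t n *\<^sub>R ?e) - v x\<bar> \<partial>lborel) \<le> t n * M"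
   proof (rule translation_variation[OF \<O> v Cv tv])
    show "x + s *\<^sub>R t n *\<^sub>R ?e \<in> \<O>" if x: "x \<in> A n" and s: "s \<in> {0..1}" for x s
    proof -
     have "\<bar>s * t n\<bar> \<le> t n" using s t(1)[of n] by (simp add: mult_left_le_one_le)
     hence "x + s *\<^sub>R t n *\<^sub>R ?e \<in> ball x (2 * t n)" using t(1)[of n] by (simp add: dist_norm norm_axis abs_mult)
     thus ?thesis using x by (auto simp: A_def)
    qed
    show "norm (\<Sum>j\<in>UNIV. \<theta> j *\<^sub>R t n *\<^sub>R ?e) \<le> t n" if "\<And>j::unit. \<bar>\<theta> j\<bar> \<le> 1" for \<theta>
     using that[of "()"] t(1)[of n] by (simp add: UNIV_unit norm_axis abs_mult mult_left_le_one_le)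
   qed measurable
   hence "(LBINT x. ind (A n) x * \<bar>v (x + t n *\<^sub>R ?e) - v x\<bar>) / t n \<le> M"
    using t(1)[of n] by (simp add: UNIV_unit pos_divide_le_eq mult.commute)
   moreover have "ind (A n) x * \<bar>q n x\<bar> = ind (A n) x * \<bar>v (x + t n *\<^sub>R ?e) - v x\<bar> / t n" for x
    using t(1)[of n] by (simp add: q_def abs_divide)
   ultimately show ?thesis by simp
  qed
  define fp where "fp n x = ind (A n) x * max 0 (q n x)" for n x
  define fm where "fm n x = ind (A n) x * max 0 (- q n x)" for n x
  have le: "(LBINT x. ind (A n) x * y (q n x)) \<le> M"
   if [measurable]: "y \<in> Borel" and y: "\<And>a. \<bar>y a\<bar> \<le> \<bar>a\<bar>" for y :: "real => real" and n
  proof -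
   have "y a \<le> \<bar>a\<bar>" for a using y[of a] by linarith
   hence "(LBINT x. ind (A n) x * y (q n x)) \<le> (LBINT x. ind (A n) x * \<bar>q n x\<bar>)"
    using y by (intro integral_mono iq) (auto simp: indicator_def)
   thus ?thesis using mass[of n] by linarith
  qed
  have fpm: "fp n \<in> Borel" and fmm: "fm n \<in> Borel" for n
   unfolding fp_def fm_def by measurable
  have ifp: "integrable lborel (fp n)" and ifm: "integrable lborel (fm n)" for n
   unfolding fp_def fm_def using iq[of "\<lambda>a. max 0 a"] iq[of "\<lambda>a. max 0 (- a)"] by (auto simp: max_def)
  have lfp: "(LBINT x. fp n x) \<le> M" and lfm: "(LBINT x. fm n x) \<le> M" for n
   unfolding fp_def fm_def using le[of "\<lambda>a. max 0 a"] le[of "\<lambda>a. max 0 (- a)"] by (auto simp: max_def)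
  have nn: "0 \<le> fp n x" "0 \<le> fm n x" and zz: "x \<notin> \<O> ==> fp n x = 0" "x \<notin> \<O> ==> fm n x = 0" for n x
   using A\<O>[of x n] by (auto simp: fp_def fm_def indicator_def)
  obtain r1 and \<mu> :: "(real^'d) measure" where r1: "strict_mono r1" and \<mu>: "finite_measure \<mu>" "sets \<mu> = sets borel" "measure \<mu> (space \<mu>) \<le> M + 1"
   and c1: "\<forall>\<psi>. continuous_on UNIV \<psi> \<and> (\<forall>x. x \<notin> \<O> --> \<psi> x = 0) \<and> (\<exists>C. \<forall>x. \<bar>\<psi> x\<bar> \<le> C) -->
    (\<lambda>n. \<integral>x. \<psi> x * fp (r1 n) x \<partial>lborel) \<longlonglongrightarrow> (\<integral>x. \<psi> x \<partial>\<mu>)"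
   using \<O>(1) fpm nn(1) zz(1) ifp lfp by (rule weak_star_compactness) (assumption | rule that)+
  \<comment> \<open>Extracted from the subsequence \<open>r1\<close>, so that both parts converge
    along the composition.\<close>
  obtain r2 and \<nu> :: "(real^'d) measure" where r2: "strict_mono r2" and \<nu>: "finite_measure \<nu>" "sets \<nu> = sets borel" "measure \<nu> (space \<nu>) \<le> M + 1"
   and c2: "\<forall>\<psi>. continuous_on UNIV \<psi> \<and> (\<forall>x. x \<notin> \<O> --> \<psi> x = 0) \<and> (\<exists>C. \<forall>x. \<bar>\<psi> x\<bar> \<le> C) -->
    (\<lambda>n. \<integral>x. \<psi> x * fm (r1 (r2 n)) x \<partial>lborel) \<longlonglongrightarrow> (\<integral>x. \<psi> x \<partial>\<nu>)"
   by (rule weak_star_compactness[where f="\<lambda>n. fm (r1 n)", OF \<O>(1) fmm nn(2) zz(2) ifm lfm]) (assumption | rule that)+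
  define r where "r n = r1 (r2 n)" for n
  have r: "strict_mono r" using r1 r2 by (auto simp: r_def strict_mono_def)
  have main: "(LBINT x. v x * partial_deriv i \<psi> x) = - ((\<integral>x. \<psi> x \<partial>\<mu>) - (\<integral>x. \<psi> x \<partial>\<nu>))" if \<psi>: "\<psi> \<in> C1c \<O>" for \<psi>
  proof -
   obtain Df N where D: "C1_grad \<psi> Df" and N: "compact N" "N \<subseteq> \<O>" and \<psi>N: "\<And>x. \<psi> x \<noteq> 0 ==> x \<in> N"
    and DN: "\<And>x. Df x \<noteq> 0 ==> x \<in> N"
    using \<psi> by (rule C1cE) (assumption | rule that)+
   have \<psi>c: "continuous_on UNIV \<psi>" using D by (rule C1_grad_continuous)
   note [measurable] = C1_grad_measurable(1)[OF D]
   obtain C where C: "\<And>x. \<bar>\<psi> x\<bar> \<le> C"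
    by (rule bounded_of_compact_support[OF \<psi>c N(1) \<psi>N]) auto
   hence Ca: "\<exists>C. \<forall>x. \<bar>\<psi> x\<bar> \<le> C" by blast
   have \<psi>0: "\<forall>x. x \<notin> \<O> --> \<psi> x = 0" using \<psi>N N(2) by blast
   have "(\<lambda>n. \<integral>x. \<psi> x * fp (r n) x \<partial>lborel) \<longlonglongrightarrow> (\<integral>x. \<psi> x \<partial>\<mu>)"
    using LIMSEQ_subseq_LIMSEQ[OF c1[THEN spec, THEN mp, OF conjI[OF \<psi>c conjI[OF \<psi>0 Ca]]] r2] by (simp add: r_def o_def)
   moreover have "(\<lambda>n. \<integral>x. \<psi> x * fm (r n) x \<partial>lborel) \<longlonglongrightarrow> (\<integral>x. \<psi> x \<partial>\<nu>)"
    using c2[THEN spec, THEN mp, OF conjI[OF \<psi>c conjI[OF \<psi>0 Ca]]] by (simp add: r_def)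
   ultimately have l1: "(\<lambda>n. (LBINT x. \<psi> x * fp (r n) x) - (LBINT x. \<psi> x * fm (r n) x)) \<longlonglongrightarrow> (\<integral>x. \<psi> x \<partial>\<mu>) - (\<integral>x. \<psi> x \<partial>\<nu>)"
    by (rule tendsto_diff)
   \<comment> \<open>Translation turns the forward quotient of \<open>v\<close> into a quotient of
     the test function with a backward step, hence the direction \<open>- ?e\<close>.\<close>
   have "(\<lambda>n. \<integral>x. v x * ((\<psi> (x + t n *\<^sub>R (- ?e)) - \<psi> x) / t n) \<partial>lborel) \<longlonglongrightarrow> (LBINT x. v x * (Df x \<bullet> (- ?e)))"
    by (rule difference_quotient_limit[OF v _ D N(1) \<psi>N t t0]) (use Cv in blast)
   hence l2: "(\<lambda>n. \<integral>x. v x * ((\<psi> (x + t (r n) *\<^sub>R (- ?e)) - \<psi> x) / t (r n)) \<partial>lborel) \<longlonglongrightarrow> (LBINT x. v x * (Df x \<bullet> (- ?e)))"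
    using LIMSEQ_subseq_LIMSEQ[OF _ r] by (auto simp: o_def)
   obtain \<rho> where \<rho>: "\<rho> > 0" "(\<Union>x\<in>N. ball x \<rho>) \<subseteq> \<O>"
    using compact_subset_open_imp_ball_epsilon_subset[OF N(1) \<O>(2) N(2)] by blast
   have i\<psi>: "integrable lborel (\<lambda>x. \<psi> (x + a) * v (x + b))" for a b
   proof -
    have "integrable lborel (\<lambda>x. \<psi> x * v (x + (b - a)))"
    proof (rule integrable_bounded_support[OF _ _ compact_imp_bounded[OF N(1)]])
     show "norm (\<psi> x * v (x + (b - a))) \<le> C * Cv" for x
      unfolding norm_mult using C[of x] Cv[of "x + (b - a)"] abs_ge_zero[of "\<psi> x"] by (intro mult_mono) auto
     show "x \<in> N" if "\<psi> x * v (x + (b - a)) \<noteq> 0" for x using that by (intro \<psi>N) auto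
    qed measurable
    moreover have "integrable lborel (\<lambda>x. (\<lambda>x. \<psi> x * v (x + (b - a))) (x + a)) \<longleftrightarrow> integrable lborel (\<lambda>x. \<psi> x * v (x + (b - a)))"
     by (rule integrable_lborel_translate) measurable
    ultimately show ?thesis by (simp add: add.assoc)
   qed
   have eq: "(LBINT x. \<psi> x * fp n x) - (LBINT x. \<psi> x * fm n x) = (LBINT x. v x * ((\<psi> (x + t n *\<^sub>R (- ?e)) - \<psi> x) / t n))"
    if small: "2 * t n < \<rho>" for n
   proof -
    let ?y = "t n *\<^sub>R ?e"
    have NA: "x \<in> A n" if "x \<in> N" for x
    proof -
     have "ball x (2 * t n) \<subseteq> ball x \<rho>" using small by (intro subset_ball) simp
     thus ?thesis using \<rho>(2) that by (auto simp: A_def)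
    qed
    have ip: "integrable lborel (\<lambda>x. \<psi> x * y (q n x))" if [measurable]: "y \<in> Borel" and y: "\<And>a. \<bar>y a\<bar> \<le> \<bar>a\<bar>" for y :: "real => real"
    proof (rule integrable_bounded_support[OF _ _ compact_imp_bounded[OF N(1)]])
     show "norm (\<psi> x * y (q n x)) \<le> C * (2 * Cv / t n)" for x
      unfolding norm_mult using C[of x] q2[of n x] y[of "q n x"] abs_ge_zero[of "\<psi> x"] by (intro mult_mono) auto
     show "x \<in> N" if "\<psi> x * y (q n x) \<noteq> 0" for x using that by (intro \<psi>N) auto
    qed measurable
    have pp: "\<psi> x * fp n x = \<psi> x * max 0 (q n x)" "\<psi> x * fm n x = \<psi> x * max 0 (- q n x)" for x
     using NA[of x] \<psi>N[of x] by (auto simp: fp_def fm_def indicator_def)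
    have "(LBINT x. \<psi> x * fp n x) - (LBINT x. \<psi> x * fm n x) = (LBINT x. \<psi> x * max 0 (q n x) - \<psi> x * max 0 (- q n x))"
     unfolding pp using ip[of "\<lambda>a. max 0 a"] ip[of "\<lambda>a. max 0 (- a)"] by (intro lint_diff[symmetric]) (auto simp: max_def)
    also have "... = (LBINT x. (\<psi> x * v (x + ?y) - \<psi> x * v x) / t n)"
     by (intro lint_cong refl) (auto simp: q_def max_def field_simps)
    also have "... = ((LBINT x. \<psi> x * v (x + ?y)) - (LBINT x. \<psi> x * v x)) / t n"
     using i\<psi>[of 0 ?y] i\<psi>[of 0 0] by simp
    also have "(LBINT x. \<psi> x * v (x + ?y)) = (LBINT x. \<psi> (x + ?y + - ?y) * v (x + ?y))" by simp
    also have "... = (LBINT x. \<psi> (x + - ?y) * v x)"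
     by (rule integral_lborel_translate) measurable
    also have "((LBINT x. \<psi> (x + - ?y) * v x) - (LBINT x. \<psi> x * v x)) / t n
      = (LBINT x. (\<psi> (x + - ?y) * v x - \<psi> x * v x) / t n)"
     using i\<psi>[of "- ?y" 0] i\<psi>[of 0 0] by simp
    also have "... = (LBINT x. v x * ((\<psi> (x + t n *\<^sub>R (- ?e)) - \<psi> x) / t n))"
     by (intro lint_cong refl) (simp add: algebra_simps diff_divide_distrib)
    finally show ?thesis .
   qed
   have "(\<lambda>n. t (r n)) \<longlonglongrightarrow> 0" using LIMSEQ_subseq_LIMSEQ[OF t0 r] by (simp add: o_def)
   hence "\<forall>\<^sub>F n in sequentially. t (r n) < \<rho> / 2" using \<rho>(1) by (intro order_tendstoD(2)) auto
   hence "\<forall>\<^sub>F n in sequentially. 2 * t (r n) < \<rho>" by eventually_elim simp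
   hence "\<forall>\<^sub>F n in sequentially. (LBINT x. v x * ((\<psi> (x + t (r n) *\<^sub>R (- ?e)) - \<psi> x) / t (r n)))
     = (LBINT x. \<psi> x * fp (r n) x) - (LBINT x. \<psi> x * fm (r n) x)"
    by eventually_elim (simp only: eq)
   from tendsto_cong[THEN iffD1, OF this l2] l1
   have "(LBINT x. v x * (Df x \<bullet> (- ?e))) = (\<integral>x. \<psi> x \<partial>\<mu>) - (\<integral>x. \<psi> x \<partial>\<nu>)" by (rule LIMSEQ_unique)
   thus ?thesis by (simp add: C1_grad_partial_deriv[OF D] inner_axis)
  qed
  have "good i \<mu> \<nu>" unfolding good_def using \<mu> \<nu> main by blast
  thus ?thesis by (intro exI[of _ "(\<mu>, \<nu>)"]) simp
 qed
 hence "\<forall>i. \<exists>p. good i (fst p) (snd p)" by blast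
 from choice[OF this] obtain p where p: "\<And>i. good i (fst (p i)) (snd (p i))" by blast
 show ?thesis
  by (rule that[of "\<lambda>i. fst (p i)" "\<lambda>i. snd (p i)"]) (use p in \<open>auto simp: good_def\<close>)
qed

text \<open>Soft thresholding at e / 2 cuts \<psi> down to a compactly supported continuous function
  within e / 2 of it; mollification costs the other half.\<close>

lemma C0_approximation:
 fixes \<O> :: "(real^'d) set"
 assumes \<O>: "open \<O>" and \<psi>: "\<psi> \<in> C0 \<O>" and e: "e > 0"
 obtains \<eta> where "\<eta> \<in> C1c \<O>" "\<And>x. x \<in> \<O> ==> \<bar>\<psi> x - \<eta> x\<bar> \<le> e"
proof -
 define N where "N = {x \<in> \<O>. e / 2 \<le> \<bar>\<psi> x\<bar>}"
 have \<psi>c: "continuous_on \<O> \<psi>" and cp: "\<And>\<epsilon>. \<epsilon> > 0 ==> compact {x \<in> \<O>. \<epsilon> \<le> \<bar>\<psi> x\<bar>}" using \<psi> by (auto simp: C0_def)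
 have N: "compact N" "N \<subseteq> \<O>" unfolding N_def using cp[of "e / 2"] e by (auto simp only: half_gt_zero)
 define k where "k x = (if x \<in> \<O> then \<psi> x - max (- (e / 2)) (min (e / 2) (\<psi> x)) else 0)" for x
 have kN: "x \<in> N" if "k x \<noteq> 0" for x using that by (auto simp: k_def N_def split: if_splits)
 \<comment> \<open>\<open>k\<close> is glued from a continuous formula on \<O> and the zero function
   on \<open>- N\<close>; both sets are open and together they cover the space.\<close>
 have "continuous_on (\<O> \<union> - N) k"
 proof (rule continuous_on_open_Un)
  have "continuous_on \<O> (\<lambda>x. \<psi> x - max (- (e / 2)) (min (e / 2) (\<psi> x)))" by (intro continuous_intros \<psi>c)
  thus "continuous_on \<O> k" by (rule continuous_on_eq) (simp add: k_def)
  have "continuous_on (- N) (\<lambda>_. 0 :: real)" by (rule continuous_on_const)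
  thus "continuous_on (- N) k" by (rule continuous_on_eq) (use kN in fastforce)
 qed (use \<O> N compact_imp_closed in auto)
 moreover have "\<O> \<union> - N = UNIV" using N(2) by blast
 ultimately have kc: "continuous_on UNIV k" by simp
 have km: "k \<in> Borel" using kc by (rule borel_measurable_continuous_onI)
 obtain R where R: "\<And>x. x \<in> N ==> x \<in> cball 0 R"
  using compact_imp_bounded[OF N(1)] unfolding bounded_iff by auto
 have e2: "e / 2 > 0" using e by simp
 obtain d where d: "d > 0" "\<And>r x. 0 < r ==> r < d ==> \<bar>mollify r k x - k x\<bar> \<le> e / 2"
  by (rule mollify_uniform[OF kc _ e2, of 0 R]) (use kN R in blast)+
 obtain \<rho> where \<rho>: "\<rho> > 0" "(\<Union>x\<in>N. cball x \<rho>) \<subseteq> \<O>"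
  using compact_subset_open_imp_cball_epsilon_subset[OF N(1) \<O> N(2)] by blast
 define r where "r = min (d / 2) \<rho>"
 have r: "0 < r" "r < d" "r \<le> \<rho>" using d(1) \<rho>(1) by (auto simp: r_def)
 obtain C where C: "\<And>x. \<bar>k x\<bar> \<le> C"
  by (rule bounded_of_compact_support[OF kc N(1) kN]) auto
 have "mollify r k \<in> C1c \<O>"
 proof (rule C1cI)
  show "C1_grad (mollify r k) (mollify_grad r k)"
   using r(1) km C compact_imp_bounded[OF N(1)] kN by (rule C1_grad_mollify)
  show "compact (\<Union>x\<in>N. cball x r)" using N(1) by (rule compact_minkowski_sum_cball)
  show "(\<Union>x\<in>N. cball x r) \<subseteq> \<O>"
  proof -
   have "cball x r \<subseteq> cball x \<rho>" for x using r(3) by (intro subset_cball)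
   thus ?thesis using \<rho>(2) by blast
  qed
  show "x \<in> (\<Union>x\<in>N. cball x r)" if nz: "mollify r k x \<noteq> 0" for x
  proof -
   obtain z where z: "norm z < r" "k (x + z) \<noteq> 0"
    using r(1) km C compact_imp_bounded[OF N(1)] kN nz by (rule mollify_support) (assumption | rule that)+
   have "x \<in> cball (x + z) r" using z(1) by (simp add: dist_norm)
   thus ?thesis using kN[OF z(2)] by blast
  qed
 qed
 moreover have "\<bar>\<psi> x - mollify r k x\<bar> \<le> e" if "x \<in> \<O>" for x
 proof -
  have "\<psi> x - k x = max (- (e / 2)) (min (e / 2) (\<psi> x))" using that by (simp add: k_def)
  hence "\<bar>\<psi> x - k x\<bar> \<le> e / 2" using e2 by linarith
  thus ?thesis using d(2)[OF r(1,2), of x] by linarith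
 qed
 ultimately show ?thesis by (rule that)
qed

section \<open>Borel representatives of functions on the domain\<close>

lemma integral_rep:
 fixes \<O> :: "(real^'d) set" and w u g :: "real^'d => real"
 assumes \<O>: "open \<O>" and w: "w \<in> borel_measurable (lebesgue_on \<O>)" "AE x in lebesgue_on \<O>. w x = u x"
  and u[measurable]: "u \<in> Borel" and g[measurable]: "g \<in> Borel" and g0: "\<And>x. x \<notin> \<O> ==> g x = 0"
 shows "(\<integral>x. w x * g x \<partial>lebesgue_on \<O>) = (LBINT x. u x * g x)"
proof -
 have m: "f \<in> borel_measurable (lebesgue_on \<O>)" if "f \<in> Borel" for f :: "real^'d => real"
  using that by (intro measurable_restrict_space1 measurable_completion) simp
 have "(\<integral>x. w x * g x \<partial>lebesgue_on \<O>) = (\<integral>x. u x * g x \<partial>lebesgue_on \<O>)"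
  using w(2) by (intro integral_cong_AE borel_measurable_times w m u g) auto
 also have "... = (\<integral>x. ind \<O> x * (u x * g x) \<partial>lebesgue)" using \<O> by (rule integral_lebesgue_on_eq)
 also have "... = (\<integral>x. u x * g x \<partial>lebesgue)"
  by (intro lint_cong refl) (auto simp: indicator_def g0)
 also have "... = (LBINT x. u x * g x)" by (rule integral_completion) measurable
 finally show ?thesis .
qed

lemma L1_dist_eq:
 fixes \<O> :: "(real^'d) set"
 assumes \<O>: "open \<O>" and w: "w \<in> borel_measurable (lebesgue_on \<O>)" "AE x in lebesgue_on \<O>. w x = u x"
  and w': "w' \<in> borel_measurable (lebesgue_on \<O>)" "AE x in lebesgue_on \<O>. w' x = u' x"
  and u: "u \<in> Borel" and u': "u' \<in> Borel"
 shows "L1_dist \<O> w w' = (LBINT x. ind \<O> x * \<bar>u x - u' x\<bar>)"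
proof -
 note [measurable] = u u'
 have [measurable]: "\<O> \<in> sets borel" using \<O> by (rule borel_open)
 have "L1_dist \<O> w w' = (\<integral>x. \<bar>w x - w' x\<bar> * ind \<O> x \<partial>lebesgue_on \<O>)"
  unfolding L1_dist_def by (intro lint_cong refl) (auto simp: indicator_def)
 also have "... = (LBINT x. \<bar>u x - u' x\<bar> * ind \<O> x)"
 proof (rule integral_rep[OF \<O>])
  show "(\<lambda>x. \<bar>w x - w' x\<bar>) \<in> borel_measurable (lebesgue_on \<O>)" using w(1) w'(1) by measurable
  show "AE x in lebesgue_on \<O>. \<bar>w x - w' x\<bar> = \<bar>u x - u' x\<bar>" using w(2) w'(2) by eventually_elim simp
  show "(\<lambda>x. \<bar>u x - u' x\<bar>) \<in> Borel" by measurable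
  show "ind \<O> \<in> Borel" by measurable
 qed simp
 finally show ?thesis by (simp add: mult.commute)
qed

text \<open>Passing to a Borel representative on the whole space does not change the pairing with a
  divergence, since the latter vanishes outside the domain.\<close>

lemma TV_le_iff_tv_le:
 fixes \<O> :: "(real^'d) set"
 assumes \<O>: "open \<O>" and w: "w \<in> borel_measurable (lebesgue_on \<O>)" "AE x in lebesgue_on \<O>. w x = u x"
  and u: "u \<in> Borel"
 shows "TV \<O> w \<le> ereal M \<longleftrightarrow> tv_le \<O> u M"
proof -
 have "(\<integral>x. w x * divergence \<phi> x \<partial>lebesgue_on \<O>) = (LBINT x. u x * divergence \<phi> x)"
  if \<phi>: "\<phi> \<in> C1c \<O>" for \<phi> :: "real^'d => real^'d"
  using \<phi> by (rule divergence_bounded) (rule integral_rep[OF \<O> w u]; assumption)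
 thus ?thesis unfolding TV_def tv_le_def SUP_le_iff by auto
qed

text \<open>Test functions in \<open>C1c\<close> suffice: they approximate functions in
  \<open>C0\<close> uniformly, and all measures have mass at most M + 1. For a \<open>C1c\<close>
  function the pairing with the derivative measure is, up to sign, an integral of a partial
  derivative against the function itself, which converges by the L1 convergence.\<close>

lemma BV_weak_star_of_L1:
 fixes \<O> :: "(real^'d) set"
 assumes \<O>: "bounded \<O>" "open \<O>" and w: "\<And>k. w k \<in> L1 \<O>" "\<And>k. AE x in lebesgue_on \<O>. w k x = u k x"
  and u[measurable]: "\<And>k. u k \<in> Borel" and Bu: "\<And>k x. \<bar>u k x\<bar> \<le> B" and tv: "\<And>k. tv_le \<O> (u k) M"
  and v[measurable]: "v \<in> Borel" and Bv: "\<And>x. \<bar>v x\<bar> \<le> B" and vL: "v \<in> L1 \<O>"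
  and lim: "(\<lambda>k. \<integral>x. ind \<O> x * \<bar>u k x - v x\<bar> \<partial>lborel) \<longlonglongrightarrow> 0"
 shows "BV_weak_star_tendsto \<O> w v"
proof -
 have [measurable]: "\<O> \<in> sets borel" using \<O> by (auto intro: borel_open)
 have m: "f \<in> borel_measurable (lebesgue_on \<O>)" if "f \<in> Borel" for f :: "real^'d => real"
  using that by (intro measurable_restrict_space1 measurable_completion) simp
 have wm: "w k \<in> borel_measurable (lebesgue_on \<O>)" for k using w(1)[of k] by (auto simp: L1_def)
 have tvv: "tv_le \<O> v M" using \<O> u Bu tv v Bv lim by (rule tv_le_limit)
 have refl_v: "AE x in lebesgue_on \<O>. v x = v x" by simp
 have wBV: "w k \<in> BV \<O>" for k
 proof -
  have "TV \<O> (w k) \<le> ereal M" using TV_le_iff_tv_le[OF \<O>(2) wm w(2) u] tv by blast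
  thus ?thesis using w(1) by (auto simp: BV_def)
 qed
 have vBV: "v \<in> BV \<O>"
 proof -
  have "TV \<O> v \<le> ereal M" using TV_le_iff_tv_le[OF \<O>(2) m[OF v] refl_v v] tvv by blast
  thus ?thesis using vL by (auto simp: BV_def)
 qed
 have L1: "(\<lambda>k. L1_dist \<O> (w k) v) \<longlonglongrightarrow> 0"
 proof -
  have "L1_dist \<O> (w k) v = (LBINT x. ind \<O> x * \<bar>u k x - v x\<bar>)" for k
   using \<O>(2) wm w(2) m[OF v] refl_v u v by (rule L1_dist_eq)
  thus ?thesis using lim by simp
 qed
 \<comment> \<open>The measures obtained on the whole space are restricted to \<O>; integrals of
   functions vanishing outside \<O> do not change.\<close>
 have res: "(\<integral>x. \<psi> x \<partial>restrict_space \<mu> \<O>) = (\<integral>x. \<psi> x \<partial>\<mu>)" if "sets \<mu> = sets borel" "\<And>x. x \<notin> \<O> ==> \<psi> x = 0" for \<mu> and \<psi> :: "real^'d => real"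
 proof -
  have "(\<integral>x. \<psi> x \<partial>restrict_space \<mu> \<O>) = (\<integral>x. ind \<O> x *\<^sub>R \<psi> x \<partial>\<mu>)"
   using that(1) sets_eq_imp_space_eq[OF that(1)] \<O>(2) by (subst integral_restrict_space) auto
  also have "... = (\<integral>x. \<psi> x \<partial>\<mu>)"
   using that(2) by (intro lint_cong refl) (auto simp: indicator_def)
  finally show ?thesis .
 qed
 have ex: "\<exists>\<mu> \<nu>. derivative_measure \<O> y \<mu> \<nu> \<and> (\<forall>i. measure (\<mu> i) (space (\<mu> i)) \<le> M + 1 \<and> measure (\<nu> i) (space (\<nu> i)) \<le> M + 1)"
  if ym: "y \<in> borel_measurable (lebesgue_on \<O>)" and yz: "AE x in lebesgue_on \<O>. y x = z x" and z: "z \<in> Borel" and Bz: "\<And>x. \<bar>z x\<bar> \<le> B" and tvz: "tv_le \<O> z M" for y z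
 proof -
  obtain \<mu> \<nu> :: "'d => (real^'d) measure" where \<mu>: "\<And>i. finite_measure (\<mu> i)" "\<And>i. sets (\<mu> i) = sets borel" "\<And>i. measure (\<mu> i) (space (\<mu> i)) \<le> M + 1"
   and \<nu>: "\<And>i. finite_measure (\<nu> i)" "\<And>i. sets (\<nu> i) = sets borel" "\<And>i. measure (\<nu> i) (space (\<nu> i)) \<le> M + 1"
   and eq: "\<forall>i. \<forall>\<psi>\<in>C1c \<O>. (LBINT x. z x * partial_deriv i \<psi> x) = - ((\<integral>x. \<psi> x \<partial>\<mu> i) - (\<integral>x. \<psi> x \<partial>\<nu> i))"
   using \<O> z Bz tvz by (rule derivative_measures_exist) (assumption | rule that)+
  have fin: "finite_measure (restrict_space \<kappa> \<O>)" "sets (restrict_space \<kappa> \<O>) = sets (restrict_space borel \<O>)"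
   "measure (restrict_space \<kappa> \<O>) (space (restrict_space \<kappa> \<O>)) \<le> M + 1"
   if \<kappa>: "finite_measure \<kappa>" "sets \<kappa> = sets borel" "measure \<kappa> (space \<kappa>) \<le> M + 1" for \<kappa> :: "(real^'d) measure"
  proof -
   have sp: "space \<kappa> = UNIV" using sets_eq_imp_space_eq[OF \<kappa>(2)] by simp
   have em: "emeasure (restrict_space \<kappa> \<O>) (space (restrict_space \<kappa> \<O>)) = emeasure \<kappa> \<O>"
    using \<kappa>(2) sp by (subst emeasure_restrict_space) (auto simp: space_restrict_space)
   show "finite_measure (restrict_space \<kappa> \<O>)"
    using \<kappa>(1) em by (intro finite_measureI) (simp add: finite_measure.emeasure_finite)
   show "sets (restrict_space \<kappa> \<O>) = sets (restrict_space borel \<O>)" using \<kappa>(2) by (rule sets_restrict_space_cong)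
   have "measure (restrict_space \<kappa> \<O>) (space (restrict_space \<kappa> \<O>)) = measure \<kappa> \<O>" using em by (simp add: measure_def)
   also have "... \<le> measure \<kappa> (space \<kappa>)" using \<kappa>(1) by (rule finite_measure.bounded_measure)
   finally show "measure (restrict_space \<kappa> \<O>) (space (restrict_space \<kappa> \<O>)) \<le> M + 1" using \<kappa>(3) by linarith
  qed
  have "derivative_measure \<O> y (\<lambda>i. restrict_space (\<mu> i) \<O>) (\<lambda>i. restrict_space (\<nu> i) \<O>)"
   unfolding derivative_measure_def
  proof (intro allI conjI ballI)
   fix i and \<psi> :: "real^'d => real" assume \<psi>: "\<psi> \<in> C1c \<O>"
   obtain Df N where D: "C1_grad \<psi> Df" and N: "compact N" "N \<subseteq> \<O>" and \<psi>N: "\<And>x. \<psi> x \<noteq> 0 ==> x \<in> N"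
    and DN: "\<And>x. Df x \<noteq> 0 ==> x \<in> N"
    using \<psi> by (rule C1cE) (assumption | rule that)+
   have pd: "partial_deriv i \<psi> = (\<lambda>x. Df x $ i)" using C1_grad_partial_deriv[OF D] by auto
   note [measurable] = C1_grad_measurable(2)[OF D]
   have \<psi>0: "\<psi> x = 0" if "x \<notin> \<O>" for x using \<psi>N[of x] N(2) that by blast
   have "(\<integral>x. y x * partial_deriv i \<psi> x \<partial>lebesgue_on \<O>) = (LBINT x. z x * partial_deriv i \<psi> x)"
   proof (rule integral_rep[OF \<O>(2) ym yz z])
    show "partial_deriv i \<psi> \<in> Borel" unfolding pd by measurable
    show "partial_deriv i \<psi> x = 0" if "x \<notin> \<O>" for x
    proof -
     have "Df x = 0" using DN[of x] N(2) that by blast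
     thus ?thesis by (simp add: pd)
    qed
   qed
   thus "(\<integral>x. y x * partial_deriv i \<psi> x \<partial>lebesgue_on \<O>) =
     - ((\<integral>x. \<psi> x \<partial>restrict_space (\<mu> i) \<O>) - (\<integral>x. \<psi> x \<partial>restrict_space (\<nu> i) \<O>))"
    using eq[THEN spec[of _ i], THEN bspec, OF \<psi>] res[OF \<mu>(2) \<psi>0] res[OF \<nu>(2) \<psi>0] by simp
  qed (use fin[OF \<mu>] fin[OF \<nu>] in auto)
  thus ?thesis using fin(3)[OF \<mu>] fin(3)[OF \<nu>] by blast
 qed
 have "\<exists>\<mu> \<nu>. derivative_measure \<O> (w k) \<mu> \<nu> \<and> (\<forall>i. measure (\<mu> i) (space (\<mu> i)) \<le> M + 1 \<and> measure (\<nu> i) (space (\<nu> i)) \<le> M + 1)" for k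
  by (rule ex[OF wm w(2) u Bu tv])
 then obtain \<mu> \<nu> where dk: "\<And>k. derivative_measure \<O> (w k) (\<mu> k) (\<nu> k)"
  and mk: "\<And>k i. measure (\<mu> k i) (space (\<mu> k i)) \<le> M + 1" "\<And>k i. measure (\<nu> k i) (space (\<nu> k i)) \<le> M + 1" by metis
 obtain \<mu>0 \<nu>0 where d0: "derivative_measure \<O> v \<mu>0 \<nu>0"
  and m0: "\<And>i. measure (\<mu>0 i) (space (\<mu>0 i)) \<le> M + 1" "\<And>i. measure (\<nu>0 i) (space (\<nu>0 i)) \<le> M + 1"
  using ex[OF m[OF v] refl_v v Bv tvv] by metis
 have C0conv: "(\<lambda>k. (\<integral>x. \<psi> x \<partial>\<mu> k i) - (\<integral>x. \<psi> x \<partial>\<nu> k i)) \<longlonglongrightarrow> (\<integral>x. \<psi> x \<partial>\<mu>0 i) - (\<integral>x. \<psi> x \<partial>\<nu>0 i)"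
  if \<psi>: "\<psi> \<in> C0 \<O>" for \<psi> i
 proof (rule LIMSEQ_I)
  fix \<epsilon> :: real assume \<epsilon>: "\<epsilon> > 0"
  have "tv_le \<O> v M" by (rule tvv)
  hence M0: "0 \<le> M" by (rule tv_le_nonneg)
  \<comment> \<open>Four measures of mass at most M + 1 contribute \<epsilon> / 5 each, and so does
    the convergence for the approximating test function.\<close>
  define e where "e = \<epsilon> / 5 / (M + 1)"
  have e: "e > 0" unfolding e_def using \<epsilon> M0 by (intro divide_pos_pos) auto
  have M1: "M + 1 \<noteq> 0" using M0 by linarith
  obtain \<eta> where \<eta>: "\<eta> \<in> C1c \<O>" and close: "\<And>x. x \<in> \<O> ==> \<bar>\<psi> x - \<eta> x\<bar> \<le> e"
   using \<O>(2) \<psi> e by (rule C0_approximation) blast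
  obtain Df N where D: "C1_grad \<eta> Df" and N: "compact N" "N \<subseteq> \<O>" and \<eta>N: "\<And>x. \<eta> x \<noteq> 0 ==> x \<in> N"
   and DN: "\<And>x. Df x \<noteq> 0 ==> x \<in> N"
   using \<eta> by (rule C1cE) (assumption | rule that)+
  have pd: "partial_deriv i \<eta> = (\<lambda>x. Df x $ i)" using C1_grad_partial_deriv[OF D] by auto
  have Dc: "continuous_on UNIV Df" using D by (simp add: C1_grad_def)
  obtain C where C: "C > 0" "\<And>x. norm (Df x) \<le> C"
   using Dc N(1) DN by (rule bounded_of_compact_support) (assumption | rule that)+
  obtain C' where C': "\<And>x. \<bar>\<eta> x\<bar> \<le> C'"
   by (rule bounded_of_compact_support[OF C1_grad_continuous[OF D] N(1) \<eta>N]) auto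
  note [measurable] = C1_grad_measurable[OF D]
  have pdm: "partial_deriv i \<eta> \<in> Borel" unfolding pd by measurable
  have pd0: "partial_deriv i \<eta> x = 0" if "x \<notin> \<O>" for x
  proof -
   have "Df x = 0" using DN[of x] N(2) that by blast
   thus ?thesis by (simp add: pd)
  qed
  have "\<bar>partial_deriv i \<eta> x\<bar> \<le> C" for x
   unfolding pd using C(2)[of x] component_le_norm_cart[of "Df x" i] by linarith
  with \<O> u Bu v Bv lim pdm less_imp_le[OF C(1)]
  have "(\<lambda>k. \<integral>x. u k x * partial_deriv i \<eta> x \<partial>lborel) \<longlonglongrightarrow> (LBINT x. v x * partial_deriv i \<eta> x)"
   using pd0 by (rule integral_divergence_tendsto)
  hence "(\<lambda>k. \<integral>x. w k x * partial_deriv i \<eta> x \<partial>lebesgue_on \<O>) \<longlonglongrightarrow> (\<integral>x. v x * partial_deriv i \<eta> x \<partial>lebesgue_on \<O>)"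
   using integral_rep[OF \<O>(2) wm w(2) u pdm pd0] integral_rep[OF \<O>(2) m[OF v] refl_v v pdm pd0] by simp
  moreover have "(\<integral>x. w k x * partial_deriv i \<eta> x \<partial>lebesgue_on \<O>) = - ((\<integral>x. \<eta> x \<partial>\<mu> k i) - (\<integral>x. \<eta> x \<partial>\<nu> k i))" for k
   using dk[of k] \<eta> by (auto simp: derivative_measure_def)
  moreover have "(\<integral>x. v x * partial_deriv i \<eta> x \<partial>lebesgue_on \<O>) = - ((\<integral>x. \<eta> x \<partial>\<mu>0 i) - (\<integral>x. \<eta> x \<partial>\<nu>0 i))"
   using d0 \<eta> by (auto simp: derivative_measure_def)
  ultimately have "(\<lambda>k. - ((\<integral>x. \<eta> x \<partial>\<mu> k i) - (\<integral>x. \<eta> x \<partial>\<nu> k i))) \<longlonglongrightarrow> - ((\<integral>x. \<eta> x \<partial>\<mu>0 i) - (\<integral>x. \<eta> x \<partial>\<nu>0 i))" by simp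
  hence "(\<lambda>k. (\<integral>x. \<eta> x \<partial>\<mu> k i) - (\<integral>x. \<eta> x \<partial>\<nu> k i)) \<longlonglongrightarrow> (\<integral>x. \<eta> x \<partial>\<mu>0 i) - (\<integral>x. \<eta> x \<partial>\<nu>0 i)"
   by (rule tendsto_minus_cancel)
  moreover have "\<epsilon> / 5 > 0" using \<epsilon> by simp
  ultimately obtain k0 where k0: "\<And>k. k \<ge> k0 ==> norm ((\<integral>x. \<eta> x \<partial>\<mu> k i) - (\<integral>x. \<eta> x \<partial>\<nu> k i) - ((\<integral>x. \<eta> x \<partial>\<mu>0 i) - (\<integral>x. \<eta> x \<partial>\<nu>0 i))) < \<epsilon> / 5"
   by (blast dest: LIMSEQ_D)
  have diff: "\<bar>(\<integral>x. \<psi> x \<partial>\<kappa>) - (\<integral>x. \<eta> x \<partial>\<kappa>)\<bar> \<le> \<epsilon> / 5"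
   if \<kappa>: "finite_measure \<kappa>" "sets \<kappa> = sets (restrict_space borel \<O>)" "measure \<kappa> (space \<kappa>) \<le> M + 1" for \<kappa> :: "(real^'d) measure"
  proof -
   have sp: "space \<kappa> = \<O>" using sets_eq_imp_space_eq[OF \<kappa>(2)] by (simp add: space_restrict_space)
   have \<psi>c: "continuous_on \<O> \<psi>" using \<psi> by (simp add: C0_def)
   have \<psi>m: "\<psi> \<in> borel_measurable \<kappa>"
    unfolding measurable_cong_sets[OF \<kappa>(2) refl] using \<psi>c by (rule borel_measurable_continuous_on_restrict)
   have \<eta>m: "\<eta> \<in> borel_measurable \<kappa>"
    unfolding measurable_cong_sets[OF \<kappa>(2) refl] by (intro measurable_restrict_space1) measurable
   have i\<eta>: "integrable \<kappa> \<eta>"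
    using C' \<eta>m by (intro finite_measure.integrable_const_bound[OF \<kappa>(1), of _ C']) auto
   have "\<bar>\<psi> x\<bar> \<le> e + C'" if "x \<in> \<O>" for x using close[OF that] C'[of x] by linarith
   hence i\<psi>: "integrable \<kappa> \<psi>"
    using \<psi>m sp by (intro finite_measure.integrable_const_bound[OF \<kappa>(1), of _ "e + C'"] AE_I2) auto
   have "\<bar>(\<integral>x. \<psi> x \<partial>\<kappa>) - (\<integral>x. \<eta> x \<partial>\<kappa>)\<bar> = \<bar>\<integral>x. \<psi> x - \<eta> x \<partial>\<kappa>\<bar>" using i\<psi> i\<eta> by simp
   also have "... \<le> (\<integral>x. e \<partial>\<kappa>)"
    unfolding real_norm_def[symmetric]
   proof (rule lint_norm_bound_lint)
    show "integrable \<kappa> (\<lambda>x. \<psi> x - \<eta> x)" using i\<psi> i\<eta> by simp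
    show "integrable \<kappa> (\<lambda>x. e)" using \<kappa>(1) by (rule finite_measure.integrable_const)
    show "norm (\<psi> x - \<eta> x) \<le> e" if "x \<in> space \<kappa>" for x using close that sp by auto
   qed
   also have "... = measure \<kappa> (space \<kappa>) * e" by simp
   also have "... \<le> (M + 1) * e" using \<kappa>(3) e by (intro mult_right_mono) auto
   also have "... = e * (M + 1)" by (rule mult.commute)
   also have "... = \<epsilon> / 5" unfolding e_def by (rule iffD1[OF nonzero_eq_divide_eq[OF M1] refl])
   finally show ?thesis .
  qed
  have dm: "finite_measure (\<mu> k i)" "sets (\<mu> k i) = sets (restrict_space borel \<O>)" "finite_measure (\<nu> k i)" "sets (\<nu> k i) = sets (restrict_space borel \<O>)" for k
   using dk[of k] by (auto simp: derivative_measure_def)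
  have dm0: "finite_measure (\<mu>0 i)" "sets (\<mu>0 i) = sets (restrict_space borel \<O>)" "finite_measure (\<nu>0 i)" "sets (\<nu>0 i) = sets (restrict_space borel \<O>)"
   using d0 by (auto simp: derivative_measure_def)
  show "\<exists>no. \<forall>k\<ge>no. norm ((\<integral>x. \<psi> x \<partial>\<mu> k i) - (\<integral>x. \<psi> x \<partial>\<nu> k i) - ((\<integral>x. \<psi> x \<partial>\<mu>0 i) - (\<integral>x. \<psi> x \<partial>\<nu>0 i))) < \<epsilon>"
  proof (intro exI allI impI)
   fix k assume "k \<ge> k0"
   note 1 = k0[OF this, unfolded real_norm_def]
   show "norm ((\<integral>x. \<psi> x \<partial>\<mu> k i) - (\<integral>x. \<psi> x \<partial>\<nu> k i) - ((\<integral>x. \<psi> x \<partial>\<mu>0 i) - (\<integral>x. \<psi> x \<partial>\<nu>0 i))) < \<epsilon>"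
    unfolding real_norm_def
    using 1 diff[OF dm(1,2) mk(1), of k] diff[OF dm(3,4) mk(2), of k] diff[OF dm0(1,2) m0(1)] diff[OF dm0(3,4) m0(2)]
    by linarith
  qed
 qed
 show ?thesis
  unfolding BV_weak_star_tendsto_def
  using wBV vBV L1 dk d0 C0conv by blast
qed

section \<open>The discretized problems\<close>

text \<open>Values outside \<open>W\<close> occur on a null set only and are replaced by a fixed
  element, so that bounds and membership hold at every point, in particular at the sample points of
  the recovery sequence.\<close>

lemma L1_W_representative:
 fixes \<O> :: "(real^'d) set"
 assumes \<O>: "open \<O>" and W: "finite W" "W \<noteq> {}" and w: "w \<in> L1_W \<O> W"
 obtains u where "u \<in> Borel" "\<And>x. u x \<in> real_of_int ` W" "AE x in lebesgue_on \<O>. w x = u x"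
proof -
 let ?S = "real_of_int ` W"
 obtain s0 where s0: "s0 \<in> ?S" using W(2) by blast
 have "w \<in> borel_measurable (lebesgue_on \<O>)" using w by (auto simp: L1_W_def L1_def)
 hence "(\<lambda>x. ind \<O> x *\<^sub>R w x) \<in> borel_measurable lebesgue"
  using \<O> by (subst (asm) borel_measurable_restrict_space_iff) auto
 then obtain g where g: "g \<in> borel_measurable lborel" "AE x in lborel. ind \<O> x *\<^sub>R w x = g x"
  using completion_ex_borel_measurable_real by blast
 have gm[measurable]: "g \<in> Borel" using g(1) by simp
 have Sm[measurable]: "?S \<in> sets borel" using W(1) by (intro borel_closed finite_imp_closed) simp
 define u where "u x = (if g x \<in> ?S then g x else s0)" for x
 have "u \<in> Borel" unfolding u_def[abs_def] by measurable
 moreover have "u x \<in> ?S" for x using s0 by (simp add: u_def)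
 moreover have "AE x in lebesgue_on \<O>. w x = u x"
 proof -
  have "AE x in lebesgue. ind \<O> x *\<^sub>R w x = g x" using g(2) by (rule AE_completion)
  moreover have "AE x in lebesgue. x \<in> \<O> --> w x \<in> ?S"
   using w AE_lebesgue_on_iff[OF \<O>] by (auto simp: L1_W_def)
  ultimately have "AE x in lebesgue. x \<in> \<O> --> w x = u x"
  proof eventually_elim
   case (elim x)
   show ?case
   proof
    assume "x \<in> \<O>"
    hence "g x = w x" "w x \<in> ?S" using elim by auto
    thus "w x = u x" by (simp add: u_def)
   qed
  qed
  thus ?thesis using AE_lebesgue_on_iff[OF \<O>] by blast
 qed
 ultimately show ?thesis by (rule that)
qed

lemma bounded_borel_spaces:
 fixes \<O> :: "(real^'d) set"
 assumes \<O>: "open \<O>" "bounded \<O>" and W: "finite W" and u: "u \<in> Borel" "\<And>x. u x \<in> real_of_int ` W"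
 shows "u \<in> L2 \<O>" "u \<in> L1_W \<O> W"
proof -
 have "bounded (real_of_int ` W)" using W by (intro finite_imp_bounded) simp
 then obtain B where B: "\<And>s. s \<in> real_of_int ` W ==> norm s \<le> B" unfolding bounded_iff by blast
 show L2: "u \<in> L2 \<O>" using \<O> u(1) B[OF u(2)] by (rule bounded_measurable_L2)
 show "u \<in> L1_W \<O> W" using integrable_of_L2(1)[OF \<O> L2] u(2) by (simp add: L1_W_def L1_def)
qed

text \<open>By translation invariance the integrals of all difference quotients of the components of
  the test field vanish, hence so do the integrals of the partial derivatives.\<close>

lemma tv_le_const:
 fixes \<O> :: "(real^'d) set"
 shows "tv_le \<O> (\<lambda>_. b) 0"
 unfolding tv_le_def
proof (intro ballI impI)
 fix \<phi> :: "real^'d => real^'d" assume \<phi>: "\<phi> \<in> C1c \<O>"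
 obtain Df K where D: "\<And>i. C1_grad (\<lambda>x. \<phi> x $ i) (Df i)" and K: "compact K" "K \<subseteq> \<O>" and \<phi>K: "\<And>x. \<phi> x \<noteq> 0 ==> x \<in> K"
  and DK: "\<And>i x. Df i x \<noteq> 0 ==> x \<in> K" and div: "\<And>x. divergence \<phi> x = (\<Sum>i\<in>UNIV. Df i x $ i)"
  using \<phi> by (rule C1c_vecE) (assumption | rule that)+
 have zero: "(LBINT x. b * (Df i x $ i)) = 0" for i
 proof -
  let ?f = "\<lambda>x. \<phi> x $ i" and ?t = "\<lambda>n. 1 / real (Suc n)"
  note [measurable] = C1_grad_measurable(1)[OF D[of i]]
  have fK: "x \<in> K" if "?f x \<noteq> 0" for x using that by (intro \<phi>K) auto
  have lim: "(\<lambda>n. \<integral>x. b * ((?f (x + ?t n *\<^sub>R axis i 1) - ?f x) / ?t n) \<partial>lborel) \<longlonglongrightarrow> (LBINT x. b * (Df i x \<bullet> axis i 1))"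
  proof (rule difference_quotient_limit[OF _ _ D[of i] K(1) fK])
   show "?t \<longlonglongrightarrow> 0" by (rule LIMSEQ_Suc[OF lim_const_over_n])
  qed auto
  have zero: "(LBINT x. b * ((?f (x + y) - ?f x) / s)) = 0" for y s
  proof -
   obtain C where C: "\<And>x. norm (?f x) \<le> C"
    by (rule bounded_of_compact_support[OF C1_grad_continuous[OF D[of i]] K(1) fK]) auto
   have if': "integrable lborel ?f"
    using C1_grad_measurable(1)[OF D[of i]] C compact_imp_bounded[OF K(1)] fK by (rule integrable_bounded_support)
   hence "integrable lborel (\<lambda>x. ?f (x + y))"
    using integrable_lborel_translate[of ?f y] C1_grad_measurable(1)[OF D[of i]] by simp
   hence "(LBINT x. b * ((?f (x + y) - ?f x) / s)) = b * (((LBINT x. ?f (x + y)) - (LBINT x. ?f x)) / s)"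
    using if' by simp
   also have "(LBINT x. ?f (x + y)) = (LBINT x. ?f x)" by (rule integral_lborel_translate) measurable
   finally show ?thesis by simp
  qed
  have "(\<lambda>n::nat. 0::real) \<longlonglongrightarrow> (LBINT x. b * (Df i x \<bullet> axis i 1))" using lim unfolding zero .
  thus ?thesis by (simp add: LIMSEQ_const_iff inner_axis)
 qed
 have "integrable lborel (\<lambda>x. b * (Df i x $ i))" for i
 proof -
  have Dc: "continuous_on UNIV (Df i)" using D[of i] by (simp add: C1_grad_def)
  obtain C where C: "\<And>x. norm (Df i x) \<le> C"
   by (rule bounded_of_compact_support[OF Dc K(1) DK]) auto
  note [measurable] = C1_grad_measurable(2)[OF D[of i]]
  show ?thesis
  proof (rule integrable_bounded_support[OF _ _ compact_imp_bounded[OF K(1)]])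
   show "norm (b * (Df i x $ i)) \<le> \<bar>b\<bar> * C" for x
    unfolding norm_mult using C[of x] component_le_norm_cart[of "Df i x" i] by (intro mult_mono) auto
   show "x \<in> K" if "b * (Df i x $ i) \<noteq> 0" for x using that by (intro DK[of i]) auto
  qed measurable
 qed
 hence "(LBINT x. b * divergence \<phi> x) = (\<Sum>i\<in>UNIV. \<integral>x. b * (Df i x $ i) \<partial>lborel)"
  unfolding div sum_distrib_left by (intro lint_sum)
 also have "... = 0" by (simp only: zero sum.neutral_const)
 finally show "(LBINT x. b * divergence \<phi> x) \<le> 0" by (rule eq_refl)
qed

lemma piecewise_constant_P0:
 fixes \<O> :: "(real^'d) set"
 assumes lm: "lattice_mesh \<O> \<tau> \<Q> a X"
 shows "(\<lambda>x. f (lindex a \<tau> x)) \<in> P0 \<Q>"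
proof -
 have \<tau>: "\<tau> > 0" and \<Q>: "\<Q> = ccell a \<tau> ` X" using lm unfolding lattice_mesh_def by blast+
 have "AE x in lebesgue_on (ccell a \<tau> k). f (lindex a \<tau> x) = f k" for k
 proof -
  have "ccell a \<tau> k - lcell a \<tau> k \<in> null_sets lebesgue"
   using negligible_frontier_interval unfolding ccell_def lcell_def negligible_iff_null_sets by blast
  hence "AE x in lebesgue. x \<notin> ccell a \<tau> k - lcell a \<tau> k" by (rule AE_not_in)
  hence "AE x in lebesgue. x \<in> ccell a \<tau> k --> f (lindex a \<tau> x) = f k"
  proof eventually_elim
   case (elim x)
   thus ?case using lcell_lindex[OF \<tau>, of x a k] by auto
  qed
  thus ?thesis by (subst AE_restrict_space_iff) (auto simp: ccell_def)
 qed
 thus ?thesis unfolding P0_def \<Q> by blast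
qed

text \<open>\<open>U\<close> is chosen to satisfy both constraints: it dominates the bound M +
  O(\<tau> / h) for \<open>TVh\<close>, and the surplus M \<delta> 2^d makes sqrt d U at least the
  bound \<open>L\<close> for \<open>TV\<close>, so that TV \<le> c U follows from sqrt d \<le>
  c.\<close>

lemma recovery_pair:
 fixes \<O> :: "(real^'d) set"
 assumes \<O>: "bounded \<O>" "open \<O>" and W: "finite W" and lmh: "lattice_mesh \<O> h \<Q>h a' X'" and lm: "lattice_mesh \<O> \<tau> \<Q>\<tau> a X"
  and v[measurable]: "v \<in> Borel" and vW: "\<And>x. v x \<in> real_of_int ` W" and tv: "tv_le \<O> v M"
  and \<delta>: "\<delta> > 0" and c: "sqrt (real CARD('d)) \<le> c"
  and L: "L = (sqrt (real CARD('d)) + \<delta> * (2^CARD('d) * sqrt (real CARD('d)))) * M"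
  and U: "U = M * (1 + \<delta> * 2^CARD('d)) + 2 * real CARD('d) / h * (\<tau> * L / \<delta>)"
 obtains v' where "v' \<in> L2 \<O>" "(v', U) \<in> Zh \<O> W c \<Q>h \<Q>\<tau>" "L1_dist \<O> v' v \<le> \<tau> * L / \<delta>"
proof -
 have h: "h > 0" and \<tau>: "\<tau> > 0" using lmh lm unfolding lattice_mesh_def by blast+
 have M0: "0 \<le> M" using tv by (rule tv_le_nonneg)
 have "bounded (real_of_int ` W)" using W by (intro finite_imp_bounded) simp
 then obtain B where B: "\<And>s. s \<in> real_of_int ` W ==> norm s \<le> B" unfolding bounded_iff by blast
 hence vB: "\<bar>v x\<bar> \<le> B" for x using vW[of x] by fastforce
 obtain z where z: "tv_le \<O> (\<lambda>x. v (lcorner a \<tau> (lindex a \<tau> x) + z)) L"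
  "(LBINT x. ind \<O> x * \<bar>v (lcorner a \<tau> (lindex a \<tau> x) + z) - v x\<bar>) \<le> \<tau> * L / \<delta>"
  using sampling[OF \<O> v vB tv lm \<delta>] unfolding L by blast
 define v' where "v' x = v (lcorner a \<tau> (lindex a \<tau> x) + z)" for x
 have v'm[measurable]: "v' \<in> Borel" unfolding v'_def by measurable
 have v'W: "v' x \<in> real_of_int ` W" for x unfolding v'_def by (rule vW)
 have v'B: "\<bar>v' x\<bar> \<le> B" for x unfolding v'_def by (rule vB)
 note sp = bounded_borel_spaces[OF \<O>(2,1) W v'm v'W]
 have m: "f \<in> borel_measurable (lebesgue_on \<O>)" if "f \<in> Borel" for f :: "real^'d => real"
  using that by (intro measurable_restrict_space1 measurable_completion) simp
 have refl': "AE x in lebesgue_on \<O>. y x = y x" for y :: "real^'d => real" by simp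
 have dist: "L1_dist \<O> v' v \<le> \<tau> * L / \<delta>"
  unfolding L1_dist_eq[OF \<O>(2) m[OF v'm] refl' m[OF v] refl' v'm v] using z(2) by (simp add: v'_def)
 have "0 \<le> L" unfolding L using M0 \<delta> by simp
 hence err: "0 \<le> 2 * real CARD('d) / h * (\<tau> * L / \<delta>)" using h \<tau> \<delta> by simp
 have "TVh \<O> \<Q>h v' \<le> ereal (M + 2 * real CARD('d) / h * (LBINT x. ind \<O> x * \<bar>v' x - v x\<bar>))"
  using \<O> v vB tv lmh v'm v'B by (rule TVh_le)
 also have "M + 2 * real CARD('d) / h * (LBINT x. ind \<O> x * \<bar>v' x - v x\<bar>) \<le> U"
 proof -
  have "2 * real CARD('d) / h * (LBINT x. ind \<O> x * \<bar>v' x - v x\<bar>) \<le> 2 * real CARD('d) / h * (\<tau> * L / \<delta>)"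
   using z(2) h unfolding v'_def by (intro mult_left_mono) auto
  moreover have "M \<le> M * (1 + \<delta> * 2^CARD('d))" using M0 \<delta> by (simp add: distrib_left)
  ultimately show ?thesis unfolding U by linarith
 qed
 finally have 1: "TVh \<O> \<Q>h v' \<le> ereal U" by simp
 have LU: "L \<le> c * U"
 proof -
  have "L = sqrt (real CARD('d)) * (M * (1 + \<delta> * 2^CARD('d)))" unfolding L by (simp add: algebra_simps)
  also have "... \<le> sqrt (real CARD('d)) * U" unfolding U using err by (intro mult_left_mono) auto
  also have "... \<le> c * U"
  proof (rule mult_right_mono[OF c])
   show "0 \<le> U" unfolding U using err M0 \<delta> by simp
  qed
  finally show ?thesis .
 qed
 have "TV \<O> v' \<le> ereal L"
  using TV_le_iff_tv_le[OF \<O>(2) m[OF v'm] refl' v'm] z(1) unfolding v'_def[abs_def] by blast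
 also have "... \<le> ereal (c * U)" using LU by simp
 finally have 2: "TV \<O> v' \<le> ereal (c * U)" .
 have "v' \<in> P0 \<Q>\<tau>" unfolding v'_def[abs_def] using lm by (rule piecewise_constant_P0)
 hence "(v', U) \<in> Zh \<O> W c \<Q>h \<Q>\<tau>" using 1 2 sp(2) by (simp add: Zh_def)
 with sp(1) show ?thesis using dist by (rule that)
qed

text \<open>A feasible competitor has a finite objective, so the minimizer is feasible as well and
  the indicator terms drop out.\<close>

lemma minimizer_PhD:
 assumes min: "minimizer_Ph \<O> W F \<alpha> c \<Q>h \<Q>\<tau> w V" and v: "v \<in> L2 \<O>" "(v, U) \<in> Zh \<O> W c \<Q>h \<Q>\<tau>"
 shows "(w, V) \<in> Zh \<O> W c \<Q>h \<Q>\<tau>" "F w + \<alpha> * V \<le> F v + \<alpha> * U"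
proof -
 have le: "Gh \<O> W F \<alpha> c \<Q>h \<Q>\<tau> w V \<le> Gh \<O> W F \<alpha> c \<Q>h \<Q>\<tau> v U"
  using min v(1) unfolding minimizer_Ph_def by blast
 show Z: "(w, V) \<in> Zh \<O> W c \<Q>h \<Q>\<tau>"
  using le v(2) by (auto simp: Gh_def indicator_functional_def split: if_splits)
 show "F w + \<alpha> * V \<le> F v + \<alpha> * U"
  using le v(2) Z by (simp add: Gh_def indicator_functional_def)
qed

section \<open>Limits along mesh sizes tending to 0\<close>

lemma le_of_forall_eps:
 fixes X :: real
 assumes "\<And>\<epsilon>. \<epsilon> > 0 ==> X \<le> (1 + \<epsilon>) * (a + b * \<epsilon>) + e * \<epsilon>"
 shows "X \<le> a"
proof (rule tendsto_lowerbound)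
 show "((\<lambda>\<epsilon>. (1 + \<epsilon>) * (a + b * \<epsilon>) + e * \<epsilon>) \<longlongrightarrow> a) (at_right 0)"
  by (auto intro!: tendsto_eq_intros)
 show "\<forall>\<^sub>F \<epsilon> in at_right 0. X \<le> (1 + \<epsilon>) * (a + b * \<epsilon>) + e * \<epsilon>"
  using eventually_at_right_less[of "0::real"] by eventually_elim (rule assms)
qed simp

lemma decreasing_sequence_to_0:
 fixes H :: "real set"
 assumes H: "H \<subseteq> {0<..}" "0 islimpt H"
 obtains hs where "subsequence_to_0 H hs"
proof -
 have small: "\<exists>h\<in>H. h < e" if "e > 0" for e
  using H that unfolding islimpt_approachable by (force simp: dist_real_def)
 have "\<exists>hs. \<forall>n. (hs n \<in> H \<and> hs n < 1 / real (Suc n)) \<and> hs (Suc n) < hs n"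
 proof (rule dependent_nat_choice)
  show "\<exists>h. h \<in> H \<and> h < 1 / real (Suc 0)" using small[of 1] by auto
  show "\<exists>y. (y \<in> H \<and> y < 1 / real (Suc (Suc n))) \<and> y < x" if "x \<in> H \<and> x < 1 / real (Suc n)" for x n
   using small[of "min x (1 / real (Suc (Suc n)))"] that H(1) by auto
 qed
 then obtain hs where hs: "\<And>n. hs n \<in> H" "\<And>n. hs n < 1 / real (Suc n)" "\<And>n. hs (Suc n) < hs n" by blast
 have "hs \<longlonglongrightarrow> 0"
 proof (rule real_tendsto_sandwich)
  show "\<forall>\<^sub>F n in sequentially. 0 \<le> hs n" using hs(1) H(1) by (intro always_eventually) (force intro: less_imp_le)
  show "\<forall>\<^sub>F n in sequentially. hs n \<le> 1 / real (Suc n)" using hs(2) by (intro always_eventually) (force intro: less_imp_le)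
  show "(\<lambda>n. 1 / real (Suc n)) \<longlonglongrightarrow> 0" by (rule LIMSEQ_Suc[OF lim_const_over_n])
 qed simp
 thus ?thesis using hs by (intro that[of hs]) (simp add: subsequence_to_0_def)
qed

text \<open>The distance of the limit to the closed set of admissible values is at most the
  pointwise error of each approximation almost everywhere, so its integral vanishes in the
  limit.\<close>

lemma L1_limit_in_L1_W:
 fixes \<O> :: "(real^'d) set"
 assumes W: "finite W" "W \<noteq> {}" and w: "\<And>k::nat. w k \<in> L1_W \<O> W" and w0: "w0 \<in> L1 \<O>" and lim: "(\<lambda>k. L1_dist \<O> (w k) w0) \<longlonglongrightarrow> 0"
 shows "w0 \<in> L1_W \<O> W"
proof -
 let ?S = "real_of_int ` W"
 have S: "?S \<noteq> {}" "closed ?S" using W by (auto intro: finite_imp_closed)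
 have w0i: "integrable (lebesgue_on \<O>) w0" using w0 by (simp add: L1_def)
 have wi: "integrable (lebesgue_on \<O>) (w k)" for k using w[of k] by (simp add: L1_W_def L1_def)
 have wS: "AE x in lebesgue_on \<O>. w k x \<in> ?S" for k using w[of k] by (simp add: L1_W_def)
 have le: "AE x in lebesgue_on \<O>. infdist (w0 x) ?S \<le> \<bar>w k x - w0 x\<bar>" for k
  using wS[of k]
 proof eventually_elim
  case (elim x)
  thus ?case using infdist_le[of "w k x" ?S "w0 x"] by (simp add: dist_real_def abs_minus_commute)
 qed
 have im: "(\<lambda>x. infdist (w0 x) ?S) \<in> borel_measurable (lebesgue_on \<O>)"
  using borel_measurable_integrable[OF w0i]
  by (rule measurable_compose) (intro borel_measurable_continuous_onI continuous_intros)
 have ii: "integrable (lebesgue_on \<O>) (\<lambda>x. infdist (w0 x) ?S)"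
 proof (rule lintegrable_bound[OF _ im])
  show "integrable (lebesgue_on \<O>) (\<lambda>x. \<bar>w 0 x - w0 x\<bar>)" using wi w0i by simp
  show "AE x in lebesgue_on \<O>. norm (infdist (w0 x) ?S) \<le> norm \<bar>w 0 x - w0 x\<bar>"
   using le[of 0] by eventually_elim (simp add: infdist_nonneg)
 qed
 have "(\<integral>x. infdist (w0 x) ?S \<partial>lebesgue_on \<O>) \<le> L1_dist \<O> (w k) w0" for k
  unfolding L1_dist_def using wi w0i le by (intro integral_mono_AE ii) auto
 hence "(\<integral>x. infdist (w0 x) ?S \<partial>lebesgue_on \<O>) \<le> 0"
  by (intro LIMSEQ_le_const[OF lim]) blast
 moreover have "0 \<le> (\<integral>x. infdist (w0 x) ?S \<partial>lebesgue_on \<O>)"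
  by (intro lint_nonneg) (simp add: infdist_nonneg)
 ultimately have "(\<integral>x. infdist (w0 x) ?S \<partial>lebesgue_on \<O>) = 0" by simp
 hence "AE x in lebesgue_on \<O>. infdist (w0 x) ?S = 0"
  using integral_nonneg_eq_0_iff_AE[OF ii] by (simp add: infdist_nonneg)
 hence "AE x in lebesgue_on \<O>. w0 x \<in> ?S"
  by eventually_elim (simp add: in_closed_iff_infdist_zero[OF S(2,1)])
 thus ?thesis using w0 by (simp add: L1_W_def)
qed

lemma L1_continuous_tendsto:
 assumes F: "L1_continuous \<O> F" and w: "\<And>k. w k \<in> L1 \<O>" "w0 \<in> L1 \<O>" and lim: "(\<lambda>k. L1_dist \<O> (w k) w0) \<longlonglongrightarrow> 0"
 shows "(\<lambda>k. F (w k)) \<longlonglongrightarrow> F w0"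
proof (rule LIMSEQ_I)
 fix r :: real assume r: "r > 0"
 then obtain d where d: "d > 0" "\<And>v. v \<in> L1 \<O> ==> L1_dist \<O> v w0 < d ==> \<bar>F v - F w0\<bar> < r"
  using F w(2) unfolding L1_continuous_def by blast
 obtain k0 where "\<And>k. k \<ge> k0 ==> L1_dist \<O> (w k) w0 < d"
  using order_tendstoD(2)[OF lim d(1)] unfolding eventually_sequentially by blast
 thus "\<exists>no. \<forall>k\<ge>no. norm (F (w k) - F w0) < r" using d(2) w(1) by auto
qed

theorem theorem3p4:
  fixes \<Omega> :: "(real^'d) set"
    and W :: "int set"
    and F :: "(real^'d \<Rightarrow> real) \<Rightarrow> real"
    and \<alpha> c :: real
    and H :: "real set"
    and \<tau> :: "real \<Rightarrow> real"
    and \<Q>h \<Q>\<tau> :: "real \<Rightarrow> (real^'d) set set"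
    and w :: "real \<Rightarrow> real^'d \<Rightarrow> real"
    and V :: "real \<Rightarrow> real"
  assumes dim: "CARD('d) \<in> {1, 2, 3}"
    and domain: "bounded_lipschitz_domain \<Omega>" "finite_union_of_cubes \<Omega>"
    and W: "finite W" "W \<noteq> {}"
    and F: "L1_continuous \<Omega> F" "L1_bounded_below \<Omega> F"
    and \<alpha>: "\<alpha> > 0"
    and c1: "CARD('d) = 1 \<Longrightarrow> c \<ge> 1"
    and c2: "CARD('d) = 2 \<Longrightarrow> c \<ge> sqrt 2"
    and c3: "CARD('d) = 3 \<Longrightarrow> c \<ge> 13 * sqrt 3"
    and H: "H \<subseteq> {0<..}" "0 islimpt H"
    and meshes: "\<And>h. h \<in> H \<Longrightarrow> admissible_mesh_pair \<Omega> h (\<tau> h) (\<Q>h h) (\<Q>\<tau> h)"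
    and ratio: "((\<lambda>h. \<tau> h / h) \<longlongrightarrow> 0) (at 0 within H)"
    and w: "\<And>h. h \<in> H \<Longrightarrow> w h \<in> BV_W \<Omega> W" "\<And>h. h \<in> H \<Longrightarrow> w h \<in> P0 (\<Q>\<tau> h)"
    and optimal: "\<And>h. h \<in> H \<Longrightarrow> minimizer_Ph \<Omega> W F \<alpha> c (\<Q>h h) (\<Q>\<tau> h) (w h) (V h)"
  shows "(\<exists>hs w0. subsequence_to_0 H hs \<and> BV_weak_star_tendsto \<Omega> (\<lambda>k. w (hs k)) w0) \<and>
         (\<forall>w0. weak_star_accumulation_point \<Omega> H w w0 \<longrightarrow> minimizer_P \<Omega> W F \<alpha> c w0)"
proof -
 have \<Omega>: "bounded \<Omega>" "open \<Omega>" using domain(1) by (auto simp: bounded_lipschitz_domain_def)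
 let ?S = "real_of_int ` W" and ?sd = "sqrt (real CARD('d))" and ?d = "CARD('d)"
 have csd: "?sd \<le> c"
 proof -
  consider "CARD('d) = 1" | "CARD('d) = 2" | "CARD('d) = 3" using dim by auto
  thus ?thesis
  proof cases
   case 3
   have "sqrt 3 \<le> 13 * sqrt (3::real)" by simp
   hence "sqrt 3 \<le> c" using c3[OF 3] by linarith
   thus ?thesis by (simp add: 3)
  qed (use c1 c2 in simp_all)
 qed
 have "1 \<le> real CARD('d)" using zero_less_card_finite[where 'a='d] by linarith
 hence c1': "1 \<le> c" using csd real_sqrt_ge_one order_trans by blast
 have H0: "h > 0" if "h \<in> H" for h using H(1) that by auto
 have "bounded ?S" using W by (intro finite_imp_bounded) simp
 then obtain B where B: "\<And>s. s \<in> ?S ==> norm s \<le> B" unfolding bounded_iff by blast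
 obtain b0 where b0: "b0 \<in> W" using W(2) by blast
 have B0: "0 \<le> B" using B[of "real_of_int b0"] b0 norm_ge_zero order_trans by blast
 have lmh: "\<exists>a X. lattice_mesh \<Omega> h (\<Q>h h) a X" and lm\<tau>: "\<exists>a X. lattice_mesh \<Omega> (\<tau> h) (\<Q>\<tau> h) a X" if "h \<in> H" for h
  by (rule mesh_lattice[OF domain(1)]; use meshes[OF that] in \<open>auto simp: admissible_mesh_pair_def\<close>)+
 have \<tau>0: "\<tau> h > 0" if "h \<in> H" for h using meshes[OF that] by (simp add: admissible_mesh_pair_def)
 have m: "f \<in> borel_measurable (lebesgue_on \<Omega>)" if "f \<in> Borel" for f :: "real^'d => real"
  using that by (intro measurable_restrict_space1 measurable_completion) simp
 have refl': "AE x in lebesgue_on \<Omega>. y x = y x" for y :: "real^'d => real" by simp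
 have L1W: "y \<in> L1 \<Omega>" "y \<in> borel_measurable (lebesgue_on \<Omega>)" if "y \<in> L1_W \<Omega> W" for y
  using that by (auto simp: L1_W_def L1_def)
 have wW: "w h \<in> L1_W \<Omega> W" if "h \<in> H" for h using w(1)[OF that] by (simp add: BV_W_def)
 have rep: "\<exists>y. y \<in> Borel \<and> (\<forall>x. y x \<in> ?S) \<and> (AE x in lebesgue_on \<Omega>. z x = y x)" if "z \<in> L1_W \<Omega> W" for z
  by (rule L1_W_representative[OF \<Omega>(2) W that]) blast
 have "\<forall>h\<in>H. \<exists>y. y \<in> Borel \<and> (\<forall>x. y x \<in> ?S) \<and> (AE x in lebesgue_on \<Omega>. w h x = y x)"
  using rep wW by blast
 from bchoice[OF this] obtain u where "\<forall>h\<in>H. u h \<in> Borel \<and> (\<forall>x. u h x \<in> ?S) \<and> (AE x in lebesgue_on \<Omega>. w h x = u h x)"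
  by blast
 hence u: "\<And>h. h \<in> H ==> u h \<in> Borel" "\<And>h x. h \<in> H ==> u h x \<in> ?S" "\<And>h. h \<in> H ==> AE x in lebesgue_on \<Omega>. w h x = u h x"
  by blast+
 have uB: "\<bar>u h x\<bar> \<le> B" if "h \<in> H" for h x using B[OF u(2)[OF that]] by simp
 \<comment> \<open>Nonnegativity excludes the value minus infinity, so finite total variations can
   be treated as real numbers.\<close>
 have TV_real: "\<exists>M\<ge>0. TV \<Omega> z = ereal M" if z: "z \<in> L1_W \<Omega> W" "TV \<Omega> z < \<infinity>" for z
 proof -
  obtain y where y: "y \<in> Borel" "AE x in lebesgue_on \<Omega>. z x = y x" using rep[OF z(1)] by blast
  have nn: "0 \<le> M" if "TV \<Omega> z \<le> ereal M" for M
   using that TV_le_iff_tv_le[OF \<Omega>(2) L1W(2)[OF z(1)] y(2,1)] tv_le_nonneg by blast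
  show ?thesis
  proof (cases "TV \<Omega> z")
   case (real M)
   thus ?thesis using nn[of M] by simp
  next
   case MInf
   thus ?thesis using nn[of "-1"] by simp
  qed (use z(2) in simp)
 qed
 \<comment> \<open>A constant with value in \<open>W\<close> is feasible with V = 0 on every mesh;
   comparison with it and the lower bound of \<open>F\<close> bound all optimal \<open>V h\<close>
   by the single number \<open>Vm\<close> below.\<close>
 define v0 where "v0 = (\<lambda>_ :: real^'d. real_of_int b0)"
 have v0m: "v0 \<in> Borel" by (simp add: v0_def)
 have v0W: "v0 x \<in> ?S" for x using b0 by (simp add: v0_def)
 note v0s = bounded_borel_spaces[OF \<Omega>(2,1) W(1) v0m v0W]
 have v0Z: "(v0, 0) \<in> Zh \<Omega> W c (\<Q>h h) (\<Q>\<tau> h)" if hH: "h \<in> H" for h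
 proof -
  obtain a X where lm: "lattice_mesh \<Omega> h (\<Q>h h) a X" using lmh[OF hH] by blast
  have tv0: "tv_le \<Omega> v0 0" unfolding v0_def by (rule tv_le_const)
  have vb: "\<bar>v0 x\<bar> \<le> \<bar>real_of_int b0\<bar>" for x by (simp add: v0_def)
  have "TVh \<Omega> (\<Q>h h) v0 \<le> ereal 0" using TVh_le[OF \<Omega> v0m vb tv0 lm v0m vb] by simp
  moreover have "TV \<Omega> v0 \<le> ereal 0" using TV_le_iff_tv_le[OF \<Omega>(2) m[OF v0m] refl' v0m] tv0 by blast
  moreover have "v0 \<in> P0 (\<Q>\<tau> h)" unfolding P0_def v0_def by auto
  ultimately show ?thesis using v0s(2) by (simp add: Zh_def)
 qed
 obtain fm where fm: "\<And>y. y \<in> L1 \<Omega> ==> fm \<le> F y" using F(2) unfolding L1_bounded_below_def by blast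
 define Vm where "Vm = (F v0 - fm) / \<alpha>"
 have hZ: "(w h, V h) \<in> Zh \<Omega> W c (\<Q>h h) (\<Q>\<tau> h)" if "h \<in> H" for h
  using minimizer_PhD(1)[OF optimal[OF that] v0s(1) v0Z[OF that]] .
 have VVm: "V h \<le> Vm" if "h \<in> H" for h
 proof -
  have "F (w h) + \<alpha> * V h \<le> F v0 + \<alpha> * 0"
   using minimizer_PhD(2)[OF optimal[OF that] v0s(1) v0Z[OF that]] .
  hence "\<alpha> * V h \<le> F v0 - fm" using fm[OF L1W(1)[OF wW[OF that]]] by simp
  thus ?thesis using \<alpha> by (simp add: Vm_def pos_le_divide_eq mult.commute)
 qed
 have tvu: "tv_le \<Omega> (u h) (c * Vm)" if "h \<in> H" for h
 proof -
  have "TV \<Omega> (w h) \<le> ereal (c * V h)" using hZ[OF that] by (simp add: Zh_def)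
  also have "... \<le> ereal (c * Vm)" using VVm[OF that] c1' by (simp add: mult_left_mono)
  finally show ?thesis using TV_le_iff_tv_le[OF \<Omega>(2) L1W(2)[OF wW[OF that]] u(3)[OF that] u(1)[OF that]] by blast
 qed
 have S: "closed ?S" using W by (intro finite_imp_closed) simp
 have part1: "\<exists>hs w0. subsequence_to_0 H hs \<and> BV_weak_star_tendsto \<Omega> (\<lambda>k. w (hs k)) w0"
 proof -
  obtain hs0 where hs0: "subsequence_to_0 H hs0" using H by (rule decreasing_sequence_to_0)
  hence hH: "hs0 k \<in> H" and dec: "hs0 (Suc k) < hs0 k" and h0: "hs0 \<longlonglongrightarrow> 0" for k by (auto simp: subsequence_to_0_def)
  \<comment> \<open>The TV meshes themselves serve as the arbitrarily fine meshes for
    \<open>L1_compactness\<close>.\<close>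
  have ms: "\<exists>h \<Q> a X. h < e \<and> lattice_mesh \<Omega> h \<Q> a X" if e: "e > 0" for e
  proof -
   obtain k where "hs0 k < e" using order_tendstoD(2)[OF h0 e] unfolding eventually_sequentially by blast
   thus ?thesis using lmh[OF hH[of k]] by blast
  qed
  obtain r v where r: "strict_mono r" and v: "v \<in> Borel" "\<And>x. v x \<in> ?S" "\<And>x. \<bar>v x\<bar> \<le> B"
   and lim: "(\<lambda>n. \<integral>x. ind \<Omega> x * \<bar>u (hs0 (r n)) x - v x\<bar> \<partial>lborel) \<longlonglongrightarrow> 0"
   using \<Omega> u(1)[OF hH] uB[OF hH] tvu[OF hH] ms S u(2)[OF hH]
   by (rule L1_compactness[where w="\<lambda>n. u (hs0 n)"]) (assumption | rule that)+
  have "hs0 (r (Suc k)) < hs0 (r k)" for k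
   using lift_Suc_mono_less[of "\<lambda>n. - hs0 n" "r k" "r (Suc k)"] dec r by (simp add: strict_mono_Suc_iff)
  moreover have "(\<lambda>k. hs0 (r k)) \<longlonglongrightarrow> 0" using LIMSEQ_subseq_LIMSEQ[OF h0 r] by (simp add: o_def)
  ultimately have "subsequence_to_0 H (\<lambda>k. hs0 (r k))" using hH by (simp add: subsequence_to_0_def)
  moreover have "BV_weak_star_tendsto \<Omega> (\<lambda>k. w (hs0 (r k))) v"
  proof (rule BV_weak_star_of_L1[OF \<Omega> _ _ u(1)[OF hH] uB[OF hH] tvu[OF hH] v(1,3) _ lim])
   show "w (hs0 (r k)) \<in> L1 \<Omega>" for k using L1W(1)[OF wW[OF hH]] .
   show "AE x in lebesgue_on \<Omega>. w (hs0 (r k)) x = u (hs0 (r k)) x" for k using u(3)[OF hH] .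
   show "v \<in> L1 \<Omega>" using L1W(1)[OF bounded_borel_spaces(2)[OF \<Omega>(2,1) W(1) v(1,2)]] .
  qed
  ultimately show ?thesis by (intro exI[of _ "\<lambda>k. hs0 (r k)"] exI[of _ v] conjI)
 qed
 have part2: "minimizer_P \<Omega> W F \<alpha> c w0" if acc: "weak_star_accumulation_point \<Omega> H w w0" for w0
 proof -
  obtain hs where hs: "subsequence_to_0 H hs" and conv: "BV_weak_star_tendsto \<Omega> (\<lambda>k. w (hs k)) w0"
   using acc by (auto simp: weak_star_accumulation_point_def)
  have hH: "hs k \<in> H" and h0: "hs \<longlonglongrightarrow> 0" for k using hs by (auto simp: subsequence_to_0_def)
  have w0L: "w0 \<in> L1 \<Omega>" and lim: "(\<lambda>k. L1_dist \<Omega> (w (hs k)) w0) \<longlonglongrightarrow> 0"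
   using conv by (auto simp: BV_weak_star_tendsto_def BV_def)
  have w0W: "w0 \<in> L1_W \<Omega> W" by (rule L1_limit_in_L1_W[OF W wW[OF hH] w0L lim])
  have w0m: "w0 \<in> borel_measurable (lebesgue_on \<Omega>)" using w0W by (rule L1W(2))
  obtain u0 where u0: "u0 \<in> Borel" "\<And>x. u0 x \<in> ?S" "AE x in lebesgue_on \<Omega>. w0 x = u0 x"
   using rep[OF w0W] by blast
  have u0B: "\<bar>u0 x\<bar> \<le> B" for x using B[OF u0(2)] by simp
  have fin: "finite_measure (lebesgue_on \<Omega>)" using \<Omega> by (intro finite_measure_lebesgue_on lmeasurable_open)
  have w0L2: "w0 \<in> L2 \<Omega>"
  proof -
   have "integrable (lebesgue_on \<Omega>) (\<lambda>x. (norm (w0 x))\<^sup>2)"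
   proof (rule finite_measure.integrable_const_bound[OF fin, where B="B\<^sup>2"])
    show "AE x in lebesgue_on \<Omega>. norm ((norm (w0 x))\<^sup>2) \<le> B\<^sup>2"
     using u0(3)
    proof eventually_elim
     case (elim x)
     have "\<bar>w0 x\<bar>\<^sup>2 \<le> B\<^sup>2" using u0B[of x] elim by (intro power_mono) auto
     thus ?case by simp
    qed
    show "(\<lambda>x. (norm (w0 x))\<^sup>2) \<in> borel_measurable (lebesgue_on \<Omega>)" using w0m by measurable
   qed
   thus ?thesis using w0m by (simp add: L2_def)
  qed
  have Fw: "(\<lambda>k. F (w (hs k))) \<longlonglongrightarrow> F w0"
   by (rule L1_continuous_tendsto[OF F(1) L1W(1)[OF wW[OF hH]] w0L lim])
  have limu: "(\<lambda>k. \<integral>x. ind \<Omega> x * \<bar>u (hs k) x - u0 x\<bar> \<partial>lborel) \<longlonglongrightarrow> 0"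
   using lim unfolding L1_dist_eq[OF \<Omega>(2) L1W(2)[OF wW[OF hH]] u(3)[OF hH] w0m u0(3) u(1)[OF hH] u0(1)] .
  have "filterlim hs (at 0 within H) sequentially"
   unfolding filterlim_at using h0 hH H0[OF hH] by (intro conjI always_eventually allI) (auto dest: less_imp_neq[symmetric])
  hence ratio0: "(\<lambda>k. \<tau> (hs k) / hs k) \<longlonglongrightarrow> 0" by (rule filterlim_compose[OF ratio])
  \<comment> \<open>The optimality inequality solved for the total variation of \<open>w0\<close>,
    so that it can be proved for one test field at a time.\<close>
  have key: "TV \<Omega> w0 \<le> ereal ((F v - F w0) / \<alpha> + M)" if v: "v \<in> L1_W \<Omega> W" and TVv: "TV \<Omega> v = ereal M" for v M
  proof -
   obtain y where y: "y \<in> Borel" "\<And>x. y x \<in> ?S" "AE x in lebesgue_on \<Omega>. v x = y x"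
    using rep[OF v] by blast
   have "TV \<Omega> v \<le> ereal M" using TVv by simp
   hence tvy: "tv_le \<Omega> y M" using TV_le_iff_tv_le[OF \<Omega>(2) L1W(2)[OF v] y(3,1)] by blast
   have yL: "y \<in> L1 \<Omega>" using L1W(1)[OF bounded_borel_spaces(2)[OF \<Omega>(2,1) W(1) y(1,2)]] .
   \<comment> \<open>An L1-continuous functional takes the same value on functions at distance 0; a
     constant sequence brings this into the form of a limit.\<close>
   have "L1_dist \<Omega> v y = 0" unfolding L1_dist_eq[OF \<Omega>(2) L1W(2)[OF v] y(3) m[OF y(1)] refl' y(1,1)] by simp
   hence "(\<lambda>k::nat. F v) \<longlonglongrightarrow> F y" by (intro L1_continuous_tendsto[OF F(1) L1W(1)[OF v] yL]) simp
   hence Fy: "F y = F v" by (simp add: LIMSEQ_const_iff)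
   let ?T = "(F v - F w0) / \<alpha> + M" and ?O = "measure lebesgue \<Omega>"
   have le: "(\<integral>x. w0 x * divergence \<phi> x \<partial>lebesgue_on \<Omega>) \<le> ?T"
    if \<phi>: "\<phi> \<in> C1c \<Omega>" "\<And>x. x \<in> \<Omega> ==> norm (\<phi> x) \<le> 1" for \<phi>
   proof (rule le_of_forall_eps[where b="M * 2^?d" and e="B * ?O"])
    \<comment> \<open>The same \<epsilon> is the weight in the sampling of the competitor and the
      tolerance in \<open>TVh_lower_bound\<close>. The mesh size tends to 0 for fixed \<epsilon>,
      and \<epsilon> is sent to 0 afterwards.\<close>
    fix \<epsilon> :: real assume \<epsilon>: "\<epsilon> > 0"
    define L where "L = (?sd + \<epsilon> * (2^?d * ?sd)) * M"
    define U where "U k = M * (1 + \<epsilon> * 2^?d) + 2 * real ?d / hs k * (\<tau> (hs k) * L / \<epsilon>)" for k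
    have "\<exists>v'. v' \<in> L2 \<Omega> \<and> (v', U k) \<in> Zh \<Omega> W c (\<Q>h (hs k)) (\<Q>\<tau> (hs k)) \<and> L1_dist \<Omega> v' y \<le> \<tau> (hs k) * L / \<epsilon>" for k
    proof -
     obtain a' X' where 1: "lattice_mesh \<Omega> (hs k) (\<Q>h (hs k)) a' X'" using lmh[OF hH] by blast
     obtain a X where 2: "lattice_mesh \<Omega> (\<tau> (hs k)) (\<Q>\<tau> (hs k)) a X" using lm\<tau>[OF hH] by blast
     show ?thesis
      by (rule recovery_pair[OF \<Omega> W(1) 1 2 y(1,2) tvy \<epsilon> csd L_def U_def]) blast
    qed
    then obtain v' where v': "\<And>k. v' k \<in> L2 \<Omega>" "\<And>k. (v' k, U k) \<in> Zh \<Omega> W c (\<Q>h (hs k)) (\<Q>\<tau> (hs k))"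
     "\<And>k. L1_dist \<Omega> (v' k) y \<le> \<tau> (hs k) * L / \<epsilon>" by metis
    have v'L: "v' k \<in> L1 \<Omega>" for k using integrable_of_L2(1)[OF \<Omega>(2,1) v'(1)] by (simp add: L1_def)
    have \<tau>lim: "(\<lambda>k. \<tau> (hs k)) \<longlonglongrightarrow> 0"
    proof -
     have "(\<lambda>k. \<tau> (hs k) / hs k * hs k) \<longlonglongrightarrow> 0 * 0" using ratio0 h0 by (rule tendsto_mult)
     moreover have "\<tau> (hs k) / hs k * hs k = \<tau> (hs k)" for k using H0[OF hH[of k]] by simp
     ultimately show ?thesis by simp
    qed
    have "(\<lambda>k. L1_dist \<Omega> (v' k) y) \<longlonglongrightarrow> 0"
    proof (rule real_tendsto_sandwich)
     show "\<forall>\<^sub>F k in sequentially. 0 \<le> L1_dist \<Omega> (v' k) y"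
      unfolding L1_dist_def by (intro always_eventually allI lint_nonneg) simp
     show "\<forall>\<^sub>F k in sequentially. L1_dist \<Omega> (v' k) y \<le> \<tau> (hs k) * L / \<epsilon>"
      using v'(3) by (intro always_eventually allI)
     show "(\<lambda>k. \<tau> (hs k) * L / \<epsilon>) \<longlonglongrightarrow> 0"
      using tendsto_mult[OF \<tau>lim tendsto_const[of "L / \<epsilon>"]] by simp
    qed simp
    hence Fv': "(\<lambda>k. F (v' k)) \<longlonglongrightarrow> F v" unfolding Fy[symmetric] by (rule L1_continuous_tendsto[OF F(1) v'L yL])
    \<comment> \<open>The condition on \<tau> / h removes the error that the divergence bound 2 d /
      h attaches to the sampling.\<close>
    have Ulim: "U \<longlonglongrightarrow> M * (1 + \<epsilon> * 2^?d)"
    proof -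
     have "(\<lambda>k. M * (1 + \<epsilon> * 2^?d) + \<tau> (hs k) / hs k * (2 * real ?d * L / \<epsilon>)) \<longlonglongrightarrow> M * (1 + \<epsilon> * 2^?d) + 0 * (2 * real ?d * L / \<epsilon>)"
      by (intro tendsto_intros ratio0)
     thus ?thesis by (simp add: U_def[abs_def] mult_ac)
    qed
    have Vle: "V (hs k) \<le> (F (v' k) - F (w (hs k))) / \<alpha> + U k" for k
    proof -
     have "F (w (hs k)) + \<alpha> * V (hs k) \<le> F (v' k) + \<alpha> * U k"
      using minimizer_PhD(2)[OF optimal[OF hH] v'(1) v'(2)] .
     thus ?thesis using \<alpha> by (simp add: field_simps)
    qed
    obtain C where C: "0 \<le> C" "\<And>x. \<bar>divergence \<phi> x\<bar> \<le> C" "divergence \<phi> \<in> Borel"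
     "\<And>x. x \<notin> \<Omega> ==> divergence \<phi> x = 0"
     using \<phi>(1) by (rule divergence_bounded) (assumption | rule that)+
    have "(\<lambda>k. \<integral>x. u (hs k) x * divergence \<phi> x \<partial>lborel) \<longlonglongrightarrow> (LBINT x. u0 x * divergence \<phi> x)"
     by (rule integral_divergence_tendsto[OF \<Omega> u(1)[OF hH] uB[OF hH] u0(1) u0B limu C(3) C(1,2,4)])
    moreover have "(\<integral>x. w (hs k) x * divergence \<phi> x \<partial>lebesgue_on \<Omega>) = (LBINT x. u (hs k) x * divergence \<phi> x)" for k
     using \<Omega>(2) L1W(2)[OF wW[OF hH[of k]]] u(3)[OF hH[of k]] u(1)[OF hH[of k]] C(3,4) by (rule integral_rep)
    moreover have "(\<integral>x. w0 x * divergence \<phi> x \<partial>lebesgue_on \<Omega>) = (LBINT x. u0 x * divergence \<phi> x)"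
     using \<Omega>(2) w0m u0(3,1) C(3,4) by (rule integral_rep)
    ultimately have lim1: "(\<lambda>k. \<integral>x. w (hs k) x * divergence \<phi> x \<partial>lebesgue_on \<Omega>) \<longlonglongrightarrow> (\<integral>x. w0 x * divergence \<phi> x \<partial>lebesgue_on \<Omega>)" by simp
    show "(\<integral>x. w0 x * divergence \<phi> x \<partial>lebesgue_on \<Omega>) \<le> (1 + \<epsilon>) * (?T + M * 2^?d * \<epsilon>) + B * ?O * \<epsilon>"
    proof (rule TVh_lower_bound[OF \<Omega>(2,1) \<phi> \<epsilon>])
     fix h1 assume h1: "h1 > 0" "\<And>h \<Q> a X z R b. h < h1 ==> lattice_mesh \<Omega> h \<Q> a X ==> integrable (lebesgue_on \<Omega>) z ==>
       AE x in lebesgue_on \<Omega>. \<bar>z x\<bar> \<le> b ==> 0 \<le> b ==> TVh \<Omega> \<Q> z \<le> ereal R ==>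
       (\<integral>x. z x * divergence \<phi> x \<partial>lebesgue_on \<Omega>) \<le> (1 + \<epsilon>) * R + b * \<epsilon> * ?O"
     define Y where "Y k = (1 + \<epsilon>) * ((F (v' k) - F (w (hs k))) / \<alpha> + U k) + B * \<epsilon> * ?O" for k
     have "\<forall>\<^sub>F k in sequentially. hs k < h1" using h0 h1(1) by (rule order_tendstoD(2))
     hence ev: "\<forall>\<^sub>F k in sequentially. (\<integral>x. w (hs k) x * divergence \<phi> x \<partial>lebesgue_on \<Omega>) \<le> Y k"
     proof eventually_elim
      case (elim k)
      obtain a X where lm: "lattice_mesh \<Omega> (hs k) (\<Q>h (hs k)) a X" using lmh[OF hH] by blast
      have wi: "integrable (lebesgue_on \<Omega>) (w (hs k))" using L1W(1)[OF wW[OF hH]] by (simp add: L1_def)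
      have wB: "AE x in lebesgue_on \<Omega>. \<bar>w (hs k) x\<bar> \<le> B"
       using u(3)[OF hH[of k]] by eventually_elim (simp add: uB[OF hH])
      have "TVh \<Omega> (\<Q>h (hs k)) (w (hs k)) \<le> ereal (V (hs k))" using hZ[OF hH[of k]] by (simp add: Zh_def)
      hence "(\<integral>x. w (hs k) x * divergence \<phi> x \<partial>lebesgue_on \<Omega>) \<le> (1 + \<epsilon>) * V (hs k) + B * \<epsilon> * ?O"
       by (rule h1(2)[OF elim lm wi wB B0])
      also have "... \<le> Y k" unfolding Y_def using Vle[of k] \<epsilon> by (intro add_right_mono mult_left_mono) auto
      finally show ?case .
     qed
     have "Y \<longlonglongrightarrow> (1 + \<epsilon>) * ((F v - F w0) / \<alpha> + M * (1 + \<epsilon> * 2^?d)) + B * \<epsilon> * ?O"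
      unfolding Y_def[abs_def] using \<alpha> by (intro tendsto_intros Fv' Fw Ulim) simp
     hence "(\<integral>x. w0 x * divergence \<phi> x \<partial>lebesgue_on \<Omega>) \<le> (1 + \<epsilon>) * ((F v - F w0) / \<alpha> + M * (1 + \<epsilon> * 2^?d)) + B * \<epsilon> * ?O"
      using lim1 ev by (rule tendsto_le[OF sequentially_bot])
     also have "... = (1 + \<epsilon>) * (?T + M * 2^?d * \<epsilon>) + B * ?O * \<epsilon>" by (simp add: algebra_simps)
     finally show ?thesis .
    qed
   qed
   show ?thesis unfolding TV_def by (rule SUP_least) (use le in simp)
  qed
  have "TV \<Omega> w0 < \<infinity>" using conv by (auto simp: BV_weak_star_tendsto_def BV_def)
  then obtain M0 where M0: "0 \<le> M0" "TV \<Omega> w0 = ereal M0" using TV_real[OF w0W] by blast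
  have "1 * M0 \<le> c * M0" using c1' M0(1) by (rule mult_right_mono)
  hence w0Z: "w0 \<in> Z \<Omega> W c" using w0W M0(2) by (simp add: Z_def)
  have "G \<Omega> W F \<alpha> c w0 \<le> G \<Omega> W F \<alpha> c v" for v
  proof (cases "v \<in> Z \<Omega> W c \<and> TV \<Omega> v < \<infinity>")
   case True
   hence vW: "v \<in> L1_W \<Omega> W" by (simp add: Z_def)
   obtain M where M: "TV \<Omega> v = ereal M" using TV_real[OF vW] True by blast
   have "M0 \<le> (F v - F w0) / \<alpha> + M" using key[OF vW M] M0(2) by simp
   hence "F w0 + \<alpha> * M0 \<le> F v + \<alpha> * M" using \<alpha> by (simp add: field_simps)
   thus ?thesis using True w0Z M M0(2) by (simp add: G_def indicator_functional_def)
  next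
   case False
   hence "G \<Omega> W F \<alpha> c v = \<infinity>"
    using \<alpha> by (cases "v \<in> Z \<Omega> W c") (auto simp: G_def indicator_functional_def)
   thus ?thesis by simp
  qed
  thus ?thesis using w0L2 by (simp add: minimizer_P_def)
 qed
 show ?thesis using part1 part2 by blast
qed

end
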